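(* Let $q\in\mathcal Z\setminus\{0\}$, let $\mathcal H_{\mathbb R}'\subset\mathcal H_{\mathbb R}$ be a closed subspace of a real Hilbert space, let $\mathcal H$, $\mathcal H'=\mathbb C\mathcal H'_{\mathbb R}$ be the complexifications, and let $P_{\mathcal H'}$ be the orthogonal projection of $\mathcal H$ onto $\mathcal H'$. (a) The map $\mathcal F(P_{\mathcal H'})(\alpha\otimes F)=\alpha\otimes(P_{\mathcal H'}^{\otimes n}F)$ ($\alpha\in S_0(n)$, $F\in\mathcal H^{\otimes n}$) extends to the orthogonal projection $\mathcal F(P_{\mathcal H'}):\mathcal F_q(\mathcal H)\to\mathcal F_q(\mathcal H')$. (b) The map $\Gamma(P_{\mathcal H'}):\overline{\mathcal{TP}}_q(\mathcal H_{\mathbb R})\to\overline{\mathcal{TP}}_q(\mathcal H'_{\mathbb R})$ obtained as the linear extension of $$\Gamma(P_{\mathcal H'})(W(\alpha\otimes F))=W(\alpha\otimes(P_{\mathcal H'}^{\otimes n}F))$$ is an algebraic conditional expectation (with respect to $\varphi$). In the GNS representation on $\mathcal F_q(\mathcal H')$ it is implemented by $$\Gamma(P_{\mathcal H'})(W(\alpha\otimes F))=\mathcal F(P_{\mathcal H'})\,W(\alpha\otimes F)\,\mathcal F(P_{\mathcal H'}).$$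
   Context: Permutations. $[n]=\{1,\dots,n\}$, $[0,n]=\{0,\dots,n\}$; $S(n)$, $S_0(n)$ are the permutation groups of $[n]$, $[0,n]$, with $S(n)\subset S_0(n)$ the permutations fixing $0$; products are composed right to left; for $m>n$, $S_0(n)\subset S_0(m)$ by fixing $n+1,\dots,m$. $\mathrm{cyc}_0(\alpha)$ is the number of cycles of $\alpha\in S_0(n)$ (fixed points are cycles) not containing $0$; $|\alpha|=n-\mathrm{cyc}_0(\alpha)$; $\chi_q$ is the linear extension of $\chi_q(\alpha)=q^{|\alpha|}$. $\mathcal Z=\{0\}\cup\{\pm1/N:N\in\mathbb N\}$. For $\alpha\in S_0(n)$, $\beta\in S_0(k)$, $\alpha\cup\beta=\beta'\alpha\in S_0(n+k)$, where $\beta'$ fixes $[n]$ and is obtained from $\beta$ by replacing each $j\in[k]$ by $n+j$ ($0$ unchanged). Contractions. $\mathcal P_{1,2}(n)$ is the set of partitions $\pi$ of $[n]$ into blocks of size 1 and 2, identified with the involution swapping the elements of each pair; $|\pi|$ is the number of pairs, $\mathrm{supp}(\pi)$ their union; $\mathcal P_{1,2}(n,k)$ is the set of $\pi\in\mathcal P_{1,2}(n+k)$ all of whose pairs $\{i<j\}$ satisfy $i\le n<j$. For $S\subset[n]$, $\alpha|_{S^c}$ is the permutation of $[0,n]\setminus S$, $x\mapsto\alpha^m(x)$, $m=\min\{j>0:\alpha^j(x)\notin S\}$. For $\ell=|\pi|$, $$C_\pi(\alpha)=q^{\mathrm{cyc}_0((\pi\alpha)|_{\mathrm{supp}(\pi)^c})-\mathrm{cyc}_0(\pi\alpha)+\ell}\;P\big((\pi\alpha)|_{\mathrm{supp}(\pi)^c}\big)\in\mathbb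 C[S_0(n-2\ell)],$$ where $P$ relabels $[0,n]\setminus\mathrm{supp}(\pi)$ by $[0,n-2\ell]$ in the order-preserving way. $C_\pi(h_1\otimes\dots\otimes h_n)=\prod_{\{i,j\}\text{ pair of }\pi}\langle h_i,h_j\rangle\bigotimes_{k\text{ singleton}}h_k$ (increasing order). Spaces. $\mathcal H^{\otimes n}$ is the Hilbert tensor power. $U_\sigma(h_1\otimes\dots\otimes h_n)=h_{\sigma^{-1}(1)}\otimes\dots\otimes h_{\sigma^{-1}(n)}$ and $\alpha\otimes_sF=\frac1{n!}\sum_{\sigma\in S(n)}\sigma\alpha\sigma^{-1}\otimes U_\sigma F$. $\overline{\mathcal{TP}}(\mathcal H)=\bigoplus_{n}\mathbb C[S_0(n)]\otimes_s\mathcal H^{\otimes n}$ and $\overline{\mathcal{TP}}(\mathcal H_{\mathbb R})$ is the complex span of $\alpha\otimes_sF$ with $F\in\mathcal H_{\mathbb R}^{\otimes n}$. The sesquilinear form $\langle\alpha\otimes F,\beta\otimes G\rangle_q=\delta_{n=k}\sum_{\sigma\in S(n)}\chi_q(\alpha\sigma\beta^{-1}\sigma^{-1})\langle F,U_\sigma G\rangle$ is positive semi-definite for $q\in\mathcal Z$; $\overline{\mathcal{TP}}_q$ denotes the quotient of $\overline{\mathcal{TP}}$ by its kernel, and $\mathcal F_q(\mathcal H)$ the Hilbert space completion of $\overline{\mathcal{TP}}_q(\mathcal H)$. $\alpha\otimes F$ denotes also the class of $\alpha\otimes_sF$. Algebra. The element of $\overline{\mathcal{TP}}(\mathcal H_{\mathbb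 R})$ (or of the quotient) corresponding to $\xi$, viewed as an algebra element, is written $W(\xi)$. The product is $W(\alpha\otimes_sF)W(\beta\otimes_sG)=\sum_{\pi\in\mathcal P_{1,2}(n,k)}W(C_\pi(\alpha\cup\beta)\otimes_sC_\pi(F\otimes G))$ (where $C_\pi(F\otimes G)$ for $\pi\in\mathcal P_{1,2}(n,k)$ is extended by continuity to Hilbert tensor powers), and the adjoint is the antilinear extension of $W(\alpha\otimes_sF)^*=W(\alpha^{-1}\otimes_sF)$, $F\in\mathcal H_{\mathbb R}^{\otimes n}$. $\varphi$ is the linear functional equal to $1$ on the unit $W((0))$ and $0$ on $W(\alpha\otimes F)$, $n\ge1$; it is a faithful tracial state on $\overline{\mathcal{TP}}_q(\mathcal H_{\mathbb R})$ with $\varphi[W(\zeta)^*W(\xi)]=\langle\xi,\zeta\rangle_q$, so its GNS space is $\mathcal F_q(\mathcal H)$ with cyclic vector $(0)$ and $W(\xi)(0)=\xi$. Algebraic conditional expectation: for a unital $*$-algebra $\mathcal A$ with faithful tracial state $\varphi$ and a unital $*$-subalgebra $\mathcal B$, with GNS spaces $L^2(\mathcal B,\varphi)\subset L^2(\mathcal A,\varphi)$ and state vector $\Omega$, a map $F:\mathcal A\to\mathcal B$ such that $a\Omega\mapsto F(a)\Omega$ extends to the orthogonal projection $L^2(\mathcal A,\varphi)\to L^2(\mathcal B,\varphi)$. *)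

theory Defs
  imports "HOL-Analysis.Analysis" "HOL-Combinatorics.Orbits" "HOL-Combinatorics.Permutations"
begin

section \<open>Complex vector spaces and semi-inner product spaces on carrier sets\<close>

text \<open>
  All sesquilinear forms are linear in the first and antilinear in the second argument.
\<close>

record 'v cvec =
  carr :: "'v set"
  vadd :: "'v \<Rightarrow> 'v \<Rightarrow> 'v"
  vscl :: "complex \<Rightarrow> 'v \<Rightarrow> 'v"

record 'v ipspace = "'v cvec" +
  ip :: "'v \<Rightarrow> 'v \<Rightarrow> complex"

record 'v staralg = "'v cvec" +
  amult :: "'v \<Rightarrow> 'v \<Rightarrow> 'v"
  aone :: "'v"
  astar :: "'v \<Rightarrow> 'v"

definition vsub :: "('v, 'r) cvec_scheme \<Rightarrow> 'v \<Rightarrow> 'v \<Rightarrow> 'v" where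
  "vsub V x y = vadd V x (vscl V (-1) y)"

definition linear_map :: "('v, 'r) cvec_scheme \<Rightarrow> ('w, 's) cvec_scheme \<Rightarrow> ('v \<Rightarrow> 'w) \<Rightarrow> bool" where
  "linear_map V W T \<longleftrightarrow> T ` carr V \<subseteq> carr W \<and>
     (\<forall>x\<in>carr V. \<forall>y\<in>carr V. T (vadd V x y) = vadd W (T x) (T y)) \<and>
     (\<forall>c. \<forall>x\<in>carr V. T (vscl V c x) = vscl W c (T x))"

text \<open>\<open>T\<close> is the orthogonal projection of \<open>V\<close> onto its subspace \<open>M\<close>.  On \<open>carr V\<close> this
  determines \<open>T\<close> as soon as the form is positive definite.\<close>

definition orthogonal_projection :: "'v ipspace \<Rightarrow> 'v set \<Rightarrow> ('v \<Rightarrow> 'v) \<Rightarrow> bool" where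
  "orthogonal_projection V M T \<longleftrightarrow> M \<subseteq> carr V \<and> (\<forall>x\<in>carr V. T x \<in> M) \<and>
     (\<forall>x\<in>carr V. \<forall>y\<in>M. ip V (vsub V x (T x)) y = 0)"

definition rep :: "'v set \<Rightarrow> 'v" where
  "rep X = (SOME x. x \<in> X)"

subsection \<open>Quotient by the kernel of a form\<close>

definition ker_form :: "'v ipspace \<Rightarrow> 'v set" where
  "ker_form V = {x \<in> carr V. \<forall>y\<in>carr V. ip V x y = 0}"

definition coset :: "'v ipspace \<Rightarrow> 'v \<Rightarrow> 'v set" where
  "coset V x = {y \<in> carr V. vsub V y x \<in> ker_form V}"

definition quotient_space :: "'v ipspace \<Rightarrow> 'v set ipspace" where
  "quotient_space V =
     \<lparr> carr = coset V ` carr V,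
       vadd = (\<lambda>X Y. coset V (vadd V (rep X) (rep Y))),
       vscl = (\<lambda>c X. coset V (vscl V c (rep X))),
       ip = (\<lambda>X Y. ip V (rep X) (rep Y)) \<rparr>"

subsection \<open>Completion\<close>

definition vnorm :: "'v ipspace \<Rightarrow> 'v \<Rightarrow> real" where
  "vnorm V x = sqrt (Re (ip V x x))"

definition cauchy_seqs :: "'v ipspace \<Rightarrow> (nat \<Rightarrow> 'v) set" where
  "cauchy_seqs V = {X. (\<forall>n. X n \<in> carr V) \<and>
     (\<forall>e>0. \<exists>N. \<forall>m\<ge>N. \<forall>n\<ge>N. vnorm V (vsub V (X m) (X n)) < e)}"

text \<open>The class of \<open>X\<close> modulo null sequences.\<close>

definition seq_class :: "'v ipspace \<Rightarrow> (nat \<Rightarrow> 'v) \<Rightarrow> (nat \<Rightarrow> 'v) set" where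
  "seq_class V X = {Y \<in> cauchy_seqs V. (\<lambda>n. vnorm V (vsub V (X n) (Y n))) \<longlonglongrightarrow> 0}"

definition completion :: "'v ipspace \<Rightarrow> (nat \<Rightarrow> 'v) set ipspace" where
  "completion V =
     \<lparr> carr = seq_class V ` cauchy_seqs V,
       vadd = (\<lambda>A B. seq_class V (\<lambda>n. vadd V (rep A n) (rep B n))),
       vscl = (\<lambda>c A. seq_class V (\<lambda>n. vscl V c (rep A n))),
       ip = (\<lambda>A B. lim (\<lambda>n. ip V (rep A n) (rep B n))) \<rparr>"

definition embed :: "'v ipspace \<Rightarrow> 'v \<Rightarrow> (nat \<Rightarrow> 'v) set" where
  "embed V x = seq_class V (\<lambda>_. x)"

text \<open>The completion of a subspace \<open>S\<close>, as a (closed) subspace of the completion of \<open>V\<close>.\<close>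

definition completion_sub :: "'v ipspace \<Rightarrow> 'v set \<Rightarrow> (nat \<Rightarrow> 'v) set set" where
  "completion_sub V S = {seq_class V X | X. X \<in> cauchy_seqs V \<and> (\<forall>n. X n \<in> S)}"


section \<open>Algebraic conditional expectations\<close>

locale unital_star_algebra =
  fixes A :: "'v staralg"
  assumes one_closed: "aone A \<in> carr A"
    and add_closed: "\<lbrakk>x \<in> carr A; y \<in> carr A\<rbrakk> \<Longrightarrow> vadd A x y \<in> carr A"
    and scl_closed: "x \<in> carr A \<Longrightarrow> vscl A c x \<in> carr A"
    and mult_closed: "\<lbrakk>x \<in> carr A; y \<in> carr A\<rbrakk> \<Longrightarrow> amult A x y \<in> carr A"
    and star_closed: "x \<in> carr A \<Longrightarrow> astar A x \<in> carr A"
    and add_assoc: "\<lbrakk>x \<in> carr A; y \<in> carr A; z \<in> carr A\<rbrakk> \<Longrightarrow>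
        vadd A (vadd A x y) z = vadd A x (vadd A y z)"
    and add_commute: "\<lbrakk>x \<in> carr A; y \<in> carr A\<rbrakk> \<Longrightarrow> vadd A x y = vadd A y x"
    and zero_add: "\<lbrakk>x \<in> carr A; y \<in> carr A\<rbrakk> \<Longrightarrow> vadd A (vscl A 0 x) y = y"
    and scl_one: "x \<in> carr A \<Longrightarrow> vscl A 1 x = x"
    and scl_scl: "x \<in> carr A \<Longrightarrow> vscl A c (vscl A d x) = vscl A (c * d) x"
    and scl_add_left: "x \<in> carr A \<Longrightarrow> vscl A (c + d) x = vadd A (vscl A c x) (vscl A d x)"
    and scl_add_right: "\<lbrakk>x \<in> carr A; y \<in> carr A\<rbrakk> \<Longrightarrow>
        vscl A c (vadd A x y) = vadd A (vscl A c x) (vscl A c y)"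
    and mult_assoc: "\<lbrakk>x \<in> carr A; y \<in> carr A; z \<in> carr A\<rbrakk> \<Longrightarrow>
        amult A (amult A x y) z = amult A x (amult A y z)"
    and one_mult: "x \<in> carr A \<Longrightarrow> amult A (aone A) x = x"
    and mult_one: "x \<in> carr A \<Longrightarrow> amult A x (aone A) = x"
    and mult_add_left: "\<lbrakk>x \<in> carr A; y \<in> carr A; z \<in> carr A\<rbrakk> \<Longrightarrow>
        amult A (vadd A x y) z = vadd A (amult A x z) (amult A y z)"
    and mult_add_right: "\<lbrakk>x \<in> carr A; y \<in> carr A; z \<in> carr A\<rbrakk> \<Longrightarrow>
        amult A x (vadd A y z) = vadd A (amult A x y) (amult A x z)"
    and mult_scl_left: "\<lbrakk>x \<in> carr A; y \<in> carr A\<rbrakk> \<Longrightarrow>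
        amult A (vscl A c x) y = vscl A c (amult A x y)"
    and mult_scl_right: "\<lbrakk>x \<in> carr A; y \<in> carr A\<rbrakk> \<Longrightarrow>
        amult A x (vscl A c y) = vscl A c (amult A x y)"
    and star_star: "x \<in> carr A \<Longrightarrow> astar A (astar A x) = x"
    and star_add: "\<lbrakk>x \<in> carr A; y \<in> carr A\<rbrakk> \<Longrightarrow>
        astar A (vadd A x y) = vadd A (astar A x) (astar A y)"
    and star_scl: "x \<in> carr A \<Longrightarrow> astar A (vscl A c x) = vscl A (cnj c) (astar A x)"
    and star_mult: "\<lbrakk>x \<in> carr A; y \<in> carr A\<rbrakk> \<Longrightarrow>
        astar A (amult A x y) = amult A (astar A y) (astar A x)"

definition unital_star_subalgebra :: "'v staralg \<Rightarrow> 'v set \<Rightarrow> bool" where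
  "unital_star_subalgebra A B \<longleftrightarrow> B \<subseteq> carr A \<and> aone A \<in> B \<and>
     (\<forall>x\<in>B. \<forall>y\<in>B. vadd A x y \<in> B \<and> amult A x y \<in> B) \<and>
     (\<forall>c. \<forall>x\<in>B. vscl A c x \<in> B) \<and> (\<forall>x\<in>B. astar A x \<in> B)"

definition faithful_tracial_state :: "'v staralg \<Rightarrow> ('v \<Rightarrow> complex) \<Rightarrow> bool" where
  "faithful_tracial_state A \<phi> \<longleftrightarrow>
     (\<forall>x\<in>carr A. \<forall>y\<in>carr A. \<phi> (vadd A x y) = \<phi> x + \<phi> y) \<and>
     (\<forall>c. \<forall>x\<in>carr A. \<phi> (vscl A c x) = c * \<phi> x) \<and>
     \<phi> (aone A) = 1 \<and>
     (\<forall>x\<in>carr A. \<phi> (amult A (astar A x) x) \<in> \<real> \<and> 0 \<le> Re (\<phi> (amult A (astar A x) x))) \<and>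
     (\<forall>x\<in>carr A. \<phi> (amult A (astar A x) x) = 0 \<longrightarrow> x = vscl A 0 x) \<and>
     (\<forall>x\<in>carr A. \<forall>y\<in>carr A. \<phi> (amult A x y) = \<phi> (amult A y x))"

text \<open>\<open>L\<^sup>2(A,\<phi>)\<close> is \<open>completion (gns_form A \<phi>)\<close>; the vector \<open>a \<Omega>\<close> is
  \<open>embed (gns_form A \<phi>) a\<close>.\<close>

definition gns_form :: "'v staralg \<Rightarrow> ('v \<Rightarrow> complex) \<Rightarrow> 'v ipspace" where
  "gns_form A \<phi> = \<lparr> carr = carr A, vadd = vadd A, vscl = vscl A,
     ip = (\<lambda>a b. \<phi> (amult A (astar A b) a)) \<rparr>"

definition algebraic_conditional_expectation ::
    "'v staralg \<Rightarrow> ('v \<Rightarrow> complex) \<Rightarrow> 'v set \<Rightarrow> ('v \<Rightarrow> 'v) \<Rightarrow> bool" where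
  "algebraic_conditional_expectation A \<phi> B E \<longleftrightarrow>
     unital_star_algebra A \<and> faithful_tracial_state A \<phi> \<and> unital_star_subalgebra A B \<and>
     (\<forall>a\<in>carr A. E a \<in> B) \<and>
     (\<exists>T. orthogonal_projection (completion (gns_form A \<phi>)) (completion_sub (gns_form A \<phi>) B) T \<and>
          (\<forall>a\<in>carr A. T (embed (gns_form A \<phi>) a) = embed (gns_form A \<phi>) (E a)))"


section \<open>Complexification and Hilbert tensor powers\<close>

text \<open>
  The complexification of a real Hilbert space \<open>'a\<close> is realised on \<open>'a \<times> 'a\<close>, the pair \<open>(u, v)\<close>
  standing for \<open>u + i v\<close>.
\<close>

definition cinner :: "'a::real_inner \<times> 'a \<Rightarrow> 'a \<times> 'a \<Rightarrow> complex" where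
  "cinner h k = Complex (fst h \<bullet> fst k + snd h \<bullet> snd k) (snd h \<bullet> fst k - fst h \<bullet> snd k)"

definition complexification :: "('a::real_inner \<times> 'a) ipspace" where
  "complexification = \<lparr> carr = UNIV, vadd = (+),
     vscl = (\<lambda>c (u, v). (Re c *\<^sub>R u - Im c *\<^sub>R v, Re c *\<^sub>R v + Im c *\<^sub>R u)),
     ip = cinner \<rparr>"

subsection \<open>An orthonormal basis\<close>

definition is_onb :: "'a::real_inner set \<Rightarrow> bool" where
  "is_onb B \<longleftrightarrow> pairwise orthogonal B \<and> (\<forall>b\<in>B. norm b = 1) \<and> closure (span B) = UNIV"

text \<open>All notions below that are written with \<open>onb\<close> do not depend on the choice of the basis.\<close>

definition onb :: "'a::real_inner set" where
  "onb = (SOME B. is_onb B)"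

subsection \<open>Tensor powers\<close>

text \<open>
  The \<open>n\<close>-th Hilbert tensor power of the complexification of \<open>'a\<close> is realised as the space of
  complex valued Hilbert--Schmidt functionals on the \<open>n\<close>-th power of \<open>'a\<close>, where
  \<open>h\<^sub>1 \<otimes> \<dots> \<otimes> h\<^sub>n\<close> is the functional \<open>x \<mapsto> \<langle>h\<^sub>1, x\<^sub>1\<rangle> \<cdots> \<langle>h\<^sub>n, x\<^sub>n\<rangle>\<close>.  (This is the usual description by
  Hilbert--Schmidt conjugate-multilinear functionals on the complexification, which are determined
  by their values on real vectors.)  A functional takes a whole sequence but depends only on the
  entries with index in \<open>{1..n}\<close>.
\<close>

type_synonym 'a tensor = "(nat \<Rightarrow> 'a) \<Rightarrow> complex"

definition pure_tensor :: "nat \<Rightarrow> (nat \<Rightarrow> 'a \<times> 'a) \<Rightarrow> 'a::real_inner tensor" where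
  "pure_tensor n h = (\<lambda>x. \<Prod>i=1..n. cinner (h i) (x i, 0))"

definition tinner :: "nat \<Rightarrow> 'a::real_inner tensor \<Rightarrow> 'a tensor \<Rightarrow> complex" where
  "tinner n F G = (\<Sum>\<^sub>\<infinity>e\<in>{1..n} \<rightarrow>\<^sub>E onb. F e * cnj (G e))"

definition hilbert_schmidt :: "nat \<Rightarrow> 'a::real_inner tensor set" where
  "hilbert_schmidt n = {F.
     (\<forall>x y. (\<forall>i\<in>{1..n}. x i = y i) \<longrightarrow> F x = F y) \<and>
     (\<forall>i\<in>{1..n}. \<forall>x. linear (\<lambda>u. F (x(i := u)))) \<and>
     (\<exists>K. \<forall>x. cmod (F x) \<le> K * (\<Prod>i=1..n. norm (x i))) \<and>
     (\<lambda>e. (cmod (F e))\<^sup>2) summable_on ({1..n} \<rightarrow>\<^sub>E onb)}"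

definition tensor_span :: "complex set \<Rightarrow> ('a \<times> 'a) set \<Rightarrow> nat \<Rightarrow> 'a::real_inner tensor set" where
  "tensor_span S V n = {\<lambda>x. \<Sum>j<m. c j * pure_tensor n (h j) x | m (c :: nat \<Rightarrow> complex) h.
     (\<forall>j<m. c j \<in> S \<and> (\<forall>i\<in>{1..n}. h j i \<in> V))}"

text \<open>The closed span, with coefficients in \<open>S\<close>, of the simple tensors of vectors in \<open>V\<close>.\<close>

definition closed_tensor_span ::
    "complex set \<Rightarrow> ('a \<times> 'a) set \<Rightarrow> nat \<Rightarrow> 'a::real_inner tensor set" where
  "closed_tensor_span S V n = {F \<in> hilbert_schmidt n. \<forall>\<epsilon>>0. \<exists>G\<in>tensor_span S V n.
     Re (tinner n (\<lambda>x. F x - G x) (\<lambda>x. F x - G x)) < \<epsilon>}"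

text \<open>The tensor power of a closed complex subspace \<open>V\<close> of the complexification, and the tensor
  power of a closed subspace \<open>M\<close> of the real Hilbert space itself.\<close>

abbreviation tensor_power :: "('a \<times> 'a) set \<Rightarrow> nat \<Rightarrow> 'a::real_inner tensor set" where
  "tensor_power V n \<equiv> closed_tensor_span UNIV V n"

abbreviation real_tensor_power :: "'a set \<Rightarrow> nat \<Rightarrow> 'a::real_inner tensor set" where
  "real_tensor_power M n \<equiv> closed_tensor_span \<real> (M \<times> {0}) n"

definition perm_op :: "(nat \<Rightarrow> nat) \<Rightarrow> 'a tensor \<Rightarrow> 'a tensor" where
  "perm_op \<sigma> F = (\<lambda>x. F (x \<circ> \<sigma>))"

definition tensor_prod :: "nat \<Rightarrow> 'a tensor \<Rightarrow> 'a tensor \<Rightarrow> 'a tensor" where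
  "tensor_prod n F G = (\<lambda>x. F x * G (\<lambda>i. x (n + i)))"

text \<open>The \<open>n\<close>-th tensor power of a bounded operator \<open>A\<close>: the expansion
  \<open>F = \<Sum>\<^sub>e F(e) e\<^sub>1 \<otimes> \<dots> \<otimes> e\<^sub>n\<close> is mapped to \<open>\<Sum>\<^sub>e F(e) A e\<^sub>1 \<otimes> \<dots> \<otimes> A e\<^sub>n\<close>.\<close>

definition tensor_op ::
    "('a \<times> 'a \<Rightarrow> 'a \<times> 'a) \<Rightarrow> nat \<Rightarrow> 'a::real_inner tensor \<Rightarrow> 'a tensor" where
  "tensor_op A n F = (\<lambda>x. \<Sum>\<^sub>\<infinity>e\<in>{1..n} \<rightarrow>\<^sub>E onb. F e * pure_tensor n (\<lambda>i. A (e i, 0)) x)"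


section \<open>Permutations and contractions\<close>

definition Sn :: "nat \<Rightarrow> (nat \<Rightarrow> nat) set" where
  "Sn n = {\<sigma>. \<sigma> permutes {1..n}}"

definition S0 :: "nat \<Rightarrow> (nat \<Rightarrow> nat) set" where
  "S0 n = {\<alpha>. \<alpha> permutes {0..n}}"

definition cyc0 :: "nat set \<Rightarrow> (nat \<Rightarrow> nat) \<Rightarrow> nat" where
  "cyc0 X \<alpha> = card {orbit \<alpha> x | x. x \<in> X \<and> 0 \<notin> orbit \<alpha> x}"

definition chi :: "real \<Rightarrow> nat \<Rightarrow> (nat \<Rightarrow> nat) \<Rightarrow> real" where
  "chi q n \<alpha> = q ^ (n - cyc0 {0..n} \<alpha>)"

definition shift :: "nat \<Rightarrow> nat \<Rightarrow> nat" where
  "shift n j = (if j = 0 then 0 else n + j)"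

text \<open>\<open>\<alpha> \<union> \<beta>\<close> for \<open>\<alpha> \<in> S0 n\<close> and \<open>\<beta> \<in> S0 k\<close>\<close>

definition perm_cup :: "nat \<Rightarrow> (nat \<Rightarrow> nat) \<Rightarrow> (nat \<Rightarrow> nat) \<Rightarrow> nat \<Rightarrow> nat" where
  "perm_cup n \<alpha> \<beta> =
     (\<lambda>x. if x \<in> {1..n} then x else shift n (\<beta> (if x = 0 then 0 else x - n))) \<circ> \<alpha>"

text \<open>Partitions into blocks of size 1 and 2 are represented by their involutions; \<open>P12 n k\<close> is
  \<open>\<P>\<^sub>1\<^sub>,\<^sub>2(n,k)\<close>.\<close>

definition P12 :: "nat \<Rightarrow> nat \<Rightarrow> (nat \<Rightarrow> nat) set" where
  "P12 n k = {\<pi>. \<pi> permutes {1..n + k} \<and> \<pi> \<circ> \<pi> = id \<and> (\<forall>i. i < \<pi> i \<longrightarrow> i \<le> n \<and> n < \<pi> i)}"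

definition supp :: "(nat \<Rightarrow> nat) \<Rightarrow> nat set" where
  "supp \<pi> = {i. \<pi> i \<noteq> i}"

definition left_ends :: "(nat \<Rightarrow> nat) \<Rightarrow> nat set" where
  "left_ends \<pi> = {i. i < \<pi> i}"

definition npairs :: "(nat \<Rightarrow> nat) \<Rightarrow> nat" where
  "npairs \<pi> = card (left_ends \<pi>)"

text \<open>\<open>\<alpha>|\<^bsub>X\<^sup>c\<^esub>\<close>, extended to be the identity on \<open>X\<close>\<close>

definition first_return :: "nat set \<Rightarrow> (nat \<Rightarrow> nat) \<Rightarrow> nat \<Rightarrow> nat" where
  "first_return X \<alpha> x = (if x \<in> X then x else (\<alpha> ^^ (LEAST j. 0 < j \<and> (\<alpha> ^^ j) x \<notin> X)) x)"

text \<open>The increasing bijection from all naturals onto those outside \<open>supp \<pi>\<close>; it restricts to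
  a bijection from \<open>{0..n - 2 * npairs \<pi>}\<close> onto \<open>{0..n} - supp \<pi>\<close>.\<close>

definition unlabel :: "(nat \<Rightarrow> nat) \<Rightarrow> nat \<Rightarrow> nat" where
  "unlabel \<pi> = enumerate (- supp \<pi>)"

text \<open>\<open>C\<^sub>\<pi>(\<alpha>)\<close> is the multiple \<open>contract_coeff q n \<pi> \<alpha>\<close> of the permutation \<open>contract_perm \<pi> \<alpha>\<close>, for
  \<open>\<alpha> \<in> S0 n\<close>.\<close>

definition contract_perm :: "(nat \<Rightarrow> nat) \<Rightarrow> (nat \<Rightarrow> nat) \<Rightarrow> nat \<Rightarrow> nat" where
  "contract_perm \<pi> \<alpha> = inv (unlabel \<pi>) \<circ> first_return (supp \<pi>) (\<pi> \<circ> \<alpha>) \<circ> unlabel \<pi>"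

definition contract_coeff :: "real \<Rightarrow> nat \<Rightarrow> (nat \<Rightarrow> nat) \<Rightarrow> (nat \<Rightarrow> nat) \<Rightarrow> real" where
  "contract_coeff q n \<pi> \<alpha> =
     q powi (int (cyc0 ({0..n} - supp \<pi>) (first_return (supp \<pi>) (\<pi> \<circ> \<alpha>)))
             - int (cyc0 {0..n} (\<pi> \<circ> \<alpha>)) + int (npairs \<pi>))"

text \<open>For each pair of \<open>\<pi>\<close>, the same basis vector is inserted at both positions, and the result is
  summed over all choices of basis vectors; the basis consists of vectors of the real Hilbert
  space, so this is the complex-linear extension of the contraction of real tensors.\<close>

definition contract_tensor :: "(nat \<Rightarrow> nat) \<Rightarrow> 'a::real_inner tensor \<Rightarrow> 'a tensor" where
  "contract_tensor \<pi> F = (\<lambda>x. \<Sum>\<^sub>\<infinity>b\<in>left_ends \<pi> \<rightarrow>\<^sub>E onb.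
     F (\<lambda>i. if i < \<pi> i then b i else if \<pi> i < i then b (\<pi> i) else x (inv (unlabel \<pi>) i)))"


section \<open>The constructions on simple tensors\<close>

text \<open>
  The lemmas named after \<open>pure_tensor\<close> show that inner product, permutation operators, tensor
  products, tensor powers of projections and contractions have the expected values on simple
  tensors, of which they are the continuous (multi)linear extensions.
\<close>

lemma closed_subspace_proj_exists:
  fixes M :: "'a::{real_inner, complete_space} set"
  assumes M: "subspace M" "closed M"
  shows "\<exists>p\<in>M. \<forall>z\<in>M. (x - p) \<bullet> z = 0"
proof -
  define d where "d = (INF y\<in>M. (norm (x - y))\<^sup>2)"
  have ne: "M \<noteq> {}" using M(1) subspace_0 by blast
  have bdd: "bdd_below ((\<lambda>y. (norm (x - y))\<^sup>2) ` M)" by (rule bdd_belowI[of _ 0]) auto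
  have dle: "d \<le> (norm (x - y))\<^sup>2" if "y \<in> M" for y
    unfolding d_def by (rule cINF_lower[OF bdd that])
  have "\<exists>y\<in>M. (norm (x - y))\<^sup>2 < d + 1 / real (Suc n)" for n
  proof -
    have "d < d + 1 / real (Suc n)" by simp
    then show ?thesis unfolding d_def using cINF_less_iff[OF ne bdd] by blast
  qed
  then obtain p where pM: "\<And>n. p n \<in> M" and pd: "\<And>n. (norm (x - p n))\<^sup>2 < d + 1 / real (Suc n)"
    by metis
  have par: "(norm (a - b))\<^sup>2 \<le> 2 * ((norm (x - a))\<^sup>2 - d) + 2 * ((norm (x - b))\<^sup>2 - d)"
    if "a \<in> M" "b \<in> M" for a b
  proof -
    have "(1/2) *\<^sub>R (a + b) \<in> M" using that M(1) by (simp add: subspace_add subspace_scale)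
    from dle[OF this] have "4 * d \<le> 4 * (norm (x - (1/2) *\<^sub>R (a + b)))\<^sup>2" by simp
    also have "\<dots> = 2 * (norm (x - a))\<^sup>2 + 2 * (norm (x - b))\<^sup>2 - (norm (a - b))\<^sup>2"
      unfolding power2_norm_eq_inner
      by (simp add: inner_diff_left inner_diff_right inner_add_left inner_add_right inner_commute algebra_simps)
    finally show ?thesis by simp
  qed
  have "Cauchy p"
  proof (rule CauchyI)
    fix e :: real assume "0 < e"
    obtain N where N: "4 / real (Suc N) < e\<^sup>2"
    proof -
      have "0 < e\<^sup>2 / 4" using \<open>0 < e\<close> by simp
      from reals_Archimedean[OF this] obtain N where "inverse (real (Suc N)) < e\<^sup>2 / 4" by blast
      then show ?thesis using that[of N] by (simp add: field_simps)
    qed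
    show "\<exists>N. \<forall>m\<ge>N. \<forall>n\<ge>N. norm (p m - p n) < e"
    proof (intro exI allI impI)
      fix m n assume mn: "N \<le> m" "N \<le> n"
      have a: "1 / real (Suc k) \<le> 1 / real (Suc N)" if "N \<le> k" for k
        using that by (simp add: field_simps)
      have "(norm (p m - p n))\<^sup>2 \<le> 2 * ((norm (x - p m))\<^sup>2 - d) + 2 * ((norm (x - p n))\<^sup>2 - d)"
        by (rule par[OF pM pM])
      also have "\<dots> \<le> 4 / real (Suc N)"
        using pd[of m] pd[of n] a[OF mn(1)] a[OF mn(2)] by simp
      also note N
      finally show "norm (p m - p n) < e"
        using \<open>0 < e\<close> by (simp add: power_less_imp_less_base)
    qed
  qed
  then obtain l where l: "p \<longlonglongrightarrow> l" using Cauchy_convergent convergent_def by blast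
  have lM: "l \<in> M" using M(2) pM l closed_sequentially by blast
  have "(\<lambda>n. (norm (x - p n))\<^sup>2) \<longlonglongrightarrow> (norm (x - l))\<^sup>2" by (intro tendsto_intros l)
  moreover have "(\<lambda>n. d + 1 / real (Suc n)) \<longlonglongrightarrow> d + 0"
    by (intro tendsto_intros LIMSEQ_Suc[OF lim_const_over_n])
  ultimately have ld: "(norm (x - l))\<^sup>2 \<le> d"
    using LIMSEQ_le[of "\<lambda>n. (norm (x - p n))\<^sup>2" _ "\<lambda>n. d + 1 / real (Suc n)" "d + 0"] pd
    by (auto intro: less_imp_le)
  have "(x - l) \<bullet> z = 0" if z: "z \<in> M" for z
  proof (rule ccontr)
    assume nz: "(x - l) \<bullet> z \<noteq> 0"
    define t where "t = ((x - l) \<bullet> z) / (z \<bullet> z)"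
    have zz: "z \<bullet> z > 0" using nz by auto
    have "l + t *\<^sub>R z \<in> M" using lM z M(1) by (simp add: subspace_add subspace_scale)
    from dle[OF this] ld have "(norm (x - l))\<^sup>2 \<le> (norm (x - (l + t *\<^sub>R z)))\<^sup>2" by linarith
    also have "\<dots> = (norm ((x - l) - t *\<^sub>R z))\<^sup>2" by (simp only: diff_diff_add)
    also have "\<dots> = (norm (x - l))\<^sup>2 - 2 * t * ((x - l) \<bullet> z) + t * t * (z \<bullet> z)"
      unfolding power2_norm_eq_inner
      by (simp add: inner_diff_left inner_diff_right inner_commute algebra_simps)
    also have "\<dots> = (norm (x - l))\<^sup>2 - ((x - l) \<bullet> z)\<^sup>2 / (z \<bullet> z)"
      using zz by (simp add: t_def field_simps power2_eq_square)
    finally have "((x - l) \<bullet> z)\<^sup>2 / (z \<bullet> z) \<le> 0" by simp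
    moreover have "((x - l) \<bullet> z)\<^sup>2 / (z \<bullet> z) > 0" using nz zz by simp
    ultimately show False by simp
  qed
  with lM show ?thesis by blast
qed

lemma subspace_closure:
  fixes X :: "'a::real_normed_vector set"
  assumes "subspace X"
  shows "subspace (closure X)"
proof (rule subspaceI)
  show "0 \<in> closure X" using assms closure_subset subspace_0 by blast
next
  fix x y assume "x \<in> closure X" "y \<in> closure X"
  then obtain f g where "\<And>n. f n \<in> X" "f \<longlonglongrightarrow> x" "\<And>n. g n \<in> X" "g \<longlonglongrightarrow> y"
    unfolding closure_sequential by blast
  then have "\<And>n. f n + g n \<in> X" "(\<lambda>n. f n + g n) \<longlonglongrightarrow> x + y"
    using assms by (auto intro: subspace_add tendsto_add)
  then show "x + y \<in> closure X"
    unfolding closure_sequential by (intro exI[of _ "\<lambda>n. f n + g n"]) auto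
next
  fix c x assume "x \<in> closure X"
  then obtain f where "\<And>n. f n \<in> X" "f \<longlonglongrightarrow> x" unfolding closure_sequential by blast
  then have "\<And>n. c *\<^sub>R f n \<in> X" "(\<lambda>n. c *\<^sub>R f n) \<longlonglongrightarrow> c *\<^sub>R x"
    using assms by (auto intro: subspace_scale tendsto_scaleR)
  then show "c *\<^sub>R x \<in> closure X"
    unfolding closure_sequential by (intro exI[of _ "\<lambda>n. c *\<^sub>R f n"]) auto
qed

lemma is_onb_onb: "is_onb (onb :: 'a::{real_inner, complete_space} set)"
proof -
  define A where "A = {B :: 'a set. pairwise orthogonal B \<and> (\<forall>b\<in>B. norm b = 1)}"
  have "\<exists>B\<in>A. \<forall>X\<in>A. B \<subseteq> X \<longrightarrow> X = B"
  proof (rule subset_Zorn')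
    fix C assume C: "subset.chain A C"
    have "pairwise orthogonal (\<Union>C)"
    proof (rule pairwiseI)
      fix x y assume xy: "x \<in> \<Union>C" "y \<in> \<Union>C" "x \<noteq> y"
      then obtain X Y where "X \<in> C" "Y \<in> C" "x \<in> X" "y \<in> Y" by blast
      moreover have "X \<subseteq> Y \<or> Y \<subseteq> X"
        using C \<open>X \<in> C\<close> \<open>Y \<in> C\<close> by (simp add: subset_chain_def)
      ultimately obtain Z where "Z \<in> C" "x \<in> Z" "y \<in> Z" by blast
      moreover have "Z \<in> A" using C \<open>Z \<in> C\<close> by (auto simp: subset_chain_def)
      ultimately show "orthogonal x y" using xy by (auto simp: A_def pairwise_def)
    qed
    moreover have "\<forall>b\<in>\<Union>C. norm b = 1" using C by (auto simp: subset_chain_def A_def)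
    ultimately show "\<Union>C \<in> A" by (simp add: A_def)
  qed
  then obtain B where B: "B \<in> A" and max: "\<And>X. X \<in> A \<Longrightarrow> B \<subseteq> X \<Longrightarrow> X = B" by blast
  have "closure (span B) = UNIV"
  proof (rule ccontr)
    assume "closure (span B) \<noteq> UNIV"
    then obtain x where x: "x \<notin> closure (span B)" by blast
    obtain p where p: "p \<in> closure (span B)" "\<forall>z\<in>closure (span B). (x - p) \<bullet> z = 0"
      using closed_subspace_proj_exists[OF subspace_closure[OF subspace_span] closed_closure] by blast
    define u where "u = (1 / norm (x - p)) *\<^sub>R (x - p)"
    have xp: "x \<noteq> p" using x p(1) by blast
    have orth: "u \<bullet> b = 0" if "b \<in> B" for b
    proof -
      have "b \<in> closure (span B)" by (rule subsetD[OF closure_subset span_base[OF that]])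
      then have "(x - p) \<bullet> b = 0" using p(2) by blast
      then show ?thesis by (simp only: u_def inner_scaleR_left mult_zero_right)
    qed
    have nu: "norm u = 1" using xp by (simp add: u_def)
    have "pairwise orthogonal (insert u B)"
      using B orth unfolding A_def pairwise_insert by (simp add: orthogonal_def inner_commute)
    then have "insert u B \<in> A" using B nu by (simp add: A_def)
    then have "u \<in> B" using max by blast
    from orth[OF this] nu show False by simp
  qed
  then have "is_onb B" using B by (simp add: is_onb_def A_def)
  then show ?thesis unfolding onb_def by (rule someI)
qed

lemma parseval:
  fixes x y :: "'a::{real_inner, complete_space}"
  shows "((\<lambda>b. (x \<bullet> b) * (b \<bullet> y)) has_sum (x \<bullet> y)) onb"
proof -
  let ?B = "onb :: 'a set"
  have on: "pairwise orthogonal ?B" "\<And>b. b \<in> ?B \<Longrightarrow> b \<bullet> b = 1" "closure (span ?B) = UNIV"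
    using is_onb_onb[where 'a='a] by (auto simp: is_onb_def norm_eq_1)
  define Q where "Q F = (\<Sum>b\<in>F. (x \<bullet> b) *\<^sub>R b)" for F :: "'a set"
  have Qo: "(x - Q F) \<bullet> z = 0" if F: "finite F" "F \<subseteq> ?B" and z: "z \<in> span F" for F z
  proof (rule orthogonal_to_span[unfolded orthogonal_def, OF z])
    fix c assume c: "c \<in> F"
    have "Q F \<bullet> c = (\<Sum>b\<in>F. (x \<bullet> b) * (b \<bullet> c))" by (simp add: Q_def inner_sum_left)
    also have "\<dots> = (\<Sum>b\<in>F. if b = c then x \<bullet> c else 0)"
      by (rule sum.cong) (use on(1,2) c subsetD[OF F(2)] in \<open>auto simp: pairwise_def orthogonal_def\<close>)
    also have "\<dots> = x \<bullet> c" using c F by simp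
    finally show "(x - Q F) \<bullet> c = 0" by (simp add: inner_diff_left)
  qed
  have Qs: "Q F \<in> span F" for F unfolding Q_def by (intro span_sum span_scale span_base)
  have best: "norm (x - Q F) \<le> norm (x - s)" if F: "finite F" "F \<subseteq> ?B" and s: "s \<in> span F" for F s
  proof -
    have "orthogonal (x - Q F) (Q F - s)"
      unfolding orthogonal_def by (rule Qo[OF F]) (intro span_diff Qs s)
    from norm_add_Pythagorean[OF this] have "(norm (x - s))\<^sup>2 = (norm (x - Q F))\<^sup>2 + (norm (Q F - s))\<^sup>2"
      by simp
    then have "(norm (x - Q F))\<^sup>2 \<le> (norm (x - s))\<^sup>2" by simp
    then show ?thesis by (rule power2_le_imp_le) simp
  qed
  have partial: "(\<Sum>b\<in>F. (x \<bullet> b) * (b \<bullet> y)) = Q F \<bullet> y" for F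
    by (simp add: Q_def inner_sum_left)
  show ?thesis
    unfolding has_sum_def tendsto_iff eventually_finite_subsets_at_top
  proof (intro allI impI)
    fix e :: real assume e: "0 < e"
    have "x \<in> closure (span ?B)" using on by simp
    moreover have "e / (norm y + 1) > 0" using e by (simp add: add_nonneg_pos)
    ultimately obtain s where s: "s \<in> span ?B" "dist s x < e / (norm y + 1)"
      unfolding closure_approachable by blast
    obtain F where F: "finite F" "F \<subseteq> ?B" "s \<in> span F"
    proof -
      obtain t r where t: "finite t" "t \<subseteq> ?B" "s = (\<Sum>a\<in>t. r a *\<^sub>R a)"
        using s(1) unfolding span_explicit by blast
      have "s \<in> span t" unfolding t(3) by (intro span_sum span_scale span_base)
      with t show thesis using that by blast
    qed
    show "\<exists>X. finite X \<and> X \<subseteq> ?B \<and> (\<forall>Y. finite Y \<and> X \<subseteq> Y \<and> Y \<subseteq> ?B \<longrightarrow>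
        dist (\<Sum>b\<in>Y. (x \<bullet> b) * (b \<bullet> y)) (x \<bullet> y) < e)"
    proof (intro exI conjI allI impI)
      fix Y assume Y: "finite Y \<and> F \<subseteq> Y \<and> Y \<subseteq> ?B"
      then have "norm (x - Q Y) \<le> norm (x - s)"
        using best[of Y s] subsetD[OF span_mono[of F Y] F(3)] by simp
      also have "\<dots> < e / (norm y + 1)" using s(2) by (simp add: dist_norm norm_minus_commute)
      finally have *: "norm (x - Q Y) < e / (norm y + 1)" .
      have "dist (\<Sum>b\<in>Y. (x \<bullet> b) * (b \<bullet> y)) (x \<bullet> y) = \<bar>(x - Q Y) \<bullet> y\<bar>"
        unfolding partial dist_real_def by (simp add: inner_diff_left)
      also have "\<dots> \<le> norm (x - Q Y) * norm y" by (rule Cauchy_Schwarz_ineq2)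
      also have "\<dots> \<le> norm (x - Q Y) * (norm y + 1)" by (simp add: mult_left_mono)
      also have "\<dots> < e" using * by (simp add: add_nonneg_pos pos_less_divide_eq)
      finally show "dist (\<Sum>b\<in>Y. (x \<bullet> b) * (b \<bullet> y)) (x \<bullet> y) < e" .
    qed (use F in auto)
  qed
qed

text \<open>\<open>\<Sum>\<^sub>b \<langle>h, b\<rangle> \<langle>b, k\<rangle> = \<langle>h, k\<rangle>\<close> on the complexification\<close>

lemma parseval_cinner:
  fixes h k :: "'a::{real_inner, complete_space} \<times> 'a"
  shows "((\<lambda>b. cinner h (b, 0) * cinner (b, 0) k) has_sum cinner h k) onb"
proof -
  have c: "cinner a b = of_real (fst a \<bullet> fst b) + of_real (snd a \<bullet> snd b)
      + \<i> * of_real (snd a \<bullet> fst b) - \<i> * of_real (fst a \<bullet> snd b)" for a b :: "'a \<times> 'a"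
    by (simp add: cinner_def complex_eq_iff)
  have r: "((\<lambda>b. of_real (u \<bullet> b) * of_real (b \<bullet> v) :: complex) has_sum of_real (u \<bullet> v)) onb"
    for u v :: 'a
    using has_sum_of_real[OF parseval[of u v], where 'a=complex] by simp
  have "((\<lambda>b. of_real (fst h \<bullet> b) * of_real (b \<bullet> fst k) + of_real (snd h \<bullet> b) * of_real (b \<bullet> snd k)
      + \<i> * (of_real (snd h \<bullet> b) * of_real (b \<bullet> fst k))
      + (- \<i>) * (of_real (fst h \<bullet> b) * of_real (b \<bullet> snd k))) has_sum
      (of_real (fst h \<bullet> fst k) + of_real (snd h \<bullet> snd k) + \<i> * of_real (snd h \<bullet> fst k)
      + (- \<i>) * of_real (fst h \<bullet> snd k) :: complex)) onb"
    by (intro has_sum_add has_sum_cmult_right r)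
  moreover have "cinner h (b, 0) * cinner (b, 0) k =
      of_real (fst h \<bullet> b) * of_real (b \<bullet> fst k) + of_real (snd h \<bullet> b) * of_real (b \<bullet> snd k)
      + \<i> * (of_real (snd h \<bullet> b) * of_real (b \<bullet> fst k))
      + (- \<i>) * (of_real (fst h \<bullet> b) * of_real (b \<bullet> snd k))" for b
    by (simp add: cinner_def complex_eq_iff algebra_simps)
  ultimately show ?thesis
    unfolding c[of h k] by simp
qed

lemma infsum_prod_parseval:
  fixes h k :: "nat \<Rightarrow> 'a::{real_inner, complete_space} \<times> 'a"
  assumes "finite A"
  shows "(\<Sum>\<^sub>\<infinity>e\<in>A \<rightarrow>\<^sub>E onb. \<Prod>i\<in>A. cinner (h i) (e i, 0) * cinner (e i, 0) (k i)) =
    (\<Prod>i\<in>A. cinner (h i) (k i))"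
proof -
  have s: "(\<lambda>b. cinner h (b, 0) * cinner (b, 0) k) summable_on onb" for h k :: "'a \<times> 'a"
    using parseval_cinner has_sum_imp_summable by blast
  have "(\<Sum>\<^sub>\<infinity>e\<in>A \<rightarrow>\<^sub>E onb. \<Prod>i\<in>A. cinner (h i) (e i, 0) * cinner (e i, 0) (k i)) =
     (\<Prod>i\<in>A. \<Sum>\<^sub>\<infinity>b\<in>onb. cinner (h i) (b, 0) * cinner (b, 0) (k i))"
    by (rule infsum_prod_PiE_abs[OF assms]) (rule s[THEN summable_on_iff_abs_summable_on_complex[THEN iffD1]])
  then show ?thesis unfolding infsumI[OF parseval_cinner] .
qed

lemma cinner_cnj: "cnj (cinner h k) = cinner k h"
  by (simp add: cinner_def complex_eq_iff inner_commute)

lemma tinner_pure_tensor: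
  fixes h k :: "nat \<Rightarrow> 'a::{real_inner, complete_space} \<times> 'a"
  shows "tinner n (pure_tensor n h) (pure_tensor n k) = (\<Prod>i=1..n. cinner (h i) (k i))"
  unfolding tinner_def pure_tensor_def
  by (simp add: cinner_cnj infsum_prod_parseval flip: prod.distrib)

lemma perm_op_pure_tensor:
  assumes "\<sigma> \<in> Sn n"
  shows "perm_op \<sigma> (pure_tensor n h) = pure_tensor n (h \<circ> inv \<sigma>)"
proof
  fix x
  have \<sigma>: "\<sigma> permutes {1..n}" using assms by (simp add: Sn_def)
  have "(\<Prod>i=1..n. cinner (h (inv \<sigma> i)) (x i, 0)) = (\<Prod>i=1..n. cinner (h (inv \<sigma> (\<sigma> i))) (x (\<sigma> i), 0))"
    using prod.permute[OF \<sigma>, of "\<lambda>i. cinner (h (inv \<sigma> i)) (x i, 0)"] by (simp add: comp_def)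
  then show "perm_op \<sigma> (pure_tensor n h) x = pure_tensor n (h \<circ> inv \<sigma>) x"
    using \<sigma> by (simp add: perm_op_def pure_tensor_def permutes_inverses)
qed

lemma tensor_prod_pure_tensor:
  "tensor_prod n (pure_tensor n h) (pure_tensor k g) =
   pure_tensor (n + k) (\<lambda>i. if i \<le> n then h i else g (i - n))"
proof
  fix x
  have "(\<Prod>i=1..n+k. cinner (if i \<le> n then h i else g (i - n)) (x i, 0)) =
    (\<Prod>i=1..n. cinner (h i) (x i, 0)) * (\<Prod>i=n+1..n+k. cinner (g (i - n)) (x i, 0))"
  proof -
    have "{1..n+k} = {1..n} \<union> {n+1..n+k}" by auto
    then show ?thesis by (simp add: prod.union_disjoint)
  qed
  also have "(\<Prod>i=n+1..n+k. cinner (g (i - n)) (x i, 0)) = (\<Prod>i=1..k. cinner (g i) (x (n + i), 0))"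
    by (rule prod.reindex_bij_witness[of _ "\<lambda>i. n + i" "\<lambda>i. i - n"]) auto
  finally show "tensor_prod n (pure_tensor n h) (pure_tensor k g) x =
      pure_tensor (n + k) (\<lambda>i. if i \<le> n then h i else g (i - n)) x"
    by (simp add: tensor_prod_def pure_tensor_def)
qed

lemma orthogonal_projection_cinner:
  assumes "orthogonal_projection complexification V P"
  shows "cinner (P h) k = cinner h (P k)"
proof -
  have m: "P x \<in> V" for x
    using assms by (simp add: orthogonal_projection_def complexification_def del: split_paired_All)
  have o: "cinner (vsub complexification x (P x)) y = 0" if "y \<in> V" for x y
  proof -
    have "ip complexification (vsub complexification x (P x)) y = 0"
      using assms that unfolding orthogonal_projection_def
      by (simp add: complexification_def del: split_paired_All)
    then show ?thesis by (simp add: complexification_def)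
  qed
  have e: "cinner (vsub complexification x x') y = cinner x y - cinner x' y" for x x' y :: "'a \<times> 'a"
    by (cases x; cases x')
      (simp add: vsub_def complexification_def cinner_def complex_eq_iff inner_diff_left)
  have o': "cinner x (P y) = cinner (P x) (P y)" for x y using o[OF m, of x y] by (simp add: e)
  show ?thesis by (metis o' cinner_cnj)
qed

lemma tensor_op_pure_tensor:
  fixes h :: "nat \<Rightarrow> 'a::{real_inner, complete_space} \<times> 'a"
  assumes "orthogonal_projection complexification V P"
  shows "tensor_op P n (pure_tensor n h) = pure_tensor n (\<lambda>i. P (h i))"
  unfolding tensor_op_def pure_tensor_def orthogonal_projection_cinner[OF assms]
  by (simp add: infsum_prod_parseval flip: prod.distrib)


lemma contract_tensor_pure_tensor:
  fixes u :: "nat \<Rightarrow> 'a::{real_inner, complete_space}"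
  assumes \<pi>: "\<pi> permutes {1..N}" "\<pi> \<circ> \<pi> = id"
  shows "contract_tensor \<pi> (pure_tensor N (\<lambda>i. (u i, 0))) =
    (\<lambda>x. (\<Prod>i\<in>left_ends \<pi>. of_real (u i \<bullet> u (\<pi> i))) *
         pure_tensor (N - 2 * npairs \<pi>) (\<lambda>i. (u (unlabel \<pi> i), 0)) x)"
proof
  fix x
  define L where "L = left_ends \<pi>"
  define T where "T = {1..N} - supp \<pi>"
  have inv: "\<pi> (\<pi> i) = i" for i using \<pi>(2) by (metis comp_apply id_apply)
  have sub: "supp \<pi> \<subseteq> {1..N}" using \<pi>(1) by (auto simp: supp_def permutes_def)
  have LR: "supp \<pi> = L \<union> \<pi> ` L"
  proof (intro set_eqI iffI)
    fix i assume "i \<in> supp \<pi>"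
    then have "i < \<pi> i \<or> \<pi> i < i" by (auto simp: supp_def neq_iff)
    then show "i \<in> L \<union> \<pi> ` L"
    proof
      assume "\<pi> i < i"
      then have "\<pi> i \<in> L" by (simp add: L_def left_ends_def inv)
      then show ?thesis using inv[of i] by (metis UnI2 imageI)
    qed (simp add: L_def left_ends_def)
  qed (auto simp: supp_def L_def left_ends_def inv)
  have disj: "L \<inter> \<pi> ` L = {}"
  proof -
    have "\<not> \<pi> j < \<pi> (\<pi> j)" if "j < \<pi> j" for j using that unfolding inv[of j] by simp
    then show ?thesis by (auto simp: L_def left_ends_def)
  qed
  have finL: "finite L" using finite_subset[OF sub] LR by simp
  have injL: "inj_on \<pi> L" by (rule inj_on_inverseI[of _ \<pi>]) (rule inv)
  have split: "(\<Prod>i=1..N. f i) = (\<Prod>i\<in>L. f i * f (\<pi> i)) * (\<Prod>i\<in>T. f i)" for f :: "nat \<Rightarrow> complex"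
  proof -
    have e: "{1..N} = (L \<union> \<pi> ` L) \<union> T" using sub LR by (auto simp: T_def)
    have "(\<Prod>i=1..N. f i) = (\<Prod>i\<in>L \<union> \<pi> ` L. f i) * (\<Prod>i\<in>T. f i)"
      unfolding e by (rule prod.union_disjoint) (use finL LR in \<open>auto simp: T_def\<close>)
    also have "(\<Prod>i\<in>L \<union> \<pi> ` L. f i) = (\<Prod>i\<in>L. f i) * (\<Prod>i\<in>\<pi> ` L. f i)"
      by (rule prod.union_disjoint) (use finL disj in auto)
    finally show ?thesis by (simp add: prod.reindex[OF injL] prod.distrib)
  qed
  define c where "c = (\<Prod>i\<in>T. cinner (u i, 0) (x (inv (unlabel \<pi>) i), 0))"
  have "contract_tensor \<pi> (pure_tensor N (\<lambda>i. (u i, 0))) x =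
    (\<Sum>\<^sub>\<infinity>b\<in>L \<rightarrow>\<^sub>E onb. (\<Prod>i\<in>L. cinner (u i, 0) (b i, 0) * cinner (b i, 0) (u (\<pi> i), 0)) * c)"
  proof -
    have "(\<Prod>i=1..N. cinner (u i, 0) (if i < \<pi> i then b i else if \<pi> i < i then b (\<pi> i)
        else x (inv (unlabel \<pi>) i), 0)) =
      (\<Prod>i\<in>L. cinner (u i, 0) (b i, 0) * cinner (b i, 0) (u (\<pi> i), 0)) * c" for b :: "nat \<Rightarrow> 'a"
    proof -
      let ?y = "\<lambda>i. if i < \<pi> i then b i else if \<pi> i < i then b (\<pi> i) else x (inv (unlabel \<pi>) i)"
      have yL: "?y i = b i" "?y (\<pi> i) = b i" if "i \<in> L" for i
        using that by (simp_all add: L_def left_ends_def inv)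
      have yT: "?y i = x (inv (unlabel \<pi>) i)" if "i \<in> T" for i
        using that by (simp add: T_def supp_def)
      have sym: "cinner (u (\<pi> i), 0) (b i, 0) = cinner (b i, 0) (u (\<pi> i), 0)" for i
        by (simp add: cinner_def inner_commute)
      have "(\<Prod>i\<in>L. cinner (u i, 0) (?y i, 0) * cinner (u (\<pi> i), 0) (?y (\<pi> i), 0)) =
          (\<Prod>i\<in>L. cinner (u i, 0) (b i, 0) * cinner (b i, 0) (u (\<pi> i), 0))"
        by (rule prod.cong[OF refl]) (simp only: yL sym)
      moreover have "(\<Prod>i\<in>T. cinner (u i, 0) (?y i, 0)) = c"
        unfolding c_def by (rule prod.cong[OF refl]) (simp only: yT)
      ultimately show ?thesis unfolding split[of "\<lambda>i. cinner (u i, 0) (?y i, 0)"] by (simp only:)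
    qed
    then show ?thesis by (simp only: contract_tensor_def pure_tensor_def L_def[symmetric])
  qed
  also have "\<dots> = (\<Prod>i\<in>L. cinner (u i, 0) (u (\<pi> i), 0)) * c"
    by (simp only: infsum_cmult_left' infsum_prod_parseval[OF finL])
  also have "(\<Prod>i\<in>L. cinner (u i, 0) (u (\<pi> i), 0)) = (\<Prod>i\<in>left_ends \<pi>. of_real (u i \<bullet> u (\<pi> i)))"
    unfolding L_def by (rule prod.cong[OF refl]) (simp add: cinner_def complex_eq_iff)
  also have "c = pure_tensor (N - 2 * npairs \<pi>) (\<lambda>i. (u (unlabel \<pi> i), 0)) x"
  proof -
    let ?r = "unlabel \<pi>"
    have "finite (supp \<pi>)" using finite_subset[OF sub] by simp
    then have inf: "infinite (- supp \<pi>)" using finite_compl by auto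
    have mono: "?r i < ?r j \<longleftrightarrow> i < j" for i j by (simp add: unlabel_def inf)
    have bij: "bij_betw ?r UNIV (- supp \<pi>)" unfolding unlabel_def by (rule bij_enumerate[OF inf])
    then have inj: "inj ?r" and range: "range ?r = - supp \<pi>" by (auto simp: bij_betw_def)
    have "0 \<notin> supp \<pi>" using sub by auto
    then have r0: "?r 0 = 0" unfolding unlabel_def enumerate_0 by (intro Least_equality) auto
    define J where "J = {j. ?r j \<le> N}"
    have JT: "?r ` J = insert 0 T"
    proof -
      have "?r ` J = range ?r \<inter> {..N}" by (auto simp: J_def)
      then show ?thesis using \<open>0 \<notin> supp \<pi>\<close> by (auto simp: range T_def)
    qed
    have "card J = card (insert 0 T)" using card_image[OF inj_on_subset[OF inj subset_UNIV], of J] JT by simp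
    also have "\<dots> = Suc (card T)" by (simp add: T_def)
    also have "card T = N - card (supp \<pi>)" using card_Diff_subset[OF finite_subset[OF sub finite_atLeastAtMost] sub] by (simp add: T_def)
    also have "card (supp \<pi>) = 2 * npairs \<pi>"
      unfolding LR by (simp add: card_Un_disjoint finL disj card_image injL npairs_def L_def[symmetric])
    finally have cJ: "card J = Suc (N - 2 * npairs \<pi>)" .
    have down: "i \<in> J" if "j \<in> J" "i \<le> j" for i j
      using that mono[of i j] unfolding J_def by (cases "i = j") auto
    have finJ: "finite J" using cJ by (intro card_ge_0_finite) simp
    have J: "J = {0..N - 2 * npairs \<pi>}"
    proof -
      have "0 \<in> J" using r0 by (simp add: J_def)
      then have "J \<noteq> {}" by blast
      then have "J = {0..Max J}" by (intro set_eqI) (metis Max_ge Max_in atLeastAtMost_iff down finJ le0)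
      then obtain m where m: "J = {0..m}" by blast
      then show ?thesis using cJ by simp
    qed
    have T: "T = ?r ` {1..N - 2 * npairs \<pi>}"
    proof -
      have "T = ?r ` J - {?r 0}" unfolding JT r0 by (auto simp: T_def)
      also have "\<dots> = ?r ` (J - {0})" by (simp only: image_set_diff[OF inj] image_insert image_empty)
      also have "J - {0} = {1..N - 2 * npairs \<pi>}" unfolding J by auto
      finally show ?thesis .
    qed
    have i1: "inj_on ?r {1..N - 2 * npairs \<pi>}" by (rule inj_on_subset[OF inj subset_UNIV])
    show ?thesis
      unfolding c_def T pure_tensor_def prod.reindex[OF i1] o_def inv_f_f[OF inj] ..
  qed
  finally show "contract_tensor \<pi> (pure_tensor N (\<lambda>i. (u i, 0))) x =
    (\<Prod>i\<in>left_ends \<pi>. of_real (u i \<bullet> u (\<pi> i))) *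
    pure_tensor (N - 2 * npairs \<pi>) (\<lambda>i. (u (unlabel \<pi> i), 0)) x" .
qed


section \<open>The algebra of trace polynomials\<close>

text \<open>
  An element \<open>\<xi>\<close> of the direct sum of the spaces \<open>\<complex>[S0 n] \<otimes> H\<^bsup>\<otimes>n\<^esup>\<close> is identified with its family
  of coefficients: its component of degree \<open>n\<close> is \<open>\<Sum>\<^sub>\<alpha> \<alpha> \<otimes> \<xi> n \<alpha>\<close>.
\<close>

type_synonym 'a tp = "nat \<Rightarrow> (nat \<Rightarrow> nat) \<Rightarrow> 'a tensor"

text \<open>\<open>\<alpha> \<otimes>\<^sub>s F\<close> for \<open>\<alpha> \<in> S0 n\<close> and an \<open>n\<close>-tensor \<open>F\<close>\<close>

definition symt :: "nat \<Rightarrow> (nat \<Rightarrow> nat) \<Rightarrow> 'a tensor \<Rightarrow> 'a tp" where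
  "symt n \<alpha> F = (\<lambda>m \<beta> x.
     (\<Sum>\<sigma>\<in>Sn n. if m = n \<and> \<beta> = \<sigma> \<circ> \<alpha> \<circ> inv \<sigma> then perm_op \<sigma> F x else 0) / fact n)"

definition cspan :: "'a tp set \<Rightarrow> 'a tp set" where
  "cspan X = {\<lambda>n \<alpha> x. \<Sum>j<m. c j * \<xi> j n \<alpha> x | m (c :: nat \<Rightarrow> complex) \<xi>. \<forall>j<m. \<xi> j \<in> X}"

definition TP :: "('a \<times> 'a) set \<Rightarrow> 'a::real_inner tp set" where
  "TP V = cspan {symt n \<alpha> F | n \<alpha> F. \<alpha> \<in> S0 n \<and> F \<in> tensor_power V n}"

definition TP_real :: "'a set \<Rightarrow> 'a::real_inner tp set" where
  "TP_real M = cspan {symt n \<alpha> F | n \<alpha> F. \<alpha> \<in> S0 n \<and> F \<in> real_tensor_power M n}"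

definition degs :: "'a tp \<Rightarrow> nat set" where
  "degs \<xi> = {n. \<exists>\<alpha> x. \<xi> n \<alpha> x \<noteq> 0}"

text \<open>
  The sesquilinear extension of
  \<open>\<langle>\<alpha> \<otimes> F, \<beta> \<otimes> G\<rangle>\<^sub>q = \<delta>\<^sub>n\<^sub>k \<Sum>\<^sub>\<sigma> \<chi>\<^sub>q(\<alpha>\<sigma>\<beta>\<^sup>-\<^sup>1\<sigma>\<^sup>-\<^sup>1) \<langle>F, U\<^sub>\<sigma> G\<rangle>\<close>; replacing \<open>\<alpha> \<otimes> F\<close> by
  \<open>\<tau>\<alpha>\<tau>\<^sup>-\<^sup>1 \<otimes> U\<^sub>\<tau> F\<close> does not change the right-hand side, so that \<open>\<otimes>\<close> may be read as \<open>\<otimes>\<^sub>s\<close>.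
\<close>

definition form :: "real \<Rightarrow> 'a::real_inner tp \<Rightarrow> 'a tp \<Rightarrow> complex" where
  "form q \<xi> \<eta> = (\<Sum>n\<in>degs \<xi> \<inter> degs \<eta>. \<Sum>\<alpha>\<in>S0 n. \<Sum>\<beta>\<in>S0 n. \<Sum>\<sigma>\<in>Sn n.
     of_real (chi q n (\<alpha> \<circ> \<sigma> \<circ> inv \<beta> \<circ> inv \<sigma>)) * tinner n (\<xi> n \<alpha>) (perm_op \<sigma> (\<eta> n \<beta>)))"

text \<open>
  The bilinear extension of
  \<open>(\<alpha> \<otimes>\<^sub>s F)(\<beta> \<otimes>\<^sub>s G) = \<Sum>\<^sub>\<pi> C\<^sub>\<pi>(\<alpha> \<union> \<beta>) \<otimes>\<^sub>s C\<^sub>\<pi>(F \<otimes> G)\<close>.  Here, too, the right-hand side is not changed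
  by replacing \<open>\<alpha> \<otimes> F\<close> by \<open>\<tau>\<alpha>\<tau>\<^sup>-\<^sup>1 \<otimes> U\<^sub>\<tau> F\<close> (which permutes the partitions \<open>\<pi>\<close>), and likewise for
  \<open>\<beta> \<otimes> G\<close>; so it may be applied to the coefficients of symmetrised elements.
\<close>

definition tpmult :: "real \<Rightarrow> 'a::real_inner tp \<Rightarrow> 'a tp \<Rightarrow> 'a tp" where
  "tpmult q \<xi> \<eta> = (\<lambda>m \<gamma> x. \<Sum>n\<in>degs \<xi>. \<Sum>k\<in>degs \<eta>. \<Sum>\<alpha>\<in>S0 n. \<Sum>\<beta>\<in>S0 k. \<Sum>\<pi>\<in>P12 n k.
     of_real (contract_coeff q (n + k) \<pi> (perm_cup n \<alpha> \<beta>)) *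
     symt (n + k - 2 * npairs \<pi>) (contract_perm \<pi> (perm_cup n \<alpha> \<beta>))
       (contract_tensor \<pi> (tensor_prod n (\<xi> n \<alpha>) (\<eta> k \<beta>))) m \<gamma> x)"

text \<open>The antilinear extension of \<open>(\<alpha> \<otimes>\<^sub>s F)\<^sup>* = \<alpha>\<^sup>-\<^sup>1 \<otimes>\<^sub>s F\<close> for real tensors \<open>F\<close>, which are the
  real-valued functionals.\<close>

definition tpstar :: "'a tp \<Rightarrow> 'a tp" where
  "tpstar \<xi> = (\<lambda>n \<alpha> x. if \<alpha> \<in> S0 n then cnj (\<xi> n (inv \<alpha>) x) else 0)"

definition TP_space :: "real \<Rightarrow> 'a::real_inner tp ipspace" where
  "TP_space q = \<lparr> carr = TP UNIV,
     vadd = (\<lambda>\<xi> \<eta> n \<alpha> x. \<xi> n \<alpha> x + \<eta> n \<alpha> x),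
     vscl = (\<lambda>c \<xi> n \<alpha> x. c * \<xi> n \<alpha> x),
     ip = form q \<rparr>"

definition TPq_space :: "real \<Rightarrow> 'a::real_inner tp set ipspace" where
  "TPq_space q = quotient_space (TP_space q)"

text \<open>\<open>Wcl q \<xi>\<close> is the class of \<open>\<xi>\<close> in the quotient; for \<open>\<xi> \<in> TP_real UNIV\<close> it is the algebra
  element \<open>W(\<xi>)\<close>.\<close>

definition Wcl :: "real \<Rightarrow> 'a::real_inner tp \<Rightarrow> 'a tp set" where
  "Wcl q \<xi> = coset (TP_space q) \<xi>"

definition TPq_alg :: "real \<Rightarrow> 'a::real_inner tp set staralg" where
  "TPq_alg q = \<lparr> carr = Wcl q ` TP_real UNIV,
     vadd = vadd (TPq_space q),
     vscl = vscl (TPq_space q),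
     amult = (\<lambda>X Y. Wcl q (tpmult q (rep X) (rep Y))),
     aone = Wcl q (symt 0 id (\<lambda>_. 1)),
     astar = (\<lambda>X. Wcl q (tpstar (rep X))) \<rparr>"

text \<open>The form on \<open>TP V\<close> is the restriction of the form on \<open>TP UNIV\<close>, so the quotients and completions
  belonging to a subspace are subspaces of those belonging to the full space.\<close>

definition TPq_sub :: "real \<Rightarrow> 'a set \<Rightarrow> 'a::real_inner tp set set" where
  "TPq_sub q M = Wcl q ` TP_real M"

text \<open>The degree 0 part is one-dimensional: \<open>S0 0 = {id}\<close>, and tensors of degree 0 are constant.\<close>

definition vacuum_state :: "'a tp set \<Rightarrow> complex" where
  "vacuum_state X = rep X 0 id undefined"

definition Fock :: "real \<Rightarrow> (nat \<Rightarrow> 'a::real_inner tp set) set ipspace" where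
  "Fock q = completion (TPq_space q)"

definition Fock_sub :: "real \<Rightarrow> ('a \<times> 'a) set \<Rightarrow> (nat \<Rightarrow> 'a::real_inner tp set) set set" where
  "Fock_sub q V = completion_sub (TPq_space q) (Wcl q ` TP V)"

text \<open>The vector \<open>a (0)\<close> of the Fock space, for \<open>a = W(\<xi>)\<close> the class of \<open>\<xi>\<close>\<close>

definition Fock_vec :: "real \<Rightarrow> 'a::real_inner tp set \<Rightarrow> (nat \<Rightarrow> 'a tp set) set" where
  "Fock_vec q X = embed (TPq_space q) X"

text \<open>The GNS representation, by possibly unbounded operators with the common dense domain
  \<open>Fock_vec q ` carr (TPq_alg q)\<close>: the operator of \<open>a\<close> maps \<open>b (0)\<close> to \<open>(a b) (0)\<close>.\<close>

definition gns_op ::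
    "real \<Rightarrow> 'a::real_inner tp set \<Rightarrow> (nat \<Rightarrow> 'a tp set) set \<Rightarrow> (nat \<Rightarrow> 'a tp set) set" where
  "gns_op q a v =
     Fock_vec q (amult (TPq_alg q) a (THE b. b \<in> carr (TPq_alg q) \<and> Fock_vec q b = v))"

definition Zset :: "real set" where
  "Zset = {0} \<union> {1 / real N | N. 1 \<le> N} \<union> {- 1 / real N | N. 1 \<le> N}"

end

theory Submission
 imports Defs
begin

text \<open>
 Write \<open>q = s / N\<close> with \<open>s = \<plusminus>1\<close>.  Everything is read off in a model by matrices of size \<open>N\<close>: the
 chaos expansion of trace polynomials in Gaussian Hermitian matrices, with an additional sign of
 \<open>\<alpha>\<close> if \<open>s = -1\<close>.  A letter \<open>(e, i, j)\<close> consists of a basis vector and two colours below \<open>N\<close>,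
 and \<open>Phi\<close> maps a trace polynomial to an \<open>N \<times> N\<close> matrix of symmetric functions on words: the entry
 \<open>(a, b)\<close> of \<open>\<alpha> \<otimes> F\<close> at the word \<open>W\<close> is \<open>F(e\<^sub>1, \<dots>, e\<^sub>n)\<close> if the column colours of \<open>W\<close> agree with the row
 colours of the letters to which \<open>\<alpha>\<close> moves them, and \<open>0\<close> otherwise.  So the cycles of \<open>\<alpha>\<close> are traces
 of products of matrix units, and the cycle of \<open>0\<close> is the product whose entry \<open>(a, b)\<close> is taken.

 All structure is determined by \<open>Phi\<close>, and the reason is twice the same count: the colour equations of
 a permutation have \<open>N\<close> free choices for each cycle.
 For the form, the equations of \<open>\<alpha>\<close> and \<open>\<beta>\<close> together have \<open>N\<close> to the number of cycles of
 \<open>\<alpha> \<beta>\<^sup>-\<^sup>1\<close> solutions, which is \<open>\<chi>\<^sub>q(\<alpha> \<beta>\<^sup>-\<^sup>1)\<close> up to sign and normalisation; hence the form is an \<open>l\<^sup>2\<close> inner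
 product of the images under \<open>Phi\<close> (\<open>form_Phi\<close>).  In particular it is positive, and its kernel is
 the kernel of \<open>Phi\<close>.
 For the product, summing over the colours of the letters contracted by \<open>\<pi>\<close> gives \<open>N\<close> to the number
 of cycles of \<open>\<pi> (\<alpha> \<union> \<beta>)\<close> inside the support of \<open>\<pi>\<close>, which is the exponent in the coefficient
 of \<open>C\<^sub>\<pi>\<close> (\<open>contraction_entry\<close>).  Hence the product becomes the product of matrices whose
 entries are multiplied by the Wick product of functions on words (\<open>Phi_mult\<close>).  The algebra axioms, the
 trace property and faithfulness now follow from those of the Wick product, of which only associativity
 (\<open>wick_assoc\<close>) is not immediate.

 On the Hilbert--Schmidt functionals that represent tensors, \<open>P\<^bsup>\<otimes>n\<^esup>\<close> is composition with the real
 projection \<open>p\<close> underlying \<open>P\<close>; it is self-adjoint (\<open>second_adjoint\<close>), and its range is the tensor power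
 of the subspace (\<open>tensor_power_eq\<close>).  So \<open>\<alpha> \<otimes> F \<mapsto> \<alpha> \<otimes> P\<^bsup>\<otimes>n\<^esup> F\<close> is self-adjoint and idempotent for the form.
 It therefore descends to the quotient and, being a contraction, extends to the completion as the orthogonal
 projection (\<open>projection_extends\<close>).  The formula in the GNS representation is the module property
 \<open>\<Gamma>(x y) = \<Gamma>(x) y\<close> for \<open>y\<close> in the subalgebra (\<open>Phi_hat_mult\<close>), a consequence of self-adjointness, the
 trace property and the closure of the subalgebra under product and adjoint.
\<close>

section \<open>Square summable families\<close>

abbreviation abs_sum :: "('i \<Rightarrow> complex) \<Rightarrow> 'i set \<Rightarrow> bool" where
 "abs_sum f A \<equiv> (\<lambda>x. cmod (f x)) summable_on A"

definition ell2 :: "('i \<Rightarrow> complex) \<Rightarrow> 'i set \<Rightarrow> bool" where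
 "ell2 f A \<longleftrightarrow> (\<lambda>x. (cmod (f x))\<^sup>2) summable_on A"

definition norm2 :: "('i \<Rightarrow> complex) \<Rightarrow> 'i set \<Rightarrow> real" where
 "norm2 f A = (\<Sum>\<^sub>\<infinity>x\<in>A. (cmod (f x))\<^sup>2)"

lemma norm2_nonneg: "0 \<le> norm2 f A"
 unfolding norm2_def by (rule infsum_nonneg) simp

lemma ell2_subset: "ell2 f A \<Longrightarrow> B \<subseteq> A \<Longrightarrow> ell2 f B"
 unfolding ell2_def by (rule summable_on_subset_banach)

lemma ell2_reindex: "bij_betw h A B \<Longrightarrow> ell2 (\<lambda>x. f (h x)) A \<longleftrightarrow> ell2 f B"
 unfolding ell2_def by (rule summable_on_reindex_bij_betw)

lemma norm2_reindex: "bij_betw h A B \<Longrightarrow> norm2 (\<lambda>x. f (h x)) A = norm2 f B"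
 unfolding norm2_def by (rule infsum_reindex_bij_betw)

lemma ell2_inj: "ell2 f B \<Longrightarrow> inj_on h A \<Longrightarrow> h ` A \<subseteq> B \<Longrightarrow> ell2 (\<lambda>x. f (h x)) A"
 using ell2_reindex[of h A "h ` A" f] by (simp add: inj_on_imp_bij_betw ell2_subset)

lemma ell2_comparison:
 assumes "ell2 g A" "\<And>x. x \<in> A \<Longrightarrow> cmod (f x) \<le> cmod (g x)"
 shows "ell2 f A"
 using assms(1) unfolding ell2_def
 by (rule summable_on_comparison_test) (use assms(2) in \<open>auto intro: power_mono\<close>)

lemma ell2_cmult: "ell2 f A \<Longrightarrow> ell2 (\<lambda>x. c * f x) A"
 unfolding ell2_def by (simp add: norm_mult power_mult_distrib summable_on_cmult_right)

lemma ell2_add: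
 assumes "ell2 f A" "ell2 g A"
 shows "ell2 (\<lambda>x. f x + g x) A"
proof -
 have "(\<lambda>x. 2 * (cmod (f x))\<^sup>2 + 2 * (cmod (g x))\<^sup>2) summable_on A"
  using assms unfolding ell2_def by (intro summable_on_add summable_on_cmult_right)
 moreover have "(cmod (f x + g x))\<^sup>2 \<le> 2 * (cmod (f x))\<^sup>2 + 2 * (cmod (g x))\<^sup>2" for x
 proof -
  have "(cmod (f x + g x))\<^sup>2 \<le> (cmod (f x) + cmod (g x))\<^sup>2" by (intro power_mono norm_triangle_ineq) simp
  also have "\<dots> \<le> 2 * (cmod (f x))\<^sup>2 + 2 * (cmod (g x))\<^sup>2"
   using sum_squares_bound[of "cmod (f x)" "cmod (g x)"] by (simp add: power2_sum)
  finally show ?thesis .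
 qed
 ultimately show ?thesis unfolding ell2_def by (rule summable_on_comparison_test) auto
qed

lemma ell2_mult_abs:
 assumes "ell2 f A" "ell2 g A"
 shows "abs_sum ((\<lambda>x. f x * g x)) (A)"
proof (rule abs_summable_product)
 show "abs_sum ((\<lambda>x. f x * f x)) (A)" "abs_sum ((\<lambda>x. g x * g x)) (A)"
  using assms by (simp_all add: ell2_def norm_mult power2_eq_square)
qed

lemma ell2_mult_summable:
 assumes "ell2 f A" "ell2 g A"
 shows "(\<lambda>x. f x * g x) summable_on A"
 by (rule abs_summable_summable[OF ell2_mult_abs[OF assms]])

lemma ell2_Cauchy_Schwarz_norm:
 assumes "ell2 f A" "ell2 g A"
 shows "(\<Sum>\<^sub>\<infinity>x\<in>A. cmod (f x * g x)) \<le> sqrt (norm2 f A) * sqrt (norm2 g A)"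
proof (rule infsum_le_finite_sums[OF ell2_mult_abs[OF assms]])
 fix F assume F: "finite F" "F \<subseteq> A"
 have "(\<Sum>x\<in>F. cmod (f x * g x)) \<le> L2_set (\<lambda>x. cmod (f x)) F * L2_set (\<lambda>x. cmod (g x)) F"
  using L2_set_mult_ineq[of "\<lambda>x. cmod (f x)" "\<lambda>x. cmod (g x)" F] by (simp add: norm_mult)
 also have "\<dots> \<le> sqrt (norm2 f A) * sqrt (norm2 g A)"
  unfolding L2_set_def norm2_def using F assms
  by (intro mult_mono real_sqrt_le_mono finite_sum_le_infsum)
   (auto simp: ell2_def sum_nonneg infsum_nonneg)
 finally show "(\<Sum>x\<in>F. cmod (f x * g x)) \<le> sqrt (norm2 f A) * sqrt (norm2 g A)" .
qed

lemma ell2_Cauchy_Schwarz: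
 assumes "ell2 f A" "ell2 g A"
 shows "cmod (\<Sum>\<^sub>\<infinity>x\<in>A. f x * g x) \<le> sqrt (norm2 f A) * sqrt (norm2 g A)"
 using norm_infsum_bound[OF ell2_mult_abs[OF assms]] ell2_Cauchy_Schwarz_norm[OF assms]
 by linarith

lemma summable_on_times:
 fixes f :: "'i \<Rightarrow> real" and g :: "'j \<Rightarrow> real"
 assumes "f summable_on A" "g summable_on B"
  and "\<And>x. x \<in> A \<Longrightarrow> 0 \<le> f x" "\<And>y. y \<in> B \<Longrightarrow> 0 \<le> g y"
 shows "(\<lambda>(x, y). f x * g y) summable_on A \<times> B"
  and "(\<Sum>\<^sub>\<infinity>(x, y)\<in>A \<times> B. f x * g y) = (\<Sum>\<^sub>\<infinity>x\<in>A. f x) * (\<Sum>\<^sub>\<infinity>y\<in>B. g y)"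
proof -
 have hs: "((\<lambda>y. case (x, y) of (x, y) \<Rightarrow> f x * g y) has_sum f x * (\<Sum>\<^sub>\<infinity>y\<in>B. g y)) B" for x
  using has_sum_cmult_right[OF has_sum_infsum[OF assms(2)]] by simp
 have hg: "((\<lambda>x. f x * (\<Sum>\<^sub>\<infinity>y\<in>B. g y)) has_sum (\<Sum>\<^sub>\<infinity>x\<in>A. f x) * (\<Sum>\<^sub>\<infinity>y\<in>B. g y)) A"
  by (rule has_sum_cmult_left[OF has_sum_infsum[OF assms(1)]])
 show 1: "(\<lambda>(x, y). f x * g y) summable_on A \<times> B"
  by (rule summable_on_SigmaI[OF hs has_sum_imp_summable[OF hg]]) (auto intro!: mult_nonneg_nonneg assms)
 show "(\<Sum>\<^sub>\<infinity>(x, y)\<in>A \<times> B. f x * g y) = (\<Sum>\<^sub>\<infinity>x\<in>A. f x) * (\<Sum>\<^sub>\<infinity>y\<in>B. g y)"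
  by (rule infsumI, rule has_sum_SigmaI[OF hs hg 1])
qed

lemma ell2_times:
 assumes "ell2 f A" "ell2 g B"
 shows "ell2 (\<lambda>(x, y). f x * g y) (A \<times> B)"
  and "norm2 (\<lambda>(x, y). f x * g y) (A \<times> B) = norm2 f A * norm2 g B"
 using summable_on_times[of "\<lambda>x. (cmod (f x))\<^sup>2" A "\<lambda>x. (cmod (g x))\<^sup>2" B] assms
 by (simp_all add: ell2_def norm2_def norm_mult power_mult_distrib case_prod_unfold)

lemma ell2_Sigma:
 assumes "ell2 f (A \<times> B)"
 shows "x \<in> A \<Longrightarrow> ell2 (\<lambda>y. f (x, y)) B"
  and "(\<lambda>x. norm2 (\<lambda>y. f (x, y)) B) summable_on A"
  and "(\<Sum>\<^sub>\<infinity>x\<in>A. norm2 (\<lambda>y. f (x, y)) B) = norm2 f (A \<times> B)"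
proof -
 have s: "(\<lambda>p. (cmod (f p))\<^sup>2) summable_on A \<times> B" using assms by (simp add: ell2_def)
 show 1: "ell2 (\<lambda>y. f (x, y)) B" if "x \<in> A" for x
  using summable_on_SigmaD1[of "\<lambda>x y. (cmod (f (x, y)))\<^sup>2" A "\<lambda>_. B" x] s that
  by (simp add: ell2_def case_prod_unfold)
 show "(\<lambda>x. norm2 (\<lambda>y. f (x, y)) B) summable_on A"
  unfolding norm2_def by (rule summable_on_SigmaD[OF s]) (use 1 in \<open>simp add: ell2_def\<close>)
 show "(\<Sum>\<^sub>\<infinity>x\<in>A. norm2 (\<lambda>y. f (x, y)) B) = norm2 f (A \<times> B)"
  unfolding norm2_def by (rule infsum_Sigma_banach[OF s])
qed

lemma ell2_SigmaI:
 assumes "\<And>x. x \<in> A \<Longrightarrow> ell2 (\<lambda>y. f (x, y)) B" "(\<lambda>x. norm2 (\<lambda>y. f (x, y)) B) summable_on A"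
 shows "ell2 f (A \<times> B)"
 unfolding ell2_def
proof (rule summable_on_SigmaI[where g = "\<lambda>x. norm2 (\<lambda>y. f (x, y)) B"])
 fix x assume "x \<in> A"
 then show "((\<lambda>y. (cmod (f (x, y)))\<^sup>2) has_sum norm2 (\<lambda>y. f (x, y)) B) B"
  using assms(1) by (simp add: ell2_def norm2_def)
qed (use assms in auto)

lemma ell2_swap:
 assumes "ell2 f (A \<times> B)"
 shows "ell2 (\<lambda>(y, x). f (x, y)) (B \<times> A)"
 using assms summable_on_swap[of "\<lambda>p. (cmod (f p))\<^sup>2" A B]
 by (simp add: ell2_def case_prod_unfold)

text \<open>For every fixed \<open>u\<close> the Cauchy--Schwarz inequality in \<open>(v, d)\<close> bounds the partial sum by
 \<open>\<parallel>G\<parallel> \<parallel>F(u, \<cdot>)\<parallel> \<parallel>H(u, \<cdot>)\<parallel>\<close>, and the last two factors are square summable in \<open>u\<close>.\<close>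

lemma triangle_abs_summable:
 assumes F: "ell2 F (U \<times> D)" and G: "ell2 G (V \<times> D)" and H: "ell2 H (U \<times> V)"
 shows "abs_sum ((\<lambda>(u, v, d). F (u, d) * G (v, d) * H (u, v))) (U \<times> V \<times> D)"
proof (rule Infinite_Sum.abs_summable_on_Sigma_iff[THEN iffD2], intro conjI ballI)
 have hf: "ell2 (\<lambda>(v, d). H (u, v) * F (u, d)) (V \<times> D)"
  and n: "norm2 (\<lambda>(v, d). H (u, v) * F (u, d)) (V \<times> D)
    = norm2 (\<lambda>v. H (u, v)) V * norm2 (\<lambda>d. F (u, d)) D" if "u \<in> U" for u
  using ell2_times[OF ell2_Sigma(1)[OF H that] ell2_Sigma(1)[OF F that]] by simp_all
 show "abs_sum ((\<lambda>y. case (u, y) of (u, v, d) \<Rightarrow> F (u, d) * G (v, d) * H (u, v))) (V \<times> D)"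
  if "u \<in> U" for u
  using ell2_mult_abs[OF G hf[OF that]] by (simp add: case_prod_unfold mult_ac)
 have b: "(\<Sum>\<^sub>\<infinity>y\<in>V \<times> D. cmod (case (u, y) of (u, v, d) \<Rightarrow> F (u, d) * G (v, d) * H (u, v)))
   \<le> sqrt (norm2 G (V \<times> D)) * (sqrt (norm2 (\<lambda>v. H (u, v)) V) * sqrt (norm2 (\<lambda>d. F (u, d)) D))"
  if "u \<in> U" for u
 proof -
  have "(\<Sum>\<^sub>\<infinity>y\<in>V \<times> D. cmod (case (u, y) of (u, v, d) \<Rightarrow> F (u, d) * G (v, d) * H (u, v))) =
   (\<Sum>\<^sub>\<infinity>y\<in>V \<times> D. cmod (G y * (case y of (v, d) \<Rightarrow> H (u, v) * F (u, d))))"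
   by (rule infsum_cong) (auto simp: norm_mult)
  then show ?thesis using ell2_Cauchy_Schwarz_norm[OF G hf[OF that]]
   by (simp add: n[OF that] real_sqrt_mult)
 qed
 have "abs_sum ((\<lambda>u. complex_of_real (sqrt (norm2 (\<lambda>v. H (u, v)) V)) * complex_of_real (sqrt (norm2 (\<lambda>d. F (u, d)) D)))) (U)"
  by (rule ell2_mult_abs) (use ell2_Sigma(2)[OF H] ell2_Sigma(2)[OF F] in
    \<open>simp_all add: ell2_def norm2_nonneg real_sqrt_pow2\<close>)
 then have "(\<lambda>u. sqrt (norm2 G (V \<times> D)) * (sqrt (norm2 (\<lambda>v. H (u, v)) V) * sqrt (norm2 (\<lambda>d. F (u, d)) D)))
   summable_on U"
  by (intro summable_on_cmult_right) (simp add: norm_mult norm2_nonneg)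
 then show "(\<lambda>u. norm (\<Sum>\<^sub>\<infinity>y\<in>V \<times> D. cmod (case (u, y) of (u, v, d) \<Rightarrow> F (u, d) * G (v, d) * H (u, v)))) summable_on U"
  by (rule Infinite_Sum.abs_summable_on_comparison_test') (use b in \<open>auto simp: infsum_nonneg\<close>)
qed

section \<open>The Wick product of functions on words\<close>

text \<open>An alphabet with a conjugation: the letter \<open>(e, i, j)\<close> stands for \<open>e\<close> times a matrix unit, whose adjoint
 has the colours exchanged.\<close>

locale letters =
 fixes L :: "'l set" and bar :: "'l \<Rightarrow> 'l"
 assumes bar_in: "x \<in> L \<Longrightarrow> bar x \<in> L" and bar_bar: "bar (bar x) = x"
begin

abbreviation words :: "'l list set" where "words \<equiv> lists L"

text \<open>The factorial compensates for summing over words instead of multisets of letters: all functions that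
 occur are symmetric.\<close>

definition pairing :: "('l list \<Rightarrow> complex) \<Rightarrow> ('l list \<Rightarrow> complex) \<Rightarrow> complex" where
 "pairing f g = (\<Sum>\<^sub>\<infinity>c\<in>words. f c * g (map bar c) / fact (length c))"

text \<open>The Wick product, by recursion on the letters of the result: fixing one of them is a derivation, since it
 comes from one of the two factors.  The letters that do not appear in the result are paired with their conjugates.\<close>

primrec wick :: "'l list \<Rightarrow> ('l list \<Rightarrow> complex) \<Rightarrow> ('l list \<Rightarrow> complex) \<Rightarrow> complex" where
 "wick [] f g = pairing f g"
| "wick (x # w) f g = wick w (\<lambda>u. f (x # u)) g + wick w f (\<lambda>u. g (x # u))"

definition symmetric :: "('l list \<Rightarrow> complex) \<Rightarrow> bool" where
 "symmetric f \<longleftrightarrow> (\<forall>u v. u \<in> words \<longrightarrow> mset u = mset v \<longrightarrow> f u = f v)"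

text \<open>These conditions make all sums over words converge absolutely, and taking away letters preserves them.\<close>

definition tame :: "('l list \<Rightarrow> complex) \<Rightarrow> bool" where
 "tame f \<longleftrightarrow> symmetric f \<and> ell2 f words \<and> (\<exists>m. \<forall>u. m < length u \<longrightarrow> f u = 0)"

lemma mset_words: "mset u = mset v \<Longrightarrow> u \<in> words \<Longrightarrow> v \<in> words"
 by (metis in_lists_conv_set set_mset_mset)

lemma map_bar_words: "u \<in> words \<Longrightarrow> map bar u \<in> words"
 by (induction u) (auto intro: bar_in)

lemma bij_map_bar: "bij_betw (map bar) words words"
 by (rule bij_betwI[of _ _ _ "map bar"]) (auto simp: map_bar_words bar_bar comp_def)

lemma symmetricD: "symmetric f \<Longrightarrow> u \<in> words \<Longrightarrow> mset u = mset v \<Longrightarrow> f u = f v"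
 by (simp add: symmetric_def)

lemma tame_prefix:
 assumes "tame f" "u \<in> words"
 shows "tame (\<lambda>c. f (u @ c))"
proof -
 obtain m where m: "\<And>v. m < length v \<Longrightarrow> f v = 0" using assms by (auto simp: tame_def)
 have "symmetric (\<lambda>c. f (u @ c))"
  using assms unfolding tame_def symmetric_def by (metis append_in_lists_conv mset_append)
 moreover have "ell2 (\<lambda>c. f (u @ c)) words"
  by (rule ell2_inj[of f words]) (use assms in \<open>auto simp: tame_def inj_on_def\<close>)
 moreover have "\<forall>c. m < length c \<longrightarrow> f (u @ c) = 0" using m by simp
 ultimately show ?thesis unfolding tame_def by blast
qed

lemma tame_Cons: "tame f \<Longrightarrow> x \<in> L \<Longrightarrow> tame (\<lambda>u. f (x # u))"
 using tame_prefix[of f "[x]"] by simp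

lemma ell2_bar: "ell2 f words \<Longrightarrow> ell2 (\<lambda>c. f (map bar c)) words"
 using ell2_reindex[OF bij_map_bar] by blast

lemma pairing_abs_summable:
 assumes "ell2 f words" "ell2 g words"
 shows "abs_sum (\<lambda>c. f c * g (map bar c) / fact (length c)) words"
proof (rule Infinite_Sum.abs_summable_on_comparison_test')
 show "(\<lambda>c. cmod (f c * g (map bar c))) summable_on words"
  by (rule ell2_mult_abs[OF assms(1) ell2_bar[OF assms(2)]])
 show "cmod (f c * g (map bar c) / fact (length c)) \<le> cmod (f c * g (map bar c))" for c
  using mult_left_mono[of 1 "fact (length c)" "cmod (f c * g (map bar c))"]
  by (simp add: norm_divide divide_le_eq fact_ge_1)
qed

lemma pairing_commute: "pairing f g = pairing g f"
proof -
 have "pairing f g = (\<Sum>\<^sub>\<infinity>c\<in>words. f (map bar c) * g (map bar (map bar c)) / fact (length (map bar c)))"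
  unfolding pairing_def
  by (rule infsum_reindex_bij_betw[symmetric, OF bij_map_bar, where f = "\<lambda>c. f c * g (map bar c) / fact (length c)"])
 then show ?thesis by (simp add: pairing_def comp_def bar_bar mult.commute)
qed

text \<open>Repeated differentiation distributes the letters of a word over the two factors; a
 distribution is a word \<open>t\<close> of letters marked by the factor they go to.\<close>

definition lpart :: "('l \<times> bool) list \<Rightarrow> 'l list" where
 "lpart t = map fst (filter snd t)"

definition rpart :: "('l \<times> bool) list \<Rightarrow> 'l list" where
 "rpart t = map fst (filter (\<lambda>x. \<not> snd x) t)"

lemma part_simps [simp]:
 "lpart [] = []" "rpart [] = []"
 "lpart ((x, True) # t) = x # lpart t" "lpart ((x, False) # t) = lpart t"
 "rpart ((x, True) # t) = rpart t" "rpart ((x, False) # t) = x # rpart t"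
 by (simp_all add: lpart_def rpart_def)

lemma marked_Nil: "{t. map fst t = []} = {[]}"
 by auto

lemma marked_Cons:
 "{t :: ('l \<times> bool) list. map fst t = x # w} =
  (#) (x, True) ` {t. map fst t = w} \<union> (#) (x, False) ` {t. map fst t = w}"
 by (auto simp: map_eq_Cons_conv image_iff)

lemma finite_marked: "finite {t :: ('l \<times> bool) list. map fst t = w}"
 by (induction w) (simp_all only: marked_Nil marked_Cons finite_Un finite_imageI finite.emptyI finite.insertI)

lemma sum_marked_Cons:
 fixes G :: "('l \<times> bool) list \<Rightarrow> complex"
 shows "(\<Sum>t | map fst t = x # w. G t) =
  (\<Sum>t | map fst t = w. G ((x, True) # t)) + (\<Sum>t | map fst t = w. G ((x, False) # t))"
 unfolding marked_Cons
 by (subst sum.union_disjoint) (auto simp: finite_marked sum.reindex)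

lemma wick_expand:
 "wick w f g = (\<Sum>t | map fst t = w. pairing (\<lambda>c. f (lpart t @ c)) (\<lambda>c. g (rpart t @ c)))"
proof (induction w arbitrary: f g)
 case Nil
 then show ?case by (simp only: marked_Nil) simp
next
 case (Cons x w)
 then show ?case by (simp only: sum_marked_Cons) simp
qed

lemma mset_parts: "mset (lpart t @ rpart t) = mset (map fst t)"
proof (induction t)
 case (Cons p t)
 then show ?case by (cases p; cases "snd p") auto
qed simp

lemma parts_words:
 assumes "map fst t \<in> words"
 shows "lpart t \<in> words" "rpart t \<in> words"
 using assms by (auto simp: lpart_def rpart_def)

lemma length_parts: "length (lpart t) + length (rpart t) = length t"
 by (simp add: lpart_def rpart_def sum_length_filter_compl)

text \<open>There are \<open>(length u + length v) choose length u\<close> marked words with given parts \<open>u\<close> and \<open>v\<close>: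
 the shuffles of \<open>u\<close> and \<open>v\<close>.\<close>

lemma parts_eq_shuffles:
 "{t. lpart t = u \<and> rpart t = v} = shuffles (map (\<lambda>x. (x, True)) u) (map (\<lambda>x. (x, False)) v)"
 (is "_ = shuffles ?u ?v")
proof (intro set_eqI iffI)
 fix t assume "t \<in> {t. lpart t = u \<and> rpart t = v}"
 moreover have "map (\<lambda>x. (x, True)) (lpart t) = filter snd t"
   "map (\<lambda>x. (x, False)) (rpart t) = filter (\<lambda>x. \<not> snd x) t"
  unfolding lpart_def rpart_def by (induction t) auto
 ultimately have "?u = filter snd t" "?v = filter (\<lambda>x. \<not> snd x) t" by auto
 then show "t \<in> shuffles ?u ?v" using partition_in_shuffles[of t snd] by metis
next
 fix t assume t: "t \<in> shuffles ?u ?v"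
 have d: "set ?u \<inter> set ?v = {}" by auto
 have s: "set t = set ?u \<union> set ?v" by (rule set_shuffles[OF t])
 have "filter snd t = filter (\<lambda>x. x \<in> set ?u) t" "filter (\<lambda>x. \<not> snd x) t = filter (\<lambda>x. x \<notin> set ?u) t"
  by (rule filter_cong[OF refl]; use s in auto)+
 then have "filter snd t = ?u" "filter (\<lambda>x. \<not> snd x) t = ?v"
  using filter_shuffles_disjoint1[OF d t] by auto
 then show "t \<in> {t. lpart t = u \<and> rpart t = v}" by (simp add: lpart_def rpart_def comp_def)
qed

lemma card_parts: "card {t. lpart t = u \<and> rpart t = v} = (length u + length v) choose length u"
 unfolding parts_eq_shuffles by (subst card_disjoint_shuffles) auto

lemma finite_parts: "finite {t. lpart t = u \<and> rpart t = v}"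
 unfolding parts_eq_shuffles by simp

lemma has_sum_marked:
 fixes Q :: "'l list \<times> 'l list \<Rightarrow> complex"
 assumes "abs_sum Q (words \<times> words)"
 defines "G \<equiv> \<lambda>t. Q (lpart t, rpart t) * (fact (length (lpart t)) * fact (length (rpart t)) / fact (length t))"
 shows "abs_sum (\<lambda>w. \<Sum>t | map fst t = w. G t) words"
  and "(\<Sum>\<^sub>\<infinity>w\<in>words. \<Sum>t | map fst t = w. G t) = (\<Sum>\<^sub>\<infinity>p\<in>words \<times> words. Q p)"
proof -
 let ?T = "lists (L \<times> (UNIV :: bool set))"
 have T: "t \<in> ?T \<longleftrightarrow> map fst t \<in> words" for t by (force simp: in_lists_conv_set)
 have T2: "t \<in> ?T \<longleftrightarrow> lpart t \<in> words \<and> rpart t \<in> words" for t :: "('l \<times> bool) list"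
 proof (induction t)
  case (Cons p t)
  then show ?case by (cases p; cases "snd p") auto
 qed simp
 define S1 where "S1 = Sigma (words \<times> words) (\<lambda>(u, v). {t. lpart t = u \<and> rpart t = v})"
 define S2 where "S2 = Sigma words (\<lambda>w. {t :: ('l \<times> bool) list. map fst t = w})"
 have b1: "bij_betw (\<lambda>t. ((lpart t, rpart t), t)) ?T S1"
 proof (rule bij_betwI[of _ _ _ snd])
  show "(\<lambda>t. ((lpart t, rpart t), t)) \<in> ?T \<rightarrow> S1" using T2 unfolding S1_def by blast
  show "snd \<in> S1 \<rightarrow> ?T" using T2 unfolding S1_def by force
 qed (auto simp: S1_def)
 have b2: "bij_betw (\<lambda>t. (map fst t, t)) ?T S2"
 proof (rule bij_betwI[of _ _ _ snd])
  show "(\<lambda>t. (map fst t, t)) \<in> ?T \<rightarrow> S2" using T unfolding S2_def by blast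
  show "snd \<in> S2 \<rightarrow> ?T" using T unfolding S2_def by force
 qed (auto simp: S2_def)
 have fact: "fact (length u) * fact (length v) / fact (length u + length v) *
   real ((length u + length v) choose length u) = 1" for u v :: "'l list"
  by (simp add: binomial_fact)
 have factC: "fact (length u) * fact (length v) / fact (length u + length v) *
   of_nat ((length u + length v) choose length u) = (1 :: complex)" for u v :: "'l list"
  by (simp add: binomial_fact)
 have G: "G t = Q (u, v) * (fact (length u) * fact (length v) / fact (length u + length v))"
  if "lpart t = u \<and> rpart t = v" for t u v
  using that length_parts[of t] by (auto simp: G_def)
 have nG: "cmod (G t) = cmod (Q (u, v)) * (fact (length u) * fact (length v) / fact (length u + length v))"
  if "lpart t = u \<and> rpart t = v" for t u v
  unfolding G[OF that] by (simp add: norm_mult norm_divide)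
 have fG: "(\<Sum>\<^sub>\<infinity>t\<in>{t. lpart t = u \<and> rpart t = v}. G t) = Q (u, v)" for u v
 proof -
  have "(\<Sum>\<^sub>\<infinity>t\<in>{t. lpart t = u \<and> rpart t = v}. G t) =
   Q (u, v) * (fact (length u) * fact (length v) / fact (length u + length v) *
   of_nat ((length u + length v) choose length u))"
   by (simp add: finite_parts card_parts G[of _ u v])
  then show ?thesis by (simp only: factC mult_1_right)
 qed
 have fnG: "(\<Sum>\<^sub>\<infinity>t\<in>{t. lpart t = u \<and> rpart t = v}. cmod (G t)) = cmod (Q (u, v))" for u v
 proof -
  have "(\<Sum>\<^sub>\<infinity>t\<in>{t. lpart t = u \<and> rpart t = v}. cmod (G t)) =
   cmod (Q (u, v)) * (fact (length u) * fact (length v) / fact (length u + length v) *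
   of_nat ((length u + length v) choose length u))"
   by (simp add: finite_parts card_parts nG[of _ u v])
  then show ?thesis by (simp only: fact mult_1_right)
 qed
 have a1: "abs_sum (\<lambda>(p, t). G t) S1"
  unfolding S1_def
  by (rule Infinite_Sum.abs_summable_on_Sigma_iff[THEN iffD2])
   (use assms(1) in \<open>auto simp: finite_parts fnG case_prod_unfold\<close>)
 have aT: "abs_sum G ?T"
  using a1 summable_on_reindex_bij_betw[OF b1, of "\<lambda>(p, t). cmod (G t)"] by (simp add: case_prod_unfold)
 have a2: "abs_sum (\<lambda>(w, t). G t) S2"
  using aT summable_on_reindex_bij_betw[OF b2, of "\<lambda>(p, t). cmod (G t)"] by (simp add: case_prod_unfold)
 have "(\<lambda>w. norm (\<Sum>\<^sub>\<infinity>t | map fst t = w. cmod (G t))) summable_on words"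
  using a2 unfolding S2_def
  by (auto simp: Infinite_Sum.abs_summable_on_Sigma_iff case_prod_unfold simp del: infsum_finite)
 then have "(\<lambda>w. \<Sum>t | map fst t = w. cmod (G t)) summable_on words"
  by (simp add: finite_marked sum_nonneg)
 then show "abs_sum (\<lambda>w. \<Sum>t | map fst t = w. G t) words"
  by (rule Infinite_Sum.abs_summable_on_comparison_test') (rule norm_sum)
 have "(\<Sum>\<^sub>\<infinity>w\<in>words. \<Sum>t | map fst t = w. G t) = (\<Sum>\<^sub>\<infinity>w\<in>words. \<Sum>\<^sub>\<infinity>t\<in>{t. map fst t = w}. G t)"
  by (simp add: finite_marked)
 also have "\<dots> = (\<Sum>\<^sub>\<infinity>(w, t)\<in>S2. G t)"
  using infsum_Sigma_banach[OF abs_summable_summable[OF a2[unfolded S2_def]]] by (simp add: S2_def case_prod_unfold)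
 also have "\<dots> = (\<Sum>\<^sub>\<infinity>t\<in>?T. G t)"
  using infsum_reindex_bij_betw[OF b2, of "\<lambda>(p, t). G t"] by (simp add: case_prod_unfold)
 also have "\<dots> = (\<Sum>\<^sub>\<infinity>(p, t)\<in>S1. G t)"
  using infsum_reindex_bij_betw[OF b1, of "\<lambda>(p, t). G t"] by (simp add: case_prod_unfold)
 also have "\<dots> = (\<Sum>\<^sub>\<infinity>(u, v)\<in>words \<times> words. \<Sum>\<^sub>\<infinity>t\<in>{t. lpart t = u \<and> rpart t = v}. G t)"
  using infsum_Sigma_banach[OF abs_summable_summable[OF a1[unfolded S1_def]]]
  by (simp add: S1_def case_prod_unfold)
 also have "\<dots> = (\<Sum>\<^sub>\<infinity>p\<in>words \<times> words. Q p)"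
  by (simp only: fG) simp
 finally show "(\<Sum>\<^sub>\<infinity>w\<in>words. \<Sum>t | map fst t = w. G t) = (\<Sum>\<^sub>\<infinity>p\<in>words \<times> words. Q p)" .
qed

text \<open>A word of length at most \<open>m\<close> can be cut in at most \<open>m + 1\<close> ways.\<close>

lemma tame_cut_ell2:
 assumes "tame f"
 shows "ell2 (\<lambda>(u, d). f (u @ d)) (words \<times> words)"
proof -
 obtain m where m: "\<And>u. m < length u \<Longrightarrow> f u = 0" using assms by (auto simp: tame_def)
 then have m': "f (u @ d) \<noteq> 0 \<Longrightarrow> length u + length d \<le> m" for u d by (metis length_append not_le)
 define S where "S = {(u, d) \<in> words \<times> words. length u + length d \<le> m}"
 have "ell2 (\<lambda>_ :: nat. 1) {..m}" by (simp add: ell2_def)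
 with assms have "ell2 (\<lambda>(c, k). f c * 1) (words \<times> {..m})"
  unfolding tame_def by (intro ell2_times(1)) auto
 then have "ell2 (\<lambda>p. (\<lambda>(c, k). f c * 1) ((\<lambda>(u, d). (u @ d, length u)) p)) S"
  by (rule ell2_inj) (auto simp: S_def inj_on_def)
 then have "(\<lambda>(u, d). (cmod (f (u @ d)))\<^sup>2) summable_on S"
  by (simp add: ell2_def case_prod_unfold)
 also have "?this \<longleftrightarrow> (\<lambda>(u, d). (cmod (f (u @ d)))\<^sup>2) summable_on words \<times> words"
  by (rule summable_on_cong_neutral) (auto simp: S_def dest: m')
 finally show ?thesis by (simp add: ell2_def case_prod_unfold)
qed

definition trip :: "('l list \<Rightarrow> complex) \<Rightarrow> ('l list \<Rightarrow> complex) \<Rightarrow> ('l list \<Rightarrow> complex) \<Rightarrow>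
  'l list \<times> 'l list \<times> 'l list \<Rightarrow> complex" where
 "trip f g h = (\<lambda>(u, v, d). f (u @ d) * g (v @ map bar d) * h (map bar u @ map bar v) /
   (fact (length u) * fact (length v) * fact (length d)))"

lemma trip_abs_summable:
 assumes "tame f" "tame g" "tame h"
 shows "abs_sum (trip f g h) (words \<times> words \<times> words)"
proof -
 have b: "bij_betw (\<lambda>(v, d). (v, map bar d)) (words \<times> words) (words \<times> words)"
  "bij_betw (\<lambda>(u, v). (map bar u, map bar v)) (words \<times> words) (words \<times> words)"
  by (rule bij_betwI[of _ _ _ "\<lambda>(v, d). (v, map bar d)"], auto simp: bar_in bar_bar comp_def)[1]
    (rule bij_betwI[of _ _ _ "\<lambda>(v, d). (map bar v, map bar d)"], auto simp: bar_in bar_bar comp_def)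
 have "abs_sum (\<lambda>(u, v, d). (case (u, d) of (u, d) \<Rightarrow> f (u @ d)) * (case (v, d) of (v, d) \<Rightarrow> g (v @ map bar d))
   * (case (u, v) of (u, v) \<Rightarrow> h (map bar u @ map bar v))) (words \<times> words \<times> words)"
 proof (rule triangle_abs_summable)
  show "ell2 (\<lambda>(u, d). f (u @ d)) (words \<times> words)" by (rule tame_cut_ell2) fact
  show "ell2 (\<lambda>(v, d). g (v @ map bar d)) (words \<times> words)"
   using tame_cut_ell2[OF assms(2)] ell2_reindex[OF b(1), of "\<lambda>(u, d). g (u @ d)"] by (simp add: case_prod_unfold)
  show "ell2 (\<lambda>(u, v). h (map bar u @ map bar v)) (words \<times> words)"
   using tame_cut_ell2[OF assms(3)] ell2_reindex[OF b(2), of "\<lambda>(u, d). h (u @ d)"] by (simp add: case_prod_unfold)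
 qed
 then show ?thesis
 proof (rule Infinite_Sum.abs_summable_on_comparison_test)
  fix p assume "p \<in> words \<times> words \<times> words"
  obtain u v d where p: "p = (u, v, d)" by (cases p) auto
  have "1 \<le> fact (length u) * fact (length v) * (fact (length d) :: real)"
  proof -
   have "1 * 1 * 1 \<le> fact (length u) * fact (length v) * (fact (length d) :: real)"
    by (intro mult_mono fact_ge_1) auto
   then show ?thesis by simp
  qed
  then show "cmod (trip f g h p) \<le> cmod (case p of (u, v, d) \<Rightarrow> (case (u, d) of (u, d) \<Rightarrow> f (u @ d)) *
    (case (v, d) of (v, d) \<Rightarrow> g (v @ map bar d)) * (case (u, v) of (u, v) \<Rightarrow> h (map bar u @ map bar v)))"
   using mult_left_mono[of 1 "fact (length u) * fact (length v) * fact (length d)"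
     "cmod (f (u @ d)) * cmod (g (v @ map bar d)) * cmod (h (map bar u @ map bar v))"]
   by (simp add: p trip_def norm_divide norm_mult divide_le_eq)
 qed
qed

lemma pairing_wick_left:
 assumes "tame f" "tame g" "tame h"
 shows "abs_sum (\<lambda>w. wick w f g * h (map bar w) / fact (length w)) words"
  and "pairing (\<lambda>w. wick w f g) h = (\<Sum>\<^sub>\<infinity>p\<in>words \<times> words \<times> words. trip f g h p)"
proof -
 note sm = trip_abs_summable[OF assms]
 define Q where "Q = (\<lambda>(u, v). pairing (\<lambda>c. f (u @ c)) (\<lambda>c. g (v @ c)) * h (map bar u @ map bar v) /
   (fact (length u) * fact (length v)))"
 have b: "bij_betw (\<lambda>((u, v), d). (u, v, d)) ((words \<times> words) \<times> words) (words \<times> words \<times> words)"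
  by (rule bij_betwI[of _ _ _ "\<lambda>(u, v, d). ((u, v), d)"]) auto
 have sm': "abs_sum (\<lambda>((u, v), d). trip f g h (u, v, d)) ((words \<times> words) \<times> words)"
  using sm summable_on_reindex_bij_betw[OF b, of "\<lambda>p. cmod (trip f g h p)"] by (simp add: case_prod_unfold)
 have QT: "Q (u, v) = (\<Sum>\<^sub>\<infinity>d\<in>words. trip f g h (u, v, d))" for u v
 proof -
  have "Q (u, v) = pairing (\<lambda>c. f (u @ c)) (\<lambda>c. g (v @ c)) *
    (h (map bar u @ map bar v) / (fact (length u) * fact (length v)))"
   by (simp add: Q_def)
  also have "\<dots> = (\<Sum>\<^sub>\<infinity>d\<in>words. f (u @ d) * g (v @ map bar d) / fact (length d) *
    (h (map bar u @ map bar v) / (fact (length u) * fact (length v))))"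
   unfolding pairing_def by (rule infsum_cmult_left'[symmetric])
  also have "\<dots> = (\<Sum>\<^sub>\<infinity>d\<in>words. trip f g h (u, v, d))"
   by (rule infsum_cong) (simp add: trip_def)
  finally show ?thesis .
 qed
 have absQ: "abs_sum Q (words \<times> words)"
 proof -
  have *: "(\<forall>p\<in>words \<times> words. (\<lambda>d. cmod (trip f g h (fst p, snd p, d))) summable_on words) \<and>
    (\<lambda>p. norm (\<Sum>\<^sub>\<infinity>d\<in>words. cmod (trip f g h (fst p, snd p, d)))) summable_on words \<times> words"
   using Infinite_Sum.abs_summable_on_Sigma_iff[THEN iffD1, OF sm'] by (simp add: case_prod_unfold)
  show ?thesis
  proof (rule Infinite_Sum.abs_summable_on_comparison_test'[OF conjunct2[OF *]])
   fix p assume p: "p \<in> words \<times> words"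
   have "cmod (Q (fst p, snd p)) \<le> (\<Sum>\<^sub>\<infinity>d\<in>words. cmod (trip f g h (fst p, snd p, d)))"
    unfolding QT by (rule norm_infsum_bound) (use * p in blast)
   then show "cmod (Q p) \<le> norm (\<Sum>\<^sub>\<infinity>d\<in>words. cmod (trip f g h (fst p, snd p, d)))" by simp
  qed
 qed
 have sumG: "(\<Sum>t | map fst t = w. Q (lpart t, rpart t) *
   (fact (length (lpart t)) * fact (length (rpart t)) / fact (length t))) =
   wick w f g * h (map bar w) / fact (length w)" if w: "w \<in> words" for w
 proof -
  have "Q (lpart t, rpart t) * (fact (length (lpart t)) * fact (length (rpart t)) / fact (length t)) =
    pairing (\<lambda>c. f (lpart t @ c)) (\<lambda>c. g (rpart t @ c)) * h (map bar w) / fact (length w)"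
   if t: "map fst t = w" for t
  proof -
   have "mset (map bar (lpart t) @ map bar (rpart t)) = mset (map bar w)"
    using arg_cong[OF mset_parts[of t], of "image_mset bar"] t by simp
   moreover have "map bar (lpart t) @ map bar (rpart t) \<in> words"
    using parts_words[of t] t w by (simp add: map_bar_words del: in_lists_conv_set)
   ultimately have "h (map bar (lpart t) @ map bar (rpart t)) = h (map bar w)"
    using assms(3) unfolding tame_def by (blast dest: symmetricD)
   moreover have "length t = length w" using t by (metis length_map)
   ultimately show ?thesis by (simp add: Q_def)
  qed
  then have "(\<Sum>t | map fst t = w. Q (lpart t, rpart t) *
   (fact (length (lpart t)) * fact (length (rpart t)) / fact (length t))) =
   (\<Sum>t | map fst t = w. pairing (\<lambda>c. f (lpart t @ c)) (\<lambda>c. g (rpart t @ c)) * h (map bar w) / fact (length w))"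
   by (intro sum.cong) auto
  then show ?thesis by (simp add: wick_expand[of w] sum_distrib_right sum_divide_distrib)
 qed
 show "abs_sum (\<lambda>w. wick w f g * h (map bar w) / fact (length w)) words"
  by (rule summable_on_cong[THEN iffD1, OF _ has_sum_marked(1)[OF absQ]]) (simp only: sumG)
 have "pairing (\<lambda>w. wick w f g) h = (\<Sum>\<^sub>\<infinity>p\<in>words \<times> words. Q p)"
  unfolding pairing_def has_sum_marked(2)[OF absQ, symmetric]
  by (rule infsum_cong) (simp only: sumG)
 also have "\<dots> = (\<Sum>\<^sub>\<infinity>p\<in>words \<times> words. \<Sum>\<^sub>\<infinity>d\<in>words. trip f g h (fst p, snd p, d))"
  by (rule infsum_cong) (simp flip: QT)
 also have "\<dots> = (\<Sum>\<^sub>\<infinity>((u, v), d)\<in>(words \<times> words) \<times> words. trip f g h (u, v, d))"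
  using infsum_Sigma_banach[OF abs_summable_summable[OF sm']] by (simp add: case_prod_unfold)
 also have "\<dots> = (\<Sum>\<^sub>\<infinity>p\<in>words \<times> words \<times> words. trip f g h p)"
  using infsum_reindex_bij_betw[OF b, of "trip f g h"] by (simp add: case_prod_unfold)
 finally show "pairing (\<lambda>w. wick w f g) h = (\<Sum>\<^sub>\<infinity>p\<in>words \<times> words \<times> words. trip f g h p)" .
qed

end

context letters begin

text \<open>Both sides are the sum over all ways to match the letters of \<open>f\<close>, \<open>g\<close> and \<open>h\<close> pairwise, a
 word \<open>u\<close> joining \<open>f\<close> and \<open>h\<close>, a word \<open>v\<close> joining \<open>g\<close> and \<open>h\<close>, and a word \<open>d\<close> joining \<open>f\<close> and
 \<open>g\<close>.\<close>

lemma pairing_wick_assoc: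
 assumes f: "tame f" and g: "tame g" and h: "tame h"
 shows "pairing (\<lambda>w. wick w f g) h = pairing f (\<lambda>w. wick w g h)"
proof -
 have b: "bij_betw (\<lambda>(u, v, d). (map bar d, map bar u, v)) (words \<times> words \<times> words) (words \<times> words \<times> words)"
  by (rule bij_betwI[of _ _ _ "\<lambda>(d, u, v). (map bar u, v, map bar d)"])
   (auto simp: bar_in bar_bar comp_def)
 have "trip g h f (map bar d, map bar u, v) = trip f g h (u, v, d)"
  if "u \<in> words" "v \<in> words" "d \<in> words" for u v d
 proof -
  have "g (map bar d @ v) = g (v @ map bar d)" "f (d @ u) = f (u @ d)"
   using that map_bar_words[OF that(3)]
    symmetricD[of g "map bar d @ v" "v @ map bar d"] symmetricD[of f "d @ u" "u @ d"] f g
   by (simp_all add: tame_def)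
  then show ?thesis by (simp add: trip_def bar_bar comp_def mult_ac)
 qed
 then have "(\<Sum>\<^sub>\<infinity>p\<in>words \<times> words \<times> words. trip f g h p) =
   (\<Sum>\<^sub>\<infinity>p\<in>words \<times> words \<times> words. trip g h f ((\<lambda>(u, v, d). (map bar d, map bar u, v)) p))"
  by (intro infsum_cong) (simp add: mem_Times_iff case_prod_unfold)
 also have "\<dots> = (\<Sum>\<^sub>\<infinity>p\<in>words \<times> words \<times> words. trip g h f p)"
  by (rule infsum_reindex_bij_betw[OF b])
 finally show ?thesis
  using pairing_wick_left(2)[OF f g h] pairing_wick_left(2)[OF g h f] pairing_commute[of f] by simp
qed

lemma wick_append:
 "wick (u @ c) f g = (\<Sum>t | map fst t = u. wick c (\<lambda>v. f (lpart t @ v)) (\<lambda>v. g (rpart t @ v)))"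
proof (induction u arbitrary: f g)
 case Nil
 show ?case unfolding append_Nil marked_Nil by simp
next
 case (Cons x u)
 show ?case
  unfolding append_Cons wick.simps Cons.IH sum_marked_Cons part_simps by (rule refl)
qed

definition pairable :: "('l list \<Rightarrow> complex) \<Rightarrow> ('l list \<Rightarrow> complex) \<Rightarrow> bool" where
 "pairable f g \<longleftrightarrow> (\<forall>u\<in>words. \<forall>v\<in>words.
   (\<lambda>c. f (u @ c) * g (v @ map bar c) / fact (length c)) summable_on words)"

lemma pairable_tame: "tame f \<Longrightarrow> tame g \<Longrightarrow> pairable f g"
 unfolding pairable_def
proof (intro ballI, rule abs_summable_summable, rule pairing_abs_summable)
 fix u v assume t: "tame f" "tame g" and "u \<in> words" "v \<in> words"
 then have "tame (\<lambda>c. f (u @ c))" "tame (\<lambda>c. g (v @ c))" by (simp_all only: tame_prefix)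
 then show "ell2 (\<lambda>c. f (u @ c)) words" "ell2 (\<lambda>c. g (v @ c)) words" by (simp_all only: tame_def)
qed

lemma summable_on_finite_sum:
 fixes F :: "'i \<Rightarrow> 'j \<Rightarrow> complex"
 assumes "finite I" "\<And>i. i \<in> I \<Longrightarrow> F i summable_on A"
 shows "(\<lambda>x. \<Sum>i\<in>I. F i x) summable_on A"
 using assms by (induction I) (simp_all add: summable_on_add)

lemma pairable_wick:
 assumes "tame f" "tame g" "tame h"
 shows "pairable (\<lambda>w. wick w f g) h"
 unfolding pairable_def
proof (intro ballI)
 fix u v assume u: "u \<in> words" and v: "v \<in> words"
 have *: "(\<lambda>c. wick c (\<lambda>v. f (lpart t @ v)) (\<lambda>v. g (rpart t @ v)) * h (v @ map bar c) / fact (length c))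
   summable_on words" if "t \<in> {t. map fst t = u}" for t
 proof (rule abs_summable_summable[OF pairing_wick_left(1)[where h = "\<lambda>c. h (v @ c)"]])
  have "lpart t \<in> words" "rpart t \<in> words" using parts_words[of t] that u by blast+
  then show "tame (\<lambda>v. f (lpart t @ v))" "tame (\<lambda>v. g (rpart t @ v))" "tame (\<lambda>c. h (v @ c))"
   using assms v by (simp_all only: tame_prefix)
 qed
 show "(\<lambda>c. wick (u @ c) f g * h (v @ map bar c) / fact (length c)) summable_on words"
  unfolding wick_append sum_distrib_right sum_divide_distrib
  by (rule summable_on_finite_sum[OF finite_marked *])
qed

lemma wick_commute: "wick w f g = wick w g f"
 by (induction w arbitrary: f g) (auto simp: pairing_commute add.commute)

lemma pairing_zero: "pairing (\<lambda>_. 0) g = 0"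
 by (simp add: pairing_def)

lemma wick_zero: "wick w (\<lambda>_. 0) g = 0"
 by (induction w arbitrary: g) (simp_all only: wick.simps pairing_zero add_0)

lemma pairing_cmult: "pairing (\<lambda>u. c * f u) g = c * pairing f g"
 unfolding pairing_def infsum_cmult_right'[symmetric]
 by (rule infsum_cong) simp

lemma wick_cmult: "wick w (\<lambda>u. c * f u) g = c * wick w f g"
 by (induction w arbitrary: f g) (simp_all only: wick.simps pairing_cmult distrib_left)

lemma wick_add:
 assumes "pairable f h" "pairable g h" "w \<in> words"
 shows "wick w (\<lambda>u. f u + g u) h = wick w f h + wick w g h"
 using assms
proof (induction w arbitrary: f g h)
 case Nil
 have "[] \<in> words" by (rule lists.Nil)
 then have "(\<lambda>c. f ([] @ c) * h ([] @ map bar c) / fact (length c)) summable_on words"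
  "(\<lambda>c. g ([] @ c) * h ([] @ map bar c) / fact (length c)) summable_on words"
  using Nil(1,2) unfolding pairable_def by blast+
 then show ?case
  unfolding wick.simps pairing_def distrib_right add_divide_distrib append_Nil by (rule infsum_add)
next
 case (Cons x w)
 have x: "x \<in> L" "w \<in> words" using Cons.prems(3) by auto
 have P1: "pairable (\<lambda>u. f (x # u)) h" if "pairable f h" for f h
  unfolding pairable_def
 proof (intro ballI)
  fix u v assume "u \<in> words" and v: "v \<in> words"
  then have "x # u \<in> words" using x(1) by (simp only: Cons_in_lists_iff simp_thms)
  from that[unfolded pairable_def, rule_format, OF this v]
  show "(\<lambda>c. f (x # u @ c) * h (v @ map bar c) / fact (length c)) summable_on words"
   by (simp only: append_Cons)
 qed
 have P2: "pairable f (\<lambda>u. h (x # u))" if "pairable f h" for f h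
  unfolding pairable_def
 proof (intro ballI)
  fix u v assume u: "u \<in> words" and "v \<in> words"
  then have "x # v \<in> words" using x(1) by (simp only: Cons_in_lists_iff simp_thms)
  from that[unfolded pairable_def, rule_format, OF u this]
  show "(\<lambda>c. f (u @ c) * h (x # v @ map bar c) / fact (length c)) summable_on words"
   by (simp only: append_Cons)
 qed
 have "wick w (\<lambda>u. f (x # u) + g (x # u)) h = wick w (\<lambda>u. f (x # u)) h + wick w (\<lambda>u. g (x # u)) h"
  by (rule Cons.IH[OF P1 P1 x(2)]) (rule Cons.prems)+
 moreover have "wick w (\<lambda>u. f u + g u) (\<lambda>u. h (x # u)) =
   wick w f (\<lambda>u. h (x # u)) + wick w g (\<lambda>u. h (x # u))"
  by (rule Cons.IH[OF P2 P2 x(2)]) (rule Cons.prems)+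
 ultimately show ?case by simp
qed

lemma pairable_add:
 assumes "pairable f h" "pairable g h"
 shows "pairable (\<lambda>u. f u + g u) h"
 using assms unfolding pairable_def
 by (simp add: distrib_right add_divide_distrib summable_on_add)

lemma pairable_sum:
 assumes "finite I" "\<And>i. i \<in> I \<Longrightarrow> pairable (f i) h"
 shows "pairable (\<lambda>u. \<Sum>i\<in>I. f i u) h"
 using assms
proof (induction I)
 case empty
 then show ?case by (simp add: pairable_def)
qed (simp add: pairable_add)

lemma wick_sum:
 assumes "finite I" "\<And>i. i \<in> I \<Longrightarrow> pairable (f i) h" "w \<in> words"
 shows "wick w (\<lambda>u. \<Sum>i\<in>I. f i u) h = (\<Sum>i\<in>I. wick w (f i) h)"
 using assms
proof (induction I)
 case (insert i I)
 then show ?case by (simp add: wick_add pairable_sum)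
qed (simp add: wick_zero)

lemma wick_cong:
 assumes "\<And>u. u \<in> words \<Longrightarrow> f u = f' u" "\<And>u. u \<in> words \<Longrightarrow> g u = g' u" "w \<in> words"
 shows "wick w f g = wick w f' g'"
 using assms
proof (induction w arbitrary: f g f' g')
 case Nil
 show ?case unfolding wick.simps pairing_def
  by (rule infsum_cong) (use Nil map_bar_words in \<open>simp\<close>)
next
 case (Cons x w)
 have "wick w (\<lambda>u. f (x # u)) g = wick w (\<lambda>u. f' (x # u)) g'"
  "wick w f (\<lambda>u. g (x # u)) = wick w f' (\<lambda>u. g' (x # u))"
  by (rule Cons.IH; use Cons.prems in simp)+
 then show ?case by simp
qed

text \<open>Differentiation is a derivation of the product, so associativity only has to be checked at the
 empty word, where it is the preceding lemma.\<close>

lemma wick_assoc: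
 assumes "tame f" "tame g" "tame h" "w \<in> words"
 shows "wick w (\<lambda>c. wick c f g) h = wick w f (\<lambda>c. wick c g h)"
 using assms
proof (induction w arbitrary: f g h)
 case Nil
 then show ?case by (simp add: pairing_wick_assoc)
next
 case (Cons x w)
 let ?f = "\<lambda>u. f (x # u)" and ?g = "\<lambda>u. g (x # u)" and ?h = "\<lambda>u. h (x # u)"
 have w: "w \<in> words" and t: "tame ?f" "tame ?g" "tame ?h"
  using Cons.prems by (auto intro: tame_Cons)
 have "wick (x # w) (\<lambda>c. wick c f g) h =
   wick w (\<lambda>c. wick c ?f g) h + wick w (\<lambda>c. wick c f ?g) h + wick w (\<lambda>c. wick c f g) ?h"
  using wick_add[OF pairable_wick pairable_wick w, of ?f g h f ?g] Cons.prems t by simp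
 also have "\<dots> = wick w ?f (\<lambda>c. wick c g h) + wick w f (\<lambda>c. wick c ?g h) + wick w f (\<lambda>c. wick c g ?h)"
  using Cons.IH[OF _ _ _ w] Cons.prems t by simp
 moreover have "wick w f (\<lambda>c. wick c ?g h) + wick w f (\<lambda>c. wick c g ?h) =
   wick w f (\<lambda>c. wick c ?g h + wick c g ?h)"
  unfolding wick_commute[of w f]
  using wick_add[OF pairable_wick pairable_wick w, of ?g h f g ?h] Cons.prems t by simp
 ultimately show ?case by (simp add: add.assoc)
qed

lemma wick_star:
 "wick w (\<lambda>c. cnj (f (map bar c))) (\<lambda>c. cnj (g (map bar c))) = cnj (wick (map bar w) f g)"
proof (induction w arbitrary: f g)
 case Nil
 have "pairing (\<lambda>c. cnj (f (map bar c))) (\<lambda>c. cnj (g (map bar c))) = cnj (pairing g f)"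
  by (simp add: pairing_def bar_bar comp_def mult.commute flip: infsum_cnj)
 then show ?case by (simp add: pairing_commute)
next
 case (Cons x w)
 then show ?case using Cons.IH[of "\<lambda>u. f (bar x # u)" g] Cons.IH[of f "\<lambda>u. g (bar x # u)"] by simp
qed

lemma wick_unit: "wick w (\<lambda>u. if u = [] then c else 0) g = c * g w"
proof (induction w arbitrary: g)
 case Nil
 have "pairing (\<lambda>u. if u = [] then c else 0) g =
   (\<Sum>\<^sub>\<infinity>u\<in>{[]}. (if u = [] then c else 0) * g (map bar u) / fact (length u))"
  unfolding pairing_def by (rule infsum_cong_neutral) auto
 then show ?case by simp
qed (simp add: wick_zero)

end

section \<open>First returns and orbits of permutations\<close>

text \<open>\<open>exit X \<rho> y\<close> is the first point outside \<open>X\<close> on the way \<open>y, \<rho> y, \<rho> (\<rho> y), \<dots>\<close>\<close>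

definition exit :: "nat set \<Rightarrow> (nat \<Rightarrow> nat) \<Rightarrow> nat \<Rightarrow> nat" where
 "exit X \<rho> y = (\<rho> ^^ (LEAST j. (\<rho> ^^ j) y \<notin> X)) y"

definition inner_orbits :: "nat set \<Rightarrow> (nat \<Rightarrow> nat) \<Rightarrow> nat set set" where
 "inner_orbits X \<rho> = {orbit \<rho> x | x. x \<in> X \<and> orbit \<rho> x \<subseteq> X}"

definition orbits_on :: "nat set \<Rightarrow> (nat \<Rightarrow> nat) \<Rightarrow> nat set set" where
 "orbits_on X \<rho> = orbit \<rho> ` X"

lemma exit_out: "y \<notin> X \<Longrightarrow> exit X \<rho> y = y"
proof -
 assume "y \<notin> X"
 then have "(LEAST j. (\<rho> ^^ j) y \<notin> X) = 0" by (intro Least_eq_0) simp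
 then show ?thesis by (simp add: exit_def)
qed

lemma exit_step:
 assumes "y \<in> X" "(\<rho> ^^ n) y \<notin> X"
 shows "exit X \<rho> y = exit X \<rho> (\<rho> y)"
proof -
 have "(LEAST j. (\<rho> ^^ j) y \<notin> X) = Suc (LEAST j. (\<rho> ^^ Suc j) y \<notin> X)"
  by (rule Least_Suc[of _ n]) (use assms in auto)
 then show ?thesis by (simp add: exit_def funpow_swap1)
qed

lemma exit_notin: "(\<rho> ^^ n) y \<notin> X \<Longrightarrow> exit X \<rho> y \<notin> X"
 unfolding exit_def by (rule LeastI[of "\<lambda>j. (\<rho> ^^ j) y \<notin> X"])

locale perm_on =
 fixes \<rho> :: "nat \<Rightarrow> nat" and Y X :: "nat set"
 assumes perm: "\<rho> permutes Y" and fin: "finite Y" and sub: "X \<subseteq> Y"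
begin

lemma permutation: "permutation \<rho>"
 using perm fin permutation_permutes by blast

lemma self_in: "x \<in> orbit \<rho> x"
 by (rule permutation_self_in_orbit[OF permutation])

lemma orbit_eq: "y \<in> orbit \<rho> x \<Longrightarrow> orbit \<rho> y = orbit \<rho> x"
 by (rule orbit_cyclic_eq3[OF cyclic_on_orbit'[OF permutation]])

lemma orbit_image [simp]: "orbit \<rho> (\<rho> x) = orbit \<rho> x"
 by (rule orbit_eq) (rule orbit.base)

lemma orbit_sub: "x \<in> Y \<Longrightarrow> orbit \<rho> x \<subseteq> Y"
 by (rule permutes_orbit_subset[OF perm])

lemma exits:
 assumes "\<not> orbit \<rho> x \<subseteq> X"
 shows "\<exists>n. (\<rho> ^^ n) x \<notin> X"
 using assms unfolding orbit_altdef by auto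

lemma first_return_exit:
 assumes "x \<notin> X"
 shows "first_return X \<rho> x = exit X \<rho> (\<rho> x)"
proof -
 obtain n where n: "0 < n" "(\<rho> ^^ n) x = x"
  using self_in[of x] unfolding orbit_altdef by auto
 have "(LEAST j. 0 < j \<and> (\<rho> ^^ j) x \<notin> X) = Suc (LEAST j. 0 < Suc j \<and> (\<rho> ^^ Suc j) x \<notin> X)"
  by (rule Least_Suc[of _ n]) (use n assms in auto)
 then show ?thesis using assms by (simp add: first_return_def exit_def funpow_swap1)
qed

lemma first_return_pow:
 assumes "x \<notin> X"
 obtains j where "0 < j" "first_return X \<rho> x = (\<rho> ^^ j) x" "first_return X \<rho> x \<notin> X"
  "\<And>i. 0 < i \<Longrightarrow> i < j \<Longrightarrow> (\<rho> ^^ i) x \<in> X"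
proof -
 let ?P = "\<lambda>j. 0 < j \<and> (\<rho> ^^ j) x \<notin> X"
 obtain n where n: "0 < n" "(\<rho> ^^ n) x = x"
  using self_in[of x] unfolding orbit_altdef by auto
 then have P: "?P (LEAST j. ?P j)" using assms by (intro LeastI[of ?P n]) simp
 show thesis
  by (rule that[of "LEAST j. ?P j"]) (use P assms not_less_Least[of _ ?P] in \<open>auto simp: first_return_def\<close>)
qed

lemma first_return_in_orbit: "x \<notin> X \<Longrightarrow> first_return X \<rho> x \<in> orbit \<rho> x"
 by (rule first_return_pow) (auto simp: orbit_altdef)

lemma first_return_notin: "x \<notin> X \<Longrightarrow> first_return X \<rho> x \<notin> X"
 by (rule first_return_pow)

lemma orbit_first_return:
 assumes "x \<notin> X"
 shows "orbit (first_return X \<rho>) x = orbit \<rho> x - X"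
proof (intro equalityI subsetI)
 fix y assume "y \<in> orbit (first_return X \<rho>) x"
 then show "y \<in> orbit \<rho> x - X"
 proof induction
  case base
  show ?case using first_return_in_orbit[OF assms] first_return_notin[OF assms] by blast
 next
  case (step y)
  then show ?case using first_return_in_orbit[of y] orbit_eq[of y x] first_return_notin[of y] by blast
 qed
next
 fix y assume "y \<in> orbit \<rho> x - X"
 then obtain k where "0 < k" "y = (\<rho> ^^ k) x" and y: "y \<notin> X" unfolding orbit_altdef by auto
 then show "y \<in> orbit (first_return X \<rho>) x"
  using assms
 proof (induction k arbitrary: x rule: less_induct)
  case (less k)
  obtain j where j: "0 < j" "first_return X \<rho> x = (\<rho> ^^ j) x" "first_return X \<rho> x \<notin> X"
   "\<And>i. 0 < i \<Longrightarrow> i < j \<Longrightarrow> (\<rho> ^^ i) x \<in> X"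
   using first_return_pow[OF less.prems(4)] by blast
  have "j \<le> k" using j(4)[OF less.prems(1)] less.prems(2,3) by (metis not_le)
  show ?case
  proof (cases "j = k")
   case True
   then show ?thesis using less.prems j orbit.base[of "first_return X \<rho>" x] by simp
  next
   case False
   have "y = (\<rho> ^^ (k - j)) (first_return X \<rho> x)"
    using \<open>j \<le> k\<close> less.prems(2) j(2) by (metis comp_apply funpow_add le_add_diff_inverse2)
   then have "y \<in> orbit (first_return X \<rho>) (first_return X \<rho> x)"
    using less.IH[of "k - j" "first_return X \<rho> x"] False \<open>j \<le> k\<close> j less.prems(3) by simp
   then show ?thesis by (meson orbit.base orbit_trans)
  qed
 qed
qed

lemma first_return_permutes: "first_return X \<rho> permutes Y - X"
proof (rule bij_imp_permutes)
 have into: "first_return X \<rho> ` (Y - X) \<subseteq> Y - X"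
  using first_return_in_orbit first_return_notin orbit_sub by blast
 have "Y - X \<subseteq> first_return X \<rho> ` (Y - X)"
 proof
  fix y assume y: "y \<in> Y - X"
  then have "y \<in> orbit (first_return X \<rho>) y" using orbit_first_return[of y] self_in by simp
  then show "y \<in> first_return X \<rho> ` (Y - X)"
  proof cases
   case base
   then show ?thesis using y by blast
  next
   case (step z)
   then have "z \<in> Y - X" using orbit_first_return[of y] y orbit_sub by blast
   then show ?thesis using step by blast
  qed
 qed
 with into have e: "first_return X \<rho> ` (Y - X) = Y - X" by blast
 then show "bij_betw (first_return X \<rho>) (Y - X) (Y - X)"
  unfolding bij_betw_def using fin eq_card_imp_inj_on[of "Y - X" "first_return X \<rho>"] by simp
next
 fix x assume "x \<notin> Y - X"
 show "first_return X \<rho> x = x"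
 proof (cases "x \<in> X")
  case False
  then have "\<rho> x = x" using \<open>x \<notin> Y - X\<close> permutes_not_in[OF perm] by blast
  then show ?thesis using first_return_exit[OF False] exit_out[OF False] by simp
 qed (simp add: first_return_def)
qed

lemma card_orbits_on: "card (orbits_on Y \<rho>) = card (orbits_on (Y - X) (first_return X \<rho>)) + card (inner_orbits X \<rho>)"
proof -
 have fX: "finite X" using fin sub finite_subset by blast
 have "orbits_on Y \<rho> = orbits_on (Y - X) \<rho> \<union> inner_orbits X \<rho>"
 proof (intro equalityI subsetI)
  fix o' assume "o' \<in> orbits_on Y \<rho>"
  then obtain x where x: "x \<in> Y" "o' = orbit \<rho> x" by (auto simp: orbits_on_def)
  show "o' \<in> orbits_on (Y - X) \<rho> \<union> inner_orbits X \<rho>"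
  proof (cases "orbit \<rho> x \<subseteq> X")
   case True
   then show ?thesis using x self_in[of x] by (auto simp: inner_orbits_def)
  next
   case False
   then obtain y where "y \<in> orbit \<rho> x" "y \<notin> X" by blast
   then have "y \<in> Y - X" "o' = orbit \<rho> y" using orbit_sub[OF x(1)] orbit_eq x by auto
   then show ?thesis by (auto simp: orbits_on_def)
  qed
 qed (use sub in \<open>auto simp: orbits_on_def inner_orbits_def\<close>)
 moreover have "orbits_on (Y - X) \<rho> \<inter> inner_orbits X \<rho> = {}"
  using self_in by (auto simp: orbits_on_def inner_orbits_def)
 moreover have "finite (inner_orbits X \<rho>)"
  by (rule finite_subset[of _ "orbit \<rho> ` X"]) (auto simp: inner_orbits_def fX)
 ultimately have "card (orbits_on Y \<rho>) = card (orbits_on (Y - X) \<rho>) + card (inner_orbits X \<rho>)"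
  using fin by (simp add: card_Un_disjoint orbits_on_def)
 also have "card (orbits_on (Y - X) \<rho>) = card ((\<lambda>o'. o' - X) ` orbits_on (Y - X) \<rho>)"
 proof (rule card_image[symmetric], rule inj_onI)
  fix o1 o2 assume "o1 \<in> orbits_on (Y - X) \<rho>" "o2 \<in> orbits_on (Y - X) \<rho>" "o1 - X = o2 - X"
  then obtain x y where x: "x \<notin> X" "o1 = orbit \<rho> x" and y: "o2 = orbit \<rho> y" and e: "o1 - X = o2 - X"
   by (auto simp: orbits_on_def)
  have "x \<in> orbit \<rho> y" using e x y self_in[of x] by blast
  then show "o1 = o2" using orbit_eq x y by blast
 qed
 also have "(\<lambda>o'. o' - X) ` orbits_on (Y - X) \<rho> = orbits_on (Y - X) (first_return X \<rho>)"
  unfolding orbits_on_def image_image by (rule image_cong) (auto simp: orbit_first_return)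
 finally show ?thesis .
qed

text \<open>Following \<open>\<rho>\<close> determines a solution at every point whose orbit leaves \<open>X\<close>; on every orbit inside
 \<open>X\<close> it is an arbitrary constant.\<close>

lemma card_solutions:
 fixes C :: "nat set"
 assumes C: "finite C" and I: "\<And>y. y \<in> Y - X \<Longrightarrow> I y \<in> C"
 shows "card {K \<in> X \<rightarrow>\<^sub>E C. \<forall>x\<in>Y. (if x \<in> X then K x else J x) = (if \<rho> x \<in> X then K (\<rho> x) else I (\<rho> x))} =
  (if \<forall>x\<in>Y - X. J x = I (first_return X \<rho> x) then card C ^ card (inner_orbits X \<rho>) else 0)"
  (is "card ?S = _")
proof -
 have funS: "K \<in> X \<rightarrow>\<^sub>E C" if "K \<in> ?S" for K using that by blast
 have stepS: "(if x \<in> X then K x else J x) = (if \<rho> x \<in> X then K (\<rho> x) else I (\<rho> x))"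
  if "K \<in> ?S" "x \<in> Y" for K x using that by blast
 have det: "(if y \<in> X then K y else I y) = I (exit X \<rho> y)" if K: "K \<in> ?S" and n: "(\<rho> ^^ n) y \<notin> X" and "y \<in> Y"
  for K n y
  using n \<open>y \<in> Y\<close>
 proof (induction n arbitrary: y)
  case (Suc n)
  show ?case
  proof (cases "y \<in> X")
   case True
   have "(if \<rho> y \<in> X then K (\<rho> y) else I (\<rho> y)) = I (exit X \<rho> (\<rho> y))"
    by (rule Suc.IH) (use Suc.prems permutes_in_image[OF perm] in \<open>auto simp: funpow_swap1\<close>)
   then show ?thesis using stepS[OF K Suc.prems(2)] True exit_step[OF True Suc.prems(1)] by simp
  qed (simp add: exit_out)
 qed (simp add: exit_out)
 have J: "J x = I (first_return X \<rho> x)" if "K \<in> ?S" "x \<in> Y - X" for K x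
 proof -
  have "x \<in> orbit \<rho> (\<rho> x)" using self_in[of x] by simp
  then have "\<not> orbit \<rho> (\<rho> x) \<subseteq> X" using that(2) by blast
  then obtain n where "(\<rho> ^^ n) (\<rho> x) \<notin> X" using exits by blast
  from det[OF that(1) this] have "(if \<rho> x \<in> X then K (\<rho> x) else I (\<rho> x)) = I (exit X \<rho> (\<rho> x))"
   using that(2) permutes_in_image[OF perm] by blast
  then show ?thesis using stepS[OF that(1), of x] that(2) first_return_exit[of x] by simp
 qed
 show ?thesis
 proof (cases "\<forall>x\<in>Y - X. J x = I (first_return X \<rho> x)")
  case False
  then have "?S = {}" using J by blast
  then show ?thesis using False by (simp only: card.empty if_False)
 next
  case True
  define O' where "O' = inner_orbits X \<rho>"
  have finO: "finite O'"
   by (rule finite_subset[of _ "orbit \<rho> ` X"])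
    (use finite_subset[OF sub fin] in \<open>auto simp: inner_orbits_def O'_def\<close>)
  define sol where "sol k = (\<lambda>x\<in>X. if orbit \<rho> x \<subseteq> X then k (orbit \<rho> x) else I (exit X \<rho> x))" for k :: "nat set \<Rightarrow> nat"
  have exit_Y: "exit X \<rho> y \<in> Y - X" if ny: "\<not> orbit \<rho> y \<subseteq> X" "y \<in> Y" for y
  proof -
   obtain n where n: "(\<rho> ^^ n) y \<notin> X" using exits[OF ny(1)] by blast
   have "(\<rho> ^^ j) y \<in> Y" for j using ny(2) permutes_in_image[OF perm] by (induction j) auto
   then show ?thesis using exit_notin[OF n] by (simp add: exit_def)
  qed
  have inO: "orbit \<rho> x \<in> O'" if "x \<in> X" "orbit \<rho> x \<subseteq> X" for x
   using that by (auto simp: O'_def inner_orbits_def)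
  have solS: "sol k \<in> ?S" if k: "k \<in> O' \<rightarrow>\<^sub>E C" for k
  proof -
   have "sol k \<in> X \<rightarrow>\<^sub>E C"
    using k inO I exit_Y sub by (auto simp: sol_def PiE_iff subset_iff)
   moreover have ext: "(if y \<in> X then sol k y else I y) = (if orbit \<rho> y \<subseteq> X then k (orbit \<rho> y) else I (exit X \<rho> y))"
    for y using self_in[of y] by (auto simp: sol_def exit_out)
   have "(if x \<in> X then sol k x else J x) = (if \<rho> x \<in> X then sol k (\<rho> x) else I (\<rho> x))" if "x \<in> Y" for x
   proof (cases "x \<in> X")
    case False
    then show ?thesis
     unfolding ext using self_in[of x] True that first_return_exit[of x] by auto
   next
    case x: True
    show ?thesis
    proof (cases "orbit \<rho> x \<subseteq> X")
     case True
     then show ?thesis unfolding ext using x by (simp add: sol_def)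
    next
     case False
     then obtain n where "(\<rho> ^^ n) x \<notin> X" using exits by blast
     then show ?thesis unfolding ext using x False exit_step[OF x] by (simp add: sol_def)
    qed
   qed
   ultimately show ?thesis by blast
  qed
  have inj: "inj_on sol (O' \<rightarrow>\<^sub>E C)"
  proof (rule inj_onI)
   fix k k' assume k: "k \<in> O' \<rightarrow>\<^sub>E C" "k' \<in> O' \<rightarrow>\<^sub>E C" "sol k = sol k'"
   show "k = k'"
   proof (rule PiE_ext[OF k(1,2)])
    fix o' assume "o' \<in> O'"
    then obtain x where "x \<in> X" "o' = orbit \<rho> x" "orbit \<rho> x \<subseteq> X" by (auto simp: O'_def inner_orbits_def)
    then show "k o' = k' o'" using fun_cong[OF k(3), of x] by (simp add: sol_def)
   qed
  qed
  have "?S \<subseteq> sol ` (O' \<rightarrow>\<^sub>E C)"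
  proof
   fix K assume K: "K \<in> ?S"
   have const: "K y = K x" if o': "orbit \<rho> x \<subseteq> X" and "y \<in> orbit \<rho> x" for x y
    using \<open>y \<in> orbit \<rho> x\<close>
   proof induction
    case base
    have "x \<in> X" "\<rho> x \<in> X" using o' self_in[of x] orbit.base[of \<rho> x] by blast+
    then have "K x = K (\<rho> x)" using stepS[OF K, of x] sub by auto
    then show ?case by simp
   next
    case (step z)
    have "z \<in> X" "\<rho> z \<in> X" using o' step orbit.step[of z \<rho> x] by blast+
    then have "K z = K (\<rho> z)" using stepS[OF K, of z] sub by auto
    then show ?case using step by simp
   qed
   define k where "k = (\<lambda>o'\<in>O'. K (SOME x. x \<in> o'))"
   have kx: "k (orbit \<rho> x) = K x" if "x \<in> X" "orbit \<rho> x \<subseteq> X" for x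
   proof -
    have "(SOME z. z \<in> orbit \<rho> x) \<in> orbit \<rho> x" by (rule someI) (rule self_in)
    then show ?thesis using const[OF that(2)] inO[OF that] by (simp add: k_def)
   qed
   have "k \<in> O' \<rightarrow>\<^sub>E C"
   proof (rule PiE_I)
    fix o' assume "o' \<in> O'"
    then obtain x where "x \<in> X" "o' = orbit \<rho> x" "orbit \<rho> x \<subseteq> X" by (auto simp: O'_def inner_orbits_def)
    then show "k o' \<in> C" using kx[of x] PiE_mem[OF funS[OF K], of x] by simp
   qed (simp add: k_def)
   moreover have "K = sol k"
   proof
    fix x
    show "K x = sol k x"
    proof (cases "x \<in> X")
     case x: True
     show ?thesis
     proof (cases "orbit \<rho> x \<subseteq> X")
      case True
      then show ?thesis using kx x by (simp add: sol_def)
     next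
      case False
      then obtain n where n: "(\<rho> ^^ n) x \<notin> X" using exits by blast
      have "x \<in> Y" using x sub by blast
      from det[OF K n this] show ?thesis using x False by (simp add: sol_def)
     qed
    next
     case False
     then show ?thesis using PiE_arb[OF funS[OF K]] by (simp add: sol_def)
    qed
   qed
   ultimately show "K \<in> sol ` (O' \<rightarrow>\<^sub>E C)" by (simp only: imageI)
  qed
  moreover have "sol ` (O' \<rightarrow>\<^sub>E C) \<subseteq> ?S" by (rule image_subsetI) (rule solS)
  ultimately have "?S = sol ` (O' \<rightarrow>\<^sub>E C)" by (rule subset_antisym)
  then have "card ?S = card (O' \<rightarrow>\<^sub>E C)" by (simp only: card_image[OF inj])
  also have "\<dots> = card C ^ card O'" by (rule card_funcsetE[OF finO])
  finally show ?thesis unfolding if_P[OF True] O'_def .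
 qed
qed

end

lemma card_invariant:
 fixes C :: "nat set"
 assumes "\<rho> permutes Y" "finite Y" "finite C"
 shows "card {K \<in> Y \<rightarrow>\<^sub>E C. \<forall>x\<in>Y. K x = K (\<rho> x)} = card C ^ card (orbits_on Y \<rho>)"
proof -
 interpret perm_on \<rho> Y Y by unfold_locales (use assms in auto)
 have "inner_orbits Y \<rho> = orbits_on Y \<rho>"
  using orbit_sub by (auto simp: inner_orbits_def orbits_on_def)
 moreover have "{K \<in> Y \<rightarrow>\<^sub>E C. \<forall>x\<in>Y. K x = K (\<rho> x)} = {K \<in> Y \<rightarrow>\<^sub>E C. \<forall>x\<in>Y.
   (if x \<in> Y then K x else 0) = (if \<rho> x \<in> Y then K (\<rho> x) else 0)}"
  using permutes_in_image[OF assms(1)] by auto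
 ultimately show ?thesis using card_solutions[OF assms(3), of "\<lambda>_. 0" "\<lambda>_. 0"] by simp
qed

text \<open>Removing a point from its cycle multiplies the permutation by a transposition.\<close>

lemma sign_orbits:
 assumes "finite Y" "\<rho> permutes Y"
 shows "sign \<rho> = (-1) ^ (card Y + card (orbits_on Y \<rho>))"
 using assms
proof (induction Y arbitrary: \<rho>)
 case empty
 then have "\<rho> = id" by (simp only: permutes_empty)
 then show ?case by (simp add: orbits_on_def)
next
 case (insert z Y)
 interpret perm_on \<rho> "insert z Y" "{z}" by unfold_locales (use insert in auto)
 let ?r = "first_return {z} \<rho>"
 have Y: "insert z Y - {z} = Y" using insert by auto
 have r: "?r permutes Y" using first_return_permutes unfolding Y .
 have rz: "?r z = z" by (simp add: first_return_def)
 have rx: "?r x = (if \<rho> x = z then \<rho> z else \<rho> x)" if "x \<noteq> z" for x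
 proof (cases "\<rho> x = z")
  case True
  then have "\<rho> z \<noteq> z" using that permutes_inj[OF perm] by (metis injD)
  then have "exit {z} \<rho> z = \<rho> z" using exit_step[of z "{z}" 1 \<rho>] exit_out[of "\<rho> z" "{z}"] by simp
  then show ?thesis using first_return_exit[of x] that True by simp
 qed (use first_return_exit[of x] that exit_out[of "\<rho> x" "{z}"] in simp)
 have eq: "\<rho> = Transposition.transpose z (\<rho> z) \<circ> ?r"
 proof
  fix x
  show "\<rho> x = (Transposition.transpose z (\<rho> z) \<circ> ?r) x"
   using rz rx[of x] permutes_inj[OF perm]
   by (cases "x = z") (auto simp: Transposition.transpose_def dest: injD)
 qed
 have sg: "sign \<rho> = (if \<rho> z = z then 1 else -1) * sign ?r"
 proof -
  have "permutation ?r" using r insert.hyps permutation_permutes by blast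
  then have "sign (Transposition.transpose z (\<rho> z) \<circ> ?r) = sign (Transposition.transpose z (\<rho> z)) * sign ?r"
   by (intro sign_compose permutation_swap_id)
  then show ?thesis using eq by (auto simp: sign_swap_id)
 qed
 have "inner_orbits {z} \<rho> = (if \<rho> z = z then {{z}} else {})"
  using orbit_eq_singleton_iff[of \<rho> z] self_in[of z] by (auto simp: inner_orbits_def)
 then have "card (inner_orbits {z} \<rho>) = (if \<rho> z = z then 1 else 0)" by simp
 then show ?case
  using sg insert.IH[OF r] card_orbits_on insert.hyps by (simp add: Y)
qed

lemma sign_involution:
 assumes "finite Y" "\<pi> permutes Y" "\<pi> \<circ> \<pi> = id"
 shows "sign \<pi> = (-1) ^ npairs \<pi>"
proof -
 define R where "R = {i. \<pi> i < i}"
 have inv: "\<pi> (\<pi> i) = i" for i using assms(3) by (metis comp_apply id_apply)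
 have "R \<subseteq> Y" using permutes_not_in[OF assms(2)] by (force simp: R_def)
 interpret perm_on \<pi> Y R by unfold_locales (use assms \<open>R \<subseteq> Y\<close> in auto)
 have RL: "R = \<pi> ` left_ends \<pi>"
 proof (intro equalityI subsetI)
  fix i assume "i \<in> R"
  then have "\<pi> i \<in> left_ends \<pi>" by (simp add: R_def left_ends_def inv)
  then show "i \<in> \<pi> ` left_ends \<pi>" using inv[of i] by (metis imageI)
 qed (auto simp: R_def left_ends_def inv)
 have "card R = npairs \<pi>"
  unfolding RL npairs_def by (rule card_image) (rule inj_onI, metis inv)
 have "inner_orbits R \<pi> = {}"
 proof -
  have "\<not> orbit \<pi> x \<subseteq> R" if "x \<in> R" for x
  proof
   assume "orbit \<pi> x \<subseteq> R"
   then have "\<pi> x \<in> R" using orbit.base[of \<pi> x] by blast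
   then show False using that by (simp add: R_def inv)
  qed
  then show ?thesis by (auto simp: inner_orbits_def)
 qed
 have fr: "first_return R \<pi> x = x" if "x \<notin> R" for x
 proof (cases "\<pi> x \<in> R")
  case True
  then show ?thesis
   using first_return_exit[OF that] exit_step[OF True, of 1 \<pi>] exit_out[OF that] that by (simp add: inv)
 next
  case False
  then have "\<pi> x = x" using that by (auto simp: R_def inv not_less)
  then show ?thesis using first_return_exit[OF that] exit_out[OF that] by simp
 qed
 have "orbits_on (Y - R) (first_return R \<pi>) = (\<lambda>x. {x}) ` (Y - R)"
  unfolding orbits_on_def by (rule image_cong) (auto simp: fr orbit_eq_singleton_iff)
 then have "card (orbits_on (Y - R) (first_return R \<pi>)) = card (Y - R)"
  by (simp add: card_image)
 then have "card (orbits_on Y \<pi>) = card Y - npairs \<pi>"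
  using card_orbits_on \<open>inner_orbits R \<pi> = {}\<close> \<open>card R = npairs \<pi>\<close> \<open>R \<subseteq> Y\<close> assms(1)
  by (simp add: card_Diff_subset finite_subset)
 moreover have "npairs \<pi> \<le> card Y" using \<open>card R = npairs \<pi>\<close> \<open>R \<subseteq> Y\<close> assms(1) by (metis card_mono)
 ultimately show ?thesis using sign_orbits[OF assms(1,2)]
  by (simp add: minus_one_power_iff)
qed

lemma cyc0_orbits:
 assumes "\<rho> permutes Y" "finite Y" "0 \<in> Y"
 shows "Suc (cyc0 Y \<rho>) = card (orbits_on Y \<rho>)"
proof -
 interpret perm_on \<rho> Y Y by unfold_locales (use assms in auto)
 have "{orbit \<rho> x | x. x \<in> Y \<and> 0 \<notin> orbit \<rho> x} = orbits_on Y \<rho> - {orbit \<rho> 0}"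
 proof (intro equalityI subsetI)
  fix o' assume "o' \<in> {orbit \<rho> x | x. x \<in> Y \<and> 0 \<notin> orbit \<rho> x}"
  then obtain x where x: "x \<in> Y" "o' = orbit \<rho> x" "0 \<notin> orbit \<rho> x" by blast
  moreover have "orbit \<rho> x \<noteq> orbit \<rho> 0" using x(3) self_in[of 0] by metis
  ultimately show "o' \<in> orbits_on Y \<rho> - {orbit \<rho> 0}" by (simp add: orbits_on_def)
 next
  fix o' assume "o' \<in> orbits_on Y \<rho> - {orbit \<rho> 0}"
  then obtain x where x: "x \<in> Y" "o' = orbit \<rho> x" "orbit \<rho> x \<noteq> orbit \<rho> 0" by (auto simp: orbits_on_def)
  moreover have "0 \<notin> orbit \<rho> x" using orbit_eq[of 0 x] x(3) by metis
  ultimately show "o' \<in> {orbit \<rho> x | x. x \<in> Y \<and> 0 \<notin> orbit \<rho> x}" by blast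
 qed
 moreover have "orbit \<rho> 0 \<in> orbits_on Y \<rho>" "finite (orbits_on Y \<rho>)" using assms by (auto simp: orbits_on_def)
 ultimately show ?thesis unfolding cyc0_def by (metis card_Suc_Diff1)
qed

section \<open>Hilbert--Schmidt functionals\<close>

lemma riesz_real:
 fixes f :: "'a::{real_inner, complete_space} \<Rightarrow> real"
 assumes lin: "linear f" and bdd: "\<And>x. \<bar>f x\<bar> \<le> K * norm x"
 shows "\<exists>v. \<forall>x. f x = v \<bullet> x"
proof (cases "\<forall>x. f x = 0")
 case True
 then show ?thesis by (intro exI[of _ 0]) simp
next
 case False
 then obtain x0 where x0: "f x0 \<noteq> 0" by blast
 have "bounded_linear f" using lin bdd by (intro bounded_linear_intro[where K = K]) (auto simp: linear_add linear_cmul mult.commute)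
 then have "closed {x. f x = 0}" "subspace {x. f x = 0}"
  using lin by (auto intro!: closed_Collect_eq continuous_intros linear_continuous_on simp: subspace_def linear_add linear_cmul linear_0)
 from closed_subspace_proj_exists[OF this(2,1), of x0]
 obtain p where p: "f p = 0" "\<And>z. f z = 0 \<Longrightarrow> (x0 - p) \<bullet> z = 0" by auto
 define z where "z = x0 - p"
 have fz: "f z \<noteq> 0" using x0 p lin by (simp add: z_def linear_diff)
 then have zz: "z \<bullet> z \<noteq> 0" using linear_0[OF lin] by auto
 have "f x = ((f z / (z \<bullet> z)) *\<^sub>R z) \<bullet> x" for x
 proof -
  have "f (x - (f x / f z) *\<^sub>R z) = 0" using fz lin by (simp add: linear_diff linear_cmul)
  then have "z \<bullet> (x - (f x / f z) *\<^sub>R z) = 0" using p(2) by (simp add: z_def)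
  then have "z \<bullet> x = f x / f z * (z \<bullet> z)" by (simp add: inner_diff_right)
  then show ?thesis using fz zz by (simp add: field_simps)
 qed
 then show ?thesis by blast
qed

lemma cinner_real: "cinner h (u, 0) = Complex (fst h \<bullet> u) (snd h \<bullet> u)"
 by (simp add: cinner_def)

lemma riesz_complex:
 fixes f :: "'a::{real_inner, complete_space} \<Rightarrow> complex"
 assumes lin: "linear f" and bdd: "\<And>x. cmod (f x) \<le> K * norm x"
 shows "\<exists>h. \<forall>x. f x = cinner h (x, 0)"
proof -
 have "\<exists>v. \<forall>x. Re (f x) = v \<bullet> x"
 proof (rule riesz_real)
  show "linear (\<lambda>x. Re (f x))" using lin by (auto simp: linear_iff)
  show "\<bar>Re (f x)\<bar> \<le> K * norm x" for x using bdd[of x] abs_Re_le_cmod[of "f x"] by linarith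
 qed
 moreover have "\<exists>v. \<forall>x. Im (f x) = v \<bullet> x"
 proof (rule riesz_real)
  show "linear (\<lambda>x. Im (f x))" using lin by (auto simp: linear_iff)
  show "\<bar>Im (f x)\<bar> \<le> K * norm x" for x using bdd[of x] abs_Im_le_cmod[of "f x"] by linarith
 qed
 ultimately obtain v w where "\<And>x. Re (f x) = v \<bullet> x" "\<And>x. Im (f x) = w \<bullet> x" by blast
 then show ?thesis by (intro exI[of _ "(v, w)"]) (simp add: cinner_real complex_eq_iff)
qed

lemma cinner_onb_norm2:
 fixes h :: "'a::{real_inner, complete_space} \<times> 'a"
 shows "ell2 (\<lambda>b. cinner h (b, 0)) onb"
  and "norm2 (\<lambda>b. cinner h (b, 0)) onb = fst h \<bullet> fst h + snd h \<bullet> snd h"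
proof -
 have "cinner h (b, 0) * cinner (b, 0) h = of_real ((cmod (cinner h (b, 0)))\<^sup>2)" for b
  by (metis cinner_cnj complex_norm_square)
 then have hs: "((\<lambda>b. complex_of_real ((cmod (cinner h (b, 0)))\<^sup>2)) has_sum cinner h h) onb"
  using parseval_cinner[of h h] by simp
 have "cinner h h = of_real (fst h \<bullet> fst h + snd h \<bullet> snd h)"
  by (simp add: cinner_def complex_eq_iff inner_commute)
 with hs have "((\<lambda>b. (cmod (cinner h (b, 0)))\<^sup>2) has_sum (fst h \<bullet> fst h + snd h \<bullet> snd h)) onb"
  by (simp only: has_sum_of_real_iff)
 then show "ell2 (\<lambda>b. cinner h (b, 0)) onb"
  "norm2 (\<lambda>b. cinner h (b, 0)) onb = fst h \<bullet> fst h + snd h \<bullet> snd h"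
  unfolding ell2_def norm2_def by (auto simp: has_sum_imp_summable infsumI)
qed

lemma cinner_le:
 "(cmod (cinner h (y, 0)))\<^sup>2 \<le> (norm y)\<^sup>2 * (fst h \<bullet> fst h + snd h \<bullet> snd h)"
 using Cauchy_Schwarz_ineq[of "fst h" y] Cauchy_Schwarz_ineq[of "snd h" y]
 by (simp add: cinner_real cmod_def power2_norm_eq_inner algebra_simps)

lemma functional_onb:
 fixes f :: "'a::{real_inner, complete_space} \<Rightarrow> complex"
 assumes "linear f" and "\<And>x. cmod (f x) \<le> K * norm x"
 shows "ell2 f onb" and "(cmod (f y))\<^sup>2 \<le> (norm y)\<^sup>2 * norm2 f onb"
  and "((\<lambda>b. f b * of_real (b \<bullet> y)) has_sum f y) onb"
proof -
 obtain h where "\<And>x. f x = cinner h (x, 0)" using riesz_complex[OF assms] by blast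
 then have f: "f = (\<lambda>x. cinner h (x, 0))" by blast
 show "ell2 f onb" unfolding f by (rule cinner_onb_norm2)
 show "(cmod (f y))\<^sup>2 \<le> (norm y)\<^sup>2 * norm2 f onb"
  unfolding f cinner_onb_norm2 by (rule cinner_le)
 have "cinner (b, 0) (y, 0) = complex_of_real (b \<bullet> y)" for b
  by (simp add: cinner_real complex_eq_iff)
 then show "((\<lambda>b. f b * of_real (b \<bullet> y)) has_sum f y) onb"
  unfolding f using parseval_cinner[of h "(y, 0)"] by simp
qed

lemma functional_onb_proj:
 fixes f g :: "'a::{real_inner, complete_space} \<Rightarrow> complex" and p :: "'a \<Rightarrow> 'a"
 assumes f: "linear f" "\<And>x. cmod (f x) \<le> K * norm x"
  and g: "linear g" "\<And>x. cmod (g x) \<le> K' * norm x"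
  and adj: "\<And>x y. p x \<bullet> y = x \<bullet> p y" and contr: "\<And>x. norm (p x) \<le> norm x"
 shows "ell2 (\<lambda>b. f (p b)) onb" and "norm2 (\<lambda>b. f (p b)) onb \<le> norm2 f onb"
  and "(\<Sum>\<^sub>\<infinity>b\<in>onb. f (p b) * cnj (g b)) = (\<Sum>\<^sub>\<infinity>b\<in>onb. f b * cnj (g (p b)))"
proof -
 obtain h where "\<And>x. f x = cinner h (x, 0)" using riesz_complex[OF f] by blast
 then have fe: "f = (\<lambda>x. cinner h (x, 0))" by blast
 obtain k where "\<And>x. g x = cinner k (x, 0)" using riesz_complex[OF g] by blast
 then have ge: "g = (\<lambda>x. cinner k (x, 0))" by blast
 have move: "cinner h (p b, 0) = cinner (p (fst h), p (snd h)) (b, 0)" for h b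
  by (simp add: cinner_real adj)
 show "ell2 (\<lambda>b. f (p b)) onb" unfolding fe move by (rule cinner_onb_norm2)
 have "p x \<bullet> p x \<le> x \<bullet> x" for x using contr[of x] by (simp add: norm_le)
 then show "norm2 (\<lambda>b. f (p b)) onb \<le> norm2 f onb"
  unfolding fe move cinner_onb_norm2 by (simp add: add_mono)
 have "(\<Sum>\<^sub>\<infinity>b\<in>onb. cinner (p (fst h), p (snd h)) (b, 0) * cnj (cinner k (b, 0))) =
   cinner (p (fst h), p (snd h)) k"
  unfolding cinner_cnj by (rule infsumI) (rule parseval_cinner)
 moreover have "(\<Sum>\<^sub>\<infinity>b\<in>onb. cinner h (b, 0) * cnj (cinner (p (fst k), p (snd k)) (b, 0))) =
   cinner h (p (fst k), p (snd k))"
  unfolding cinner_cnj by (rule infsumI) (rule parseval_cinner)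
 moreover have "cinner (p (fst h), p (snd h)) k = cinner h (p (fst k), p (snd k))"
  by (simp add: cinner_def adj)
 ultimately show "(\<Sum>\<^sub>\<infinity>b\<in>onb. f (p b) * cnj (g b)) = (\<Sum>\<^sub>\<infinity>b\<in>onb. f b * cnj (g (p b)))"
  unfolding fe ge move by simp
qed

lemma bij_PiE_insert:
 assumes "i \<notin> A"
 shows "bij_betw (\<lambda>(e, b). e(i := b)) ((A \<rightarrow>\<^sub>E B) \<times> B) (insert i A \<rightarrow>\<^sub>E B)"
proof (rule bij_betwI[of _ _ _ "\<lambda>e. (e(i := undefined), e i)"])
 show "(\<lambda>e. (e(i := undefined), e i)) \<in> (insert i A \<rightarrow>\<^sub>E B) \<rightarrow> (A \<rightarrow>\<^sub>E B) \<times> B"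
  using assms by (auto simp: PiE_iff extensional_def)
qed (use assms in \<open>auto simp: PiE_iff extensional_def fun_eq_iff split: if_splits\<close>)

lemma ell2_prod_PiE:
 assumes "finite A" "\<And>i. i \<in> A \<Longrightarrow> ell2 (g i) B"
 shows "ell2 (\<lambda>e. \<Prod>i\<in>A. g i (e i)) (A \<rightarrow>\<^sub>E B)"
 using assms
proof (induction A)
 case empty
 then show ?case by (simp add: ell2_def)
next
 case (insert i A)
 have "ell2 (\<lambda>(e, b). (\<Prod>j\<in>A. g j (e j)) * g i b) ((A \<rightarrow>\<^sub>E B) \<times> B)"
  by (rule ell2_times) (use insert in auto)
 also have "(\<lambda>(e, b). (\<Prod>j\<in>A. g j (e j)) * g i b) =
   (\<lambda>p. (\<lambda>e. \<Prod>j\<in>insert i A. g j (e j)) ((\<lambda>(e, b). e(i := b)) p))"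
 proof
  fix p :: "(_ \<Rightarrow> 'b) \<times> 'b"
  have "(\<Prod>j\<in>A. g j (((fst p)(i := snd p)) j)) = (\<Prod>j\<in>A. g j (fst p j))"
   by (rule prod.cong) (use insert.hyps in auto)
  then show "(case p of (e, b) \<Rightarrow> (\<Prod>j\<in>A. g j (e j)) * g i b) =
    (\<lambda>e. \<Prod>j\<in>insert i A. g j (e j)) ((\<lambda>(e, b). e(i := b)) p)"
   using insert.hyps by (simp add: case_prod_unfold mult.commute)
 qed
 finally show ?case
  using ell2_reindex[OF bij_PiE_insert[OF insert.hyps(2)], of "\<lambda>e. \<Prod>j\<in>insert i A. g j (e j)"] by blast
qed

subsection \<open>Bounded multilinear functionals\<close>

definition multilin :: "nat \<Rightarrow> 'a::real_inner tensor \<Rightarrow> bool" where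
 "multilin n F \<longleftrightarrow> (\<forall>x y. (\<forall>i\<in>{1..n}. x i = y i) \<longrightarrow> F x = F y) \<and>
   (\<forall>i\<in>{1..n}. \<forall>x. linear (\<lambda>u. F (x(i := u)))) \<and>
   (\<exists>K. \<forall>x. cmod (F x) \<le> K * (\<Prod>i=1..n. norm (x i)))"

lemma hilbert_schmidt_iff: "F \<in> hilbert_schmidt n \<longleftrightarrow> multilin n F \<and> ell2 F ({1..n} \<rightarrow>\<^sub>E onb)"
 by (auto simp: hilbert_schmidt_def multilin_def ell2_def)

lemma multilin_cong: "multilin n F \<Longrightarrow> (\<And>i. i \<in> {1..n} \<Longrightarrow> x i = y i) \<Longrightarrow> F x = F y"
 unfolding multilin_def by blast

lemma multilin_linear: "multilin n F \<Longrightarrow> i \<in> {1..n} \<Longrightarrow> linear (\<lambda>u. F (x(i := u)))"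
 unfolding multilin_def by blast

lemma multilin_slice_bound:
 assumes "multilin n F" "i \<in> {1..n}"
 shows "\<exists>K. \<forall>u. cmod (F (x(i := u))) \<le> K * norm u"
proof -
 obtain K where K: "\<And>x. cmod (F x) \<le> K * (\<Prod>i=1..n. norm (x i))" using assms unfolding multilin_def by blast
 have "(\<Prod>j=1..n. norm ((x(i := u)) j)) = norm u * (\<Prod>j\<in>{1..n} - {i}. norm (x j))" for u
  using assms(2) by (simp add: prod.remove)
 then show ?thesis
  using K[of "x(i := _)"] by (intro exI[of _ "K * (\<Prod>j\<in>{1..n} - {i}. norm (x j))"]) (simp add: mult_ac)
qed

lemma multilin_slice:
 fixes F :: "'a::{real_inner, complete_space} tensor"
 assumes "multilin n F" "i \<in> {1..n}"
 shows "ell2 (\<lambda>b. F (x(i := b))) onb" and "(cmod (F x))\<^sup>2 \<le> (norm (x i))\<^sup>2 * norm2 (\<lambda>b. F (x(i := b))) onb"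
  and "((\<lambda>b. F (x(i := b)) * of_real (b \<bullet> x i)) has_sum F x) onb"
proof -
 obtain K where K: "\<And>u. cmod (F (x(i := u))) \<le> K * norm u" using multilin_slice_bound[OF assms] by blast
 note * = functional_onb[OF multilin_linear[OF assms] K]
 show "ell2 (\<lambda>b. F (x(i := b))) onb" by (rule *(1))
 show "(cmod (F x))\<^sup>2 \<le> (norm (x i))\<^sup>2 * norm2 (\<lambda>b. F (x(i := b))) onb" using *(2)[of "x i"] by simp
 show "((\<lambda>b. F (x(i := b)) * of_real (b \<bullet> x i)) has_sum F x) onb" using *(3)[of "x i"] by simp
qed

lemma override_on_insert_upd:
 "i \<notin> A \<Longrightarrow> override_on y (e(i := b)) (insert i A) = (override_on y e A)(i := b)"
 by (auto simp: override_on_def fun_eq_iff)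

lemma ell2_insert_iff:
 fixes F :: "'a::real_inner tensor"
 assumes "i \<notin> A"
 shows "ell2 (\<lambda>e. F (override_on y e (insert i A))) (insert i A \<rightarrow>\<^sub>E B) \<longleftrightarrow>
   ell2 (\<lambda>(e, b). F ((override_on y e A)(i := b))) ((A \<rightarrow>\<^sub>E B) \<times> B)"
  and "norm2 (\<lambda>e. F (override_on y e (insert i A))) (insert i A \<rightarrow>\<^sub>E B) =
   norm2 (\<lambda>(e, b). F ((override_on y e A)(i := b))) ((A \<rightarrow>\<^sub>E B) \<times> B)"
 unfolding ell2_reindex[OF bij_PiE_insert[OF assms], symmetric]
  norm2_reindex[OF bij_PiE_insert[OF assms], symmetric] case_prod_unfold override_on_insert_upd[OF assms]
 by (rule refl)+

text \<open>By Bessel's inequality, inserting a vector \<open>y\<^sub>i\<close> for the \<open>i\<close>-th basis vector costs at most the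
 factor \<open>\<parallel>y\<^sub>i\<parallel>\<close>.\<close>

lemma partial_eval:
 fixes F :: "'a::{real_inner, complete_space} tensor"
 assumes F: "F \<in> hilbert_schmidt n" and A: "A \<subseteq> {1..n}"
 shows "ell2 (\<lambda>e. F (override_on y e A)) (A \<rightarrow>\<^sub>E onb)"
  and "norm2 (\<lambda>e. F (override_on y e A)) (A \<rightarrow>\<^sub>E onb) \<le>
   (\<Prod>i\<in>{1..n} - A. (norm (y i))\<^sup>2) * norm2 F ({1..n} \<rightarrow>\<^sub>E onb)"
proof -
 have ml: "multilin n F" and e2: "ell2 F ({1..n} \<rightarrow>\<^sub>E onb)" using F by (auto simp: hilbert_schmidt_iff)
 have "ell2 (\<lambda>e. F (override_on y e ({1..n} - D))) ({1..n} - D \<rightarrow>\<^sub>E onb) \<and>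
   norm2 (\<lambda>e. F (override_on y e ({1..n} - D))) ({1..n} - D \<rightarrow>\<^sub>E onb) \<le>
   (\<Prod>i\<in>D. (norm (y i))\<^sup>2) * norm2 F ({1..n} \<rightarrow>\<^sub>E onb)" if "finite D" "D \<subseteq> {1..n}" for D
  using that
 proof (induction D)
  case empty
  have "F (override_on y e {1..n}) = F e" for e by (rule multilin_cong[OF ml]) simp
  then show ?case using e2 by simp
 next
  case (insert i D)
  let ?A = "{1..n} - insert i D"
  have iA: "i \<notin> ?A" and ins: "{1..n} - D = insert i ?A" and i: "i \<in> {1..n}" using insert by auto
  have IH: "ell2 (\<lambda>(e, b). F ((override_on y e ?A)(i := b))) ((?A \<rightarrow>\<^sub>E onb) \<times> onb)"
   "norm2 (\<lambda>(e, b). F ((override_on y e ?A)(i := b))) ((?A \<rightarrow>\<^sub>E onb) \<times> onb) \<le>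
    (\<Prod>i\<in>D. (norm (y i))\<^sup>2) * norm2 F ({1..n} \<rightarrow>\<^sub>E onb)"
   using insert unfolding ins ell2_insert_iff[OF iA] by auto
  have le: "(cmod (F (override_on y e ?A)))\<^sup>2 \<le>
    (norm (y i))\<^sup>2 * norm2 (\<lambda>b. F ((override_on y e ?A)(i := b))) onb" for e
   using multilin_slice(2)[OF ml i, of "override_on y e ?A"] by simp
  have sm: "(\<lambda>e. (norm (y i))\<^sup>2 * norm2 (\<lambda>b. F ((override_on y e ?A)(i := b))) onb) summable_on (?A \<rightarrow>\<^sub>E onb)"
   using summable_on_cmult_right[OF ell2_Sigma(2)[OF IH(1)]] by simp
  have e: "ell2 (\<lambda>e. F (override_on y e ?A)) (?A \<rightarrow>\<^sub>E onb)"
   unfolding ell2_def by (rule summable_on_comparison_test[OF sm]) (use le in auto)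
  have "norm2 (\<lambda>e. F (override_on y e ?A)) (?A \<rightarrow>\<^sub>E onb) \<le>
    (\<Sum>\<^sub>\<infinity>e\<in>?A \<rightarrow>\<^sub>E onb. (norm (y i))\<^sup>2 * norm2 (\<lambda>b. F ((override_on y e ?A)(i := b))) onb)"
   unfolding norm2_def[of "\<lambda>e. F (override_on y e ?A)"]
   by (rule infsum_mono) (use e sm le in \<open>auto simp: ell2_def\<close>)
  also have "\<dots> = (norm (y i))\<^sup>2 * norm2 (\<lambda>(e, b). F ((override_on y e ?A)(i := b))) ((?A \<rightarrow>\<^sub>E onb) \<times> onb)"
   using ell2_Sigma(3)[OF IH(1)] by (simp add: infsum_cmult_right')
  also have "\<dots> \<le> (norm (y i))\<^sup>2 * ((\<Prod>i\<in>D. (norm (y i))\<^sup>2) * norm2 F ({1..n} \<rightarrow>\<^sub>E onb))"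
   by (rule mult_left_mono[OF IH(2)]) simp
  finally show ?case using e insert.hyps by (simp add: mult.assoc)
 qed
 from this[of "{1..n} - A"] A show "ell2 (\<lambda>e. F (override_on y e A)) (A \<rightarrow>\<^sub>E onb)"
  "norm2 (\<lambda>e. F (override_on y e A)) (A \<rightarrow>\<^sub>E onb) \<le>
   (\<Prod>i\<in>{1..n} - A. (norm (y i))\<^sup>2) * norm2 F ({1..n} \<rightarrow>\<^sub>E onb)"
  by (simp_all add: double_diff)
qed

lemma hilbert_schmidt_bound:
 fixes F :: "'a::{real_inner, complete_space} tensor"
 assumes F: "F \<in> hilbert_schmidt n"
 shows "cmod (F x) \<le> sqrt (norm2 F ({1..n} \<rightarrow>\<^sub>E onb)) * (\<Prod>i=1..n. norm (x i))"
proof (rule power2_le_imp_le)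
 show "(cmod (F x))\<^sup>2 \<le> (sqrt (norm2 F ({1..n} \<rightarrow>\<^sub>E onb)) * (\<Prod>i=1..n. norm (x i)))\<^sup>2"
  using partial_eval(2)[OF F, of "{}" x]
  by (simp add: norm2_def[of _ "{_}"] power_mult_distrib norm2_nonneg prod_power_distrib mult.commute)
qed (simp add: norm2_nonneg prod_nonneg)

lemma reproducing:
 fixes F :: "'a::{real_inner, complete_space} tensor"
 assumes F: "F \<in> hilbert_schmidt n" and A: "A \<subseteq> {1..n}"
 shows "(\<Sum>\<^sub>\<infinity>e\<in>A \<rightarrow>\<^sub>E onb. F (override_on y e A) * (\<Prod>i\<in>A. of_real (e i \<bullet> y i))) = F y"
 using finite_subset[OF A finite_atLeastAtMost] A
proof (induction A)
 case empty
 then show ?case by simp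
next
 case (insert i A)
 have ml: "multilin n F" using F by (auto simp: hilbert_schmidt_iff)
 let ?G = "\<lambda>e. F (override_on y e (insert i A)) * (\<Prod>j\<in>insert i A. complex_of_real (e j \<bullet> y j))"
 have G: "?G (e(i := b)) = F ((override_on y e A)(i := b)) * of_real (b \<bullet> y i) * (\<Prod>j\<in>A. of_real (e j \<bullet> y j))"
  for e b
 proof -
  have "(\<Prod>j\<in>A. complex_of_real ((e(i := b)) j \<bullet> y j)) = (\<Prod>j\<in>A. of_real (e j \<bullet> y j))"
   by (rule prod.cong) (use insert.hyps in auto)
  then show ?thesis using insert.hyps by (simp add: override_on_insert_upd)
 qed
 have "ell2 (\<lambda>e. \<Prod>j\<in>insert i A. complex_of_real (e j \<bullet> y j)) (insert i A \<rightarrow>\<^sub>E onb)"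
 proof (rule ell2_prod_PiE)
  have "complex_of_real (b \<bullet> y j) = cinner (y j, 0) (b, 0)" for j b
   by (simp add: cinner_real complex_eq_iff inner_commute)
  then show "ell2 (\<lambda>b. complex_of_real (b \<bullet> y j)) onb" for j
   using cinner_onb_norm2(1)[of "(y j, 0)"] by simp
 qed (use insert in auto)
 then have "?G summable_on (insert i A \<rightarrow>\<^sub>E onb)"
  by (intro ell2_mult_summable partial_eval(1)[OF F] insert.prems)
 then have sm: "(\<lambda>(e, b). ?G (e(i := b))) summable_on ((A \<rightarrow>\<^sub>E onb) \<times> onb)"
  using summable_on_reindex_bij_betw[OF bij_PiE_insert[OF insert.hyps(2)], of ?G] by (simp add: case_prod_unfold)
 have "(\<Sum>\<^sub>\<infinity>e\<in>insert i A \<rightarrow>\<^sub>E onb. ?G e) = (\<Sum>\<^sub>\<infinity>(e, b)\<in>(A \<rightarrow>\<^sub>E onb) \<times> onb. ?G (e(i := b)))"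
  using infsum_reindex_bij_betw[OF bij_PiE_insert[OF insert.hyps(2)], of ?G] by (simp add: case_prod_unfold)
 also have "\<dots> = (\<Sum>\<^sub>\<infinity>e\<in>A \<rightarrow>\<^sub>E onb. \<Sum>\<^sub>\<infinity>b\<in>onb. ?G (e(i := b)))"
  using infsum_Sigma_banach[OF sm] by simp
 also have "\<dots> = (\<Sum>\<^sub>\<infinity>e\<in>A \<rightarrow>\<^sub>E onb. F (override_on y e A) * (\<Prod>j\<in>A. of_real (e j \<bullet> y j)))"
 proof (rule infsum_cong)
  fix e
  have "((\<lambda>b. F ((override_on y e A)(i := b)) * of_real (b \<bullet> y i)) has_sum F (override_on y e A)) onb"
   using multilin_slice(3)[OF ml, of i "override_on y e A"] insert by simp
  from infsumI[OF has_sum_cmult_left[OF this]]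
  show "(\<Sum>\<^sub>\<infinity>b\<in>onb. ?G (e(i := b))) = F (override_on y e A) * (\<Prod>j\<in>A. of_real (e j \<bullet> y j))"
   unfolding G by simp
 qed
 also have "\<dots> = F y" using insert by simp
 finally show ?case .
qed

lemma multilin_add: "multilin n F \<Longrightarrow> multilin n G \<Longrightarrow> multilin n (\<lambda>x. F x + G x)"
proof -
 assume F: "multilin n F" and G: "multilin n G"
 obtain K K' where K: "\<And>x. cmod (F x) \<le> K * (\<Prod>i=1..n. norm (x i))" "\<And>x. cmod (G x) \<le> K' * (\<Prod>i=1..n. norm (x i))"
  using F G unfolding multilin_def by blast
 have "cmod (F x + G x) \<le> (K + K') * (\<Prod>i=1..n. norm (x i))" for x
  using norm_triangle_ineq[of "F x" "G x"] K[of x] by (simp add: distrib_right)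
 moreover have "F x + G x = F y + G y" if "\<forall>i\<in>{1..n}. x i = y i" for x y
  using multilin_cong[OF F, of x y] multilin_cong[OF G, of x y] that by simp
 moreover have "linear (\<lambda>u. F (x(i := u)) + G (x(i := u)))" if "i \<in> {1..n}" for i x
  by (rule linear_compose_add[OF multilin_linear[OF F that] multilin_linear[OF G that]])
 ultimately show ?thesis unfolding multilin_def by blast
qed

lemma multilin_cmult: "multilin n F \<Longrightarrow> multilin n (\<lambda>x. c * F x)"
proof -
 assume F: "multilin n F"
 obtain K where K: "\<And>x. cmod (F x) \<le> K * (\<Prod>i=1..n. norm (x i))" using F unfolding multilin_def by blast
 have "cmod (c * F x) \<le> (cmod c * K) * (\<Prod>i=1..n. norm (x i))" for x
  using mult_left_mono[OF K[of x] norm_ge_zero[of c]] by (simp add: norm_mult mult.assoc)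
 moreover have "c * F x = c * F y" if "\<forall>i\<in>{1..n}. x i = y i" for x y
  using multilin_cong[OF F, of x y] that by simp
 moreover have "linear (\<lambda>u. c * F (x(i := u)))" if "i \<in> {1..n}" for i x
  using multilin_linear[OF F that, of x] by (simp add: linear_iff distrib_left scaleR_conv_of_real)
 ultimately show ?thesis unfolding multilin_def by blast
qed

lemma hilbert_schmidt_add: "F \<in> hilbert_schmidt n \<Longrightarrow> G \<in> hilbert_schmidt n \<Longrightarrow> (\<lambda>x. F x + G x) \<in> hilbert_schmidt n"
 by (simp add: hilbert_schmidt_iff multilin_add ell2_add)

lemma hilbert_schmidt_cmult: "F \<in> hilbert_schmidt n \<Longrightarrow> (\<lambda>x. c * F x) \<in> hilbert_schmidt n"
 by (simp add: hilbert_schmidt_iff multilin_cmult ell2_cmult)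

lemma hilbert_schmidt_zero: "(\<lambda>_. 0) \<in> hilbert_schmidt n"
 by (auto simp: hilbert_schmidt_iff multilin_def ell2_def linear_zero intro!: exI[of _ 0])

lemma hilbert_schmidt_sum:
 "finite I \<Longrightarrow> (\<And>i. i \<in> I \<Longrightarrow> F i \<in> hilbert_schmidt n) \<Longrightarrow> (\<lambda>x. \<Sum>i\<in>I. F i x) \<in> hilbert_schmidt n"
 by (induction I rule: finite_induct) (auto intro: hilbert_schmidt_zero hilbert_schmidt_add)

lemma hilbert_schmidt_diff:
 assumes "F \<in> hilbert_schmidt n" "G \<in> hilbert_schmidt n"
 shows "(\<lambda>x. F x - G x) \<in> hilbert_schmidt n"
 using hilbert_schmidt_add[OF assms(1) hilbert_schmidt_cmult[OF assms(2), of "-1"]] by simp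

lemma cmod_cinner_le: "cmod (cinner h (x, 0)) \<le> sqrt (fst h \<bullet> fst h + snd h \<bullet> snd h) * norm x"
proof (rule power2_le_imp_le)
 show "(cmod (cinner h (x, 0)))\<^sup>2 \<le> (sqrt (fst h \<bullet> fst h + snd h \<bullet> snd h) * norm x)\<^sup>2"
  using cinner_le[of h x] by (simp add: power_mult_distrib mult.commute)
qed simp

lemma pure_tensor_hilbert_schmidt:
 fixes h :: "nat \<Rightarrow> 'a::{real_inner, complete_space} \<times> 'a"
 shows "pure_tensor n h \<in> hilbert_schmidt n"
 unfolding hilbert_schmidt_iff multilin_def
proof (intro conjI ballI allI impI)
 fix x y :: "nat \<Rightarrow> 'a" assume "\<forall>i\<in>{1..n}. x i = y i"
 then show "pure_tensor n h x = pure_tensor n h y" unfolding pure_tensor_def by (intro prod.cong) auto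
next
 fix i and x :: "nat \<Rightarrow> 'a" assume i: "i \<in> {1..n}"
 have "pure_tensor n h (x(i := u)) = cinner (h i) (u, 0) * (\<Prod>j\<in>{1..n} - {i}. cinner (h j) (x j, 0))" for u
  using i by (simp add: pure_tensor_def prod.remove)
 moreover have "linear (\<lambda>u. cinner (h i) (u, 0) * c)" for c
  by (simp add: linear_iff cinner_real complex_eq_iff inner_add_right algebra_simps)
 ultimately show "linear (\<lambda>u. pure_tensor n h (x(i := u)))" by simp
next
 have "cmod (pure_tensor n h x) \<le> (\<Prod>i=1..n. sqrt (fst (h i) \<bullet> fst (h i) + snd (h i) \<bullet> snd (h i))) * (\<Prod>i=1..n. norm (x i))" for x
  unfolding pure_tensor_def prod_norm[symmetric] prod.distrib[symmetric]
  by (rule prod_mono) (simp add: cmod_cinner_le)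
 then show "\<exists>K. \<forall>x. cmod (pure_tensor n h x) \<le> K * (\<Prod>i=1..n. norm (x i))" by blast
 show "ell2 (pure_tensor n h) ({1..n} \<rightarrow>\<^sub>E onb)"
  unfolding pure_tensor_def by (rule ell2_prod_PiE) (auto intro: cinner_onb_norm2)
qed

lemma tinner_norm2:
 assumes "ell2 F ({1..n} \<rightarrow>\<^sub>E onb)"
 shows "tinner n F F = of_real (norm2 F ({1..n} \<rightarrow>\<^sub>E onb))"
proof -
 have "F e * cnj (F e) = of_real ((cmod (F e))\<^sup>2)" for e by (metis complex_norm_square)
 moreover have "((\<lambda>e. complex_of_real ((cmod (F e))\<^sup>2)) has_sum
   of_real (\<Sum>\<^sub>\<infinity>e\<in>{1..n} \<rightarrow>\<^sub>E onb. (cmod (F e))\<^sup>2)) ({1..n} \<rightarrow>\<^sub>E onb)"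
  using assms unfolding ell2_def has_sum_of_real_iff by (rule has_sum_infsum)
 ultimately show ?thesis unfolding tinner_def norm2_def by (simp only: infsumI)
qed

lemma perm_op_hilbert_schmidt:
 fixes F :: "'a::real_inner tensor"
 assumes \<sigma>: "\<sigma> \<in> Sn n" and F: "F \<in> hilbert_schmidt n"
 shows "perm_op \<sigma> F \<in> hilbert_schmidt n"
proof -
 have p: "\<sigma> permutes {1..n}" using \<sigma> by (simp add: Sn_def)
 have ml: "multilin n F" and e2: "ell2 F ({1..n} \<rightarrow>\<^sub>E onb)" using F by (auto simp: hilbert_schmidt_iff)
 obtain K where K: "\<And>x. cmod (F x) \<le> K * (\<Prod>i=1..n. norm (x i))" using ml unfolding multilin_def by blast
 have "F (x \<circ> \<sigma>) = F (y \<circ> \<sigma>)" if "\<forall>i\<in>{1..n}. x i = y i" for x y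
  by (rule multilin_cong[OF ml]) (use that permutes_in_image[OF p] in auto)
 moreover have "linear (\<lambda>u. F (x(i := u) \<circ> \<sigma>))" if "i \<in> {1..n}" for i x
 proof -
  have "x(i := u) \<circ> \<sigma> = (x \<circ> \<sigma>)(inv \<sigma> i := u)" for u
   using permutes_inverses[OF p] by (auto simp: fun_eq_iff)
  then show ?thesis using multilin_linear[OF ml, of "inv \<sigma> i" "x \<circ> \<sigma>"] that
    permutes_in_image[OF permutes_inv[OF p]] by simp
 qed
 moreover have "cmod (F (x \<circ> \<sigma>)) \<le> K * (\<Prod>i=1..n. norm (x i))" for x
  using K[of "x \<circ> \<sigma>"] prod.permute[OF p, of "\<lambda>i. norm (x i)"] by (simp add: comp_def)
 moreover have "ell2 (\<lambda>x. F (x \<circ> \<sigma>)) ({1..n} \<rightarrow>\<^sub>E onb)"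
 proof (rule ell2_inj[OF e2])
  show "inj_on (\<lambda>x. x \<circ> \<sigma>) ({1..n} \<rightarrow>\<^sub>E onb)"
   by (rule inj_onI) (metis comp_assoc comp_id permutes_inv_o(1)[OF p])
  show "(\<lambda>x. x \<circ> \<sigma>) ` ({1..n} \<rightarrow>\<^sub>E onb) \<subseteq> {1..n} \<rightarrow>\<^sub>E onb"
   using permutes_in_image[OF p] permutes_not_in[OF p] by (auto simp: PiE_iff extensional_def)
 qed
 ultimately show ?thesis unfolding hilbert_schmidt_iff multilin_def perm_op_def by blast
qed

section \<open>Second quantisation of a real projection\<close>

text \<open>The orthogonal projection onto a closed subspace of the real Hilbert space, given by its algebraic
 properties.  The case \<open>p x = x\<close> gives the full space, so that statements about the two algebras
 need only one proof.\<close>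

locale real_projection =
 fixes p :: "'a::{real_inner, complete_space} \<Rightarrow> 'a" and M :: "'a set"
 assumes p_lin: "linear p" and p_M: "p x \<in> M" and p_fix: "x \<in> M \<Longrightarrow> p x = x"
  and p_adj: "p x \<bullet> y = x \<bullet> p y"
begin

lemma p_idem [simp]: "p (p x) = p x"
 by (simp add: p_fix p_M)

lemma p_contr: "norm (p x) \<le> norm x"
proof -
 have "(norm (p x))\<^sup>2 = x \<bullet> p x" by (metis p_adj p_idem power2_norm_eq_inner)
 also have "\<dots> \<le> norm x * norm (p x)" by (rule norm_cauchy_schwarz)
 finally show ?thesis by (cases "p x = 0") (simp_all add: power2_eq_square)
qed

definition at_coord :: "nat \<Rightarrow> 'a tensor \<Rightarrow> 'a tensor" where
 "at_coord i F = (\<lambda>x. F (x(i := p (x i))))"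

definition second :: "'a tensor \<Rightarrow> 'a tensor" where
 "second F = (\<lambda>x. F (\<lambda>i. p (x i)))"

lemma second_idem [simp]: "second (second F) = second F"
 by (simp add: second_def)

context
 fixes n i :: nat
 assumes i: "i \<in> {1..n}"
begin

lemma at_coord_multilin:
 assumes F: "multilin n F"
 shows "multilin n (at_coord i F)"
 unfolding multilin_def
proof (intro conjI ballI allI impI)
 fix x y :: "nat \<Rightarrow> 'a" assume "\<forall>i\<in>{1..n}. x i = y i"
 then show "at_coord i F x = at_coord i F y"
  unfolding at_coord_def by (intro multilin_cong[OF F]) (use i in auto)
next
 fix j and x :: "nat \<Rightarrow> 'a" assume j: "j \<in> {1..n}"
 show "linear (\<lambda>u. at_coord i F (x(j := u)))"
 proof (cases "j = i")
  case True
  then show ?thesis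
   using linear_compose[OF p_lin multilin_linear[OF F i, of x]] by (simp add: at_coord_def comp_def)
 next
  case False
  then show ?thesis
   using multilin_linear[OF F j, of "x(i := p (x i))"] by (simp add: at_coord_def fun_upd_twist)
 qed
next
 obtain K where K: "\<And>x. cmod (F x) \<le> K * (\<Prod>i=1..n. norm (x i))" using F unfolding multilin_def by blast
 have "cmod (at_coord i F x) \<le> \<bar>K\<bar> * (\<Prod>i=1..n. norm (x i))" for x
 proof -
  have "cmod (at_coord i F x) \<le> \<bar>K\<bar> * (\<Prod>j=1..n. norm ((x(i := p (x i))) j))"
   unfolding at_coord_def by (rule order_trans[OF K]) (intro mult_right_mono prod_nonneg, auto)
  also have "\<dots> \<le> \<bar>K\<bar> * (\<Prod>j=1..n. norm (x j))"
   by (intro mult_left_mono prod_mono) (auto simp: p_contr)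
  finally show ?thesis .
 qed
 then show "\<exists>K. \<forall>x. cmod (at_coord i F x) \<le> K * (\<Prod>i=1..n. norm (x i))" by blast
qed

lemma insert_i: "insert i ({1..n} - {i}) = {1..n}"
 using i by auto

lemma bij_i: "bij_betw (\<lambda>(e, b). e(i := b)) ((({1..n} - {i}) \<rightarrow>\<^sub>E B) \<times> B) ({1..n} \<rightarrow>\<^sub>E B)"
 using bij_PiE_insert[of i "{1..n} - {i}" B] insert_i by simp

lemma at_coord_hilbert_schmidt:
 assumes F: "F \<in> hilbert_schmidt n"
 shows "at_coord i F \<in> hilbert_schmidt n"
  and "norm2 (at_coord i F) ({1..n} \<rightarrow>\<^sub>E onb) \<le> norm2 F ({1..n} \<rightarrow>\<^sub>E onb)"
proof -
 have ml: "multilin n F" and e2: "ell2 F ({1..n} \<rightarrow>\<^sub>E onb)" using F by (auto simp: hilbert_schmidt_iff)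
 let ?P = "({1..n} - {i}) \<rightarrow>\<^sub>E (onb :: 'a set)"
 have e2': "ell2 (\<lambda>(e, b). F (e(i := b))) (?P \<times> onb)"
  using e2 ell2_reindex[OF bij_i, of F] by (simp add: case_prod_unfold)
 have K: "\<exists>K. \<forall>u. cmod (F (e(i := u))) \<le> K * norm u" for e by (rule multilin_slice_bound[OF ml i])
 have sl: "ell2 (\<lambda>b. F (e(i := p b))) onb"
  "norm2 (\<lambda>b. F (e(i := p b))) onb \<le> norm2 (\<lambda>b. F (e(i := b))) onb" for e
 proof -
  obtain K where K: "\<And>u. cmod (F (e(i := u))) \<le> K * norm u" using K by blast
  note * = functional_onb_proj[OF multilin_linear[OF ml i] K multilin_linear[OF ml i] K p_adj p_contr]
  show "ell2 (\<lambda>b. F (e(i := p b))) onb" by (rule *(1))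
  show "norm2 (\<lambda>b. F (e(i := p b))) onb \<le> norm2 (\<lambda>b. F (e(i := b))) onb" by (rule *(2))
 qed
 have sm: "(\<lambda>e. norm2 (\<lambda>b. F (e(i := b))) onb) summable_on ?P"
  using ell2_Sigma(2)[OF e2'] by simp
 have sm': "(\<lambda>e. norm2 (\<lambda>b. F (e(i := p b))) onb) summable_on ?P"
  by (rule summable_on_comparison_test[OF sm]) (use sl norm2_nonneg in auto)
 have l: "ell2 (\<lambda>(e, b). F (e(i := p b))) (?P \<times> onb)"
  by (rule ell2_SigmaI) (use sl sm' in auto)
 have *: "at_coord i F (case x of (e, b) \<Rightarrow> e(i := b)) = (case x of (e, b) \<Rightarrow> F (e(i := p b)))" for x
  by (simp add: at_coord_def case_prod_unfold)
 have "ell2 (at_coord i F) ({1..n} \<rightarrow>\<^sub>E onb)"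
  using l unfolding ell2_reindex[OF bij_i, symmetric] * .
 with at_coord_multilin[OF ml] show "at_coord i F \<in> hilbert_schmidt n" by (simp add: hilbert_schmidt_iff)
 have "norm2 (at_coord i F) ({1..n} \<rightarrow>\<^sub>E onb) = norm2 (\<lambda>(e, b). F (e(i := p b))) (?P \<times> onb)"
  unfolding norm2_reindex[OF bij_i, symmetric] * ..
 also have "\<dots> = (\<Sum>\<^sub>\<infinity>e\<in>?P. norm2 (\<lambda>b. F (e(i := p b))) onb)" using ell2_Sigma(3)[OF l] by simp
 also have "\<dots> \<le> (\<Sum>\<^sub>\<infinity>e\<in>?P. norm2 (\<lambda>b. F (e(i := b))) onb)"
  by (rule infsum_mono) (use sm sm' sl in auto)
 also have "\<dots> = norm2 (\<lambda>(e, b). F (e(i := b))) (?P \<times> onb)" using ell2_Sigma(3)[OF e2'] by simp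
 also have "\<dots> = norm2 F ({1..n} \<rightarrow>\<^sub>E onb)"
  using norm2_reindex[OF bij_i, of F] by (simp add: case_prod_unfold)
 finally show "norm2 (at_coord i F) ({1..n} \<rightarrow>\<^sub>E onb) \<le> norm2 F ({1..n} \<rightarrow>\<^sub>E onb)" .
qed

lemma tinner_iterated:
 assumes "F \<in> hilbert_schmidt n" "G \<in> hilbert_schmidt n"
 shows "tinner n F G = (\<Sum>\<^sub>\<infinity>e\<in>({1..n} - {i}) \<rightarrow>\<^sub>E onb. \<Sum>\<^sub>\<infinity>b\<in>onb. F (e(i := b)) * cnj (G (e(i := b))))"
proof -
 have "ell2 (\<lambda>e. cnj (G e)) ({1..n} \<rightarrow>\<^sub>E onb)" using assms by (simp add: hilbert_schmidt_iff ell2_def)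
 then have "(\<lambda>e. F e * cnj (G e)) summable_on ({1..n} \<rightarrow>\<^sub>E onb)"
  using assms by (intro ell2_mult_summable) (auto simp: hilbert_schmidt_iff)
 then have "(\<lambda>(e, b). F (e(i := b)) * cnj (G (e(i := b)))) summable_on (({1..n} - {i}) \<rightarrow>\<^sub>E onb) \<times> onb"
  using summable_on_reindex_bij_betw[OF bij_i, of "\<lambda>e. F e * cnj (G e)"] by (simp add: case_prod_unfold)
 from infsum_Sigma_banach[OF this] show ?thesis
  unfolding tinner_def
  using infsum_reindex_bij_betw[OF bij_i, of "\<lambda>e. F e * cnj (G e)"] by (simp add: case_prod_unfold)
qed

lemma at_coord_adjoint:
 assumes F: "F \<in> hilbert_schmidt n" and G: "G \<in> hilbert_schmidt n"
 shows "tinner n (at_coord i F) G = tinner n F (at_coord i G)"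
proof -
 have ml: "multilin n F" "multilin n G" using F G by (auto simp: hilbert_schmidt_iff)
 have "(\<Sum>\<^sub>\<infinity>b\<in>onb. F (e(i := p b)) * cnj (G (e(i := b)))) = (\<Sum>\<^sub>\<infinity>b\<in>onb. F (e(i := b)) * cnj (G (e(i := p b))))" for e
 proof -
  obtain K K' where K: "\<And>u. cmod (F (e(i := u))) \<le> K * norm u" "\<And>u. cmod (G (e(i := u))) \<le> K' * norm u"
   using multilin_slice_bound[OF ml(1) i] multilin_slice_bound[OF ml(2) i] by blast
  show ?thesis
   by (rule functional_onb_proj(3)[OF multilin_linear[OF ml(1) i] K(1) multilin_linear[OF ml(2) i] K(2) p_adj p_contr])
 qed
 then show ?thesis
  unfolding tinner_iterated[OF at_coord_hilbert_schmidt(1)[OF F] G]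
   tinner_iterated[OF F at_coord_hilbert_schmidt(1)[OF G]]
  by (simp add: at_coord_def)
qed

end

definition on_coords :: "nat set \<Rightarrow> 'a tensor \<Rightarrow> 'a tensor" where
 "on_coords S F = (\<lambda>x. F (\<lambda>i. if i \<in> S then p (x i) else x i))"

lemma on_coords_insert: "i \<notin> S \<Longrightarrow> on_coords (insert i S) F = at_coord i (on_coords S F)"
 "i \<notin> S \<Longrightarrow> on_coords (insert i S) F = on_coords S (at_coord i F)"
 unfolding on_coords_def at_coord_def by (auto intro!: ext arg_cong[where f = F])

lemma on_coords_props:
 assumes "S \<subseteq> {1..n}" and F: "F \<in> hilbert_schmidt n" and G: "G \<in> hilbert_schmidt n"
 shows "on_coords S F \<in> hilbert_schmidt n \<and>
  norm2 (on_coords S F) ({1..n} \<rightarrow>\<^sub>E onb) \<le> norm2 F ({1..n} \<rightarrow>\<^sub>E onb) \<and>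
  tinner n (on_coords S F) G = tinner n F (on_coords S G)"
 using finite_subset[OF assms(1) finite_atLeastAtMost] assms(1) G
proof (induction S arbitrary: G)
 case empty
 then show ?case using F by (simp add: on_coords_def)
next
 case (insert i S)
 then have i: "i \<in> {1..n}" by auto
 have IH: "on_coords S F \<in> hilbert_schmidt n"
  "norm2 (on_coords S F) ({1..n} \<rightarrow>\<^sub>E onb) \<le> norm2 F ({1..n} \<rightarrow>\<^sub>E onb)"
  "\<And>G. G \<in> hilbert_schmidt n \<Longrightarrow> tinner n (on_coords S F) G = tinner n F (on_coords S G)"
  using insert by auto
 have "tinner n (at_coord i (on_coords S F)) G = tinner n (on_coords S F) (at_coord i G)"
  by (rule at_coord_adjoint[OF i IH(1) insert.prems(2)])
 also have "\<dots> = tinner n F (on_coords S (at_coord i G))"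
  by (rule IH(3)[OF at_coord_hilbert_schmidt(1)[OF i insert.prems(2)]])
 finally show ?case
  using at_coord_hilbert_schmidt[OF i IH(1)] IH(2) on_coords_insert(1)[OF insert.hyps(2), of F]
   on_coords_insert(2)[OF insert.hyps(2), of G] by simp
qed

lemma on_coords_all: "multilin n F \<Longrightarrow> on_coords {1..n} F = second F"
 unfolding on_coords_def second_def by (rule ext) (auto intro: multilin_cong)

lemma second_hilbert_schmidt: "F \<in> hilbert_schmidt n \<Longrightarrow> second F \<in> hilbert_schmidt n"
 and second_norm2: "F \<in> hilbert_schmidt n \<Longrightarrow>
  norm2 (second F) ({1..n} \<rightarrow>\<^sub>E onb) \<le> norm2 F ({1..n} \<rightarrow>\<^sub>E onb)"
 and second_adjoint: "F \<in> hilbert_schmidt n \<Longrightarrow> G \<in> hilbert_schmidt n \<Longrightarrow>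
  tinner n (second F) G = tinner n F (second G)"
 using on_coords_props[of "{1..n}" n F F] on_coords_props[of "{1..n}" n F G]
  on_coords_all[of n F] on_coords_all[of n G] by (simp_all add: hilbert_schmidt_iff)

lemma tensor_op_second:
 assumes P: "orthogonal_projection complexification V P" and p: "\<And>x. P (x, 0) = (p x, 0)"
  and F: "F \<in> hilbert_schmidt n"
 shows "tensor_op P n F = second F"
proof
 fix x
 have "cinner (P (e, 0)) (y, 0) = of_real (e \<bullet> p y)" for e y
  unfolding orthogonal_projection_cinner[OF P] p by (simp add: cinner_real complex_eq_iff p_adj)
 then have pt: "pure_tensor n (\<lambda>i. P (e i, 0)) x = (\<Prod>i=1..n. of_real (e i \<bullet> p (x i)))" for e
  by (simp add: pure_tensor_def)
 have "F e = F (override_on (\<lambda>i. p (x i)) e {1..n})" for e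
  using F by (intro multilin_cong[of n F]) (auto simp: hilbert_schmidt_iff)
 then have "tensor_op P n F x = (\<Sum>\<^sub>\<infinity>e\<in>{1..n} \<rightarrow>\<^sub>E onb. F (override_on (\<lambda>i. p (x i)) e {1..n}) *
   (\<Prod>i=1..n. of_real (e i \<bullet> p (x i))))"
  unfolding tensor_op_def pt by simp
 then show "tensor_op P n F x = second F x"
  unfolding second_def using reproducing[OF F order_refl, of "\<lambda>i. p (x i)"] by simp
qed

text \<open>The functionals in the tensor power of \<open>M\<close> are those that only see the projections of their
 arguments to \<open>M\<close>.\<close>

definition tensors :: "nat \<Rightarrow> 'a tensor set" where
 "tensors n = {F \<in> hilbert_schmidt n. second F = F}"

lemma tensor_span_sub:
 assumes "G \<in> tensor_span S (M' \<times> M'') n" "M' \<subseteq> M" "M'' \<subseteq> M"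
 shows "G \<in> tensors n"
proof -
 obtain m :: nat and c :: "nat \<Rightarrow> complex" and h :: "nat \<Rightarrow> nat \<Rightarrow> 'a \<times> 'a" where G: "G = (\<lambda>x. \<Sum>j<m. c j * pure_tensor n (h j) x)"
  and h: "\<And>j i. j < m \<Longrightarrow> i \<in> {1..n} \<Longrightarrow> h j i \<in> M' \<times> M''"
  using assms(1) unfolding tensor_span_def by blast
 have "pure_tensor n (h j) (\<lambda>i. p (x i)) = pure_tensor n (h j) x" if "j < m" for j x
  unfolding pure_tensor_def
 proof (rule prod.cong[OF refl])
  fix i assume "i \<in> {1..n}"
  then have "p (fst (h j i)) = fst (h j i)" "p (snd (h j i)) = snd (h j i)"
   using h[OF that, of i] assms(2,3) p_fix by (auto simp: mem_Times_iff)
  then show "cinner (h j i) (p (x i), 0) = cinner (h j i) (x i, 0)"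
   unfolding cinner_real by (metis p_adj)
 qed
 then have "second G = G" by (simp add: G second_def)
 moreover have "G \<in> hilbert_schmidt n"
  unfolding G by (intro hilbert_schmidt_sum hilbert_schmidt_cmult pure_tensor_hilbert_schmidt) simp
 ultimately show ?thesis by (simp add: tensors_def)
qed

lemma closed_span_approx:
 fixes F :: "'a tensor"
 assumes F: "F \<in> closed_tensor_span S V n" and S: "\<And>G. G \<in> tensor_span S V n \<Longrightarrow> G \<in> hilbert_schmidt n"
  and d: "0 < \<delta>"
 shows "\<exists>G\<in>tensor_span S V n. cmod (F x - G x) < \<delta> \<and> cmod (F y - G y) < \<delta>"
proof -
 define c where "c = 1 + (\<Prod>i=1..n. norm (x i)) + (\<Prod>i=1..n. norm (y i))"
 have c: "1 \<le> c" "(\<Prod>i=1..n. norm (x i)) \<le> c" "(\<Prod>i=1..n. norm (y i)) \<le> c"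
  unfolding c_def by (simp_all add: prod_nonneg add_nonneg_nonneg)
 have "0 < (\<delta> / c)\<^sup>2" using d c by simp
 then obtain G where G: "G \<in> tensor_span S V n" "Re (tinner n (\<lambda>x. F x - G x) (\<lambda>x. F x - G x)) < (\<delta> / c)\<^sup>2"
  using F unfolding closed_tensor_span_def by blast
 have FG: "(\<lambda>x. F x - G x) \<in> hilbert_schmidt n"
  using F S[OF G(1)] by (intro hilbert_schmidt_diff) (auto simp: closed_tensor_span_def)
 let ?N = "norm2 (\<lambda>x. F x - G x) ({1..n} \<rightarrow>\<^sub>E onb)"
 have "?N < (\<delta> / c)\<^sup>2" using G(2) tinner_norm2[of "\<lambda>x. F x - G x" n] FG by (simp add: hilbert_schmidt_iff)
 then have "sqrt ?N < \<delta> / c"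
  using d c by (intro real_less_lsqrt) (auto simp: norm2_nonneg)
 then have sc: "sqrt ?N * c < \<delta>" using c by (simp add: pos_less_divide_eq)
 have "cmod (F z - G z) < \<delta>" if "(\<Prod>i=1..n. norm (z i)) \<le> c" for z
  using hilbert_schmidt_bound[OF FG, of z] mult_left_mono[OF that, of "sqrt ?N"] sc by (simp add: norm2_nonneg)
 then show ?thesis using G(1) c by blast
qed

lemma closed_span_sub:
 assumes F: "F \<in> closed_tensor_span S (M' \<times> M'') n" and sub: "M' \<subseteq> M" "M'' \<subseteq> M"
 shows "F \<in> tensors n"
proof -
 have hs: "G \<in> hilbert_schmidt n" "second G = G" if "G \<in> tensor_span S (M' \<times> M'') n" for G
  using tensor_span_sub[OF that sub] by (auto simp: tensors_def)
 have "second F x = F x" for x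
 proof (rule ccontr)
  assume ne: "second F x \<noteq> F x"
  define \<delta> where "\<delta> = cmod (second F x - F x) / 2"
  have "0 < \<delta>" using ne by (simp add: \<delta>_def)
  from closed_span_approx[OF F hs(1) this, of x "\<lambda>i. p (x i)"]
  obtain G where G: "G \<in> tensor_span S (M' \<times> M'') n" "cmod (F x - G x) < \<delta>"
    "cmod (F (\<lambda>i. p (x i)) - G (\<lambda>i. p (x i))) < \<delta>" by blast
  have "G (\<lambda>i. p (x i)) = G x" using fun_cong[OF hs(2)[OF G(1)], of x] by (simp add: second_def)
  then have e: "second F x - F x = (F (\<lambda>i. p (x i)) - G (\<lambda>i. p (x i))) - (F x - G x)" by (simp add: second_def)
  have "cmod (second F x - F x) \<le> cmod (F (\<lambda>i. p (x i)) - G (\<lambda>i. p (x i))) + cmod (F x - G x)"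
   unfolding e by (rule norm_triangle_ineq4)
  then have "cmod (second F x - F x) < \<delta> + \<delta>" using G(2,3) by linarith
  then show False by (simp add: \<delta>_def)
 qed
 moreover have "F \<in> hilbert_schmidt n" using F by (simp add: closed_tensor_span_def)
 ultimately show ?thesis by (auto simp: tensors_def)
qed

text \<open>Truncating the basis expansion of \<open>F\<close> and projecting the basis vectors to \<open>M\<close> approximates
 \<open>F\<close>, since projecting does not increase the Hilbert--Schmidt norm of the remainder.\<close>

lemma tensors_closed_span:
 assumes F: "F \<in> tensors n" and S: "\<And>x. F x \<in> S" and z: "M'' = {0} \<or> M'' = M"
 shows "F \<in> closed_tensor_span S (M \<times> M'') n"
 unfolding closed_tensor_span_def
proof (intro CollectI conjI allI impI)
 have Fh: "F \<in> hilbert_schmidt n" and Fp: "second F = F" using F by (auto simp: tensors_def)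
 show "F \<in> hilbert_schmidt n" by fact
 have e2: "ell2 F ({1..n} \<rightarrow>\<^sub>E onb)" using Fh by (simp add: hilbert_schmidt_iff)
 fix \<epsilon> :: real assume "0 < \<epsilon>"
 then obtain X where X: "finite X" "X \<subseteq> {1..n} \<rightarrow>\<^sub>E onb"
  "dist (\<Sum>e\<in>X. (cmod (F e))\<^sup>2) (norm2 F ({1..n} \<rightarrow>\<^sub>E onb)) < \<epsilon>"
  using infsum_finite_approximation[of "\<lambda>e. (cmod (F e))\<^sup>2" "{1..n} \<rightarrow>\<^sub>E onb" "\<epsilon> / 2"] e2
  unfolding ell2_def norm2_def by fastforce
 define H where "H = (\<lambda>x. \<Sum>e\<in>X. F e * pure_tensor n (\<lambda>i. (e i, 0)) x)"
 have Hh: "H \<in> hilbert_schmidt n"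
  unfolding H_def by (intro hilbert_schmidt_sum hilbert_schmidt_cmult pure_tensor_hilbert_schmidt X)
 have FH: "(\<lambda>x. F x - H x) \<in> hilbert_schmidt n" by (rule hilbert_schmidt_diff[OF Fh Hh])
 have orth: "pure_tensor n (\<lambda>i. (e i, 0)) e' = (if e' = e then 1 else 0)"
  if "e \<in> {1..n} \<rightarrow>\<^sub>E onb" "e' \<in> {1..n} \<rightarrow>\<^sub>E (onb :: 'a set)" for e e'
 proof (cases "e' = e")
  case True
  have "cinner (e i, 0) (e i, 0) = 1" if "i \<in> {1..n}" for i
  proof -
   have "norm (e i) = 1" using is_onb_onb PiE_mem[OF \<open>e \<in> _\<close> that] by (auto simp: is_onb_def)
   then show ?thesis by (simp add: cinner_real complex_eq_iff norm_eq_1)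
  qed
  then show ?thesis using True by (simp add: pure_tensor_def)
 next
  case False
  then obtain i where i: "e i \<noteq> e' i" by (metis ext)
  then have "i \<in> {1..n}" using PiE_arb[OF that(1), of i] PiE_arb[OF that(2), of i] by metis
  with i have i: "i \<in> {1..n}" "e i \<noteq> e' i" by blast+
  have "e i \<in> onb" "e' i \<in> onb" using that i by auto
  then have "e i \<bullet> e' i = 0"
   using is_onb_onb[where 'a = 'a] i(2) by (auto simp: is_onb_def pairwise_def orthogonal_def)
  then have "cinner (e i, 0) (e' i, 0) = 0" by (simp add: cinner_real complex_eq_iff)
  then show ?thesis using False i(1) by (auto simp: pure_tensor_def)
 qed
 have H: "H e' = (if e' \<in> X then F e' else 0)" if "e' \<in> {1..n} \<rightarrow>\<^sub>E onb" for e'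
 proof -
  have "H e' = (\<Sum>e\<in>X. if e' = e then F e else 0)"
   unfolding H_def by (rule sum.cong[OF refl]) (use X(2) orth that in auto)
  then show ?thesis using X(1) by simp
 qed
 have "norm2 (\<lambda>x. F x - H x) ({1..n} \<rightarrow>\<^sub>E onb) = norm2 F (({1..n} \<rightarrow>\<^sub>E onb) - X)"
  unfolding norm2_def by (rule infsum_cong_neutral) (auto simp: H)
 moreover have "norm2 F ({1..n} \<rightarrow>\<^sub>E onb) = norm2 F (({1..n} \<rightarrow>\<^sub>E onb) - X) + (\<Sum>e\<in>X. (cmod (F e))\<^sup>2)"
 proof -
  have "norm2 F (({1..n} \<rightarrow>\<^sub>E onb) - X \<union> X) = norm2 F (({1..n} \<rightarrow>\<^sub>E onb) - X) + norm2 F X"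
   unfolding norm2_def
   by (rule infsum_Un_disjoint) (use X(1) ell2_subset[OF e2] in \<open>auto simp: ell2_def\<close>)
  then show ?thesis using X(1,2) by (simp add: Un_absorb2 norm2_def)
 qed
 ultimately have small: "norm2 (\<lambda>x. F x - H x) ({1..n} \<rightarrow>\<^sub>E onb) < \<epsilon>"
  using X(3) norm2_nonneg[of F "({1..n} \<rightarrow>\<^sub>E onb) - X"] by (simp add: dist_real_def)
 have "second H \<in> tensor_span S (M \<times> M'') n"
 proof -
  obtain f where f: "bij_betw f {..<card X} X" using ex_bij_betw_nat_finite[OF X(1)] by (auto simp: atLeast0LessThan)
  have move: "pure_tensor n (\<lambda>i. (e i, 0)) (\<lambda>i. p (x i)) = pure_tensor n (\<lambda>i. (p (e i), 0)) x" for e x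
   by (simp add: pure_tensor_def cinner_real p_adj)
  have "second H = (\<lambda>x. \<Sum>j<card X. F (f j) * pure_tensor n (\<lambda>i. (p (f j i), 0)) x)"
   unfolding H_def second_def move
   by (rule ext) (rule sum.reindex_bij_betw[OF f, symmetric, where g = "\<lambda>e. F e * pure_tensor n (\<lambda>i. (p (e i), 0)) _"])
  moreover have "0 \<in> M''" using z p_M[of 0] linear_0[OF p_lin] by auto
  ultimately show ?thesis
   unfolding tensor_span_def
   by (intro CollectI exI[of _ "card X"] exI[of _ "\<lambda>j. F (f j)"] exI[of _ "\<lambda>j i. (p (f j i), 0)"])
    (auto simp: S p_M)
 qed
 moreover have "Re (tinner n (\<lambda>x. F x - second H x) (\<lambda>x. F x - second H x)) < \<epsilon>"
 proof -
  have e: "(\<lambda>x. F x - second H x) = second (\<lambda>x. F x - H x)"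
   using fun_cong[OF Fp] by (simp add: second_def)
  have "second (\<lambda>x. F x - H x) \<in> hilbert_schmidt n" by (rule second_hilbert_schmidt[OF FH])
  then have "Re (tinner n (\<lambda>x. F x - second H x) (\<lambda>x. F x - second H x)) =
    norm2 (second (\<lambda>x. F x - H x)) ({1..n} \<rightarrow>\<^sub>E onb)"
   unfolding e by (simp add: tinner_norm2 hilbert_schmidt_iff)
  then show ?thesis using second_norm2[OF FH] small by linarith
 qed
 ultimately show "\<exists>G\<in>tensor_span S (M \<times> M'') n. Re (tinner n (\<lambda>x. F x - G x) (\<lambda>x. F x - G x)) < \<epsilon>"
  by blast
qed

lemma tensor_power_eq: "tensor_power (M \<times> M) n = tensors n"
 using closed_span_sub[of _ UNIV M M n] tensors_closed_span[of _ n UNIV M] by auto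

lemma zero_M: "0 \<in> M"
 using p_M[of 0] linear_0[OF p_lin] by simp

lemma real_tensor_power_eq: "real_tensor_power M n = {F \<in> tensors n. \<forall>x. F x \<in> \<real>}"
proof (intro equalityI subsetI)
 fix F assume F: "F \<in> real_tensor_power M n"
 have Ft: "F \<in> tensors n" by (rule closed_span_sub[OF F]) (use zero_M in auto)
 have re: "G x \<in> \<real>" if Gs: "G \<in> tensor_span \<real> (M \<times> {0}) n" for G x
 proof -
  obtain m :: nat and c :: "nat \<Rightarrow> complex" and h :: "nat \<Rightarrow> nat \<Rightarrow> 'a \<times> 'a" where G: "G = (\<lambda>x. \<Sum>j<m. c j * pure_tensor n (h j) x)"
   and h: "\<And>j i. j < m \<Longrightarrow> c j \<in> \<real> \<and> (\<forall>i\<in>{1..n}. h j i \<in> M \<times> {0})"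
   using Gs unfolding tensor_span_def by blast
  have "cinner (h j i) (x i, 0) \<in> \<real>" if "j < m" "i \<in> {1..n}" for i j
   using h[OF that(1)] that(2) by (auto simp: cinner_real complex_is_Real_iff mem_Times_iff)
  then show ?thesis unfolding G pure_tensor_def
   by (intro sum_in_Reals Reals_mult prod_in_Reals) (use h in auto)
 qed
 have "F x \<in> \<real>" for x
 proof (rule ccontr)
  assume "F x \<notin> \<real>"
  then have "0 < \<bar>Im (F x)\<bar>" by (simp add: complex_is_Real_iff)
  moreover have "\<And>G. G \<in> tensor_span \<real> (M \<times> {0}) n \<Longrightarrow> G \<in> hilbert_schmidt n"
   using tensor_span_sub[of _ \<real> M "{0}" n] zero_M by (auto simp: tensors_def)
  ultimately obtain G where "G \<in> tensor_span \<real> (M \<times> {0}) n" "cmod (F x - G x) < \<bar>Im (F x)\<bar>"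
   using closed_span_approx[OF F, of "\<bar>Im (F x)\<bar>" x x] by blast
  then show False using re[of G x] abs_Im_le_cmod[of "F x - G x"] by (simp add: complex_is_Real_iff)
 qed
 with Ft show "F \<in> {F \<in> tensors n. \<forall>x. F x \<in> \<real>}" by blast
next
 fix F assume "F \<in> {F \<in> tensors n. \<forall>x. F x \<in> \<real>}"
 then show "F \<in> real_tensor_power M n" using tensors_closed_span[of F n \<real> "{0}"] by blast
qed

end

section \<open>Contractions of Hilbert--Schmidt functionals\<close>

lemma bij_PiE_reindex:
 assumes "bij_betw g A L"
 shows "bij_betw (\<lambda>b. \<lambda>i\<in>A. b (g i)) (L \<rightarrow>\<^sub>E B) (A \<rightarrow>\<^sub>E B)"
proof (rule bij_betwI[of _ _ _ "\<lambda>e. \<lambda>l\<in>L. e (the_inv_into A g l)"])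
 have g: "inj_on g A" "g ` A = L" using assms by (auto simp: bij_betw_def)
 have inv: "the_inv_into A g l \<in> A" if "l \<in> L" for l using the_inv_into_into[OF g(1)] that g(2) by blast
 show "(\<lambda>b. \<lambda>i\<in>A. b (g i)) \<in> (L \<rightarrow>\<^sub>E B) \<rightarrow> A \<rightarrow>\<^sub>E B" using g(2) by auto
 show "(\<lambda>e. \<lambda>l\<in>L. e (the_inv_into A g l)) \<in> (A \<rightarrow>\<^sub>E B) \<rightarrow> L \<rightarrow>\<^sub>E B" using inv by auto
 show "(\<lambda>l\<in>L. (\<lambda>i\<in>A. b (g i)) (the_inv_into A g l)) = b" if "b \<in> L \<rightarrow>\<^sub>E B" for b
 proof
  fix l
  show "(\<lambda>l\<in>L. (\<lambda>i\<in>A. b (g i)) (the_inv_into A g l)) l = b l"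
   using inv[of l] f_the_inv_into_f[OF g(1), of l] g(2) PiE_arb[OF that, of l] by (cases "l \<in> L") simp_all
 qed
 show "(\<lambda>i\<in>A. (\<lambda>l\<in>L. e (the_inv_into A g l)) (g i)) = e" if "e \<in> A \<rightarrow>\<^sub>E B" for e
 proof
  fix i
  have "i \<in> A \<Longrightarrow> g i \<in> L" using g(2) by blast
  then show "(\<lambda>i\<in>A. (\<lambda>l\<in>L. e (the_inv_into A g l)) (g i)) i = e i"
   using the_inv_into_f_f[OF g(1), of i] PiE_arb[OF that, of i] by (cases "i \<in> A") simp_all
 qed
qed

lemma bij_PiE_Un:
 assumes "A \<inter> A' = {}"
 shows "bij_betw (\<lambda>(e, e'). \<lambda>i\<in>A \<union> A'. if i \<in> A then e i else e' i)
  ((A \<rightarrow>\<^sub>E B) \<times> (A' \<rightarrow>\<^sub>E B)) (A \<union> A' \<rightarrow>\<^sub>E B)"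
proof (rule bij_betwI[of _ _ _ "\<lambda>e. (restrict e A, restrict e A')"])
 show "(case (restrict e A, restrict e A') of (e, e') \<Rightarrow> \<lambda>i\<in>A \<union> A'. if i \<in> A then e i else e' i) = e"
  if "e \<in> A \<union> A' \<rightarrow>\<^sub>E B" for e
  using PiE_arb[OF that] by (auto simp: fun_eq_iff)
 show "(restrict (case p of (e, e') \<Rightarrow> \<lambda>i\<in>A \<union> A'. if i \<in> A then e i else e' i) A,
   restrict (case p of (e, e') \<Rightarrow> \<lambda>i\<in>A \<union> A'. if i \<in> A then e i else e' i) A') = p"
  if pin: "p \<in> (A \<rightarrow>\<^sub>E B) \<times> (A' \<rightarrow>\<^sub>E B)" for p
 proof -
  obtain e e' where p: "p = (e, e')" "e \<in> A \<rightarrow>\<^sub>E B" "e' \<in> A' \<rightarrow>\<^sub>E B" using pin by auto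
  show ?thesis unfolding p(1) using PiE_arb[OF p(2)] PiE_arb[OF p(3)] assms by (auto simp: fun_eq_iff)
 qed
qed auto

text \<open>Some of the arguments of \<open>F\<close> (the positions in \<open>A\<close>, labelled by \<open>L\<close>) will be summed over, the
 others (labelled by \<open>J\<close>) remain.\<close>

definition mix :: "nat set \<Rightarrow> (nat \<Rightarrow> nat) \<Rightarrow> (nat \<Rightarrow> nat) \<Rightarrow> (nat \<Rightarrow> 'b) \<Rightarrow> (nat \<Rightarrow> 'b) \<Rightarrow> nat \<Rightarrow> 'b" where
 "mix A g h x b = (\<lambda>i. if i \<in> A then b (g i) else x (h i))"

locale slicing =
 fixes F :: "'a::{real_inner, complete_space} tensor" and n :: nat and A L J :: "nat set" and g h :: "nat \<Rightarrow> nat"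
 assumes F: "F \<in> hilbert_schmidt n" and A: "A \<subseteq> {1..n}"
  and g: "bij_betw g A L" and h: "bij_betw h ({1..n} - A) J"
begin

lemma ml: "multilin n F"
 using F by (simp add: hilbert_schmidt_iff)

lemma finJ: "finite J"
 using bij_betw_finite[OF h] by simp

lemma h_in: "i \<in> {1..n} \<Longrightarrow> i \<notin> A \<Longrightarrow> h i \<in> J"
 using bij_betwE[OF h] by blast

lemma slice_ell2: "ell2 (\<lambda>b. F (mix A g h x b)) (L \<rightarrow>\<^sub>E onb)"
 and slice_norm2: "norm2 (\<lambda>b. F (mix A g h x b)) (L \<rightarrow>\<^sub>E onb) \<le>
  (\<Prod>j\<in>J. (norm (x j))\<^sup>2) * norm2 F ({1..n} \<rightarrow>\<^sub>E onb)"
proof -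
 have e: "F (mix A g h x b) = (\<lambda>e. F (override_on (x \<circ> h) e A)) (\<lambda>i\<in>A. b (g i))" for b
  by (auto intro!: arg_cong[where f = F] simp: mix_def override_on_def fun_eq_iff)
 show "ell2 (\<lambda>b. F (mix A g h x b)) (L \<rightarrow>\<^sub>E onb)"
  unfolding e using partial_eval(1)[OF F A, of "x \<circ> h"]
   ell2_reindex[OF bij_PiE_reindex[OF g], of "\<lambda>e. F (override_on (x \<circ> h) e A)"] by blast
 have "(\<Prod>i\<in>{1..n} - A. (norm ((x \<circ> h) i))\<^sup>2) = (\<Prod>j\<in>J. (norm (x j))\<^sup>2)"
  using prod.reindex_bij_betw[OF h, of "\<lambda>j. (norm (x j))\<^sup>2"] by simp
 then show "norm2 (\<lambda>b. F (mix A g h x b)) (L \<rightarrow>\<^sub>E onb) \<le>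
   (\<Prod>j\<in>J. (norm (x j))\<^sup>2) * norm2 F ({1..n} \<rightarrow>\<^sub>E onb)"
  unfolding e using partial_eval(2)[OF F A, of "x \<circ> h"]
   norm2_reindex[OF bij_PiE_reindex[OF g], of "\<lambda>e. F (override_on (x \<circ> h) e A)" onb] by (simp only:)
qed

lemma slice_summable: "(\<lambda>x. norm2 (\<lambda>b. F (mix A g h x b)) (L \<rightarrow>\<^sub>E onb)) summable_on (J \<rightarrow>\<^sub>E onb)"
proof -
 let ?C = "{1..n} - A"
 have un: "A \<union> ?C = {1..n}" using A by auto
 have b1: "bij_betw (\<lambda>(b, x). (\<lambda>i\<in>A. b (g i), \<lambda>i\<in>?C. x (h i)))
   ((L \<rightarrow>\<^sub>E onb) \<times> (J \<rightarrow>\<^sub>E (onb :: 'a set))) ((A \<rightarrow>\<^sub>E onb) \<times> (?C \<rightarrow>\<^sub>E onb))"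
  using bij_betw_map_prod[OF bij_PiE_reindex[OF g] bij_PiE_reindex[OF h]] by (simp add: map_prod_def)
 have b: "bij_betw ((\<lambda>(e, e'). \<lambda>i\<in>A \<union> ?C. if i \<in> A then e i else e' i) \<circ>
   (\<lambda>(b, x). (\<lambda>i\<in>A. b (g i), \<lambda>i\<in>?C. x (h i))))
   ((L \<rightarrow>\<^sub>E onb) \<times> (J \<rightarrow>\<^sub>E (onb :: 'a set))) (A \<union> ?C \<rightarrow>\<^sub>E onb)"
  by (rule bij_betw_trans[OF b1 bij_PiE_Un]) auto
 have e: "F (((\<lambda>(e, e'). \<lambda>i\<in>A \<union> ?C. if i \<in> A then e i else e' i) \<circ>
   (\<lambda>(b, x). (\<lambda>i\<in>A. b (g i), \<lambda>i\<in>?C. x (h i)))) q) = (case q of (b, x) \<Rightarrow> F (mix A g h x b))" for q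
  by (cases q) (auto intro!: multilin_cong[OF ml] simp: mix_def)
 have "ell2 F (A \<union> ?C \<rightarrow>\<^sub>E onb)" using F un by (simp add: hilbert_schmidt_iff)
 then have "ell2 (\<lambda>(b, x). F (mix A g h x b)) ((L \<rightarrow>\<^sub>E onb) \<times> (J \<rightarrow>\<^sub>E onb))"
  unfolding ell2_reindex[OF b, symmetric] e .
 from ell2_Sigma(2)[OF ell2_swap[OF this]] show ?thesis by simp
qed

lemma mix_cong: "(\<And>j. j \<in> J \<Longrightarrow> x j = x' j) \<Longrightarrow> F (mix A g h x b) = F (mix A g h x' b)"
proof (rule multilin_cong[OF ml])
 fix i assume "\<And>j. j \<in> J \<Longrightarrow> x j = x' j" "i \<in> {1..n}"
 then show "mix A g h x b i = mix A g h x' b i" using h_in[of i] by (simp add: mix_def)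
qed

lemma mix_linear:
 assumes "j \<in> J"
 shows "linear (\<lambda>u. F (mix A g h (x(j := u)) b))"
proof -
 obtain i where i: "i \<in> {1..n} - A" "h i = j" using assms bij_betw_imp_surj_on[OF h] by blast
 have "F (mix A g h (x(j := u)) b) = F ((mix A g h x b)(i := u))" for u
 proof (rule multilin_cong[OF ml])
  fix i' assume i': "i' \<in> {1..n}"
  show "mix A g h (x(j := u)) b i' = ((mix A g h x b)(i := u)) i'"
  proof (cases "i' = i \<or> i' \<in> A")
   case True
   then show ?thesis using i by (auto simp: mix_def)
  next
   case False
   then have "h i' \<noteq> h i" using i i' inj_onD[OF bij_betw_imp_inj_on[OF h], of i' i] by blast
   then show ?thesis using False i by (simp add: mix_def)
  qed
 qed
 then show ?thesis using multilin_linear[OF ml, of i "mix A g h x b"] i by simp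
qed

end

lemma linear_infsum:
 fixes f g :: "'c::real_vector \<Rightarrow> 'b \<Rightarrow> complex"
 assumes "\<And>u. (\<lambda>b. f u b) summable_on B" and "\<And>b. linear (\<lambda>u. f u b)"
 shows "linear (\<lambda>u. \<Sum>\<^sub>\<infinity>b\<in>B. f u b)"
proof (rule linearI)
 fix u v
 have "(\<Sum>\<^sub>\<infinity>b\<in>B. f (u + v) b) = (\<Sum>\<^sub>\<infinity>b\<in>B. f u b + f v b)"
  by (simp only: linear_add[OF assms(2)])
 also have "\<dots> = (\<Sum>\<^sub>\<infinity>b\<in>B. f u b) + (\<Sum>\<^sub>\<infinity>b\<in>B. f v b)" by (rule infsum_add[OF assms(1) assms(1)])
 finally show "(\<Sum>\<^sub>\<infinity>b\<in>B. f (u + v) b) = (\<Sum>\<^sub>\<infinity>b\<in>B. f u b) + (\<Sum>\<^sub>\<infinity>b\<in>B. f v b)" .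
next
 fix r u
 have "(\<Sum>\<^sub>\<infinity>b\<in>B. f (r *\<^sub>R u) b) = (\<Sum>\<^sub>\<infinity>b\<in>B. of_real r * f u b)"
  by (simp only: linear_cmul[OF assms(2)] scaleR_conv_of_real)
 also have "\<dots> = of_real r * (\<Sum>\<^sub>\<infinity>b\<in>B. f u b)" by (rule infsum_cmult_right')
 finally show "(\<Sum>\<^sub>\<infinity>b\<in>B. f (r *\<^sub>R u) b) = r *\<^sub>R (\<Sum>\<^sub>\<infinity>b\<in>B. f u b)"
  by (simp only: scaleR_conv_of_real)
qed

lemma linear_times_const:
 fixes f :: "'c::real_vector \<Rightarrow> complex"
 assumes f: "linear f"
 shows "linear (\<lambda>u. f u * c)"
proof (rule linearI)
 show "f (u + v) * c = f u * c + f v * c" for u v unfolding linear_add[OF f] by (rule distrib_right)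
 show "f (r *\<^sub>R u) * c = r *\<^sub>R (f u * c)" for r u unfolding linear_cmul[OF f] by (rule mult_scaleR_left)
qed

lemma slice_product_hilbert_schmidt:
 fixes F G :: "'a::{real_inner, complete_space} tensor"
 assumes "slicing F n A L J g h" and "slicing G k A' L J' g' h'"
  and J: "J \<inter> J' = {}" "J \<union> J' = {1..m}"
 shows "(\<lambda>x. \<Sum>\<^sub>\<infinity>b\<in>L \<rightarrow>\<^sub>E onb. F (mix A g h x b) * G (mix A' g' h' x b)) \<in> hilbert_schmidt m"
  and "\<And>x. (\<lambda>b. F (mix A g h x b) * G (mix A' g' h' x b)) summable_on (L \<rightarrow>\<^sub>E onb)"
proof -
 interpret F: slicing F n A L J g h by fact
 interpret G: slicing G k A' L J' g' h' by fact
 let ?Z = "\<lambda>x. \<Sum>\<^sub>\<infinity>b\<in>L \<rightarrow>\<^sub>E onb. F (mix A g h x b) * G (mix A' g' h' x b)"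
 show sm: "(\<lambda>b. F (mix A g h x b) * G (mix A' g' h' x b)) summable_on (L \<rightarrow>\<^sub>E onb)" for x
  by (rule ell2_mult_summable[OF F.slice_ell2 G.slice_ell2])
 have cs: "cmod (?Z x) \<le> sqrt (norm2 (\<lambda>b. F (mix A g h x b)) (L \<rightarrow>\<^sub>E onb)) *
   sqrt (norm2 (\<lambda>b. G (mix A' g' h' x b)) (L \<rightarrow>\<^sub>E onb))" for x
  by (rule ell2_Cauchy_Schwarz[OF F.slice_ell2 G.slice_ell2])
 have "multilin m ?Z"
  unfolding multilin_def
 proof (intro conjI ballI allI impI)
  fix x y :: "nat \<Rightarrow> 'a" assume xy: "\<forall>i\<in>{1..m}. x i = y i"
  have "F (mix A g h x b) = F (mix A g h y b)" "G (mix A' g' h' x b) = G (mix A' g' h' y b)" for b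
   by (rule F.mix_cong, use xy J(2) in blast) (rule G.mix_cong, use xy J(2) in blast)
  then show "?Z x = ?Z y" by (simp only:)
 next
  fix j and x :: "nat \<Rightarrow> 'a" assume j: "j \<in> {1..m}"
  show "linear (\<lambda>u. ?Z (x(j := u)))"
  proof (rule linear_infsum[where f = "\<lambda>u b. F (mix A g h (x(j := u)) b) * G (mix A' g' h' (x(j := u)) b)"])
   fix u
   show "(\<lambda>b. F (mix A g h (x(j := u)) b) * G (mix A' g' h' (x(j := u)) b)) summable_on (L \<rightarrow>\<^sub>E onb)"
    by (rule sm)
  next
   fix b
   show "linear (\<lambda>u. F (mix A g h (x(j := u)) b) * G (mix A' g' h' (x(j := u)) b))"
   proof (cases "j \<in> J")
    case True
    have "G (mix A' g' h' (x(j := u)) b) = G (mix A' g' h' x b)" for u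
    proof (rule G.mix_cong)
     fix i assume "i \<in> J'"
     then have "i \<noteq> j" using True J(1) by blast
     then show "(x(j := u)) i = x i" by (rule fun_upd_other)
    qed
    then have "(\<lambda>u. F (mix A g h (x(j := u)) b) * G (mix A' g' h' (x(j := u)) b)) =
      (\<lambda>u. F (mix A g h (x(j := u)) b) * G (mix A' g' h' x b))" by presburger
    moreover have "linear (\<lambda>u. F (mix A g h (x(j := u)) b) * G (mix A' g' h' x b))"
     by (rule linear_times_const) (rule F.mix_linear[OF True])
    ultimately show ?thesis by presburger
   next
    case False
    have "j \<in> J'" using False j J(2) by blast
    have eq: "F (mix A g h (x(j := u)) b) = F (mix A g h x b)" for u
    proof (rule F.mix_cong)
     fix i assume "i \<in> J"
     then have "i \<noteq> j" using False by blast
     then show "(x(j := u)) i = x i" by (rule fun_upd_other)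
    qed
    have "F (mix A g h (x(j := u)) b) * G (mix A' g' h' (x(j := u)) b) =
      G (mix A' g' h' (x(j := u)) b) * F (mix A g h x b)" for u
     unfolding eq by (rule mult.commute)
    then have "(\<lambda>u. F (mix A g h (x(j := u)) b) * G (mix A' g' h' (x(j := u)) b)) =
      (\<lambda>u. G (mix A' g' h' (x(j := u)) b) * F (mix A g h x b))" by presburger
    moreover have "linear (\<lambda>u. G (mix A' g' h' (x(j := u)) b) * F (mix A g h x b))"
     by (rule linear_times_const) (rule G.mix_linear[OF \<open>j \<in> J'\<close>])
    ultimately show ?thesis by presburger
   qed
  qed
 next
  let ?K = "sqrt (norm2 F ({1..n} \<rightarrow>\<^sub>E onb)) * sqrt (norm2 G ({1..k} \<rightarrow>\<^sub>E onb))"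
  have "cmod (?Z x) \<le> ?K * (\<Prod>i=1..m. norm (x i))" for x
  proof -
   have sq: "sqrt (\<Prod>j\<in>I. (norm (x j))\<^sup>2) = (\<Prod>j\<in>I. norm (x j))" for I
    by (rule real_sqrt_unique) (simp_all add: prod_power_distrib prod_nonneg)
   have "sqrt (norm2 (\<lambda>b. F (mix A g h x b)) (L \<rightarrow>\<^sub>E onb)) \<le> (\<Prod>j\<in>J. norm (x j)) * sqrt (norm2 F ({1..n} \<rightarrow>\<^sub>E onb))"
    using real_sqrt_le_mono[OF F.slice_norm2[of x]] unfolding real_sqrt_mult sq .
   moreover have "sqrt (norm2 (\<lambda>b. G (mix A' g' h' x b)) (L \<rightarrow>\<^sub>E onb)) \<le>
     (\<Prod>j\<in>J'. norm (x j)) * sqrt (norm2 G ({1..k} \<rightarrow>\<^sub>E onb))"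
    using real_sqrt_le_mono[OF G.slice_norm2[of x]] unfolding real_sqrt_mult sq .
   ultimately have "cmod (?Z x) \<le> ((\<Prod>j\<in>J. norm (x j)) * sqrt (norm2 F ({1..n} \<rightarrow>\<^sub>E onb))) *
     ((\<Prod>j\<in>J'. norm (x j)) * sqrt (norm2 G ({1..k} \<rightarrow>\<^sub>E onb)))"
    by (intro order_trans[OF cs] mult_mono) (auto simp: norm2_nonneg prod_nonneg)
   also have "\<dots> = ?K * (\<Prod>j\<in>J \<union> J'. norm (x j))"
    by (subst prod.union_disjoint[OF F.finJ G.finJ J(1)]) (simp add: mult_ac)
   finally show ?thesis using J(2) by simp
  qed
  then show "\<exists>K. \<forall>x. cmod (?Z x) \<le> K * (\<Prod>i=1..m. norm (x i))" by blast
 qed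
 moreover have "ell2 ?Z ({1..m} \<rightarrow>\<^sub>E onb)"
 proof -
  let ?f = "\<lambda>x. norm2 (\<lambda>b. F (mix A g h x b)) (L \<rightarrow>\<^sub>E onb)" and ?g = "\<lambda>x. norm2 (\<lambda>b. G (mix A' g' h' x b)) (L \<rightarrow>\<^sub>E onb)"
  have "(\<lambda>(x, y). ?f x * ?g y) summable_on (J \<rightarrow>\<^sub>E onb) \<times> (J' \<rightarrow>\<^sub>E onb)"
   by (rule summable_on_times(1)) (use F.slice_summable G.slice_summable in \<open>auto simp: norm2_nonneg\<close>)
  moreover have "(case q of (x, y) \<Rightarrow> ?f x * ?g y) =
    (\<lambda>z. ?f z * ?g z) (case q of (e, e') \<Rightarrow> \<lambda>i\<in>J \<union> J'. if i \<in> J then e i else e' i)" for q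
  proof -
   obtain x y where q: "q = (x, y)" by (cases q)
   let ?z = "\<lambda>i\<in>J \<union> J'. if i \<in> J then x i else y i"
   have "F (mix A g h x b) = F (mix A g h ?z b)" "G (mix A' g' h' y b) = G (mix A' g' h' ?z b)" for b
    using J(1) by (auto intro!: F.mix_cong G.mix_cong)
   then show ?thesis by (simp add: q)
  qed
  ultimately have "(\<lambda>q. (\<lambda>z. ?f z * ?g z) (case q of (e, e') \<Rightarrow> \<lambda>i\<in>J \<union> J'. if i \<in> J then e i else e' i))
    summable_on (J \<rightarrow>\<^sub>E onb) \<times> (J' \<rightarrow>\<^sub>E onb)"
   by (rule summable_on_cong[THEN iffD1, rotated])
  then have "(\<lambda>z. ?f z * ?g z) summable_on (J \<union> J' \<rightarrow>\<^sub>E onb)"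
   by (rule summable_on_reindex_bij_betw[OF bij_PiE_Un[OF J(1)], THEN iffD1])
  then show ?thesis
   unfolding ell2_def J(2)
  proof (rule summable_on_comparison_test)
   fix x
   have "(cmod (?Z x))\<^sup>2 \<le> (sqrt (?f x) * sqrt (?g x))\<^sup>2" by (intro power_mono cs) simp
   then show "(cmod (?Z x))\<^sup>2 \<le> ?f x * ?g x" by (simp add: power_mult_distrib norm2_nonneg)
  qed simp
 qed
 ultimately show "?Z \<in> hilbert_schmidt m" by (simp add: hilbert_schmidt_iff)
qed

subsection \<open>Relabelling the points outside a set of pairs\<close>

lemma down_closed_eq:
 fixes J :: "nat set"
 assumes "finite J" "\<And>i j. j \<in> J \<Longrightarrow> i < j \<Longrightarrow> i \<in> J"
 shows "J = {..<card J}"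
proof -
 define m where "m = (LEAST m. m \<notin> J)"
 have "\<exists>m. m \<notin> J" using assms(1) ex_new_if_finite[OF infinite_UNIV_nat] by blast
 then have m: "m \<notin> J" unfolding m_def by (rule LeastI_ex)
 have "J = {..<m}"
 proof (intro equalityI subsetI)
  fix j assume "j \<in> J"
  then show "j \<in> {..<m}" using m assms(2)[of j m] by (metis lessThan_iff linorder_neqE_nat)
 next
  fix j assume "j \<in> {..<m}"
  then show "j \<in> J" using not_less_Least[of j "\<lambda>m. m \<notin> J"] by (auto simp: m_def)
 qed
 then show ?thesis by simp
qed

locale pair_partition =
 fixes \<pi> :: "nat \<Rightarrow> nat" and n k :: nat
 assumes P: "\<pi> \<in> P12 n k"
begin

abbreviation "u \<equiv> unlabel \<pi>"
abbreviation "r \<equiv> npairs \<pi>"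
definition "lefts = left_ends \<pi>"
definition "rights = \<pi> ` left_ends \<pi>"

lemma perm: "\<pi> permutes {1..n + k}" and invol: "\<pi> \<circ> \<pi> = id"
 using P by (auto simp: P12_def)

lemma inv2 [simp]: "\<pi> (\<pi> i) = i"
 using invol by (metis comp_apply id_apply)

lemma lefts_iff: "i \<in> lefts \<longleftrightarrow> i < \<pi> i"
 by (simp add: lefts_def left_ends_def)

lemma rights_iff: "i \<in> rights \<longleftrightarrow> \<pi> i < i"
proof
 assume "\<pi> i < i"
 then have "\<pi> i \<in> left_ends \<pi>" by (simp add: left_ends_def)
 then show "i \<in> rights" unfolding rights_def by (metis imageI inv2)
qed (auto simp: rights_def left_ends_def)

lemma lefts_sub: "lefts \<subseteq> {1..n}"
proof
 fix i assume "i \<in> lefts"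
 then have i: "i < \<pi> i" by (simp add: lefts_iff)
 then have "i \<in> {1..n + k}" using permutes_not_in[OF perm] by force
 moreover have "i \<le> n" using P i by (simp add: P12_def)
 ultimately show "i \<in> {1..n}" by simp
qed

lemma rights_sub: "rights \<subseteq> {n + 1..n + k}"
proof
 fix i assume "i \<in> rights"
 then have i: "\<pi> i < \<pi> (\<pi> i)" by (simp add: rights_iff)
 then have "n < \<pi> (\<pi> i)" using P unfolding P12_def by blast
 moreover have "i \<in> {1..n + k}" using i permutes_not_in[OF perm] by force
 ultimately show "i \<in> {n + 1..n + k}" by simp
qed

lemma supp_eq: "supp \<pi> = lefts \<union> rights"
 by (auto simp: supp_def lefts_iff rights_iff)

lemma supp_sub: "supp \<pi> \<subseteq> {1..n + k}"
 using lefts_sub rights_sub by (auto simp: supp_eq)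

lemma fin_lefts: "finite lefts" and fin_rights: "finite rights" and fin_supp: "finite (supp \<pi>)"
 using finite_subset[OF lefts_sub] finite_subset[OF rights_sub] by (auto simp: supp_eq)

lemma card_lefts: "card lefts = r"
 by (simp add: lefts_def npairs_def)

lemma card_rights: "card rights = r"
proof -
 have "inj_on \<pi> (left_ends \<pi>)" by (rule inj_onI) (metis inv2)
 then show ?thesis unfolding rights_def npairs_def by (rule card_image)
qed

lemma r_le: "r \<le> n" "r \<le> k"
 using card_mono[OF _ lefts_sub] card_mono[OF _ rights_sub] by (simp_all add: card_lefts card_rights)

lemma inf_supp: "infinite (- supp \<pi>)"
 using fin_supp finite_compl by auto

lemma u_less: "u i < u j \<longleftrightarrow> i < j"
 by (simp add: unlabel_def inf_supp)

lemma u_bij: "bij_betw u UNIV (- supp \<pi>)"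
 unfolding unlabel_def by (rule bij_enumerate[OF inf_supp])

lemma u_inj: "inj u" and u_range: "range u = - supp \<pi>"
 using u_bij by (auto simp: bij_betw_def)

lemma u_inv [simp]: "inv u (u i) = i"
 by (rule inv_f_f[OF u_inj])

lemma inv_u: "i \<notin> supp \<pi> \<Longrightarrow> u (inv u i) = i"
 using u_range by (metis ComplI f_inv_into_f)

lemma u_image_card:
 assumes "N = card {i. i \<le> c \<and> i \<notin> supp \<pi>}"
 shows "u ` {..<N} = {i. i \<le> c \<and> i \<notin> supp \<pi>}"
proof -
 define J where "J = {j. u j \<le> c}"
 have J: "u ` J = {i. i \<le> c \<and> i \<notin> supp \<pi>}"
 proof (intro equalityI subsetI)
  fix i assume "i \<in> {i. i \<le> c \<and> i \<notin> supp \<pi>}"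
  then have "u (inv u i) = i" "i \<le> c" using inv_u by auto
  then show "i \<in> u ` J" by (metis J_def imageI mem_Collect_eq)
 qed (use u_range in \<open>auto simp: J_def\<close>)
 have "finite (u ` J)" unfolding J by (rule finite_subset[of _ "{..c}"]) auto
 then have "finite J" using finite_imageD[OF _ inj_on_subset[OF u_inj]] by blast
 moreover have "i \<in> J" if "j \<in> J" "i < j" for i j
  using that u_less[of i j] by (auto simp: J_def)
 ultimately have "J = {..<card J}" by (rule down_closed_eq)
 moreover have "card J = N" using card_image[OF inj_on_subset[OF u_inj], of J] by (simp add: J assms)
 ultimately show ?thesis using J by simp
qed

lemma u_image0: "u ` {0..n - r} = {0..n} - lefts" and u_image_all0: "u ` {0..n + k - 2 * r} = {0..n + k} - supp \<pi>"
proof -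
 have "{i. i \<le> n \<and> i \<notin> supp \<pi>} = {0..n} - lefts"
  using lefts_sub rights_sub by (auto simp: supp_eq)
 moreover from this have "card {i. i \<le> n \<and> i \<notin> supp \<pi>} = Suc (n - r)"
  using lefts_sub r_le by (simp add: card_Diff_subset fin_lefts card_lefts subset_iff Suc_diff_le)
 ultimately show "u ` {0..n - r} = {0..n} - lefts"
  using u_image_card[of "Suc (n - r)" n] by (simp add: atLeast0AtMost lessThan_Suc_atMost)
 have e: "{i. i \<le> n + k \<and> i \<notin> supp \<pi>} = {0..n + k} - supp \<pi>" by auto
 have "lefts \<inter> rights = {}" by (auto simp: lefts_iff rights_iff)
 then have "card (supp \<pi>) = 2 * r"
  by (simp add: supp_eq card_Un_disjoint fin_lefts fin_rights card_lefts card_rights)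
 then have "card ({0..n + k} - supp \<pi>) = Suc (n + k - 2 * r)"
  using supp_sub r_le by (subst card_Diff_subset) (auto simp: fin_supp)
 then show "u ` {0..n + k - 2 * r} = {0..n + k} - supp \<pi>"
  using u_image_card[of "Suc (n + k - 2 * r)" "n + k"] e by (simp add: atLeast0AtMost lessThan_Suc_atMost)
qed

lemma u0 [simp]: "u 0 = 0"
proof -
 have "0 \<notin> supp \<pi>" using supp_sub by auto
 then have "u (inv u 0) = 0" by (rule inv_u)
 then show ?thesis using u_less[of 0 "inv u 0"] by (cases "inv u 0") auto
qed

lemma inv_u_bij: "bij_betw (inv u) (u ` S) S"
 by (rule bij_betwI[of _ _ _ u]) auto

lemma u_image1: "u ` {1..n - r} = {1..n} - lefts"
proof -
 have "u ` {1..n - r} = u ` ({0..n - r} - {0})" by (rule arg_cong[where f = "(`) u"]) auto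
 also have "\<dots> = u ` {0..n - r} - {0}" by (simp add: image_set_diff[OF u_inj])
 finally show ?thesis unfolding u_image0 using lefts_sub by auto
qed

lemma u_image2: "u ` {n - r + 1..n + k - 2 * r} = {n + 1..n + k} - rights"
proof -
 have "{n - r + 1..n + k - 2 * r} = {0..n + k - 2 * r} - {0..n - r}" using r_le by auto
 then have "u ` {n - r + 1..n + k - 2 * r} = u ` {0..n + k - 2 * r} - u ` {0..n - r}"
  by (simp only: image_set_diff[OF u_inj])
 then show ?thesis unfolding u_image0 u_image_all0 using lefts_sub rights_sub by (auto simp: supp_eq)
qed

definition shifted_rights :: "nat set" where "shifted_rights = {i \<in> {1..k}. n + i \<in> rights}"

lemma slicing_left:
 assumes "F \<in> hilbert_schmidt n"
 shows "slicing F n lefts lefts {1..n - r} (\<lambda>i. i) (inv u)"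
proof
 show "bij_betw (inv u) ({1..n} - lefts) {1..n - r}"
  using inv_u_bij[of "{1..n - r}"] unfolding u_image1 .
 show "bij_betw (\<lambda>i. i) lefts lefts" by (simp add: bij_betw_def)
qed (use assms lefts_sub in auto)

lemma slicing_right:
 assumes "G \<in> hilbert_schmidt k"
 shows "slicing G k shifted_rights lefts {n - r + 1..n + k - 2 * r} (\<lambda>i. \<pi> (n + i)) (\<lambda>i. inv u (n + i))"
proof
 have s: "bij_betw ((+) n) shifted_rights rights"
  by (rule bij_betwI[of _ _ _ "\<lambda>i. i - n"]) (use rights_sub in \<open>auto simp: shifted_rights_def subset_iff\<close>)
 have "bij_betw \<pi> rights lefts"
  by (rule bij_betwI[of _ _ _ \<pi>]) (auto simp: lefts_iff rights_iff)
 from bij_betw_trans[OF s this] show "bij_betw (\<lambda>i. \<pi> (n + i)) shifted_rights lefts" by (simp add: comp_def)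
 have "bij_betw ((+) n) ({1..k} - shifted_rights) ({n + 1..n + k} - rights)"
  by (rule bij_betwI[of _ _ _ "\<lambda>i. i - n"]) (use rights_sub in \<open>auto simp: shifted_rights_def subset_iff\<close>)
 from bij_betw_trans[OF this[folded u_image2] inv_u_bij]
 show "bij_betw (\<lambda>i. inv u (n + i)) ({1..k} - shifted_rights) {n - r + 1..n + k - 2 * r}" by (simp add: comp_def)
qed (use assms in \<open>auto simp: shifted_rights_def\<close>)

definition join :: "(nat \<Rightarrow> 'b) \<Rightarrow> (nat \<Rightarrow> 'b) \<Rightarrow> nat \<Rightarrow> 'b" where
 "join x b = (\<lambda>i. if i < \<pi> i then b i else if \<pi> i < i then b (\<pi> i) else x (inv u i))"

lemma join_left:
 "F \<in> hilbert_schmidt n \<Longrightarrow> F (join x b) = F (mix lefts (\<lambda>i. i) (inv u) x b)"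
proof -
 assume F: "F \<in> hilbert_schmidt n"
 show ?thesis
 proof (rule multilin_cong[of n F])
  fix i assume "i \<in> {1..n}"
  then have "\<not> \<pi> i < i" using rights_sub by (auto simp flip: rights_iff)
  then show "join x b i = mix lefts (\<lambda>i. i) (inv u) x b i" by (simp add: join_def mix_def lefts_iff)
 qed (use F in \<open>simp add: hilbert_schmidt_iff\<close>)
qed

lemma join_right:
 "G \<in> hilbert_schmidt k \<Longrightarrow>
  G (\<lambda>i. join x b (n + i)) = G (mix shifted_rights (\<lambda>i. \<pi> (n + i)) (\<lambda>i. inv u (n + i)) x b)"
proof -
 assume G: "G \<in> hilbert_schmidt k"
 show ?thesis
 proof (rule multilin_cong[of k G])
  fix i assume i: "i \<in> {1..k}"
  then have "\<not> n + i < \<pi> (n + i)" using lefts_sub by (auto simp flip: lefts_iff)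
  then show "join x b (n + i) = mix shifted_rights (\<lambda>i. \<pi> (n + i)) (\<lambda>i. inv u (n + i)) x b i"
   using i by (simp add: join_def mix_def shifted_rights_def rights_iff)
 qed (use G in \<open>simp add: hilbert_schmidt_iff\<close>)
qed

lemma contract_join:
 "contract_tensor \<pi> (tensor_prod n F G) x = (\<Sum>\<^sub>\<infinity>b\<in>lefts \<rightarrow>\<^sub>E onb. F (join x b) * G (\<lambda>i. join x b (n + i)))"
 by (simp add: contract_tensor_def tensor_prod_def join_def lefts_def)

lemma contract_hilbert_schmidt:
 fixes F G :: "'a::{real_inner, complete_space} tensor"
 assumes F: "F \<in> hilbert_schmidt n" and G: "G \<in> hilbert_schmidt k"
 shows "contract_tensor \<pi> (tensor_prod n F G) \<in> hilbert_schmidt (n + k - 2 * r)"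
  and "(\<lambda>b. F (join x b) * G (\<lambda>i. join x b (n + i))) summable_on (lefts \<rightarrow>\<^sub>E onb)"
proof -
 have J: "{1..n - r} \<inter> {n - r + 1..n + k - 2 * r} = {}"
  "{1..n - r} \<union> {n - r + 1..n + k - 2 * r} = {1..n + k - 2 * r}" using r_le by auto
 note * = slice_product_hilbert_schmidt[OF slicing_left[OF F] slicing_right[OF G] J]
 show "contract_tensor \<pi> (tensor_prod n F G) \<in> hilbert_schmidt (n + k - 2 * r)"
  using *(1) unfolding contract_join[abs_def] join_left[OF F] join_right[OF G] .
 show "(\<lambda>b. F (join x b) * G (\<lambda>i. join x b (n + i))) summable_on (lefts \<rightarrow>\<^sub>E onb)"
  using *(2) unfolding join_left[OF F] join_right[OF G] .
qed

end

lemma (in real_projection) contract_tensors: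
 assumes "\<pi> \<in> P12 n k" "F \<in> tensors n" "G \<in> tensors k"
 shows "contract_tensor \<pi> (tensor_prod n F G) \<in> tensors (n + k - 2 * npairs \<pi>)"
proof -
 interpret pair_partition \<pi> n k by unfold_locales fact
 have F: "F y = F (\<lambda>i. p (y i))" and G: "G y = G (\<lambda>i. p (y i))" for y
 proof -
  have "second F y = F y" "second G y = G y" using assms by (simp_all add: tensors_def)
  then show "F y = F (\<lambda>i. p (y i))" "G y = G (\<lambda>i. p (y i))" by (simp_all add: second_def)
 qed
 have j: "p (join (\<lambda>i. p (x i)) b i) = p (join x b i)" for x b i
  by (simp add: join_def)
 have "F (join (\<lambda>i. p (x i)) b) = F (join x b)" 
  "G (\<lambda>i. join (\<lambda>i. p (x i)) b (n + i)) = G (\<lambda>i. join x b (n + i))" for x b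
  using F[of "join (\<lambda>i. p (x i)) b"] F[of "join x b"] G[of "\<lambda>i. join (\<lambda>i. p (x i)) b (n + i)"]
   G[of "\<lambda>i. join x b (n + i)"] by (simp_all only: j)
 then have "second (contract_tensor \<pi> (tensor_prod n F G)) = contract_tensor \<pi> (tensor_prod n F G)"
  unfolding second_def contract_join[abs_def] by simp
 then show ?thesis using contract_hilbert_schmidt(1)[of F G] assms by (simp add: tensors_def)
qed

section \<open>Trace polynomials as symmetric families\<close>

lemma finite_S0: "finite (S0 n)" and finite_Sn: "finite (Sn n)"
 by (simp_all add: S0_def Sn_def finite_permutations)

lemma card_Sn: "card (Sn n) = fact n"
 unfolding Sn_def by (subst card_permutations[of "{1..n}" n]) auto

lemma Sn_permutes: "\<sigma> \<in> Sn n \<Longrightarrow> \<sigma> permutes {1..n}"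
 by (simp add: Sn_def)

lemma S0_permutes: "\<alpha> \<in> S0 n \<Longrightarrow> \<alpha> permutes {0..n}"
 by (simp add: S0_def)

lemma Sn_S0: "\<sigma> \<in> Sn n \<Longrightarrow> \<sigma> \<in> S0 n"
 unfolding Sn_def S0_def by (auto intro: permutes_subset)

lemma Sn_inv: "\<sigma> \<in> Sn n \<Longrightarrow> inv \<sigma> \<in> Sn n"
 by (simp add: Sn_def permutes_inv)

lemma S0_inv: "\<alpha> \<in> S0 n \<Longrightarrow> inv \<alpha> \<in> S0 n"
 by (simp add: S0_def permutes_inv)

lemma S0_comp: "\<alpha> \<in> S0 n \<Longrightarrow> \<beta> \<in> S0 n \<Longrightarrow> \<alpha> \<circ> \<beta> \<in> S0 n"
 by (simp add: S0_def permutes_compose)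

lemma Sn_comp: "\<sigma> \<in> Sn n \<Longrightarrow> \<tau> \<in> Sn n \<Longrightarrow> \<sigma> \<circ> \<tau> \<in> Sn n"
 by (simp add: Sn_def permutes_compose)

definition conj_by :: "(nat \<Rightarrow> nat) \<Rightarrow> (nat \<Rightarrow> nat) \<Rightarrow> nat \<Rightarrow> nat" where
 "conj_by \<sigma> \<alpha> = \<sigma> \<circ> \<alpha> \<circ> inv \<sigma>"

lemma conj_S0: "\<sigma> \<in> Sn n \<Longrightarrow> \<alpha> \<in> S0 n \<Longrightarrow> conj_by \<sigma> \<alpha> \<in> S0 n"
 by (simp add: conj_by_def S0_comp Sn_S0 S0_inv)

lemma conj_inv:
 assumes "\<sigma> \<in> Sn n"
 shows "conj_by \<sigma> (conj_by (inv \<sigma>) \<alpha>) = \<alpha>" "conj_by (inv \<sigma>) (conj_by \<sigma> \<alpha>) = \<alpha>"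
 using permutes_inverses[OF Sn_permutes[OF assms]] permutes_inv_inv[OF Sn_permutes[OF assms]]
 by (auto simp: conj_by_def fun_eq_iff)

lemma conj_comp:
 assumes "\<sigma> \<in> Sn n" "\<tau> \<in> Sn n"
 shows "conj_by (\<tau> \<circ> \<sigma>) \<alpha> = conj_by \<tau> (conj_by \<sigma> \<alpha>)"
proof -
 have "inv (\<tau> \<circ> \<sigma>) = inv \<sigma> \<circ> inv \<tau>"
  using assms by (intro o_inv_distrib) (auto simp: Sn_def permutes_bij)
 then show ?thesis by (simp add: conj_by_def comp_assoc)
qed

lemma bij_conj: "\<sigma> \<in> Sn n \<Longrightarrow> bij_betw (conj_by \<sigma>) (S0 n) (S0 n)"
 by (rule bij_betwI[of _ _ _ "conj_by (inv \<sigma>)"]) (auto simp: conj_S0 Sn_inv conj_inv)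

lemma bij_comp_left:
 assumes "\<tau> \<in> Sn n"
 shows "bij_betw (\<lambda>\<sigma>. \<tau> \<circ> \<sigma>) (Sn n) (Sn n)"
proof (rule bij_betwI[of _ _ _ "\<lambda>\<sigma>. inv \<tau> \<circ> \<sigma>"])
 show "inv \<tau> \<circ> (\<tau> \<circ> \<sigma>) = \<sigma>" "\<tau> \<circ> (inv \<tau> \<circ> \<sigma>) = \<sigma>" for \<sigma>
  using permutes_inverses[OF Sn_permutes[OF assms]] by (auto simp: fun_eq_iff)
qed (use assms in \<open>auto intro: Sn_comp Sn_inv\<close>)

lemma symt_conj: "symt n \<alpha> F = (\<lambda>m \<beta> x.
  (\<Sum>\<sigma>\<in>Sn n. if m = n \<and> \<beta> = conj_by \<sigma> \<alpha> then perm_op \<sigma> F x else 0) / fact n)"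
 by (simp add: symt_def conj_by_def)

lemma cspan_zero: "(\<lambda>n \<alpha> x. 0) \<in> cspan X"
 unfolding cspan_def by (intro CollectI exI[of _ 0]) auto

lemma cspan_step:
 assumes "\<xi> \<in> cspan X" "\<eta> \<in> X"
 shows "(\<lambda>n \<alpha> x. d * \<eta> n \<alpha> x + \<xi> n \<alpha> x) \<in> cspan X"
proof -
 obtain m :: nat and c :: "nat \<Rightarrow> complex" and \<zeta> where
  \<xi>: "\<xi> = (\<lambda>n \<alpha> x. \<Sum>j<m. c j * \<zeta> j n \<alpha> x)" and \<zeta>: "\<And>j. j < m \<Longrightarrow> \<zeta> j \<in> X"
  using assms(1) unfolding cspan_def by blast
 have e: "(\<lambda>n \<alpha> x. d * \<eta> n \<alpha> x + \<xi> n \<alpha> x) =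
   (\<lambda>n \<alpha> x. \<Sum>j<Suc m. (c(m := d)) j * (\<zeta>(m := \<eta>)) j n \<alpha> x)"
  unfolding \<xi> by (simp add: add.commute)
 have "(\<zeta>(m := \<eta>)) j \<in> X" if "j < Suc m" for j
  using \<zeta>[of j] assms(2) that by (cases "j = m") auto
 then show ?thesis unfolding cspan_def
  by (intro CollectI exI[of _ "Suc m"] exI[of _ "c(m := d)"] exI[of _ "\<zeta>(m := \<eta>)"] conjI e) blast
qed

lemma cspan_sum:
 assumes "finite I" "\<And>i. i \<in> I \<Longrightarrow> \<xi> i \<in> X"
 shows "(\<lambda>n \<alpha> x. \<Sum>i\<in>I. c i * \<xi> i n \<alpha> x) \<in> cspan X"
 using assms
proof (induction I)
 case empty
 then show ?case by (simp add: cspan_zero)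
next
 case (insert i I)
 from cspan_step[of "\<lambda>n \<alpha> x. \<Sum>i\<in>I. c i * \<xi> i n \<alpha> x" X "\<xi> i" "c i"] insert
 show ?case by simp
qed

lemma cnj_hilbert_schmidt:
 fixes F :: "'a::real_inner tensor"
 shows "F \<in> hilbert_schmidt n \<Longrightarrow> (\<lambda>x. cnj (F x)) \<in> hilbert_schmidt n"
 unfolding hilbert_schmidt_def
 by (auto simp: linear_iff scaleR_conv_of_real)

context real_projection
begin

lemma tensors_add: "F \<in> tensors n \<Longrightarrow> G \<in> tensors n \<Longrightarrow> (\<lambda>x. F x + G x) \<in> tensors n"
 unfolding tensors_def by (auto simp: hilbert_schmidt_add second_def fun_eq_iff)

lemma tensors_cmult: "F \<in> tensors n \<Longrightarrow> (\<lambda>x. c * F x) \<in> tensors n"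
 unfolding tensors_def by (auto simp: hilbert_schmidt_cmult second_def fun_eq_iff)

lemma tensors_zero: "(\<lambda>_. 0) \<in> tensors n"
 by (simp add: tensors_def hilbert_schmidt_zero second_def)

lemma tensors_sum:
 "finite I \<Longrightarrow> (\<And>i. i \<in> I \<Longrightarrow> F i \<in> tensors n) \<Longrightarrow> (\<lambda>x. \<Sum>i\<in>I. F i x) \<in> tensors n"
 by (induction I rule: finite_induct) (auto intro: tensors_zero tensors_add)

lemma tensors_perm: "\<sigma> \<in> Sn n \<Longrightarrow> F \<in> tensors n \<Longrightarrow> perm_op \<sigma> F \<in> tensors n"
proof -
 assume s: "\<sigma> \<in> Sn n" and F: "F \<in> tensors n"
 have "F (\<lambda>i. p (y i)) = F y" for y
  using F by (simp add: tensors_def second_def fun_eq_iff)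
 from this[of "x \<circ> \<sigma>" for x] have "second (perm_op \<sigma> F) = perm_op \<sigma> F"
  by (simp add: second_def perm_op_def comp_def)
 moreover have "perm_op \<sigma> F \<in> hilbert_schmidt n"
  by (rule perm_op_hilbert_schmidt[OF s]) (use F in \<open>simp add: tensors_def\<close>)
 ultimately show ?thesis by (simp add: tensors_def)
qed

lemma tensors_cnj: "F \<in> tensors n \<Longrightarrow> (\<lambda>x. cnj (F x)) \<in> tensors n"
 unfolding tensors_def by (auto simp: cnj_hilbert_schmidt second_def fun_eq_iff)

text \<open>The coefficient families of the elements of \<open>TP\<close>: symmetrised tensors are exactly those invariant under
 simultaneous conjugation of the permutation and rearrangement of the tensor.\<close>

definition families :: "'a tp set" where
 "families = {\<xi>. finite (degs \<xi>) \<and> (\<forall>n \<alpha>. \<alpha> \<notin> S0 n \<longrightarrow> \<xi> n \<alpha> = (\<lambda>_. 0)) \<and>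
   (\<forall>n. \<forall>\<alpha>\<in>S0 n. \<xi> n \<alpha> \<in> tensors n) \<and>
   (\<forall>n. \<forall>\<sigma>\<in>Sn n. \<forall>\<alpha>\<in>S0 n. \<xi> n (conj_by \<sigma> \<alpha>) = perm_op \<sigma> (\<xi> n \<alpha>))}"

lemma familiesD:
 assumes "\<xi> \<in> families"
 shows "finite (degs \<xi>)" "\<alpha> \<notin> S0 n \<Longrightarrow> \<xi> n \<alpha> x = 0" "\<xi> n \<alpha> \<in> tensors n"
  "\<sigma> \<in> Sn n \<Longrightarrow> \<alpha> \<in> S0 n \<Longrightarrow> \<xi> n (conj_by \<sigma> \<alpha>) x = \<xi> n \<alpha> (x \<circ> \<sigma>)"
  "\<xi> n \<alpha> \<in> hilbert_schmidt n"
proof -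
 show "finite (degs \<xi>)" using assms by (simp add: families_def)
 show "\<alpha> \<notin> S0 n \<Longrightarrow> \<xi> n \<alpha> x = 0" using assms by (simp add: families_def)
 show t: "\<xi> n \<alpha> \<in> tensors n"
  using assms tensors_zero unfolding families_def by (cases "\<alpha> \<in> S0 n") auto
 then show "\<xi> n \<alpha> \<in> hilbert_schmidt n" by (simp add: tensors_def)
 show "\<xi> n (conj_by \<sigma> \<alpha>) x = \<xi> n \<alpha> (x \<circ> \<sigma>)" if "\<sigma> \<in> Sn n" "\<alpha> \<in> S0 n"
 proof -
  have "\<xi> n (conj_by \<sigma> \<alpha>) = perm_op \<sigma> (\<xi> n \<alpha>)" using assms that unfolding families_def by blast
  then show ?thesis by (simp add: perm_op_def)
 qed
qed

lemma degs_zero: "n \<notin> degs \<xi> \<Longrightarrow> \<xi> n \<alpha> x = 0"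
 by (auto simp: degs_def)

lemma familiesI:
 assumes "finite X" "\<And>n \<alpha> x. n \<notin> X \<Longrightarrow> \<xi> n \<alpha> x = 0" "\<And>n \<alpha> x. \<alpha> \<notin> S0 n \<Longrightarrow> \<xi> n \<alpha> x = 0"
  and "\<And>n \<alpha>. \<alpha> \<in> S0 n \<Longrightarrow> \<xi> n \<alpha> \<in> tensors n"
  and "\<And>n \<sigma> \<alpha> x. \<sigma> \<in> Sn n \<Longrightarrow> \<alpha> \<in> S0 n \<Longrightarrow> \<xi> n (conj_by \<sigma> \<alpha>) x = \<xi> n \<alpha> (x \<circ> \<sigma>)"
 shows "\<xi> \<in> families"
proof -
 have "degs \<xi> \<subseteq> X" using assms(2) unfolding degs_def by blast
 then have "finite (degs \<xi>)" using assms(1) finite_subset by blast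
 then show ?thesis unfolding families_def perm_op_def using assms(3,4,5) by (auto intro!: ext)
qed

lemma families_zero: "(\<lambda>n \<alpha> x. 0) \<in> families"
 by (rule familiesI[of "{}"]) (auto intro: tensors_zero)

lemma families_add:
 assumes \<xi>: "\<xi> \<in> families" and \<eta>: "\<eta> \<in> families"
 shows "(\<lambda>n \<alpha> x. \<xi> n \<alpha> x + \<eta> n \<alpha> x) \<in> families"
proof (rule familiesI[of "degs \<xi> \<union> degs \<eta>"])
 show "finite (degs \<xi> \<union> degs \<eta>)" using familiesD(1) \<xi> \<eta> by blast
qed (use familiesD[OF \<xi>] familiesD[OF \<eta>] in \<open>auto simp: degs_zero intro: tensors_add\<close>)

lemma families_cmult:
 assumes \<xi>: "\<xi> \<in> families"
 shows "(\<lambda>n \<alpha> x. c * \<xi> n \<alpha> x) \<in> families"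
 by (rule familiesI[of "degs \<xi>"]) (use familiesD[OF \<xi>] in \<open>auto simp: degs_zero intro: tensors_cmult\<close>)

lemma families_cspan:
 assumes "X \<subseteq> families"
 shows "cspan X \<subseteq> families"
proof
 fix \<xi> assume "\<xi> \<in> cspan X"
 then obtain m :: nat and c :: "nat \<Rightarrow> complex" and \<zeta> where
  \<xi>: "\<xi> = (\<lambda>n \<alpha> x. \<Sum>j<m. c j * \<zeta> j n \<alpha> x)" and \<zeta>: "\<And>j. j < m \<Longrightarrow> \<zeta> j \<in> X"
  unfolding cspan_def by blast
 have "(\<lambda>n \<alpha> x. \<Sum>j<k. c j * \<zeta> j n \<alpha> x) \<in> families" if "k \<le> m" for k
  using that
 proof (induction k)
  case 0
  then show ?case by (simp add: families_zero)
 next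
  case (Suc k)
  have "\<zeta> k \<in> families" using \<zeta>[of k] assms Suc.prems by auto
  then have "(\<lambda>n \<alpha> x. (\<Sum>j<k. c j * \<zeta> j n \<alpha> x) + c k * \<zeta> k n \<alpha> x) \<in> families"
   using Suc by (intro families_add families_cmult) auto
  then show ?case by simp
 qed
 then show "\<xi> \<in> families" unfolding \<xi> by blast
qed

lemma symt_families:
 assumes \<alpha>: "\<alpha> \<in> S0 n" and F: "F \<in> tensors n"
 shows "symt n \<alpha> F \<in> families"
proof (rule familiesI[of "{n}"])
 show "symt n \<alpha> F m \<beta> x = 0" if "m \<notin> {n}" for m \<beta> x using that by (simp add: symt_conj)
 show "symt n \<alpha> F m \<beta> x = 0" if "\<beta> \<notin> S0 m" for m \<beta> x
 proof -
  have "\<not> (m = n \<and> \<beta> = conj_by \<sigma> \<alpha>)" if "\<sigma> \<in> Sn n" for \<sigma>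
   using conj_S0[OF that \<alpha>] \<open>\<beta> \<notin> S0 m\<close> by blast
  then have "(\<Sum>\<sigma>\<in>Sn n. if m = n \<and> \<beta> = conj_by \<sigma> \<alpha> then perm_op \<sigma> F x else 0) = 0"
   by (intro sum.neutral) auto
  then show ?thesis unfolding symt_conj by simp
 qed
 show "symt n \<alpha> F m \<beta> \<in> tensors m" for m \<beta>
 proof (cases "m = n")
  case True
  have "(\<lambda>x. \<Sum>\<sigma>\<in>Sn n. if \<beta> = conj_by \<sigma> \<alpha> then perm_op \<sigma> F x else 0) \<in> tensors n"
  proof (rule tensors_sum[OF finite_Sn])
   show "(\<lambda>x. if \<beta> = conj_by \<sigma> \<alpha> then perm_op \<sigma> F x else 0) \<in> tensors n" if "\<sigma> \<in> Sn n" for \<sigma>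
    using tensors_perm[OF that F] tensors_zero by (cases "\<beta> = conj_by \<sigma> \<alpha>") auto
  qed
  from tensors_cmult[OF this, of "1 / fact n"] show ?thesis unfolding symt_conj using True by simp
 qed (simp add: symt_conj tensors_zero)
 show "symt n \<alpha> F m (conj_by \<tau> \<beta>) x = symt n \<alpha> F m \<beta> (x \<circ> \<tau>)" if \<tau>: "\<tau> \<in> Sn m" for m \<tau> \<beta> x
 proof (cases "m = n")
  case True
  have "(\<Sum>\<sigma>\<in>Sn n. if conj_by \<tau> \<beta> = conj_by \<sigma> \<alpha> then F (x \<circ> \<sigma>) else 0) =
   (\<Sum>\<sigma>\<in>Sn n. if conj_by \<tau> \<beta> = conj_by (\<tau> \<circ> \<sigma>) \<alpha> then F (x \<circ> (\<tau> \<circ> \<sigma>)) else 0)"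
   by (rule sum.reindex_bij_betw[OF bij_comp_left, symmetric]) (use \<tau> True in blast)
  also have "\<dots> = (\<Sum>\<sigma>\<in>Sn n. if \<beta> = conj_by \<sigma> \<alpha> then F ((x \<circ> \<tau>) \<circ> \<sigma>) else 0)"
  proof (rule sum.cong[OF refl])
   fix \<sigma> assume "\<sigma> \<in> Sn n"
   then have "conj_by \<tau> \<beta> = conj_by (\<tau> \<circ> \<sigma>) \<alpha> \<longleftrightarrow> \<beta> = conj_by \<sigma> \<alpha>"
    using conj_comp[of \<sigma> n \<tau> \<alpha>] conj_inv(2)[of \<tau> n] \<tau> True by metis
   then show "(if conj_by \<tau> \<beta> = conj_by (\<tau> \<circ> \<sigma>) \<alpha> then F (x \<circ> (\<tau> \<circ> \<sigma>)) else 0) =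
     (if \<beta> = conj_by \<sigma> \<alpha> then F ((x \<circ> \<tau>) \<circ> \<sigma>) else 0)" by (simp only: comp_assoc)
  qed
  finally show ?thesis unfolding symt_conj perm_op_def using True by (simp only: simp_thms)
 qed (simp add: symt_conj)
qed simp

lemma families_expand:
 assumes \<xi>: "\<xi> \<in> families"
 shows "\<xi> = (\<lambda>m \<beta> x. \<Sum>n\<in>degs \<xi>. \<Sum>\<alpha>\<in>S0 n. symt n \<alpha> (\<xi> n \<alpha>) m \<beta> x)"
proof (intro ext)
 fix m \<beta> x
 have *: "(\<Sum>\<alpha>\<in>S0 n. symt n \<alpha> (\<xi> n \<alpha>) m \<beta> x) = (if m = n then \<xi> m \<beta> x else 0)" for n
 proof (cases "m = n")
  case mn: True
  have "(\<Sum>\<alpha>\<in>S0 n. symt n \<alpha> (\<xi> n \<alpha>) m \<beta> x) =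
    (\<Sum>\<alpha>\<in>S0 n. \<Sum>\<sigma>\<in>Sn n. if \<beta> = conj_by \<sigma> \<alpha> then \<xi> n \<alpha> (x \<circ> \<sigma>) else 0) / fact n"
   unfolding symt_conj perm_op_def using mn by (simp add: sum_divide_distrib)
  also have "(\<Sum>\<alpha>\<in>S0 n. \<Sum>\<sigma>\<in>Sn n. if \<beta> = conj_by \<sigma> \<alpha> then \<xi> n \<alpha> (x \<circ> \<sigma>) else 0) =
    (\<Sum>\<sigma>\<in>Sn n. \<Sum>\<alpha>\<in>S0 n. if \<beta> = conj_by \<sigma> \<alpha> then \<xi> n \<alpha> (x \<circ> \<sigma>) else 0)" by (rule sum.swap)
  also have "\<dots> = (\<Sum>\<sigma>\<in>Sn n. \<xi> n \<beta> x)"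
  proof (rule sum.cong[OF refl])
   fix \<sigma> assume s: "\<sigma> \<in> Sn n"
   have "(\<Sum>\<alpha>\<in>S0 n. if \<beta> = conj_by \<sigma> \<alpha> then \<xi> n \<alpha> (x \<circ> \<sigma>) else 0) =
     (\<Sum>\<alpha>\<in>S0 n. if \<beta> = conj_by \<sigma> \<alpha> then \<xi> n (conj_by \<sigma> \<alpha>) x else 0)"
    by (rule sum.cong[OF refl]) (simp add: familiesD(4)[OF \<xi> s])
   also have "\<dots> = (\<Sum>\<gamma>\<in>S0 n. if \<beta> = \<gamma> then \<xi> n \<gamma> x else 0)"
    by (rule sum.reindex_bij_betw[OF bij_conj[OF s]])
   also have "\<dots> = \<xi> n \<beta> x" using familiesD(2)[OF \<xi>] finite_S0 by simp
   finally show "(\<Sum>\<alpha>\<in>S0 n. if \<beta> = conj_by \<sigma> \<alpha> then \<xi> n \<alpha> (x \<circ> \<sigma>) else 0) = \<xi> n \<beta> x" .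
  qed
  finally show ?thesis using mn by (simp add: card_Sn)
 qed (simp add: symt_conj)
 show "\<xi> m \<beta> x = (\<Sum>n\<in>degs \<xi>. \<Sum>\<alpha>\<in>S0 n. symt n \<alpha> (\<xi> n \<alpha>) m \<beta> x)"
  unfolding * using familiesD(1)[OF \<xi>] degs_zero[of m \<xi>] by simp
qed

text \<open>Real and imaginary parts of an invariant tensor are again invariant, so the span over \<open>\<complex>\<close> of
 symmetrised real tensors already contains everything; this identifies \<open>TP_real\<close> with \<open>TP\<close>.\<close>

lemma families_in_cspan:
 assumes \<xi>: "\<xi> \<in> families"
  and X: "\<And>n \<alpha> F. \<alpha> \<in> S0 n \<Longrightarrow> F \<in> tensors n \<Longrightarrow> (\<forall>x. F x \<in> \<real>) \<Longrightarrow> symt n \<alpha> F \<in> X"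
 shows "\<xi> \<in> cspan X"
proof -
 define part where "part b F = (\<lambda>x. if b then complex_of_real (Re (F x)) else complex_of_real (Im (F x)))"
  for b and F :: "'a tensor"
 have part: "part b F \<in> tensors n" if F: "F \<in> tensors n" for b n F
 proof -
  have "complex_of_real (Re z) = (1/2) * (z + 1 * cnj z)" "complex_of_real (Im z) = (-\<i>/2) * (z + (-1) * cnj z)" for z
   by (simp_all add: complex_eq_iff)
  then have e: "part b F = (if b then (\<lambda>x. (1/2) * (F x + 1 * cnj (F x))) else (\<lambda>x. (-\<i>/2) * (F x + (-1) * cnj (F x))))"
   unfolding part_def by presburger
  show ?thesis unfolding e by (cases b; simp only: if_True if_False; intro tensors_cmult tensors_add tensors_cnj F)
 qed
 have ps: "symt n \<alpha> F m \<beta> x = symt n \<alpha> (part True F) m \<beta> x + \<i> * symt n \<alpha> (part False F) m \<beta> x" for n \<alpha> F m \<beta> x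
 proof -
  have "perm_op \<sigma> F x = perm_op \<sigma> (part True F) x + \<i> * perm_op \<sigma> (part False F) x" for \<sigma>
   by (simp add: perm_op_def part_def complex_eq)
  then have "(if C then perm_op \<sigma> F x else 0) = (if C then perm_op \<sigma> (part True F) x else 0) +
    \<i> * (if C then perm_op \<sigma> (part False F) x else 0)" for \<sigma> C by simp
  then show ?thesis unfolding symt_conj
   by (simp only: sum.distrib sum_distrib_left[symmetric] add_divide_distrib times_divide_eq_right)
 qed
 define I where "I = (SIGMA n:degs \<xi>. S0 n) \<times> (UNIV :: bool set)"
 define c where "c = (\<lambda>((n :: nat, \<alpha> :: nat \<Rightarrow> nat), b). if b then 1 else \<i>)"
 define \<zeta> where "\<zeta> = (\<lambda>((n, \<alpha>), b). symt n \<alpha> (part b (\<xi> n \<alpha>)))"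
 have fin: "finite (SIGMA n:degs \<xi>. S0 n)" using familiesD(1)[OF \<xi>] finite_S0 by blast
 have "\<xi> m \<beta> x = (\<Sum>i\<in>I. c i * \<zeta> i m \<beta> x)" for m \<beta> x
 proof -
  have "(\<Sum>i\<in>I. c i * \<zeta> i m \<beta> x) = (\<Sum>(n, \<alpha>)\<in>(SIGMA n:degs \<xi>. S0 n). symt n \<alpha> (\<xi> n \<alpha>) m \<beta> x)"
  proof -
   have "(\<Sum>i\<in>I. c i * \<zeta> i m \<beta> x) = (\<Sum>p\<in>(SIGMA n:degs \<xi>. S0 n). \<Sum>b\<in>UNIV. c (p, b) * \<zeta> (p, b) m \<beta> x)"
    by (simp only: I_def sum.cartesian_product case_prod_unfold prod.collapse)
   also have "\<dots> = (\<Sum>(n, \<alpha>)\<in>(SIGMA n:degs \<xi>. S0 n). symt n \<alpha> (\<xi> n \<alpha>) m \<beta> x)"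
   proof (rule sum.cong[OF refl])
    fix p :: "nat \<times> (nat \<Rightarrow> nat)"
    obtain n \<alpha> where p: "p = (n, \<alpha>)" by (cases p)
    show "(\<Sum>b\<in>UNIV. c (p, b) * \<zeta> (p, b) m \<beta> x) = (case p of (n, \<alpha>) \<Rightarrow> symt n \<alpha> (\<xi> n \<alpha>) m \<beta> x)"
     using ps[of n \<alpha> "\<xi> n \<alpha>" m \<beta> x] by (simp add: UNIV_bool c_def \<zeta>_def p)
   qed
   finally show ?thesis .
  qed
  also have "\<dots> = (\<Sum>n\<in>degs \<xi>. \<Sum>\<alpha>\<in>S0 n. symt n \<alpha> (\<xi> n \<alpha>) m \<beta> x)"
   by (rule sum.Sigma[symmetric]) (use familiesD(1)[OF \<xi>] finite_S0 in auto)
  also have "\<dots> = \<xi> m \<beta> x" using families_expand[OF \<xi>] by metis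
  finally show ?thesis by simp
 qed
 then have e: "\<xi> = (\<lambda>m \<beta> x. \<Sum>i\<in>I. c i * \<zeta> i m \<beta> x)" by blast
 show ?thesis
 proof (subst e, rule cspan_sum)
  show "finite I" using fin by (simp add: I_def)
  fix i assume "i \<in> I"
  then obtain n \<alpha> b where i: "i = ((n, \<alpha>), b)" "\<alpha> \<in> S0 n" by (auto simp: I_def)
  have "symt n \<alpha> (part b (\<xi> n \<alpha>)) \<in> X"
   by (rule X[OF i(2) part[OF familiesD(3)[OF \<xi>]]]) (simp add: part_def)
  then show "\<zeta> i \<in> X" by (simp add: \<zeta>_def i)
 qed
qed

lemma TP_eq: "TP (M \<times> M) = families"
 unfolding TP_def tensor_power_eq
proof (rule equalityI)
 show "cspan {symt n \<alpha> F | n \<alpha> F. \<alpha> \<in> S0 n \<and> F \<in> tensors n} \<subseteq> families"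
  by (rule families_cspan) (auto intro: symt_families)
 show "families \<subseteq> cspan {symt n \<alpha> F | n \<alpha> F. \<alpha> \<in> S0 n \<and> F \<in> tensors n}"
  by (rule subsetI, erule families_in_cspan) blast
qed

lemma TP_real_eq: "TP_real M = families"
 unfolding TP_real_def real_tensor_power_eq
proof (rule equalityI)
 show "cspan {symt n \<alpha> F | n \<alpha> F. \<alpha> \<in> S0 n \<and> F \<in> {F \<in> tensors n. \<forall>x. F x \<in> \<real>}} \<subseteq> families"
  by (rule families_cspan) (auto intro: symt_families)
 show "families \<subseteq> cspan {symt n \<alpha> F | n \<alpha> F. \<alpha> \<in> S0 n \<and> F \<in> {F \<in> tensors n. \<forall>x. F x \<in> \<real>}}"
  by (rule subsetI, erule families_in_cspan) blast
qed

end

section \<open>The matrix model\<close>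

lemma has_sum_finite_sum:
 fixes f :: "'i \<Rightarrow> 'j \<Rightarrow> complex"
 assumes "finite I" "\<And>i. i \<in> I \<Longrightarrow> (f i has_sum s i) A"
 shows "((\<lambda>x. \<Sum>i\<in>I. f i x) has_sum (\<Sum>i\<in>I. s i)) A"
 using assms by (induction I) (simp_all add: has_sum_add)

lemma bij_PiE_pair:
 "bij_betw (\<lambda>(e, c). \<lambda>i\<in>A. (e i, c i)) ((A \<rightarrow>\<^sub>E B) \<times> (A \<rightarrow>\<^sub>E C)) (A \<rightarrow>\<^sub>E B \<times> C)"
proof (rule bij_betwI[of _ _ _ "\<lambda>W. (\<lambda>i\<in>A. fst (W i), \<lambda>i\<in>A. snd (W i))"])
 show "(\<lambda>W. (\<lambda>i\<in>A. fst (W i), \<lambda>i\<in>A. snd (W i))) \<in> (A \<rightarrow>\<^sub>E B \<times> C) \<rightarrow> (A \<rightarrow>\<^sub>E B) \<times> (A \<rightarrow>\<^sub>E C)"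
  by (force simp: PiE_iff)
 show "(\<lambda>(e, c). \<lambda>i\<in>A. (e i, c i)) \<in> (A \<rightarrow>\<^sub>E B) \<times> (A \<rightarrow>\<^sub>E C) \<rightarrow> (A \<rightarrow>\<^sub>E B \<times> C)"
  by (force simp: PiE_iff)
 show "(\<lambda>i\<in>A. fst ((case p of (e, c) \<Rightarrow> \<lambda>i\<in>A. (e i, c i)) i), \<lambda>i\<in>A. snd ((case p of (e, c) \<Rightarrow> \<lambda>i\<in>A. (e i, c i)) i)) = p"
  if "p \<in> (A \<rightarrow>\<^sub>E B) \<times> (A \<rightarrow>\<^sub>E C)" for p
 proof -
  obtain e c where p: "p = (e, c)" by (cases p)
  have "e \<in> A \<rightarrow>\<^sub>E B" "c \<in> A \<rightarrow>\<^sub>E C" using that by (auto simp: p)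
  from PiE_arb[OF this(1)] PiE_arb[OF this(2)] show ?thesis by (auto simp: p fun_eq_iff)
 qed
 show "(case (\<lambda>i\<in>A. fst (W i), \<lambda>i\<in>A. snd (W i)) of (e, c) \<Rightarrow> \<lambda>i\<in>A. (e i, c i)) = W"
  if "W \<in> A \<rightarrow>\<^sub>E B \<times> C" for W
  using PiE_arb[OF that] by (auto simp: fun_eq_iff)
qed

lemma nth_word: "k < n \<Longrightarrow> map W [1..<Suc n] ! k = W (Suc k)"
 by (subst nth_map) (simp_all del: upt_Suc)

lemma bij_words:
 "bij_betw (\<lambda>W. map W [1..<Suc n]) ({1..n} \<rightarrow>\<^sub>E L) {w \<in> lists L. length w = n}"
proof (rule bij_betwI[of _ _ _ "\<lambda>w. \<lambda>k\<in>{1..n}. w ! (k - 1)"])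
 show "(\<lambda>W. map W [1..<Suc n]) \<in> ({1..n} \<rightarrow>\<^sub>E L) \<rightarrow> {w \<in> lists L. length w = n}"
  by (auto simp: PiE_iff simp del: upt_Suc)
 show "(\<lambda>w. \<lambda>k\<in>{1..n}. w ! (k - 1)) \<in> {w \<in> lists L. length w = n} \<rightarrow> {1..n} \<rightarrow>\<^sub>E L"
  by (auto simp: in_lists_conv_set)
 show "(\<lambda>k\<in>{1..n}. map W [1..<Suc n] ! (k - 1)) = W" if "W \<in> {1..n} \<rightarrow>\<^sub>E L" for W
 proof
  fix k
  show "(\<lambda>k\<in>{1..n}. map W [1..<Suc n] ! (k - 1)) k = W k"
  proof (cases "k \<in> {1..n}")
   case True
   then have "map W [1..<Suc n] ! (k - 1) = W (Suc (k - 1))" by (intro nth_word) auto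
   then show ?thesis using True by simp
  next
   case False
   then show ?thesis using PiE_arb[OF that False] by (simp only: restrict_apply if_False)
  qed
 qed
 show "map (\<lambda>k\<in>{1..n}. w ! (k - 1)) [1..<Suc n] = w" if "w \<in> {w \<in> lists L. length w = n}" for w
  using that by (intro nth_equalityI) (simp_all del: upt_Suc)
qed

lemma ell2_finite: "finite A \<Longrightarrow> ell2 f A"
 by (simp add: ell2_def)

type_synonym 'a letter = "'a \<times> nat \<times> nat"

locale matrix_model =
 fixes N :: nat and neg :: bool and q :: real and ty :: "'a::{real_inner, complete_space} itself"
 assumes N: "1 \<le> N" and q: "q = (if neg then - 1 else 1) / real N"
begin

definition bar :: "'a letter \<Rightarrow> 'a letter" where
 "bar = (\<lambda>(e, i, j). (e, j, i))"

definition L :: "'a letter set" where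
 "L = onb \<times> {..<N} \<times> {..<N}"

sublocale letters L bar
 by unfold_locales (auto simp: L_def bar_def)

sublocale U: real_projection "\<lambda>x :: 'a. x" UNIV
 by unfold_locales (auto simp: linear_iff)

lemma U_tensors: "U.tensors n = hilbert_schmidt n"
 by (simp add: U.tensors_def U.second_def)

definition sg :: "(nat \<Rightarrow> nat) \<Rightarrow> real" where
 "sg \<alpha> = (if neg then of_int (sign \<alpha>) else 1)"

definition rowf :: "nat \<Rightarrow> (nat \<Rightarrow> 'a letter) \<Rightarrow> nat \<Rightarrow> nat" where
 "rowf b W k = (if k = 0 then b else fst (snd (W k)))"

definition colf :: "nat \<Rightarrow> (nat \<Rightarrow> 'a letter) \<Rightarrow> nat \<Rightarrow> nat" where
 "colf a W k = (if k = 0 then a else snd (snd (W k)))"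

text \<open>The coefficient of the letters \<open>W\<^sub>1 \<dots> W\<^sub>n\<close> in the entry \<open>(a, b)\<close> of \<open>\<alpha> \<otimes> F\<close>: the product over the
 cycles of \<open>\<alpha>\<close> of matrix entries, the cycle of \<open>0\<close> being the one whose trace is not taken.\<close>

definition entry :: "nat \<Rightarrow> (nat \<Rightarrow> nat) \<Rightarrow> 'a tensor \<Rightarrow> nat \<Rightarrow> nat \<Rightarrow> (nat \<Rightarrow> 'a letter) \<Rightarrow> complex" where
 "entry n \<alpha> F a b W = (if \<forall>k\<in>{0..n}. colf a W k = rowf b W (\<alpha> k)
   then of_real (sg \<alpha>) * F (\<lambda>k. fst (W k)) else 0)"

definition Psi :: "'a tp \<Rightarrow> nat \<Rightarrow> nat \<Rightarrow> nat \<Rightarrow> (nat \<Rightarrow> 'a letter) \<Rightarrow> complex" where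
 "Psi \<xi> n a b W = (\<Sum>\<alpha>\<in>S0 n. entry n \<alpha> (\<xi> n \<alpha>) a b W)"

text \<open>The power of \<open>1 / sqrt N\<close> makes each contraction cost a factor \<open>1 / N\<close>; the factorial turns
 the coefficient of a symmetric tensor into an iterated derivative, as the Wick product expects.\<close>

definition scale :: "nat \<Rightarrow> complex" where
 "scale n = fact n * of_real (sqrt (1 / real N) ^ n)"

definition Phi :: "'a tp \<Rightarrow> nat \<Rightarrow> nat \<Rightarrow> 'a letter list \<Rightarrow> complex" where
 "Phi \<xi> a b w = (if a < N \<and> b < N \<and> w \<in> words then
   scale (length w) * Psi \<xi> (length w) a b (\<lambda>k. w ! (k - 1)) else 0)"

lemma scale_nz: "scale n \<noteq> 0"
 using N by (simp add: scale_def)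

lemma S0_permutation: "\<alpha> \<in> S0 n \<Longrightarrow> permutation \<alpha>"
 unfolding S0_def using permutation_permutes by blast

lemma sg_comp: "permutation \<alpha> \<Longrightarrow> permutation \<beta> \<Longrightarrow> sg (\<alpha> \<circ> \<beta>) = sg \<alpha> * sg \<beta>"
 by (simp add: sg_def sign_compose)

lemma sg_inv: "permutation \<alpha> \<Longrightarrow> sg (inv \<alpha>) = sg \<alpha>"
 by (simp add: sg_def sign_inverse)

lemma sg_sq [simp]: "sg \<alpha> * sg \<alpha> = 1"
 by (simp add: sg_def flip: of_int_mult)

lemma abs_sg: "\<bar>sg \<alpha>\<bar> = 1"
 using abs_sign[of \<alpha>] by (simp add: sg_def flip: of_int_abs del: abs_sign)

lemma sg_id [simp]: "sg id = 1"
 by (simp add: sg_def)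

lemma sg_conj: "\<sigma> \<in> Sn n \<Longrightarrow> \<alpha> \<in> S0 n \<Longrightarrow> sg (conj_by \<sigma> \<alpha>) = sg \<alpha>"
proof -
 assume s: "\<sigma> \<in> Sn n" and a: "\<alpha> \<in> S0 n"
 have p: "permutation \<sigma>" "permutation \<alpha>" "permutation (inv \<sigma>)"
  using S0_permutation Sn_S0 Sn_inv s a by blast+
 have "sg (conj_by \<sigma> \<alpha>) = sg \<sigma> * sg \<alpha> * sg (inv \<sigma>)"
  unfolding conj_by_def using p by (simp add: sg_comp permutation_compose)
 also have "\<dots> = sg \<alpha> * (sg \<sigma> * sg \<sigma>)" using sg_inv[OF p(1)] by (simp add: mult_ac)
 finally show ?thesis by simp
qed

lemma entry_cong:
 assumes \<alpha>: "\<alpha> \<in> S0 n" and F: "F \<in> hilbert_schmidt n" and W: "\<And>k. k \<in> {1..n} \<Longrightarrow> W k = W' k"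
 shows "entry n \<alpha> F a b W = entry n \<alpha> F a b W'"
proof -
 have "F (\<lambda>k. fst (W k)) = F (\<lambda>k. fst (W' k))"
  by (rule multilin_cong[of n]) (use F W in \<open>simp_all add: hilbert_schmidt_iff\<close>)
 moreover have "colf a W k = colf a W' k" "rowf b W k = rowf b W' k" if "k \<in> {0..n}" for k
  using W[of k] that by (simp_all add: colf_def rowf_def)
 moreover have "\<alpha> k \<in> {0..n}" if "k \<in> {0..n}" for k
  using permutes_in_image[OF S0_permutes[OF \<alpha>]] that by blast
 ultimately show ?thesis unfolding entry_def by simp
qed

lemma entry_conj:
 assumes \<sigma>: "\<sigma> \<in> Sn n" and \<alpha>: "\<alpha> \<in> S0 n"
 shows "entry n (conj_by \<sigma> \<alpha>) (\<lambda>x. F (x \<circ> \<sigma>)) a b W = entry n \<alpha> F a b (W \<circ> \<sigma>)"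
proof -
 have ps: "\<sigma> permutes {1..n}" by (rule Sn_permutes[OF \<sigma>])
 have s0: "\<sigma> 0 = 0" using permutes_not_in[OF ps, of 0] by simp
 have snz: "\<sigma> k = 0 \<longleftrightarrow> k = 0" for k using s0 permutes_inj[OF ps] by (metis injD)
 have r: "colf a (W \<circ> \<sigma>) k = colf a W (\<sigma> k)" "rowf b (W \<circ> \<sigma>) k = rowf b W (\<sigma> k)" for k
  by (simp_all add: colf_def rowf_def snz)
 have c: "conj_by \<sigma> \<alpha> (\<sigma> k) = \<sigma> (\<alpha> k)" for k
  using permutes_inverses(2)[OF ps] by (simp add: conj_by_def)
 have p0: "\<sigma> permutes {0..n}" by (rule S0_permutes[OF Sn_S0[OF \<sigma>]])
 have "(\<forall>k\<in>{0..n}. colf a W k = rowf b W (conj_by \<sigma> \<alpha> k)) \<longleftrightarrow>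
   (\<forall>k\<in>\<sigma> ` {0..n}. colf a W k = rowf b W (conj_by \<sigma> \<alpha> k))"
  by (simp only: permutes_image[OF p0])
 also have "\<dots> \<longleftrightarrow> (\<forall>k\<in>{0..n}. colf a (W \<circ> \<sigma>) k = rowf b (W \<circ> \<sigma>) (\<alpha> k))"
  unfolding ball_simps(9) c r by (rule refl)
 finally show ?thesis unfolding entry_def sg_conj[OF assms] by (simp add: comp_def)
qed

lemma Psi_cong:
 assumes "\<xi> \<in> U.families" and "\<And>k. k \<in> {1..n} \<Longrightarrow> W k = W' k"
 shows "Psi \<xi> n a b W = Psi \<xi> n a b W'"
 unfolding Psi_def by (rule sum.cong[OF refl]) (rule entry_cong[OF _ U.familiesD(5)[OF assms(1)] assms(2)])

lemma Psi_perm: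
 assumes \<xi>: "\<xi> \<in> U.families" and \<sigma>: "\<sigma> \<in> Sn n"
 shows "Psi \<xi> n a b (W \<circ> \<sigma>) = Psi \<xi> n a b W"
proof -
 have "Psi \<xi> n a b (W \<circ> \<sigma>) = (\<Sum>\<alpha>\<in>S0 n. entry n (conj_by \<sigma> \<alpha>) (\<xi> n (conj_by \<sigma> \<alpha>)) a b W)"
  unfolding Psi_def
 proof (rule sum.cong[OF refl])
  fix \<alpha> assume \<alpha>: "\<alpha> \<in> S0 n"
  have "\<xi> n (conj_by \<sigma> \<alpha>) = (\<lambda>x. \<xi> n \<alpha> (x \<circ> \<sigma>))" using U.familiesD(4)[OF \<xi> \<sigma> \<alpha>] by blast
  then show "entry n \<alpha> (\<xi> n \<alpha>) a b (W \<circ> \<sigma>) = entry n (conj_by \<sigma> \<alpha>) (\<xi> n (conj_by \<sigma> \<alpha>)) a b W"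
   using entry_conj[OF \<sigma> \<alpha>] by simp
 qed
 also have "\<dots> = Psi \<xi> n a b W"
  unfolding Psi_def by (rule sum.reindex_bij_betw[OF bij_conj[OF \<sigma>]])
 finally show ?thesis .
qed

text \<open>Conjugating \<open>\<alpha>\<close> renames the positions of the letters, and the coefficients of a family are invariant under
 that, so only the multiset of letters matters.\<close>

lemma Psi_mset:
 assumes \<xi>: "\<xi> \<in> U.families" and m: "mset (map W [1..<Suc n]) = mset (map W' [1..<Suc n])"
 shows "Psi \<xi> n a b W = Psi \<xi> n a b W'"
proof -
 from mset_eq_permutation[OF m] obtain f where f: "f permutes {..<length (map W' [1..<Suc n])}"
  and pl: "permute_list f (map W' [1..<Suc n]) = map W [1..<Suc n]" .
 have f': "f permutes {..<n}" using f by (simp del: upt_Suc)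
 define \<sigma> where "\<sigma> k = (if k \<in> {1..n} then Suc (f (k - 1)) else k)" for k
 have fin: "f i < n \<longleftrightarrow> i < n" for i using permutes_in_image[OF f', of i] by simp
 have "bij_betw \<sigma> {1..n} {1..n}"
 proof (rule bij_betwI[of _ _ _ "\<lambda>k. Suc (inv f (k - 1))"])
  have inv: "inv f i < n \<longleftrightarrow> i < n" for i using permutes_in_image[OF permutes_inv[OF f'], of i] by simp
  show "\<sigma> \<in> {1..n} \<rightarrow> {1..n}"
  proof
   fix k assume k: "k \<in> {1..n}"
   then have "f (k - 1) < n" unfolding fin by auto
   then show "\<sigma> k \<in> {1..n}" using k by (simp add: \<sigma>_def)
  qed
  show "(\<lambda>k. Suc (inv f (k - 1))) \<in> {1..n} \<rightarrow> {1..n}"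
  proof
   fix k assume k: "k \<in> {1..n}"
   then have "inv f (k - 1) < n" unfolding inv by auto
   then show "Suc (inv f (k - 1)) \<in> {1..n}" by simp
  qed
  show "Suc (inv f (\<sigma> k - 1)) = k" if "k \<in> {1..n}" for k
   using that permutes_inverses(2)[OF f', of "k - 1"] by (simp add: \<sigma>_def)
  show "\<sigma> (Suc (inv f (k - 1))) = k" if k: "k \<in> {1..n}" for k
  proof -
   have "inv f (k - 1) < n" using k unfolding inv by auto
   then show ?thesis using k permutes_inverses(1)[OF f', of "k - 1"] by (simp add: \<sigma>_def)
  qed
 qed
 then have \<sigma>: "\<sigma> \<in> Sn n" unfolding Sn_def by (auto intro!: bij_imp_permutes simp: \<sigma>_def)
 have "W k = (W' \<circ> \<sigma>) k" if k: "k \<in> {1..n}" for k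
 proof -
  have k1: "k - 1 < n" using k by auto
  then have "map W [1..<Suc n] ! (k - 1) = map W' [1..<Suc n] ! f (k - 1)"
   unfolding pl[symmetric] by (intro permute_list_nth[OF f]) (simp del: upt_Suc)
  also have "map W [1..<Suc n] ! (k - 1) = W k" using nth_word[OF k1, of W] k by simp
  also have "map W' [1..<Suc n] ! f (k - 1) = W' (Suc (f (k - 1)))"
   by (rule nth_word) (use fin k1 in blast)
  also have "\<dots> = (W' \<circ> \<sigma>) k" using k by (simp add: \<sigma>_def)
  finally show ?thesis .
 qed
 then have "Psi \<xi> n a b W = Psi \<xi> n a b (W' \<circ> \<sigma>)" by (rule Psi_cong[OF \<xi>])
 then show ?thesis using Psi_perm[OF \<xi> \<sigma>] by simp
qed

lemma word_map: "map (\<lambda>k. w ! (k - 1)) [1..<Suc (length w)] = w"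
 by (rule nth_equalityI) (simp_all del: upt_Suc)

lemma Phi_map:
 assumes \<xi>: "\<xi> \<in> U.families" and "a < N" "b < N" and W: "\<And>k. k \<in> {1..n} \<Longrightarrow> W k \<in> L" and m: "mset w = mset (map W [1..<Suc n])"
 shows "Phi \<xi> a b w = scale n * Psi \<xi> n a b W"
proof -
 have len: "length w = n" using mset_eq_length[OF m] by (simp del: upt_Suc)
 have "map W [1..<Suc n] \<in> words" using W by (auto simp del: upt_Suc)
 then have "w \<in> words" using mset_words[OF m[symmetric]] by blast
 moreover have "Psi \<xi> n a b (\<lambda>k. w ! (k - 1)) = Psi \<xi> n a b W"
  by (rule Psi_mset[OF \<xi>]) (use m word_map[of w] len in \<open>simp del: upt_Suc\<close>)
 ultimately show ?thesis using assms len by (simp add: Phi_def)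
qed

lemma Phi_symmetric:
 assumes \<xi>: "\<xi> \<in> U.families"
 shows "symmetric (Phi \<xi> a b)"
 unfolding symmetric_def
proof (intro allI impI)
 fix u v assume u: "u \<in> words" and m: "mset u = mset v"
 have v: "v \<in> words" using mset_words[OF m u] .
 have len: "length u = length v" by (rule mset_eq_length[OF m])
 show "Phi \<xi> a b u = Phi \<xi> a b v"
 proof (cases "a < N \<and> b < N")
  case True
  have "Phi \<xi> a b u = scale (length v) * Psi \<xi> (length v) a b (\<lambda>k. v ! (k - 1))"
  proof (rule Phi_map[OF \<xi>])
   show "v ! (k - 1) \<in> L" if "k \<in> {1..length v}" for k using v that by (auto simp: in_lists_conv_set)
   show "mset u = mset (map (\<lambda>k. v ! (k - 1)) [1..<Suc (length v)])" unfolding word_map by (rule m)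
  qed (use True in auto)
  then show ?thesis using True v by (simp add: Phi_def)
 qed (auto simp: Phi_def)
qed

lemma entry_ell2:
 assumes F: "F \<in> hilbert_schmidt n"
 shows "ell2 (entry n \<alpha> F a b) ({1..n} \<rightarrow>\<^sub>E L)"
proof -
 have "ell2 (\<lambda>(e, c). F e * 1) (({1..n} \<rightarrow>\<^sub>E onb) \<times> ({1..n} \<rightarrow>\<^sub>E {..<N} \<times> {..<N}))"
  by (rule ell2_times(1)) (use F in \<open>auto simp: hilbert_schmidt_iff intro!: ell2_finite finite_PiE\<close>)
 also have "(\<lambda>(e, c). F e * 1) = (\<lambda>p. (\<lambda>W. F (\<lambda>k. fst (W k))) (case p of (e, c) \<Rightarrow> \<lambda>i\<in>{1..n}. (e i, c i :: nat \<times> nat)))"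
 proof
  fix p :: "(nat \<Rightarrow> 'a) \<times> (nat \<Rightarrow> nat \<times> nat)"
  have "F (fst p) = F (\<lambda>k. fst ((\<lambda>i\<in>{1..n}. (fst p i, snd p i)) k))"
   by (rule multilin_cong[of n]) (use F in \<open>auto simp: hilbert_schmidt_iff\<close>)
  then show "(case p of (e, c) \<Rightarrow> F e * 1) =
    (\<lambda>W. F (\<lambda>k. fst (W k))) (case p of (e, c) \<Rightarrow> \<lambda>i\<in>{1..n}. (e i, c i))" by (simp add: case_prod_unfold)
 qed
 finally have "ell2 (\<lambda>W. F (\<lambda>k. fst (W k))) ({1..n} \<rightarrow>\<^sub>E L)"
  unfolding L_def by (rule ell2_reindex[OF bij_PiE_pair, THEN iffD1])
 then show ?thesis
  by (rule ell2_comparison) (auto simp: entry_def abs_sg norm_mult)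
qed

lemma ell2_sum:
 assumes "finite I" "\<And>i. i \<in> I \<Longrightarrow> ell2 (f i) A"
 shows "ell2 (\<lambda>x. \<Sum>i\<in>I. f i x) A"
 using assms by (induction I) (simp_all add: ell2_add, simp add: ell2_def)

lemma Phi_len:
 assumes "\<xi> \<in> U.families" "length w \<notin> degs \<xi>"
 shows "Phi \<xi> a b w = 0"
proof -
 have "entry (length w) \<alpha> (\<xi> (length w) \<alpha>) a b W = 0" for \<alpha> W
  unfolding entry_def U.degs_zero[OF assms(2)] by simp
 then show ?thesis by (simp add: Phi_def Psi_def)
qed

lemma Phi_word:
 assumes \<xi>: "\<xi> \<in> U.families" and ab: "a < N" "b < N" and W: "W \<in> {1..n} \<rightarrow>\<^sub>E L"
 shows "Phi \<xi> a b (map W [1..<Suc n]) = scale n * Psi \<xi> n a b W"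
 by (rule Phi_map[OF \<xi> ab]) (use W in auto)

lemma words_by_length:
 fixes f :: "'a letter list \<Rightarrow> complex"
 assumes D: "finite D" "\<And>w. w \<in> words \<Longrightarrow> length w \<notin> D \<Longrightarrow> f w = 0"
  and s: "\<And>n. n \<in> D \<Longrightarrow> ((\<lambda>W. f (map W [1..<Suc n])) has_sum S n) ({1..n} \<rightarrow>\<^sub>E L)"
 shows "(f has_sum (\<Sum>n\<in>D. S n)) words"
proof -
 have 1: "(f has_sum S n) {w \<in> words. length w = n}" if "n \<in> D" for n
  using has_sum_reindex_bij_betw[OF bij_words[of n L], of f "S n"] s[OF that] by blast
 have "(f has_sum (\<Sum>n\<in>D. S n)) (\<Union>n\<in>D. {w \<in> words. length w = n})"
  by (rule sum_has_sum[OF D(1) 1]) auto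
 also have "?this \<longleftrightarrow> (f has_sum (\<Sum>n\<in>D. S n)) words"
  by (rule has_sum_cong_neutral) (use D(2) in auto)
 finally show ?thesis .
qed

lemma Psi_ell2:
 assumes "\<xi> \<in> U.families"
 shows "ell2 (Psi \<xi> n a b) ({1..n} \<rightarrow>\<^sub>E L)"
proof -
 have "ell2 (\<lambda>W. \<Sum>\<alpha>\<in>S0 n. entry n \<alpha> (\<xi> n \<alpha>) a b W) ({1..n} \<rightarrow>\<^sub>E L)"
  by (rule ell2_sum[OF finite_S0 entry_ell2[OF U.familiesD(5)[OF assms]]])
 then show ?thesis unfolding Psi_def[abs_def] .
qed

lemma Phi_ell2:
 assumes \<xi>: "\<xi> \<in> U.families"
 shows "ell2 (Phi \<xi> a b) words"
proof (cases "a < N \<and> b < N")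
 case True
 have "((\<lambda>W. complex_of_real ((cmod (Phi \<xi> a b (map W [1..<Suc n])))\<^sup>2)) has_sum
   of_real (norm2 (\<lambda>W. scale n * Psi \<xi> n a b W) ({1..n} \<rightarrow>\<^sub>E L))) ({1..n} \<rightarrow>\<^sub>E L)" for n
 proof -
  have "ell2 (\<lambda>W. scale n * Psi \<xi> n a b W) ({1..n} \<rightarrow>\<^sub>E L)" by (rule ell2_cmult[OF Psi_ell2[OF \<xi>]])
  then have "((\<lambda>W. (cmod (scale n * Psi \<xi> n a b W))\<^sup>2) has_sum norm2 (\<lambda>W. scale n * Psi \<xi> n a b W) ({1..n} \<rightarrow>\<^sub>E L)) ({1..n} \<rightarrow>\<^sub>E L)"
   unfolding ell2_def norm2_def by (rule has_sum_infsum)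
  from has_sum_of_real[OF this, where 'a = complex]
  show ?thesis
   by (rule has_sum_cong[THEN iffD1, rotated]) (use Phi_word[OF \<xi>] True in simp)
 qed
 from words_by_length[OF U.familiesD(1)[OF \<xi>] _ this]
 have "((\<lambda>w. complex_of_real ((cmod (Phi \<xi> a b w))\<^sup>2)) has_sum
   (\<Sum>n\<in>degs \<xi>. of_real (norm2 (\<lambda>W. scale n * Psi \<xi> n a b W) ({1..n} \<rightarrow>\<^sub>E L)))) words"
  using Phi_len[OF \<xi>] by simp
 then have "((\<lambda>w. complex_of_real ((cmod (Phi \<xi> a b w))\<^sup>2)) has_sum
   of_real (\<Sum>n\<in>degs \<xi>. (norm2 (\<lambda>W. scale n * Psi \<xi> n a b W) ({1..n} \<rightarrow>\<^sub>E L)))) words"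
  by (simp only: of_real_sum)
 then show ?thesis
  unfolding ell2_def has_sum_of_real_iff by (rule has_sum_imp_summable)
next
 case False
 then have "Phi \<xi> a b = (\<lambda>_. 0)" by (auto simp: Phi_def fun_eq_iff)
 then show ?thesis by (simp add: ell2_def)
qed

lemma Phi_tame:
 assumes \<xi>: "\<xi> \<in> U.families"
 shows "tame (Phi \<xi> a b)"
proof -
 have "Phi \<xi> a b w = 0" if "Max (insert 0 (degs \<xi>)) < length w" for w
 proof (rule Phi_len[OF \<xi>])
  show "length w \<notin> degs \<xi>"
   using that U.familiesD(1)[OF \<xi>] by auto
 qed
 then show ?thesis unfolding tame_def using Phi_symmetric[OF \<xi>] Phi_ell2[OF \<xi>] by blast
qed

end

section \<open>Extending projections to completions\<close>

locale hermitian_space =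
 fixes V :: "'v ipspace"
 assumes add_in: "x \<in> carr V \<Longrightarrow> y \<in> carr V \<Longrightarrow> vadd V x y \<in> carr V"
  and scl_in: "x \<in> carr V \<Longrightarrow> vscl V c x \<in> carr V"
  and ip_add: "x \<in> carr V \<Longrightarrow> y \<in> carr V \<Longrightarrow> z \<in> carr V \<Longrightarrow> ip V (vadd V x y) z = ip V x z + ip V y z"
  and ip_scl: "x \<in> carr V \<Longrightarrow> y \<in> carr V \<Longrightarrow> ip V (vscl V c x) y = c * ip V x y"
  and ip_cnj: "x \<in> carr V \<Longrightarrow> y \<in> carr V \<Longrightarrow> ip V y x = cnj (ip V x y)"
  and ip_pos: "x \<in> carr V \<Longrightarrow> 0 \<le> Re (ip V x x)"
begin

abbreviation N where "N \<equiv> vnorm V"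

lemma sub_in: "x \<in> carr V \<Longrightarrow> y \<in> carr V \<Longrightarrow> vsub V x y \<in> carr V"
 by (simp add: vsub_def add_in scl_in)

lemma ip_sub: "x \<in> carr V \<Longrightarrow> y \<in> carr V \<Longrightarrow> z \<in> carr V \<Longrightarrow> ip V (vsub V x y) z = ip V x z - ip V y z"
 by (simp add: vsub_def ip_add ip_scl scl_in)

lemma ip_add2: "x \<in> carr V \<Longrightarrow> y \<in> carr V \<Longrightarrow> z \<in> carr V \<Longrightarrow> ip V z (vadd V x y) = ip V z x + ip V z y"
 using ip_cnj[of "vadd V x y" z] ip_cnj[of x z] ip_cnj[of y z] by (simp add: ip_add add_in)

lemma ip_scl2: "x \<in> carr V \<Longrightarrow> z \<in> carr V \<Longrightarrow> ip V z (vscl V c x) = cnj c * ip V z x"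
 using ip_cnj[of "vscl V c x" z] ip_cnj[of x z] by (simp add: ip_scl scl_in)

lemma ip_sub2: "x \<in> carr V \<Longrightarrow> y \<in> carr V \<Longrightarrow> z \<in> carr V \<Longrightarrow> ip V z (vsub V x y) = ip V z x - ip V z y"
 by (simp add: vsub_def ip_add2 ip_scl2 scl_in)

lemmas ip_simps = add_in scl_in sub_in ip_add ip_scl ip_sub ip_add2 ip_scl2 ip_sub2

lemma ip_self: "x \<in> carr V \<Longrightarrow> ip V x x = of_real ((N x)\<^sup>2)"
 using ip_cnj[of x x] ip_pos[of x] by (simp add: vnorm_def complex_eq_iff)

lemma N_nonneg: "x \<in> carr V \<Longrightarrow> 0 \<le> N x"
 using ip_pos[of x] by (simp add: vnorm_def)

lemma N_sq: "x \<in> carr V \<Longrightarrow> (N x)\<^sup>2 = Re (ip V x x)"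
 using ip_pos[of x] by (simp add: vnorm_def)

lemma Cauchy_Schwarz:
 assumes x: "x \<in> carr V" and y: "y \<in> carr V"
 shows "cmod (ip V x y) \<le> N x * N y"
proof (rule power2_le_imp_le)
 define a where "a = ip V x y"
 define A where "A = (cmod a)\<^sup>2"
 have yx: "ip V y x = cnj a" using ip_cnj[OF x y] by (simp add: a_def)
 have ineq: "0 \<le> (N x)\<^sup>2 - 2 * t * A + t\<^sup>2 * A * (N y)\<^sup>2" for t
 proof -
  let ?z = "vsub V x (vscl V (of_real t * a) y)"
  have "ip V ?z ?z = of_real ((N x)\<^sup>2) - of_real (2 * t) * (a * cnj a) + of_real (t\<^sup>2 * (N y)\<^sup>2) * (a * cnj a)"
   using x y by (simp add: ip_simps yx ip_self[OF x] ip_self[OF y] flip: a_def) (simp add: algebra_simps power2_eq_square)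
  also have "a * cnj a = of_real A" by (simp add: A_def complex_norm_square[symmetric])
  finally have "Re (ip V ?z ?z) = (N x)\<^sup>2 - 2 * t * A + t\<^sup>2 * (N y)\<^sup>2 * A" by simp
  then show ?thesis using ip_pos[of ?z] x y by (simp add: ip_simps mult_ac)
 qed
 show "(cmod (ip V x y))\<^sup>2 \<le> (N x * N y)\<^sup>2"
 proof (cases "(N y)\<^sup>2 = 0")
  case True
  have "A \<le> 0"
  proof (rule ccontr)
   assume "\<not> A \<le> 0"
   then show False using ineq[of "((N x)\<^sup>2 + 1) / (2 * A)"] True by (simp add: field_simps)
  qed
  then show ?thesis by (simp add: A_def a_def power_mult_distrib)
 next
  case False
  define Y where "Y = (N y)\<^sup>2"
  have Y: "0 < Y" using False by (simp add: Y_def)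
  have "(1 / Y)\<^sup>2 * A * Y = A / Y" using Y by (simp add: power2_eq_square)
  then have "A / Y \<le> (N x)\<^sup>2" using ineq[of "1 / Y"] by (simp flip: Y_def)
  then have "A \<le> (N x)\<^sup>2 * (N y)\<^sup>2" using Y by (simp add: pos_divide_le_eq flip: Y_def)
  then show ?thesis by (simp add: A_def a_def power_mult_distrib)
 qed
qed (simp add: N_nonneg x y)

lemma N_add: "a \<in> carr V \<Longrightarrow> b \<in> carr V \<Longrightarrow> N (vadd V a b) \<le> N a + N b"
proof (rule power2_le_imp_le)
 assume ab: "a \<in> carr V" "b \<in> carr V"
 have "(N (vadd V a b))\<^sup>2 = (N a)\<^sup>2 + (N b)\<^sup>2 + 2 * Re (ip V a b)"
  using ab ip_cnj[OF ab] by (simp add: N_sq ip_simps)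
 also have "Re (ip V a b) \<le> N a * N b"
  using Cauchy_Schwarz[OF ab] complex_Re_le_cmod[of "ip V a b"] by linarith
 finally show "(N (vadd V a b))\<^sup>2 \<le> (N a + N b)\<^sup>2" by (simp add: power2_sum)
qed (simp add: N_nonneg)

lemma N_eqI:
 assumes "x \<in> carr V" "y \<in> carr V" "Re (ip V x x) = Re (ip V y y)"
 shows "N x = N y"
 using assms by (simp add: vnorm_def)

lemma N_eq_weak:
 assumes x: "x \<in> carr V" and y: "y \<in> carr V" and e: "\<And>z. z \<in> carr V \<Longrightarrow> ip V x z = ip V y z"
 shows "N x = N y"
proof (rule N_eqI[OF x y])
 have "ip V x x = cnj (ip V x y)" using e[OF x] ip_cnj[OF x y] by simp
 then show "Re (ip V x x) = Re (ip V y y)" using e[OF y] by simp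
qed

lemma N_triangle:
 assumes "x \<in> carr V" "y \<in> carr V" "z \<in> carr V"
 shows "N (vsub V x z) \<le> N (vsub V x y) + N (vsub V y z)"
proof -
 have "N (vsub V x z) = N (vadd V (vsub V x y) (vsub V y z))"
  by (rule N_eqI) (use assms in \<open>simp_all add: ip_simps\<close>)
 also have "\<dots> \<le> N (vsub V x y) + N (vsub V y z)" by (rule N_add) (use assms in \<open>simp_all add: ip_simps\<close>)
 finally show ?thesis .
qed

lemma N_sym: "x \<in> carr V \<Longrightarrow> y \<in> carr V \<Longrightarrow> N (vsub V x y) = N (vsub V y x)"
 by (rule N_eqI) (simp_all add: ip_simps)

lemma N_self: "x \<in> carr V \<Longrightarrow> N (vsub V x x) = 0"
 by (simp add: vnorm_def ip_simps)

lemma cauchy_in: "X \<in> cauchy_seqs V \<Longrightarrow> X n \<in> carr V"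
 by (simp add: cauchy_seqs_def)

lemma seq_class_self: "X \<in> cauchy_seqs V \<Longrightarrow> X \<in> seq_class V X"
 by (simp add: seq_class_def N_self cauchy_in)

lemma rep_seq_class:
 assumes "X \<in> cauchy_seqs V"
 shows "rep (seq_class V X) \<in> cauchy_seqs V" "(\<lambda>n. N (vsub V (X n) (rep (seq_class V X) n))) \<longlonglongrightarrow> 0"
proof -
 have "rep (seq_class V X) \<in> seq_class V X"
  unfolding rep_def by (rule someI[where P = "\<lambda>Z. Z \<in> seq_class V X", OF seq_class_self[OF assms]])
 then show "rep (seq_class V X) \<in> cauchy_seqs V" "(\<lambda>n. N (vsub V (X n) (rep (seq_class V X) n))) \<longlonglongrightarrow> 0"
  by (simp_all add: seq_class_def)
qed

lemma null_trans:
 assumes "\<And>n. X n \<in> carr V" "\<And>n. Y n \<in> carr V" "\<And>n. Z n \<in> carr V"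
  and "(\<lambda>n. N (vsub V (X n) (Y n))) \<longlonglongrightarrow> 0" "(\<lambda>n. N (vsub V (Y n) (Z n))) \<longlonglongrightarrow> 0"
 shows "(\<lambda>n. N (vsub V (X n) (Z n))) \<longlonglongrightarrow> 0"
proof (rule tendsto_sandwich[OF _ _ tendsto_const])
 show "(\<lambda>n. N (vsub V (X n) (Y n)) + N (vsub V (Y n) (Z n))) \<longlonglongrightarrow> 0"
  using tendsto_add[OF assms(4,5)] by simp
qed (use assms(1-3) in \<open>auto intro!: always_eventually N_triangle N_nonneg sub_in\<close>)

lemma seq_class_eqI:
 assumes X: "X \<in> cauchy_seqs V" and Y: "Y \<in> cauchy_seqs V" and XY: "(\<lambda>n. N (vsub V (X n) (Y n))) \<longlonglongrightarrow> 0"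
 shows "seq_class V X = seq_class V Y"
proof -
 have YX: "(\<lambda>n. N (vsub V (Y n) (X n))) \<longlonglongrightarrow> 0"
  using XY N_sym[OF cauchy_in[OF X] cauchy_in[OF Y]] by simp
 have sub: "seq_class V X \<subseteq> seq_class V Y"
  if X: "X \<in> cauchy_seqs V" and Y: "Y \<in> cauchy_seqs V" and YX: "(\<lambda>n. N (vsub V (Y n) (X n))) \<longlonglongrightarrow> 0" for X Y
 proof
  fix Z assume "Z \<in> seq_class V X"
  then have Z: "Z \<in> cauchy_seqs V" "(\<lambda>n. N (vsub V (X n) (Z n))) \<longlonglongrightarrow> 0" by (simp_all add: seq_class_def)
  then show "Z \<in> seq_class V Y"
   using null_trans[of Y X Z, OF cauchy_in[OF Y] cauchy_in[OF X] cauchy_in[OF Z(1)] YX Z(2)]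
   by (simp add: seq_class_def)
 qed
 show ?thesis using sub[OF X Y YX] sub[OF Y X XY] by (rule subset_antisym)
qed

lemma cauchy_const: "x \<in> carr V \<Longrightarrow> (\<lambda>_. x) \<in> cauchy_seqs V"
 by (simp add: cauchy_seqs_def N_self)

lemma cauchy_lipschitz:
 assumes X: "X \<in> cauchy_seqs V" and Y: "\<And>n. Y n \<in> carr V"
  and le: "\<And>m n. N (vsub V (Y m) (Y n)) \<le> N (vsub V (X m) (X n))"
 shows "Y \<in> cauchy_seqs V"
 unfolding cauchy_seqs_def
proof (intro CollectI conjI allI impI Y)
 fix e :: real assume "0 < e"
 then obtain M where "\<forall>m\<ge>M. \<forall>n\<ge>M. N (vsub V (X m) (X n)) < e" using X unfolding cauchy_seqs_def by blast
 then show "\<exists>M. \<forall>m\<ge>M. \<forall>n\<ge>M. N (vsub V (Y m) (Y n)) < e" by (meson le order_le_less_trans)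
qed

lemma cauchy_add:
 assumes X: "X \<in> cauchy_seqs V" and Y: "Y \<in> cauchy_seqs V"
 shows "(\<lambda>n. vadd V (X n) (Y n)) \<in> cauchy_seqs V"
 unfolding cauchy_seqs_def
proof (intro CollectI conjI allI impI)
 show "vadd V (X n) (Y n) \<in> carr V" for n by (intro add_in cauchy_in X Y)
 fix e :: real assume "0 < e"
 then have "0 < e / 2" by simp
 obtain M1 where M1: "\<forall>m\<ge>M1. \<forall>n\<ge>M1. N (vsub V (X m) (X n)) < e / 2"
  using X \<open>0 < e / 2\<close> unfolding cauchy_seqs_def by blast
 obtain M2 where M2: "\<forall>m\<ge>M2. \<forall>n\<ge>M2. N (vsub V (Y m) (Y n)) < e / 2"
  using Y \<open>0 < e / 2\<close> unfolding cauchy_seqs_def by blast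
 have "N (vsub V (vadd V (X m) (Y m)) (vadd V (X n) (Y n))) < e" if "max M1 M2 \<le> m" "max M1 M2 \<le> n" for m n
 proof -
  have "N (vsub V (vadd V (X m) (Y m)) (vadd V (X n) (Y n))) =
    N (vadd V (vsub V (X m) (X n)) (vsub V (Y m) (Y n)))"
   by (rule N_eqI) (simp_all add: ip_simps cauchy_in[OF X] cauchy_in[OF Y])
  also have "\<dots> \<le> N (vsub V (X m) (X n)) + N (vsub V (Y m) (Y n))"
   by (intro N_add sub_in cauchy_in X Y)
  finally show ?thesis using M1[rule_format, of m n] M2[rule_format, of m n] that by simp
 qed
 then show "\<exists>M. \<forall>m\<ge>M. \<forall>n\<ge>M. N (vsub V (vadd V (X m) (Y m)) (vadd V (X n) (Y n))) < e"
  by (intro exI[of _ "max M1 M2"] allI impI)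
qed

lemma cauchy_bounded:
 assumes X: "X \<in> cauchy_seqs V"
 shows "\<exists>K. \<forall>n. N (X n) \<le> K"
proof -
 obtain M where M: "\<forall>m\<ge>M. \<forall>n\<ge>M. N (vsub V (X m) (X n)) < 1"
  using X zero_less_one unfolding cauchy_seqs_def by blast
 have "N (X n) \<le> (\<Sum>k\<le>M. N (X k)) + 1" for n
 proof (cases "n \<le> M")
  case True
  then have "N (X n) \<le> (\<Sum>k\<le>M. N (X k))" by (intro member_le_sum) (auto intro: N_nonneg cauchy_in X)
  then show ?thesis by simp
 next
  case False
  have "N (X n) = N (vadd V (vsub V (X n) (X M)) (X M))"
   by (rule N_eqI) (simp_all add: ip_simps cauchy_in[OF X])
  also have "\<dots> \<le> N (vsub V (X n) (X M)) + N (X M)" by (intro N_add sub_in cauchy_in X)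
  also have "N (X M) \<le> (\<Sum>k\<le>M. N (X k))" by (intro member_le_sum) (auto intro: N_nonneg cauchy_in X)
  finally show ?thesis using M[rule_format, of n M] False by simp
 qed
 then show ?thesis by blast
qed

lemma ip_limit:
 assumes a: "\<And>n. a n \<in> carr V" and b: "\<And>n. b n \<in> carr V"
  and a': "\<And>n. a' n \<in> carr V" and b': "\<And>n. b' n \<in> carr V"
  and bd: "\<And>n. N (a n) \<le> K" "\<And>n. N (b' n) \<le> K'"
  and aa: "(\<lambda>n. N (vsub V (a' n) (a n))) \<longlonglongrightarrow> 0" and bb: "(\<lambda>n. N (vsub V (b' n) (b n))) \<longlonglongrightarrow> 0"
  and z: "\<And>n. ip V (a n) (b n) = 0"
 shows "(\<lambda>n. ip V (a' n) (b' n)) \<longlonglongrightarrow> 0"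
proof (rule Lim_null_comparison)
 show "(\<lambda>n. N (vsub V (a' n) (a n)) * K' + K * N (vsub V (b' n) (b n))) \<longlonglongrightarrow> 0"
  using tendsto_add[OF tendsto_mult_right[OF aa, of K'] tendsto_mult_left[OF bb, of K]] by simp
 have "cmod (ip V (a' n) (b' n)) \<le> N (vsub V (a' n) (a n)) * K' + K * N (vsub V (b' n) (b n))" for n
 proof -
  have "ip V (a' n) (b' n) = ip V (vsub V (a' n) (a n)) (b' n) + ip V (a n) (vsub V (b' n) (b n))"
   using z[of n] by (simp add: ip_simps a b a' b')
  then have "cmod (ip V (a' n) (b' n)) \<le> cmod (ip V (vsub V (a' n) (a n)) (b' n)) + cmod (ip V (a n) (vsub V (b' n) (b n)))"
   by (simp only: norm_triangle_ineq)
  also have "\<dots> \<le> N (vsub V (a' n) (a n)) * N (b' n) + N (a n) * N (vsub V (b' n) (b n))"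
   by (intro add_mono Cauchy_Schwarz sub_in a b a' b')
  also have "\<dots> \<le> N (vsub V (a' n) (a n)) * K' + K * N (vsub V (b' n) (b n))"
   by (intro add_mono mult_left_mono mult_right_mono bd N_nonneg sub_in a b a' b')
  finally show ?thesis .
 qed
 then show "\<forall>\<^sub>F n in sequentially. norm (ip V (a' n) (b' n)) \<le> N (vsub V (a' n) (a n)) * K' + K * N (vsub V (b' n) (b n))"
  by simp
qed

text \<open>A map that is an orthogonal projection on a dense subspace is a contraction there, so it extends
 along Cauchy sequences.\<close>

lemma projection_extends:
 assumes SV: "S \<subseteq> carr V" and Ssub: "\<And>x y. x \<in> S \<Longrightarrow> y \<in> S \<Longrightarrow> vsub V x y \<in> S"
  and T0: "\<And>x. x \<in> carr V \<Longrightarrow> T0 x \<in> S"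
  and orth: "\<And>x y. x \<in> carr V \<Longrightarrow> y \<in> S \<Longrightarrow> ip V (vsub V x (T0 x)) y = 0"
 defines "T \<equiv> \<lambda>A. seq_class V (\<lambda>n. T0 (rep A n))"
 shows "orthogonal_projection (completion V) (completion_sub V S) T"
  and "\<And>x. x \<in> carr V \<Longrightarrow> T (embed V x) = embed V (T0 x)"
proof -
 have T0V: "T0 x \<in> carr V" if "x \<in> carr V" for x using T0[OF that] SV by blast
 have contr: "N (vsub V (T0 x) (T0 y)) \<le> N (vsub V x y)" if x: "x \<in> carr V" and y: "y \<in> carr V" for x y
 proof -
  let ?e = "vsub V (T0 x) (T0 y)"
  have e: "?e \<in> S" "?e \<in> carr V" using Ssub[OF T0[OF x] T0[OF y]] SV by auto
  have "ip V (vsub V x y) ?e - ip V ?e ?e = ip V (vsub V x (T0 x)) ?e - ip V (vsub V y (T0 y)) ?e"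
   using e x y T0V[OF x] T0V[OF y] by (simp add: ip_simps)
  also have "\<dots> = 0" using orth[OF x e(1)] orth[OF y e(1)] by simp
  finally have "of_real ((N ?e)\<^sup>2) = ip V (vsub V x y) ?e" using ip_self[OF e(2)] by simp
  then have "cmod (of_real ((N ?e)\<^sup>2)) \<le> N (vsub V x y) * N ?e"
   using Cauchy_Schwarz[OF sub_in[OF x y] e(2)] by (simp only:)
  then have "N ?e * N ?e \<le> N (vsub V x y) * N ?e"
   by (simp only: norm_of_real abs_power2) (simp only: power2_eq_square)
  then show ?thesis
   using N_nonneg[OF e(2)] N_nonneg[OF sub_in[OF x y]] by (cases "N ?e = 0") auto
 qed
 have small: "N (vsub V x (T0 x)) \<le> N x" if x: "x \<in> carr V" for x
 proof -
  let ?d = "vsub V x (T0 x)"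
  have d: "?d \<in> carr V" by (rule sub_in[OF x T0V[OF x]])
  have "ip V ?d ?d = ip V ?d x"
   using ip_sub2[OF x T0V[OF x] d] orth[OF x T0[OF x]] by simp
  then have "of_real ((N ?d)\<^sup>2) = ip V ?d x" using ip_self[OF d] by simp
  then have "cmod (of_real ((N ?d)\<^sup>2)) \<le> N ?d * N x" using Cauchy_Schwarz[OF d x] by (simp only:)
  then have "N ?d * N ?d \<le> N ?d * N x"
   by (simp only: norm_of_real abs_power2) (simp only: power2_eq_square)
  then show ?thesis using N_nonneg[OF d] N_nonneg[OF x] by (cases "N ?d = 0") auto
 qed
 have T0c: "(\<lambda>n. T0 (X n)) \<in> cauchy_seqs V" if "X \<in> cauchy_seqs V" for X
  by (rule cauchy_lipschitz[OF that]) (intro T0V contr cauchy_in that)+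
 show "T (embed V x) = embed V (T0 x)" if x: "x \<in> carr V" for x
 proof -
  let ?R = "rep (seq_class V (\<lambda>_. x))"
  have R: "?R \<in> cauchy_seqs V" "(\<lambda>n. N (vsub V x (?R n))) \<longlonglongrightarrow> 0"
   using rep_seq_class[OF cauchy_const[OF x]] by auto
  have "(\<lambda>n. N (vsub V (T0 (?R n)) (T0 x))) \<longlonglongrightarrow> 0"
  proof (rule tendsto_sandwich[OF _ _ tendsto_const R(2)])
   show "\<forall>\<^sub>F n in sequentially. N (vsub V (T0 (?R n)) (T0 x)) \<le> N (vsub V x (?R n))"
    using contr[OF cauchy_in[OF R(1)] x] N_sym[OF cauchy_in[OF R(1)] x] by simp
  qed (use N_nonneg sub_in T0V cauchy_in[OF R(1)] x in simp)
  then show ?thesis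
   unfolding T_def embed_def by (rule seq_class_eqI[OF T0c[OF R(1)] cauchy_const[OF T0V[OF x]]])
 qed
 show "orthogonal_projection (completion V) (completion_sub V S) T"
  unfolding orthogonal_projection_def
 proof (intro conjI ballI)
  show "completion_sub V S \<subseteq> carr (completion V)"
   by (auto simp: completion_sub_def completion_def)
  fix A assume "A \<in> carr (completion V)"
  then obtain X where X: "X \<in> cauchy_seqs V" "A = seq_class V X" by (auto simp: completion_def)
  define R where "R = rep A"
  have R: "R \<in> cauchy_seqs V" using rep_seq_class(1)[OF X(1)] by (simp add: R_def X)
  show TA: "T A \<in> completion_sub V S"
   using T0c[OF R] T0 cauchy_in[OF R] by (auto simp: T_def completion_sub_def R_def[symmetric])
  fix B assume "B \<in> completion_sub V S"
  then obtain Y where Y: "Y \<in> cauchy_seqs V" "\<And>n. Y n \<in> S" "B = seq_class V Y" by (auto simp: completion_sub_def)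
  define Q where "Q = rep (T A)"
  define D where "D = rep (seq_class V (\<lambda>n. vscl V (-1) (Q n)))"
  define E where "E = rep (seq_class V (\<lambda>n. vadd V (R n) (D n)))"
  define Z where "Z = rep B"
  have Q: "Q \<in> cauchy_seqs V" "(\<lambda>n. N (vsub V (T0 (R n)) (Q n))) \<longlonglongrightarrow> 0"
   using rep_seq_class[OF T0c[OF R]] by (simp_all add: Q_def T_def R_def)
  have scl: "N (vsub V (vscl V (-1) x) (vscl V (-1) y)) = N (vsub V x y)" if "x \<in> carr V" "y \<in> carr V" for x y
   by (rule N_eqI) (use that in \<open>simp_all add: ip_simps\<close>)
  have mQ: "(\<lambda>n. vscl V (-1) (Q n)) \<in> cauchy_seqs V"
   by (rule cauchy_lipschitz[OF Q(1)]) (simp_all add: scl scl_in cauchy_in[OF Q(1)])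
  have D: "D \<in> cauchy_seqs V" "(\<lambda>n. N (vsub V (vscl V (-1) (Q n)) (D n))) \<longlonglongrightarrow> 0"
   using rep_seq_class[OF mQ] by (simp_all add: D_def)
  have RD: "(\<lambda>n. vadd V (R n) (D n)) \<in> cauchy_seqs V" by (rule cauchy_add[OF R D(1)])
  have E: "E \<in> cauchy_seqs V" "(\<lambda>n. N (vsub V (vadd V (R n) (D n)) (E n))) \<longlonglongrightarrow> 0"
   using rep_seq_class[OF RD] by (simp_all add: E_def)
  have Z: "Z \<in> cauchy_seqs V" "(\<lambda>n. N (vsub V (Y n) (Z n))) \<longlonglongrightarrow> 0"
   using rep_seq_class[OF Y(1)] by (simp_all add: Z_def Y(3))
  note ins = cauchy_in[OF R] cauchy_in[OF Q(1)] cauchy_in[OF D(1)] cauchy_in[OF E(1)] cauchy_in[OF Z(1)]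
   cauchy_in[OF Y(1)] T0V[OF cauchy_in[OF R]]
  have "(\<lambda>n. ip V (E n) (Z n)) \<longlonglongrightarrow> 0"
  proof -
   from cauchy_bounded[OF R] obtain K where "\<forall>n. N (R n) \<le> K" ..
   then have K: "N (R n) \<le> K" for n ..
   from cauchy_bounded[OF Z(1)] obtain K' where "\<forall>n. N (Z n) \<le> K'" ..
   then have K': "N (Z n) \<le> K'" for n ..
   have "(\<lambda>n. N (vsub V (vadd V (R n) (D n)) (vsub V (R n) (T0 (R n))))) \<longlonglongrightarrow> 0"
   proof (rule tendsto_sandwich[OF _ _ tendsto_const])
    show "(\<lambda>n. N (vsub V (vscl V (-1) (Q n)) (D n)) + N (vsub V (T0 (R n)) (Q n))) \<longlonglongrightarrow> 0"
     using tendsto_add[OF D(2) Q(2)] by simp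
    have "N (vsub V (vadd V (R n) (D n)) (vsub V (R n) (T0 (R n)))) \<le>
      N (vsub V (vscl V (-1) (Q n)) (D n)) + N (vsub V (T0 (R n)) (Q n))" for n
    proof -
     have "N (vsub V (vadd V (R n) (D n)) (vsub V (R n) (T0 (R n)))) =
       N (vadd V (vscl V (-1) (vsub V (vscl V (-1) (Q n)) (D n))) (vsub V (T0 (R n)) (Q n)))"
      by (rule N_eq_weak) (simp_all add: ip_simps ins)
     also have "\<dots> \<le> N (vscl V (-1) (vsub V (vscl V (-1) (Q n)) (D n))) + N (vsub V (T0 (R n)) (Q n))"
      by (rule N_add) (simp_all add: scl_in sub_in ins)
     also have "N (vscl V (-1) (vsub V (vscl V (-1) (Q n)) (D n))) = N (vsub V (vscl V (-1) (Q n)) (D n))"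
      by (rule N_eqI) (simp_all add: ip_scl ip_scl2 scl_in sub_in ins)
     finally show ?thesis .
    qed
    then show "\<forall>\<^sub>F n in sequentially. N (vsub V (vadd V (R n) (D n)) (vsub V (R n) (T0 (R n)))) \<le>
      N (vsub V (vscl V (-1) (Q n)) (D n)) + N (vsub V (T0 (R n)) (Q n))" by simp
   qed (simp add: N_nonneg add_in sub_in ins)
   note RDA = this
   have ERD: "(\<lambda>n. N (vsub V (E n) (vadd V (R n) (D n)))) \<longlonglongrightarrow> 0"
    unfolding N_sym[OF cauchy_in[OF E(1)] cauchy_in[OF RD]] by (rule E(2))
   have EA: "(\<lambda>n. N (vsub V (E n) (vsub V (R n) (T0 (R n))))) \<longlonglongrightarrow> 0"
    by (rule null_trans[OF _ _ _ ERD RDA]) (rule ins cauchy_in[OF RD] sub_in)+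
   have ZY: "(\<lambda>n. N (vsub V (Z n) (Y n))) \<longlonglongrightarrow> 0"
    unfolding N_sym[OF cauchy_in[OF Z(1)] cauchy_in[OF Y(1)]] by (rule Z(2))
   show ?thesis
   proof (rule ip_limit[of "\<lambda>n. vsub V (R n) (T0 (R n))" Y E Z K K'])
    show "N (vsub V (R n) (T0 (R n))) \<le> K" for n by (rule order_trans[OF small[OF ins(1)] K])
    show "ip V (vsub V (R n) (T0 (R n))) (Y n) = 0" for n by (rule orth[OF ins(1) Y(2)])
   qed (rule EA ZY K' ins sub_in)+
  qed
  then have "lim (\<lambda>n. ip V (E n) (Z n)) = 0" by (rule limI)
  then show "ip (completion V) (vsub (completion V) A (T A)) B = 0"
   by (simp add: completion_def vsub_def E_def D_def R_def Q_def Z_def)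
 qed
qed

end

section \<open>Contractions in the matrix model\<close>

lemma has_sum_times_finite:
 fixes f :: "'i \<Rightarrow> complex"
 assumes f: "(f has_sum s) A" and B: "finite B"
 shows "((\<lambda>(x, y). f x * g y) has_sum (s * (\<Sum>y\<in>B. g y))) (A \<times> B)"
proof -
 have "((\<lambda>(x, y). f x * g y) has_sum (s * g y)) (A \<times> {y})" for y
 proof -
  have b: "bij_betw (\<lambda>x. (x, y)) A (A \<times> {y})" by (rule bij_betwI[of _ _ _ fst]) auto
  show ?thesis
   using has_sum_reindex_bij_betw[OF b, of "\<lambda>(x, y). f x * g y" "s * g y"] has_sum_cmult_left[OF f] by simp
 qed
 then have "((\<lambda>(x, y). f x * g y) has_sum (\<Sum>y\<in>B. s * g y)) (\<Union>y\<in>B. A \<times> {y})"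
  by (intro sum_has_sum B) auto
 moreover have "(\<Union>y\<in>B. A \<times> {y}) = A \<times> B" by auto
 ultimately show ?thesis by (simp add: sum_distrib_left)
qed

lemma shift_image: "shift n ` {0..k} = insert 0 {n + 1..n + k}"
proof (intro equalityI subsetI)
 fix x assume "x \<in> insert 0 {n + 1..n + k}"
 then have "x = shift n (x - n)" "x - n \<in> {0..k}" by (auto simp: shift_def)
 then show "x \<in> shift n ` {0..k}" by (rule image_eqI)
qed (auto simp: shift_def)

lemma shift_inj: "inj (shift n)"
 by (rule injI) (auto simp: shift_def split: if_splits)

definition shift_perm :: "nat \<Rightarrow> (nat \<Rightarrow> nat) \<Rightarrow> nat \<Rightarrow> nat" where
 "shift_perm n \<beta> = (\<lambda>x. if x \<in> {1..n} then x else shift n (\<beta> (if x = 0 then 0 else x - n)))"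

lemma shift_perm_map:
 assumes \<beta>: "\<beta> permutes {0..k}"
 shows "shift_perm n \<beta> = map_permutation {0..k} (shift n) \<beta>"
proof
 fix x
 have inj: "inj_on (shift n) {0..k}" by (rule inj_on_subset[OF shift_inj]) simp
 show "shift_perm n \<beta> x = map_permutation {0..k} (shift n) \<beta> x"
 proof (cases "x \<in> shift n ` {0..k}")
  case True
  then obtain j where j: "j \<in> {0..k}" "x = shift n j" by blast
  have "map_permutation {0..k} (shift n) \<beta> x = shift n (\<beta> j)"
   using True inv_into_f_f[OF inj j(1)] by (simp add: map_permutation_def restrict_id_def j)
  moreover have "shift_perm n \<beta> x = shift n (\<beta> j)" using j by (auto simp: shift_perm_def shift_def)
  ultimately show ?thesis by simp
 next
  case False
  then have x: "x \<in> {1..n} \<or> n + k < x" unfolding shift_image by auto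
  have "shift n (\<beta> (x - n)) = x" if "n + k < x"
   using permutes_not_in[OF \<beta>, of "x - n"] that by (auto simp: shift_def)
  then have "shift_perm n \<beta> x = x" using x by (auto simp: shift_perm_def)
  then show ?thesis using False by (simp add: map_permutation_def restrict_id_def)
 qed
qed

lemma shift_perm_permutes: "\<beta> permutes {0..k} \<Longrightarrow> shift_perm n \<beta> permutes {0..n + k}"
proof -
 assume \<beta>: "\<beta> permutes {0..k}"
 have "map_permutation {0..k} (shift n) \<beta> permutes shift n ` {0..k}"
  by (rule map_permutation_permutes[OF _ \<beta>]) (rule inj_on_imp_bij_betw[OF inj_on_subset[OF shift_inj subset_UNIV]])
 then show ?thesis unfolding shift_perm_map[OF \<beta>] shift_image by (rule permutes_subset) auto
qed

lemma perm_cup_eq: "perm_cup n \<alpha> \<beta> = shift_perm n \<beta> \<circ> \<alpha>"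
 by (simp add: perm_cup_def shift_perm_def)

lemma perm_cup_S0: "\<alpha> \<in> S0 n \<Longrightarrow> \<beta> \<in> S0 k \<Longrightarrow> perm_cup n \<alpha> \<beta> \<in> S0 (n + k)"
 unfolding perm_cup_eq S0_def
 by (auto intro!: permutes_compose shift_perm_permutes intro: permutes_subset)

context pair_partition
begin

abbreviation "m \<equiv> n + k - 2 * r"

lemma zero_supp: "0 \<notin> supp \<pi>"
 using supp_sub by auto

lemma perm0: "\<pi> permutes {0..n + k}"
 by (rule permutes_subset[OF perm]) auto

lemma contract_map:
 assumes \<gamma>: "\<gamma> permutes {0..n + k}"
 shows "contract_perm \<pi> \<gamma> =
  map_permutation ({0..n + k} - supp \<pi>) (inv u) (first_return (supp \<pi>) (\<pi> \<circ> \<gamma>))"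
proof
 interpret pm: perm_on "\<pi> \<circ> \<gamma>" "{0..n + k}" "supp \<pi>"
  by unfold_locales (use permutes_compose[OF \<gamma> perm0] supp_sub in auto)
 let ?A = "{0..n + k} - supp \<pi>"
 fix j
 have im: "inv u ` ?A = {0..m}" unfolding u_image_all0[symmetric] by (simp add: image_image)
 have inj: "inj_on (inv u) ?A" unfolding u_image_all0[symmetric] by (rule inj_onI) auto
 show "contract_perm \<pi> \<gamma> j = map_permutation ?A (inv u) (first_return (supp \<pi>) (\<pi> \<circ> \<gamma>)) j"
 proof (cases "j \<in> {0..m}")
  case True
  then have "u j \<in> ?A" using u_image_all0 by blast
  from inv_into_f_f[OF inj this] have "inv_into ?A (inv u) j = u j" by simp
  then show ?thesis using True by (simp add: map_permutation_def restrict_id_def im contract_perm_def)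
 next
  case False
  have "u j \<notin> ?A"
  proof
   assume "u j \<in> ?A"
   then have "inv u (u j) \<in> inv u ` ?A" by (rule imageI)
   then show False using False unfolding im by simp
  qed
  then have "first_return (supp \<pi>) (\<pi> \<circ> \<gamma>) (u j) = u j"
   by (rule permutes_not_in[OF pm.first_return_permutes])
  then show ?thesis using False by (simp add: map_permutation_def restrict_id_def im contract_perm_def)
 qed
qed

lemma contract_perm_S0:
 assumes \<gamma>: "\<gamma> permutes {0..n + k}"
 shows "contract_perm \<pi> \<gamma> \<in> S0 m"
proof -
 interpret pm: perm_on "\<pi> \<circ> \<gamma>" "{0..n + k}" "supp \<pi>"
  by unfold_locales (use permutes_compose[OF \<gamma> perm0] supp_sub in auto)
 have "map_permutation ({0..n + k} - supp \<pi>) (inv u) (first_return (supp \<pi>) (\<pi> \<circ> \<gamma>)) permutes {0..m}"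
  by (rule map_permutation_permutes[OF _ pm.first_return_permutes])
   (use inv_u_bij[of "{0..m}"] in \<open>simp only: u_image_all0\<close>)
 then show ?thesis unfolding contract_map[OF \<gamma>] S0_def by blast
qed

lemma sign_contract:
 assumes \<gamma>: "\<gamma> permutes {0..n + k}"
 shows "sign (contract_perm \<pi> \<gamma>) = (-1) ^ (card (inner_orbits (supp \<pi>) (\<pi> \<circ> \<gamma>)) + r) * sign \<gamma>"
proof -
 interpret pm: perm_on "\<pi> \<circ> \<gamma>" "{0..n + k}" "supp \<pi>"
  by unfold_locales (use permutes_compose[OF \<gamma> perm0] supp_sub in auto)
 let ?I = "card (inner_orbits (supp \<pi>) (\<pi> \<circ> \<gamma>))"
 let ?f = "first_return (supp \<pi>) (\<pi> \<circ> \<gamma>)"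
 have "inj_on (inv u) ({0..n + k} - supp \<pi>)"
  using inv_u_bij[of "{0..m}"] unfolding u_image_all0 by (rule bij_betw_imp_inj_on)
 then have "sign (contract_perm \<pi> \<gamma>) = sign ?f"
  unfolding contract_map[OF \<gamma>] by (rule sign_map_permutation[OF _ pm.first_return_permutes]) simp
 also have "sign ?f = (-1) ^ (card ({0..n + k} - supp \<pi>) + card (orbits_on ({0..n + k} - supp \<pi>) ?f))"
  by (rule sign_orbits[OF _ pm.first_return_permutes]) simp
 finally have f: "sign (contract_perm \<pi> \<gamma>) = \<dots>" .
 have Y: "card {0..n + k} = card ({0..n + k} - supp \<pi>) + 2 * r"
 proof -
  have "card ({0..n + k} - supp \<pi>) = card (u ` {0..m})" by (simp only: u_image_all0)
  also have "\<dots> = card {0..m}" by (rule card_image[OF inj_on_subset[OF u_inj subset_UNIV]])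
  finally show ?thesis using r_le by simp
 qed
 have "sign (\<pi> \<circ> \<gamma>) = (-1) ^ (card {0..n + k} + card (orbits_on {0..n + k} (\<pi> \<circ> \<gamma>)))"
  by (rule sign_orbits[OF _ pm.perm]) simp
 also have "\<dots> = sign (contract_perm \<pi> \<gamma>) * (-1) ^ ?I"
  unfolding f pm.card_orbits_on Y by (simp add: power_add)
 finally have 1: "sign (\<pi> \<circ> \<gamma>) = sign (contract_perm \<pi> \<gamma>) * (-1) ^ ?I" .
 have "permutation \<pi>" "permutation \<gamma>" using perm0 \<gamma> permutation_permutes finite_atLeastAtMost by blast+
 then have "sign (\<pi> \<circ> \<gamma>) = sign \<pi> * sign \<gamma>" by (rule sign_compose)
 moreover have "sign \<pi> = (-1) ^ r" by (rule sign_involution[OF _ perm invol]) simp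
 ultimately have "sign (contract_perm \<pi> \<gamma>) * (-1) ^ ?I = (-1) ^ r * sign \<gamma>" using 1 by simp
 then have "sign (contract_perm \<pi> \<gamma>) * ((-1) ^ ?I * (-1) ^ ?I) = (-1) ^ r * sign \<gamma> * (-1) ^ ?I"
  by (metis mult.assoc)
 moreover have "(-1 :: int) ^ ?I * (-1) ^ ?I = 1" by (simp flip: power_mult_distrib)
 ultimately show ?thesis by (simp add: power_add)
qed

lemma coeff_exponent:
 assumes \<gamma>: "\<gamma> permutes {0..n + k}"
 shows "contract_coeff q (n + k) \<pi> \<gamma> =
  q powi (int r - int (card (inner_orbits (supp \<pi>) (\<pi> \<circ> \<gamma>))))"
proof -
 interpret pm: perm_on "\<pi> \<circ> \<gamma>" "{0..n + k}" "supp \<pi>"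
  by unfold_locales (use permutes_compose[OF \<gamma> perm0] supp_sub in auto)
 have "Suc (cyc0 {0..n + k} (\<pi> \<circ> \<gamma>)) = card (orbits_on {0..n + k} (\<pi> \<circ> \<gamma>))"
  by (rule cyc0_orbits[OF pm.perm]) auto
 moreover have "Suc (cyc0 ({0..n + k} - supp \<pi>) (first_return (supp \<pi>) (\<pi> \<circ> \<gamma>))) =
   card (orbits_on ({0..n + k} - supp \<pi>) (first_return (supp \<pi>) (\<pi> \<circ> \<gamma>)))"
  by (rule cyc0_orbits[OF pm.first_return_permutes]) (use zero_supp in auto)
 ultimately have "int (cyc0 ({0..n + k} - supp \<pi>) (first_return (supp \<pi>) (\<pi> \<circ> \<gamma>))) - int (cyc0 {0..n + k} (\<pi> \<circ> \<gamma>))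
   = - int (card (inner_orbits (supp \<pi>) (\<pi> \<circ> \<gamma>)))"
  using pm.card_orbits_on by linarith
 then have e: "int (cyc0 ({0..n + k} - supp \<pi>) (first_return (supp \<pi>) (\<pi> \<circ> \<gamma>))) -
   int (cyc0 {0..n + k} (\<pi> \<circ> \<gamma>)) + int r = int r - int (card (inner_orbits (supp \<pi>) (\<pi> \<circ> \<gamma>)))"
  by linarith
 show ?thesis unfolding contract_coeff_def e by (rule refl)
qed

end

context matrix_model
begin

lemma coeff_sg:
 assumes P: "\<pi> \<in> P12 n k" and \<gamma>: "\<gamma> \<in> S0 (n + k)"
 shows "contract_coeff q (n + k) \<pi> \<gamma> * sg (contract_perm \<pi> \<gamma>) =
  real N ^ card (inner_orbits (supp \<pi>) (\<pi> \<circ> \<gamma>)) / real N ^ npairs \<pi> * sg \<gamma>"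
proof -
 interpret pair_partition \<pi> n k by unfold_locales (rule P)
 let ?I = "card (inner_orbits (supp \<pi>) (\<pi> \<circ> \<gamma>))"
 have g: "\<gamma> permutes {0..n + k}" by (rule S0_permutes[OF \<gamma>])
 define s :: real where "s = (if neg then -1 else 1)"
 have s: "s * s = 1" "s \<noteq> 0" by (simp_all add: s_def)
 have sp: "s ^ i * s ^ i = 1" for i by (simp only: power_mult_distrib[symmetric] s(1) power_one)
 have qs: "q = s / real N" by (simp add: q s_def)
 have q0: "q \<noteq> 0" using N s by (simp add: qs)
 have "q powi (int r - int ?I) = q ^ r / q ^ ?I" using q0 by (simp add: power_int_diff)
 also have "\<dots> = s ^ r * (1 / s ^ ?I) * (real N ^ ?I / real N ^ r)"
  by (simp add: qs power_divide)
 also have "1 / s ^ ?I = s ^ ?I"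
  using sp[of ?I] s(2) by (simp only: nonzero_divide_eq_eq[OF power_not_zero[OF s(2)]])
 finally have c: "contract_coeff q (n + k) \<pi> \<gamma> = s ^ r * s ^ ?I * (real N ^ ?I / real N ^ r)"
  unfolding coeff_exponent[OF g] .
 have "sg (contract_perm \<pi> \<gamma>) = s ^ ?I * s ^ r * sg \<gamma>"
  by (simp add: sg_def s_def sign_contract[OF g] power_add)
 then have "contract_coeff q (n + k) \<pi> \<gamma> * sg (contract_perm \<pi> \<gamma>) =
   (s ^ r * s ^ r) * (s ^ ?I * s ^ ?I) * (real N ^ ?I / real N ^ r * sg \<gamma>)"
  unfolding c by (simp only: mult_ac)
 then show ?thesis unfolding sp by simp
qed

lemma row_shift: "rowf b W (shift n j) = rowf b (\<lambda>i. W (n + i)) j"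
 by (simp add: rowf_def shift_def)

text \<open>The middle index of the matrix product is the one that \<open>\<alpha> \<union> \<beta>\<close> passes through \<open>0\<close>.\<close>

lemma entry_product:
 assumes \<alpha>: "\<alpha> \<in> S0 n" and \<beta>: "\<beta> \<in> S0 k" and b: "b < N" and W: "\<And>i. i \<in> {1..n + k} \<Longrightarrow> W i \<in> L"
 shows "(\<Sum>c<N. entry n \<alpha> F a c W * entry k \<beta> G c b (\<lambda>i. W (n + i))) =
  (if \<forall>x\<in>{0..n + k}. colf a W x = rowf b W (perm_cup n \<alpha> \<beta> x)
   then of_real (sg \<alpha> * sg \<beta>) * (F (\<lambda>i. fst (W i)) * G (\<lambda>i. fst (W (n + i)))) else 0)"
proof -
 let ?V = "\<lambda>i. W (n + i)"
 have p\<alpha>: "\<alpha> permutes {0..n}" and p\<beta>: "\<beta> permutes {0..k}" by (rule S0_permutes[OF \<alpha>] S0_permutes[OF \<beta>])+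
 define c0 where "c0 = rowf b ?V (\<beta> 0)"
 have "\<beta> 0 \<in> {0..k}" using permutes_in_image[OF p\<beta>, of 0] by simp
 then have c0: "c0 < N" using W[of "n + \<beta> 0"] b by (auto simp: c0_def rowf_def L_def)
 have ne: "entry k \<beta> G c b ?V = 0" if "c \<noteq> c0" for c
 proof -
  have "colf c ?V 0 \<noteq> rowf b ?V (\<beta> 0)" using that by (simp add: colf_def c0_def)
  then show ?thesis unfolding entry_def by (metis atLeastAtMost_iff le0 less_eq_nat.simps(1))
 qed
 have "(\<Sum>c<N. entry n \<alpha> F a c W * entry k \<beta> G c b ?V) =
   (\<Sum>c<N. if c = c0 then entry n \<alpha> F a c0 W * entry k \<beta> G c0 b ?V else 0)"
  by (rule sum.cong[OF refl]) (use ne in auto)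
 also have "\<dots> = entry n \<alpha> F a c0 W * entry k \<beta> G c0 b ?V" using c0 by simp
 finally have 1: "(\<Sum>c<N. entry n \<alpha> F a c W * entry k \<beta> G c b ?V) = \<dots>" .
 have low: "rowf b W (perm_cup n \<alpha> \<beta> x) = rowf c0 W (\<alpha> x)" if "x \<in> {0..n}" for x
 proof (cases "\<alpha> x = 0")
  case True
  then show ?thesis unfolding perm_cup_eq by (simp add: shift_perm_def row_shift c0_def) (simp add: rowf_def)
 next
  case False
  then have "\<alpha> x \<in> {1..n}" using permutes_in_image[OF p\<alpha>, of x] that by auto
  then show ?thesis unfolding perm_cup_eq by (simp add: shift_perm_def rowf_def)
 qed
 have high: "rowf b W (perm_cup n \<alpha> \<beta> (n + y)) = rowf b ?V (\<beta> y)" if "y \<in> {1..k}" for y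
 proof -
  have "\<alpha> (n + y) = n + y" by (rule permutes_not_in[OF p\<alpha>]) (use that in auto)
  then show ?thesis unfolding perm_cup_eq using that by (simp add: shift_perm_def row_shift)
 qed
 have colh: "colf a W (n + y) = colf c0 ?V y" if "y \<in> {1..k}" for y using that by (simp add: colf_def)
 have "(\<forall>x\<in>{0..n + k}. colf a W x = rowf b W (perm_cup n \<alpha> \<beta> x)) \<longleftrightarrow>
   (\<forall>x\<in>{0..n}. colf a W x = rowf c0 W (\<alpha> x)) \<and> (\<forall>y\<in>{0..k}. colf c0 ?V y = rowf b ?V (\<beta> y))" (is "?A \<longleftrightarrow> ?B \<and> ?C")
 proof (intro iffI conjI ballI)
  assume A: ?A
  show "colf a W x = rowf c0 W (\<alpha> x)" if "x \<in> {0..n}" for x using A low[OF that] that by auto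
  show "colf c0 ?V y = rowf b ?V (\<beta> y)" if "y \<in> {0..k}" for y
  proof (cases "y = 0")
   case True
   then show ?thesis by (simp add: c0_def) (simp add: colf_def)
  next
   case False
   then have y: "y \<in> {1..k}" using that by auto
   have "n + y \<in> {0..n + k}" using y by auto
   then have "colf a W (n + y) = rowf b W (perm_cup n \<alpha> \<beta> (n + y))" using A by blast
   then show ?thesis unfolding high[OF y] colh[OF y] .
  qed
 next
  fix x assume BC: "?B \<and> ?C" and x: "x \<in> {0..n + k}"
  show "colf a W x = rowf b W (perm_cup n \<alpha> \<beta> x)"
  proof (cases "x \<le> n")
   case True
   then show ?thesis using BC low[of x] by auto
  next
   case False
   then have y: "x - n \<in> {1..k}" "x = n + (x - n)" using x by auto
   have "colf c0 ?V (x - n) = rowf b ?V (\<beta> (x - n))" using BC y(1) by auto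
   then show ?thesis using high[OF y(1)] colh[OF y(1)] y(2) by simp
  qed
 qed
 then consider (yes) "?A" "?B" "?C" | (no) "\<not> ?A" "\<not> (?B \<and> ?C)" by blast
 then show ?thesis
 proof cases
  case yes
  show ?thesis unfolding 1 unfolding entry_def if_P[OF yes(1)] if_P[OF yes(2)] if_P[OF yes(3)] by (simp add: mult_ac)
 next
  case no
  have z: "entry n \<alpha> F a c0 W * entry k \<beta> G c0 b ?V = 0"
  proof (cases ?B)
   case True
   then have "\<not> ?C" using no(2) by blast
   then show ?thesis unfolding entry_def by (simp only: if_False mult_zero_right)
  next
   case False
   then show ?thesis unfolding entry_def by (simp only: if_False mult_zero_left)
  qed
  show ?thesis unfolding if_not_P[OF no(1)] 1 by (rule z)
 qed
qed

end

lemma sg_shift_perm: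
 assumes "\<beta> permutes {0..k}"
 shows "sign (shift_perm n \<beta>) = sign \<beta>"
 unfolding shift_perm_map[OF assms]
 by (rule sign_map_permutation[OF inj_on_subset[OF shift_inj subset_UNIV] assms]) simp

lemma bij_list:
 assumes "distinct ls"
 shows "bij_betw (\<lambda>c. map c ls) (set ls \<rightarrow>\<^sub>E L) {w \<in> lists L. length w = length ls}"
proof -
 have f: "inj_on (\<lambda>c. map c ls) (set ls \<rightarrow>\<^sub>E L)"
  by (rule inj_onI) (rule PiE_ext, assumption, assumption, simp)
 have "w \<in> (\<lambda>c. map c ls) ` (set ls \<rightarrow>\<^sub>E L)" if w: "w \<in> lists L" "length w = length ls" for w
 proof -
  define c where "c = (\<lambda>i\<in>set ls. the (map_of (zip ls w) i))"
  have nth: "c (ls ! i) = w ! i" if "i < length ls" for i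
   using that w(2) assms by (simp add: c_def map_of_zip_nth)
  have "map c ls = w" by (rule nth_equalityI) (simp_all add: w(2) nth)
  moreover have "c \<in> set ls \<rightarrow>\<^sub>E L"
  proof (rule PiE_I)
   fix x assume "x \<in> set ls"
   then obtain i where "i < length ls" "x = ls ! i" by (metis in_set_conv_nth)
   then show "c x \<in> L" using nth w by (auto simp: in_lists_conv_set)
  qed (simp add: c_def)
  ultimately show ?thesis by (metis imageI)
 qed
 then have "(\<lambda>c. map c ls) ` (set ls \<rightarrow>\<^sub>E L) = {w \<in> lists L. length w = length ls}"
  by (auto simp: PiE_iff)
 with f show ?thesis by (simp add: bij_betw_def)
qed

locale model_pairing = matrix_model N neg q ty + pair_partition \<pi> n k
 for N neg q and ty :: "'a::{real_inner, complete_space} itself" and \<pi> n k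
begin

definition joinw :: "(nat \<Rightarrow> 'a letter) \<Rightarrow> (nat \<Rightarrow> 'a letter) \<Rightarrow> nat \<Rightarrow> 'a letter" where
 "joinw w c = (\<lambda>i. if i < \<pi> i then c i else if \<pi> i < i then bar (c (\<pi> i)) else w (inv u i))"

lemma lefts_not_rights: "i \<in> lefts \<Longrightarrow> i \<notin> rights"
 by (simp add: lefts_iff rights_iff)

lemma pi_lefts: "i \<in> rights \<Longrightarrow> \<pi> i \<in> lefts" and pi_rights: "i \<in> lefts \<Longrightarrow> \<pi> i \<in> rights"
 by (simp_all add: lefts_iff rights_iff)

lemma pi_fix: "i \<notin> supp \<pi> \<Longrightarrow> \<pi> i = i"
 by (simp add: supp_def)

lemma pi_supp: "\<pi> i \<in> supp \<pi> \<longleftrightarrow> i \<in> supp \<pi>"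
 unfolding supp_def by (metis (mono_tags, lifting) inv2 mem_Collect_eq)

lemma joinw_left: "i \<in> lefts \<Longrightarrow> joinw w c i = c i"
 and joinw_right: "i \<in> rights \<Longrightarrow> joinw w c i = bar (c (\<pi> i))"
 and joinw_out: "i \<notin> supp \<pi> \<Longrightarrow> joinw w c i = w (inv u i)"
 using lefts_not_rights[of i] by (auto simp: joinw_def lefts_iff rights_iff supp_def)

lemma joinw_u: "joinw w c (u j) = w j"
proof -
 have "u j \<notin> supp \<pi>" using u_range by auto
 then show ?thesis by (simp add: joinw_out)
qed

lemma joinw_L:
 assumes w: "\<And>j. j \<in> {1..m} \<Longrightarrow> w j \<in> L" and c: "c \<in> lefts \<rightarrow>\<^sub>E L" and i: "i \<in> {1..n + k}"
 shows "joinw w c i \<in> L"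
proof (cases "i \<in> supp \<pi>")
 case True
 show ?thesis
 proof (cases "i \<in> lefts")
  case True
  then show ?thesis using PiE_mem[OF c True] by (simp add: joinw_left)
 next
  case False
  then have r: "i \<in> rights" using \<open>i \<in> supp \<pi>\<close> by (simp add: supp_eq)
  show ?thesis unfolding joinw_right[OF r] by (rule bar_in[OF PiE_mem[OF c pi_lefts[OF r]]])
 qed
next
 case False
 then have "i \<in> u ` {0..m}" unfolding u_image_all0 using i by auto
 then obtain j where j: "j \<in> {0..m}" "i = u j" by blast
 then have "j \<noteq> 0" using i u0 by (metis atLeastAtMost_iff not_one_le_zero)
 then show ?thesis using j w[of j] joinw_u by auto
qed

text \<open>The colours of the contracted letters are indexed by all points of the support of \<open>\<pi>\<close>: the letter at the
 left end of a pair carries both colours, and the conjugate letter at the right end repeats them.\<close>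

lemma bij_split:
 "bij_betw (\<lambda>(e, K). \<lambda>i\<in>lefts. (e i, K (\<pi> i), K i))
  ((lefts \<rightarrow>\<^sub>E onb) \<times> (supp \<pi> \<rightarrow>\<^sub>E {..<N})) (lefts \<rightarrow>\<^sub>E (L :: 'a letter set))"
proof (rule bij_betwI[of _ _ _ "\<lambda>c. (\<lambda>i\<in>lefts. fst (c i),
   \<lambda>i\<in>supp \<pi>. if i \<in> lefts then snd (snd (c i)) else fst (snd (c (\<pi> i))))"])
 have ls: "lefts \<subseteq> supp \<pi>" by (auto simp: supp_eq)
 show "(\<lambda>(e, K). \<lambda>i\<in>lefts. (e i, K (\<pi> i), K i)) \<in>
   (lefts \<rightarrow>\<^sub>E onb) \<times> (supp \<pi> \<rightarrow>\<^sub>E {..<N}) \<rightarrow> (lefts \<rightarrow>\<^sub>E L)"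
 proof
  fix p :: "(nat \<Rightarrow> 'a) \<times> (nat \<Rightarrow> nat)" assume "p \<in> (lefts \<rightarrow>\<^sub>E onb) \<times> (supp \<pi> \<rightarrow>\<^sub>E {..<N})"
  then obtain e K where p: "p = (e, K)" "e \<in> lefts \<rightarrow>\<^sub>E onb" "K \<in> supp \<pi> \<rightarrow>\<^sub>E {..<N}" by (cases p) auto
  have "(e i, K (\<pi> i), K i) \<in> L" if "i \<in> lefts" for i
   using PiE_mem[OF p(2) that] PiE_mem[OF p(3), of i] PiE_mem[OF p(3), of "\<pi> i"] that ls pi_supp
   by (auto simp: L_def)
  then show "(case p of (e, K) \<Rightarrow> \<lambda>i\<in>lefts. (e i, K (\<pi> i), K i)) \<in> lefts \<rightarrow>\<^sub>E L" by (simp add: p(1))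
 qed
 show "(\<lambda>c. (\<lambda>i\<in>lefts. fst (c i), \<lambda>i\<in>supp \<pi>. if i \<in> lefts then snd (snd (c i)) else fst (snd (c (\<pi> i)))))
   \<in> (lefts \<rightarrow>\<^sub>E L) \<rightarrow> (lefts \<rightarrow>\<^sub>E onb) \<times> (supp \<pi> \<rightarrow>\<^sub>E {..<N})"
 proof
  fix c assume c: "c \<in> lefts \<rightarrow>\<^sub>E (L :: 'a letter set)"
  have "(if i \<in> lefts then snd (snd (c i)) else fst (snd (c (\<pi> i)))) < N" if "i \<in> supp \<pi>" for i
   using that PiE_mem[OF c, of i] PiE_mem[OF c pi_lefts, of i] by (auto simp: supp_eq L_def)
  moreover have "fst (c i) \<in> onb" if "i \<in> lefts" for i
   using PiE_mem[OF c that] by (auto simp: L_def)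
  ultimately show "(\<lambda>i\<in>lefts. fst (c i), \<lambda>i\<in>supp \<pi>. if i \<in> lefts then snd (snd (c i)) else fst (snd (c (\<pi> i))))
   \<in> (lefts \<rightarrow>\<^sub>E onb) \<times> (supp \<pi> \<rightarrow>\<^sub>E {..<N})" by simp
 qed
 show "(\<lambda>i\<in>lefts. fst ((case p of (e, K) \<Rightarrow> \<lambda>i\<in>lefts. (e i, K (\<pi> i), K i)) i),
   \<lambda>i\<in>supp \<pi>. if i \<in> lefts then snd (snd ((case p of (e, K) \<Rightarrow> \<lambda>i\<in>lefts. (e i, K (\<pi> i), K i)) i))
    else fst (snd ((case p of (e, K) \<Rightarrow> \<lambda>i\<in>lefts. (e i, K (\<pi> i), K i)) (\<pi> i)))) = p"
  if "p \<in> (lefts \<rightarrow>\<^sub>E onb) \<times> (supp \<pi> \<rightarrow>\<^sub>E {..<N})" for p :: "(nat \<Rightarrow> 'a) \<times> (nat \<Rightarrow> nat)"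
 proof -
  obtain e K where p: "p = (e, K)" by (cases p)
  have e: "e \<in> lefts \<rightarrow>\<^sub>E onb" and K: "K \<in> supp \<pi> \<rightarrow>\<^sub>E {..<N}" using that by (auto simp: p)
  have "(\<lambda>i\<in>lefts. e i) = e" using PiE_arb[OF e] by (auto simp: fun_eq_iff)
  moreover have "(\<lambda>i\<in>supp \<pi>. if i \<in> lefts then K i else K (\<pi> (\<pi> i))) = K"
   using PiE_arb[OF K] by (auto simp: fun_eq_iff)
  moreover have "(\<lambda>i\<in>supp \<pi>. if i \<in> lefts then snd (snd ((\<lambda>i\<in>lefts. (e i, K (\<pi> i), K i)) i))
    else fst (snd ((\<lambda>i\<in>lefts. (e i, K (\<pi> i), K i)) (\<pi> i)))) =
    (\<lambda>i\<in>supp \<pi>. if i \<in> lefts then K i else K (\<pi> (\<pi> i)))"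
   using pi_lefts by (auto simp: fun_eq_iff supp_eq)
  moreover have "(\<lambda>i\<in>lefts. fst ((\<lambda>i\<in>lefts. (e i, K (\<pi> i), K i)) i)) = (\<lambda>i\<in>lefts. e i)"
   by (auto simp: fun_eq_iff)
  ultimately show ?thesis by (simp only: p case_prod_conv)
 qed
 show "(case (\<lambda>i\<in>lefts. fst (c i), \<lambda>i\<in>supp \<pi>. if i \<in> lefts then snd (snd (c i)) else fst (snd (c (\<pi> i)))) of
   (e, K) \<Rightarrow> \<lambda>i\<in>lefts. (e i, K (\<pi> i), K i)) = c" if c: "c \<in> lefts \<rightarrow>\<^sub>E L" for c
 proof
  fix i
  show "(case (\<lambda>i\<in>lefts. fst (c i), \<lambda>i\<in>supp \<pi>. if i \<in> lefts then snd (snd (c i)) else fst (snd (c (\<pi> i)))) of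
   (e, K) \<Rightarrow> \<lambda>i\<in>lefts. (e i, K (\<pi> i), K i)) i = c i"
  proof (cases "i \<in> lefts")
   case True
   then have "i \<in> supp \<pi>" "\<pi> i \<in> supp \<pi>" "\<pi> i \<notin> lefts" using ls pi_supp by (auto simp: lefts_iff)
   then show ?thesis using True by simp
  next
   case False
   then show ?thesis using PiE_arb[OF c False] by simp
  qed
 qed
qed

end

context model_pairing
begin

text \<open>Summing over the colours of the contracted letters counts the solutions of the colour
 equations along the cycles of \<open>\<pi> (\<alpha> \<union> \<beta>)\<close>; summing over their vectors contracts the tensors.\<close>

lemma contraction_entry:
 assumes \<alpha>: "\<alpha> \<in> S0 n" and \<beta>: "\<beta> \<in> S0 k" and F: "F \<in> hilbert_schmidt n" and G: "G \<in> hilbert_schmidt k"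
  and b: "b < N" and w: "\<And>j. j \<in> {1..m} \<Longrightarrow> w j \<in> L"
 defines "\<gamma> \<equiv> perm_cup n \<alpha> \<beta>"
 shows "((\<lambda>c. \<Sum>d<N. entry n \<alpha> F a d (joinw w c) * entry k \<beta> G d b (\<lambda>i. joinw w c (n + i))) has_sum
  of_real (real N ^ r * contract_coeff q (n + k) \<pi> \<gamma>) *
   entry m (contract_perm \<pi> \<gamma>) (contract_tensor \<pi> (tensor_prod n F G)) a b w) (lefts \<rightarrow>\<^sub>E L)"
proof -
 have \<gamma>S: "\<gamma> \<in> S0 (n + k)" unfolding \<gamma>_def by (rule perm_cup_S0[OF \<alpha> \<beta>])
 have g: "\<gamma> permutes {0..n + k}" by (rule S0_permutes[OF \<gamma>S])
 interpret pm: perm_on "\<pi> \<circ> \<gamma>" "{0..n + k}" "supp \<pi>"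
  by unfold_locales (use permutes_compose[OF g perm0] supp_sub in auto)
 let ?X = "supp \<pi>" and ?Y = "{0..n + k}"
 let ?J = "\<lambda>x. colf a w (inv u x)" and ?I = "\<lambda>y. rowf b w (inv u y)"
 let ?x = "\<lambda>j. fst (w j)"
 define cond where "cond K \<longleftrightarrow> (\<forall>x\<in>?Y. (if x \<in> ?X then K x else ?J x) =
   (if (\<pi> \<circ> \<gamma>) x \<in> ?X then K ((\<pi> \<circ> \<gamma>) x) else ?I ((\<pi> \<circ> \<gamma>) x)))" for K
 define f where "f e = F (join ?x e) * G (\<lambda>i. join ?x e (n + i))" for e
 define g' where "g' K = (if cond K then complex_of_real (sg \<alpha> * sg \<beta>) else 0)" for K
 have inv0: "inv u 0 = 0" using u_inv[of 0] by simp
 have uz: "inv u x = 0 \<longleftrightarrow> x = 0" if "x \<notin> ?X" for x using inv_u[OF that] inv0 by (metis u0)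
 have entries: "(\<Sum>d<N. entry n \<alpha> F a d (joinw w c) * entry k \<beta> G d b (\<lambda>i. joinw w c (n + i))) = f e * g' K"
  if c: "c = (\<lambda>i\<in>lefts. (e i, K (\<pi> i), K i))" and cL: "c \<in> lefts \<rightarrow>\<^sub>E L" for e K c
 proof -
  have cl: "c i = (e i, K (\<pi> i), K i)" if "i \<in> lefts" for i using that by (simp add: c)
  have jl: "joinw w c i = (e i, K (\<pi> i), K i)" if "i \<in> lefts" for i
   using joinw_left[OF that] cl[OF that] by simp
  have jr: "joinw w c i = (e (\<pi> i), K (\<pi> i), K i)" if "i \<in> rights" for i
   using joinw_right[OF that] cl[OF pi_lefts[OF that]] by (simp add: bar_def)
  have col: "colf a (joinw w c) x = (if x \<in> ?X then K x else ?J x)" for x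
  proof (cases "x \<in> ?X")
   case True
   then have x0: "x \<noteq> 0" and lr: "x \<in> lefts \<or> x \<in> rights" using zero_supp by (metis, simp add: supp_eq)
   from lr have "snd (snd (joinw w c x)) = K x" by (elim disjE) (simp_all only: jl jr snd_conv)
   then show ?thesis using True x0 by (simp add: colf_def)
  next
   case False
   then show ?thesis using uz[of x] by (simp add: colf_def joinw_out)
  qed
  have row: "rowf b (joinw w c) y = (if \<pi> y \<in> ?X then K (\<pi> y) else ?I (\<pi> y))" for y
  proof (cases "y \<in> ?X")
   case True
   then have x0: "y \<noteq> 0" and lr: "y \<in> lefts \<or> y \<in> rights" using zero_supp by (metis, simp add: supp_eq)
   from lr have "fst (snd (joinw w c y)) = K (\<pi> y)" by (elim disjE) (simp_all only: jl jr snd_conv fst_conv)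
   then show ?thesis using True x0 pi_supp[of y] by (simp add: rowf_def)
  next
   case False
   then show ?thesis using uz[of y] pi_supp[of y] pi_fix[of y] by (simp add: rowf_def joinw_out)
  qed
  have fst: "fst (joinw w c i) = join ?x e i" for i
  proof (cases "i \<in> ?X")
   case True
   then consider "i \<in> lefts" "i < \<pi> i" | "i \<in> rights" "\<pi> i < i" by (auto simp: supp_eq lefts_iff rights_iff)
   then show ?thesis
   proof cases
    case 1 then show ?thesis by (simp only: jl fst_conv) (simp add: join_def)
   next
    case 2 then show ?thesis by (simp only: jr fst_conv) (simp add: join_def)
   qed
  next
   case False
   then show ?thesis using pi_fix[OF False] by (simp add: joinw_def join_def)
  qed
  have "(\<forall>x\<in>?Y. colf a (joinw w c) x = rowf b (joinw w c) (perm_cup n \<alpha> \<beta> x)) \<longleftrightarrow> cond K"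
   unfolding cond_def col row \<gamma>_def[symmetric] comp_def by (rule refl)
  note iff = this
  have "(\<Sum>d<N. entry n \<alpha> F a d (joinw w c) * entry k \<beta> G d b (\<lambda>i. joinw w c (n + i))) =
   (if cond K then of_real (sg \<alpha> * sg \<beta>) * (F (\<lambda>i. fst (joinw w c i)) * G (\<lambda>i. fst (joinw w c (n + i)))) else 0)"
   unfolding iff[symmetric]
  proof (rule entry_product[OF \<alpha> \<beta> b])
   show "joinw w c i \<in> L" if "i \<in> {1..n + k}" for i by (rule joinw_L[OF _ cL that]) (rule w)
  qed
  then show ?thesis unfolding fst f_def g'_def by simp
 qed
 have sumK: "(\<Sum>K\<in>?X \<rightarrow>\<^sub>E {..<N}. g' K) = of_real (sg \<alpha> * sg \<beta>) *
   (if \<forall>x\<in>?Y - ?X. ?J x = ?I (first_return ?X (\<pi> \<circ> \<gamma>) x) then of_nat (N ^ card (inner_orbits ?X (\<pi> \<circ> \<gamma>))) else 0)"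
 proof -
  have fin: "finite (?X \<rightarrow>\<^sub>E {..<N})" by (rule finite_PiE) (auto simp: fin_supp)
  have "(\<Sum>K\<in>?X \<rightarrow>\<^sub>E {..<N}. g' K) = (\<Sum>K\<in>{K \<in> ?X \<rightarrow>\<^sub>E {..<N}. cond K}. of_real (sg \<alpha> * sg \<beta>))"
   unfolding g'_def sum.inter_filter[OF fin] by (rule refl)
  also have "\<dots> = of_nat (card {K \<in> ?X \<rightarrow>\<^sub>E {..<N}. cond K}) * of_real (sg \<alpha> * sg \<beta>)" by simp
  also have "card {K \<in> ?X \<rightarrow>\<^sub>E {..<N}. cond K} = (if \<forall>x\<in>?Y - ?X. ?J x = ?I (first_return ?X (\<pi> \<circ> \<gamma>) x)
    then card {..<N} ^ card (inner_orbits ?X (\<pi> \<circ> \<gamma>)) else 0)"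
   unfolding cond_def
  proof (rule pm.card_solutions)
   fix y assume y: "y \<in> ?Y - ?X"
   then obtain j where j: "j \<in> {0..m}" "y = u j" unfolding u_image_all0[symmetric] by blast
   show "?I y \<in> {..<N}"
   proof (cases "j = 0")
    case True
    then show ?thesis using b j inv0 by (simp add: rowf_def)
   next
    case False
    then have "w j \<in> L" using w j by auto
    then show ?thesis using False j by (auto simp: rowf_def L_def)
   qed
  qed simp
  finally show ?thesis by (simp add: mult.commute)
 qed
 have cond': "(\<forall>x\<in>?Y - ?X. ?J x = ?I (first_return ?X (\<pi> \<circ> \<gamma>) x)) \<longleftrightarrow>
   (\<forall>j\<in>{0..m}. colf a w j = rowf b w (contract_perm \<pi> \<gamma> j))"
  unfolding u_image_all0[symmetric] ball_simps(9) u_inv contract_perm_def comp_def by (rule refl)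
 have "(f has_sum contract_tensor \<pi> (tensor_prod n F G) ?x) (lefts \<rightarrow>\<^sub>E onb)"
  unfolding contract_join f_def[symmetric]
  by (rule has_sum_infsum) (use contract_hilbert_schmidt(2)[OF F G, of ?x] in \<open>simp add: f_def[abs_def]\<close>)
 from has_sum_times_finite[OF this, of "?X \<rightarrow>\<^sub>E {..<N}" g']
 have "((\<lambda>(e, K). f e * g' K) has_sum (contract_tensor \<pi> (tensor_prod n F G) ?x * (\<Sum>K\<in>?X \<rightarrow>\<^sub>E {..<N}. g' K)))
   ((lefts \<rightarrow>\<^sub>E onb) \<times> (?X \<rightarrow>\<^sub>E {..<N}))"
  by (simp add: finite_PiE fin_supp)
 then have "((\<lambda>p. (\<lambda>c. \<Sum>d<N. entry n \<alpha> F a d (joinw w c) * entry k \<beta> G d b (\<lambda>i. joinw w c (n + i)))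
   (case p of (e, K) \<Rightarrow> \<lambda>i\<in>lefts. (e i, K (\<pi> i), K i))) has_sum
   (contract_tensor \<pi> (tensor_prod n F G) ?x * (\<Sum>K\<in>?X \<rightarrow>\<^sub>E {..<N}. g' K)))
   ((lefts \<rightarrow>\<^sub>E onb) \<times> (?X \<rightarrow>\<^sub>E {..<N}))"
 proof (rule has_sum_cong[THEN iffD1, rotated])
  fix p :: "(nat \<Rightarrow> 'a) \<times> (nat \<Rightarrow> nat)" assume p: "p \<in> (lefts \<rightarrow>\<^sub>E onb) \<times> (?X \<rightarrow>\<^sub>E {..<N})"
  obtain e K where eK: "p = (e, K)" by (cases p)
  have "(\<lambda>i\<in>lefts. (e i, K (\<pi> i), K i)) \<in> lefts \<rightarrow>\<^sub>E (L :: 'a letter set)"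
   using bij_betwE[OF bij_split] p unfolding eK by force
  from entries[OF refl this]
  show "(case p of (e, K) \<Rightarrow> f e * g' K) = (\<lambda>c. \<Sum>d<N. entry n \<alpha> F a d (joinw w c) *
   entry k \<beta> G d b (\<lambda>i. joinw w c (n + i))) (case p of (e, K) \<Rightarrow> \<lambda>i\<in>lefts. (e i, K (\<pi> i), K i))"
   by (simp only: eK case_prod_conv)
 qed
 then have "((\<lambda>c. \<Sum>d<N. entry n \<alpha> F a d (joinw w c) * entry k \<beta> G d b (\<lambda>i. joinw w c (n + i))) has_sum
   (contract_tensor \<pi> (tensor_prod n F G) ?x * (\<Sum>K\<in>?X \<rightarrow>\<^sub>E {..<N}. g' K))) (lefts \<rightarrow>\<^sub>E L)"
  by (rule has_sum_reindex_bij_betw[OF bij_split, THEN iffD1])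
 moreover have "contract_tensor \<pi> (tensor_prod n F G) ?x * (\<Sum>K\<in>?X \<rightarrow>\<^sub>E {..<N}. g' K) =
   of_real (real N ^ r * contract_coeff q (n + k) \<pi> \<gamma>) *
   entry m (contract_perm \<pi> \<gamma>) (contract_tensor \<pi> (tensor_prod n F G)) a b w"
 proof -
  have "permutation \<alpha>" "permutation (shift_perm n \<beta>)"
   using S0_permutation[OF \<alpha>] shift_perm_permutes[OF S0_permutes[OF \<beta>], of n] permutation_permutes by blast+
  then have "sg \<gamma> = sg \<alpha> * sg \<beta>"
   unfolding \<gamma>_def perm_cup_eq by (simp add: sg_comp mult.commute) (simp add: sg_def sg_shift_perm[OF S0_permutes[OF \<beta>]])
  then have "real N ^ r * contract_coeff q (n + k) \<pi> \<gamma> * sg (contract_perm \<pi> \<gamma>) =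
    real N ^ card (inner_orbits ?X (\<pi> \<circ> \<gamma>)) * (sg \<alpha> * sg \<beta>)"
   using coeff_sg[OF P \<gamma>S] N by (simp add: mult.assoc)
  then have "complex_of_real (real N ^ r * contract_coeff q (n + k) \<pi> \<gamma> * sg (contract_perm \<pi> \<gamma>)) =
    of_real (real N ^ card (inner_orbits ?X (\<pi> \<circ> \<gamma>)) * (sg \<alpha> * sg \<beta>))" by (simp only:)
  note prod = this
  show ?thesis
  proof (cases "\<forall>j\<in>{0..m}. colf a w j = rowf b w (contract_perm \<pi> \<gamma> j)")
   case True
   then show ?thesis unfolding sumK cond' entry_def if_P[OF True] using prod by (simp add: mult_ac)
  next
   case False
   show ?thesis unfolding sumK cond' entry_def if_not_P[OF False] by simp
  qed
 qed
 ultimately show ?thesis by simp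
qed

end

section \<open>Counting contractions and rearrangements\<close>

lemma ex_permutation_image:
 assumes A: "A \<subseteq> {1..M}" and B: "B \<subseteq> {1..M}" and c: "card A = card B"
 shows "\<exists>\<tau>\<in>Sn M. \<tau> ` A = B"
proof -
 have fin: "finite A" "finite B" using A B finite_subset by blast+
 obtain f where f: "bij_betw f A B" using finite_same_card_bij[OF fin c] by blast
 have "card ({1..M} - A) = card ({1..M} - B)" by (simp only: card_Diff_subset[OF fin(1) A] card_Diff_subset[OF fin(2) B] c)
 then obtain g where g: "bij_betw g ({1..M} - A) ({1..M} - B)"
  using finite_same_card_bij[of "{1..M} - A" "{1..M} - B"] by blast
 define \<tau> where "\<tau> x = (if x \<in> A then f x else if x \<in> {1..M} then g x else x)" for x
 have 1: "bij_betw \<tau> A B" by (rule bij_betw_cong[THEN iffD1, OF _ f]) (simp add: \<tau>_def)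
 have 2: "bij_betw \<tau> ({1..M} - A) ({1..M} - B)" by (rule bij_betw_cong[THEN iffD1, OF _ g]) (simp add: \<tau>_def)
 have "bij_betw \<tau> (A \<union> ({1..M} - A)) (B \<union> ({1..M} - B))" by (rule bij_betw_combine[OF 1 2]) blast
 then have "bij_betw \<tau> {1..M} {1..M}" using A B by (simp only: Un_Diff_cancel Un_absorb1)
 moreover have "\<tau> x = x" if "x \<notin> {1..M}" for x using that A by (auto simp: \<tau>_def)
 ultimately have "\<tau> permutes {1..M}" by (rule bij_imp_permutes)
 then show ?thesis using bij_betw_imp_surj_on[OF 1] by (auto simp: Sn_def)
qed

text \<open>The symmetric group acts transitively on the subsets of a given size, so all fibres of
 \<open>\<sigma> \<mapsto> \<sigma> ` {1..p}\<close> are equally large.\<close>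

lemma card_permutation_image:
 assumes A: "A \<subseteq> {1..M}" "card A = p" and p: "p \<le> M"
 shows "card {\<sigma> \<in> Sn M. \<sigma> ` {1..p} = A} = fact p * fact (M - p)"
proof -
 define X where "X A = {\<sigma> \<in> Sn M. \<sigma> ` {1..p} = A}" for A
 define T where "T = {A. A \<subseteq> {1..M} \<and> card A = p}"
 have eq: "card (X A) = card (X {1..p})" if A: "A \<in> T" for A
 proof -
  obtain \<tau> where \<tau>: "\<tau> \<in> Sn M" "\<tau> ` {1..p} = A"
   using ex_permutation_image[of "{1..p}" M A] A p by (auto simp: T_def)
  have pt: "\<tau> permutes {1..M}" by (rule Sn_permutes[OF \<tau>(1)])
  have "bij_betw (\<lambda>\<sigma>. \<tau> \<circ> \<sigma>) (X {1..p}) (X A)"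
  proof (rule bij_betw_byWitness[where f' = "\<lambda>\<sigma>. inv \<tau> \<circ> \<sigma>"])
   show "\<forall>\<sigma>\<in>X {1..p}. inv \<tau> \<circ> (\<tau> \<circ> \<sigma>) = \<sigma>" "\<forall>\<sigma>\<in>X A. \<tau> \<circ> (inv \<tau> \<circ> \<sigma>) = \<sigma>"
    by (simp_all add: comp_assoc[symmetric] permutes_inv_o[OF pt])
   have im: "(\<tau> \<circ> \<sigma>) ` {1..p} = \<tau> ` (\<sigma> ` {1..p})" for \<tau> \<sigma> :: "nat \<Rightarrow> nat" by (rule image_comp[symmetric])
   have "\<tau> \<circ> \<sigma> \<in> X A" if "\<sigma> \<in> X {1..p}" for \<sigma>
    using Sn_comp[OF \<tau>(1), of \<sigma>] that unfolding X_def mem_Collect_eq im by (simp only: \<tau>(2))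
   then show "(\<lambda>\<sigma>. \<tau> \<circ> \<sigma>) ` X {1..p} \<subseteq> X A" by blast
   have "inv \<tau> ` A = {1..p}" unfolding \<tau>(2)[symmetric] image_comp permutes_inv_o(2)[OF pt] by simp
   then have "inv \<tau> \<circ> \<sigma> \<in> X {1..p}" if "\<sigma> \<in> X A" for \<sigma>
    using Sn_comp[OF Sn_inv[OF \<tau>(1)], of \<sigma>] that unfolding X_def mem_Collect_eq im by simp
   then show "(\<lambda>\<sigma>. inv \<tau> \<circ> \<sigma>) ` X A \<subseteq> X {1..p}" by blast
  qed
  then show ?thesis by (rule bij_betw_same_card[symmetric])
 qed
 have im: "\<sigma> ` {1..p} \<in> T" if \<sigma>: "\<sigma> \<in> Sn M" for \<sigma>
 proof -
  have "card (\<sigma> ` {1..p}) = p" using card_image[OF permutes_inj_on[OF Sn_permutes[OF \<sigma>]], of "{1..p}"] by simp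
  moreover have "\<sigma> ` {1..p} \<subseteq> {1..M}"
   using permutes_image[OF Sn_permutes[OF \<sigma>]] image_mono[of "{1..p}" "{1..M}" \<sigma>] p by auto
  ultimately show ?thesis by (simp add: T_def)
 qed
 have finT: "finite T" by (rule finite_subset[of _ "Pow {1..M}"]) (auto simp: T_def)
 have "(\<Sum>A\<in>T. \<Sum>\<sigma> | \<sigma> \<in> Sn M \<and> \<sigma> ` {1..p} = A. 1::nat) = (\<Sum>\<sigma>\<in>Sn M. 1)"
  by (rule sum.group[OF finite_Sn finT]) (use im in blast)
 then have "(\<Sum>A\<in>T. card (X A)) = fact M" by (simp add: X_def card_Sn)
 moreover have "(\<Sum>A\<in>T. card (X A)) = card T * card (X {1..p})" using eq by simp
 moreover have "card T = M choose p" unfolding T_def by (simp add: n_subsets)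
 ultimately have "fact p * fact (M - p) * (M choose p) = card (X {1..p}) * (M choose p)"
  using binomial_fact_lemma[OF p] by (simp add: mult.commute)
 then have "card (X {1..p}) = fact p * fact (M - p)" using p by simp
 then show ?thesis using eq[of A] A by (simp add: T_def X_def)
qed

lemma sum_permutations_image:
 fixes G :: "nat set \<Rightarrow> complex"
 assumes p: "p \<le> M"
 shows "(\<Sum>\<sigma>\<in>Sn M. G (\<sigma> ` {1..p})) = fact p * fact (M - p) * (\<Sum>A | A \<subseteq> {1..M} \<and> card A = p. G A)"
proof -
 let ?T = "{A. A \<subseteq> {1..M} \<and> card A = p}"
 have finT: "finite ?T" by (rule finite_subset[of _ "Pow {1..M}"]) auto
 have im: "\<sigma> ` {1..p} \<in> ?T" if \<sigma>: "\<sigma> \<in> Sn M" for \<sigma>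
 proof -
  have "card (\<sigma> ` {1..p}) = p" using card_image[OF permutes_inj_on[OF Sn_permutes[OF \<sigma>]], of "{1..p}"] by simp
  moreover have "\<sigma> ` {1..p} \<subseteq> {1..M}"
   using permutes_image[OF Sn_permutes[OF \<sigma>]] image_mono[of "{1..p}" "{1..M}" \<sigma>] p by auto
  ultimately show ?thesis by simp
 qed
 have "(\<Sum>\<sigma>\<in>Sn M. G (\<sigma> ` {1..p})) = (\<Sum>A\<in>?T. \<Sum>\<sigma> | \<sigma> \<in> Sn M \<and> \<sigma> ` {1..p} = A. G (\<sigma> ` {1..p}))"
  by (rule sum.group[OF finite_Sn finT, symmetric]) (use im in blast)
 also have "\<dots> = (\<Sum>A\<in>?T. fact p * fact (M - p) * G A)"
 proof (rule sum.cong[OF refl])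
  fix A assume A: "A \<in> ?T"
  have "(\<Sum>\<sigma> | \<sigma> \<in> Sn M \<and> \<sigma> ` {1..p} = A. G (\<sigma> ` {1..p})) = (\<Sum>\<sigma> | \<sigma> \<in> Sn M \<and> \<sigma> ` {1..p} = A. G A)"
   by (rule sum.cong) auto
  also have "\<dots> = of_nat (fact p * fact (M - p)) * G A"
   using card_permutation_image[of A M p] A p by simp
  finally show "(\<Sum>\<sigma> | \<sigma> \<in> Sn M \<and> \<sigma> ` {1..p} = A. G (\<sigma> ` {1..p})) = fact p * fact (M - p) * G A" by simp
 qed
 finally show ?thesis by (simp add: sum_distrib_left)
qed

definition pairing_of :: "nat set \<times> (nat \<Rightarrow> nat) \<Rightarrow> nat \<Rightarrow> nat" where
 "pairing_of = (\<lambda>(A, f) i. if i \<in> A then f i else if i \<in> f ` A then inv_into A f i else i)"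

text \<open>A contraction is the set of its left ends together with an injective map from it to the right block.\<close>

lemma card_P12:
 assumes r: "r \<le> n" "r \<le> k"
 shows "card {\<pi> \<in> P12 n k. npairs \<pi> = r} * (fact r * fact (n - r) * fact (k - r)) = fact n * (fact k :: nat)"
proof -
 define S where "S = Sigma {A. A \<subseteq> {1..n} \<and> card A = r} (\<lambda>A. {f \<in> A \<rightarrow>\<^sub>E {n + 1..n + k}. inj_on f A})"
 have "bij_betw pairing_of S {\<pi> \<in> P12 n k. npairs \<pi> = r}"
 proof (rule bij_betw_byWitness[where f' = "\<lambda>\<pi>. (left_ends \<pi>, restrict \<pi> (left_ends \<pi>))"])
  have from_S: "pairing_of (A, f) \<in> P12 n k \<and> left_ends (pairing_of (A, f)) = A"
   if A: "A \<subseteq> {1..n}" and f: "f \<in> A \<rightarrow>\<^sub>E {n + 1..n + k}" and i: "inj_on f A" for A f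
  proof -
   let ?\<pi> = "pairing_of (A, f)"
   have fA: "f x \<in> {n + 1..n + k}" if "x \<in> A" for x using PiE_mem[OF f that] .
   have Ale: "x \<in> {1..n}" if "x \<in> A" for x using A that by blast
   have 1: "?\<pi> x = f x" if "x \<in> A" for x using that by (simp add: pairing_of_def)
   have 2: "?\<pi> (f x) = x" if x: "x \<in> A" for x
   proof -
    have "f x \<notin> A" using fA[OF x] Ale[of "f x"] by auto
    then show ?thesis using x i by (simp add: pairing_of_def)
   qed
   have 3: "?\<pi> x = x" if "x \<notin> A" "x \<notin> f ` A" for x using that by (simp add: pairing_of_def)
   have cases: "(x \<in> A \<and> ?\<pi> x = f x \<and> x \<le> n \<and> n < f x) \<or> (\<exists>y\<in>A. x = f y \<and> ?\<pi> x = y \<and> y \<le> n \<and> n < x) \<or> (x \<notin> A \<and> ?\<pi> x = x)" for x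
    using 1[of x] 2 3[of x] fA Ale by (cases "x \<in> A"; cases "x \<in> f ` A") force+
   have inv: "?\<pi> (?\<pi> x) = x" for x using cases[of x] 1 2 by metis
   have outside: "?\<pi> x = x" if "x \<notin> {1..n + k}" for x
    by (rule 3) (use that fA Ale in \<open>force+\<close>)
   have "?\<pi> permutes {1..n + k}"
    unfolding permutes_def using inv outside by metis
   moreover have "i \<le> n \<and> n < ?\<pi> i" if "i < ?\<pi> i" for i using cases[of i] that by auto
   moreover have "left_ends ?\<pi> = A" unfolding left_ends_def using cases 1 fA Ale by force
   ultimately show ?thesis using inv by (auto simp: P12_def fun_eq_iff)
  qed
  show "pairing_of ` S \<subseteq> {\<pi> \<in> P12 n k. npairs \<pi> = r}"
   using from_S by (auto simp: S_def npairs_def)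
  show "\<forall>p\<in>S. (left_ends (pairing_of p), restrict (pairing_of p) (left_ends (pairing_of p))) = p"
  proof
   fix p assume "p \<in> S"
   then obtain A f where p: "p = (A, f)" "A \<subseteq> {1..n}" and f: "f \<in> A \<rightarrow>\<^sub>E {n + 1..n + k}" "inj_on f A"
    by (auto simp: S_def)
   have l: "left_ends (pairing_of p) = A" using from_S[OF p(2) f] p(1) by blast
   have "restrict (pairing_of p) A = f"
   proof
    fix x show "restrict (pairing_of p) A x = f x"
     using PiE_arb[OF f(1), of x] by (simp add: p(1) pairing_of_def)
   qed
   then show "(left_ends (pairing_of p), restrict (pairing_of p) (left_ends (pairing_of p))) = p"
    unfolding l by (simp only: p(1))
  qed
  have to_S: "pairing_of (left_ends \<pi>, restrict \<pi> (left_ends \<pi>)) = \<pi> \<and>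
    (left_ends \<pi>, restrict \<pi> (left_ends \<pi>)) \<in> S" if \<pi>: "\<pi> \<in> P12 n k" "npairs \<pi> = r" for \<pi>
  proof -
   interpret pair_partition \<pi> n k by unfold_locales (rule \<pi>(1))
   have inj: "inj_on \<pi> X" for X by (rule permutes_inj_on[OF perm])
   have im: "restrict \<pi> (left_ends \<pi>) ` left_ends \<pi> = rights" by (auto simp: rights_def)
   have "pairing_of (left_ends \<pi>, restrict \<pi> (left_ends \<pi>)) i = \<pi> i" for i
   proof -
    consider "i < \<pi> i" | "\<pi> i < i" | "\<pi> i = i" by linarith
    then show ?thesis
    proof cases
     case 1 then show ?thesis by (simp add: pairing_of_def left_ends_def)
    next
     case 2
     then have "i \<in> rights" "i \<notin> left_ends \<pi>" "\<pi> i \<in> left_ends \<pi>" by (auto simp: rights_iff left_ends_def)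
     moreover have "inv_into (left_ends \<pi>) (restrict \<pi> (left_ends \<pi>)) i = \<pi> i"
      by (rule inv_into_f_eq) (use calculation inj in \<open>auto simp: inj_on_def\<close>)
     ultimately show ?thesis unfolding pairing_of_def case_prod_conv im by simp
    next
     case 3
     then have "i \<notin> rights" "i \<notin> left_ends \<pi>" by (auto simp: rights_iff left_ends_def)
     then show ?thesis using 3 unfolding pairing_of_def case_prod_conv im by simp
    qed
   qed
   moreover have "left_ends \<pi> \<subseteq> {1..n}" using lefts_sub by (simp add: lefts_def)
   moreover have "\<pi> i \<in> {n + 1..n + k}" if "i \<in> left_ends \<pi>" for i
    using rights_sub that unfolding rights_def by blast
   ultimately show ?thesis using \<pi>(2) inj by (auto simp: S_def npairs_def inj_on_def)
  qed
  then show "\<forall>\<pi>\<in>{\<pi> \<in> P12 n k. npairs \<pi> = r}. pairing_of (left_ends \<pi>, restrict \<pi> (left_ends \<pi>)) = \<pi>"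
   "(\<lambda>\<pi>. (left_ends \<pi>, restrict \<pi> (left_ends \<pi>))) ` {\<pi> \<in> P12 n k. npairs \<pi> = r} \<subseteq> S"
   by blast+
 qed
 from bij_betw_same_card[OF this] have "card {\<pi> \<in> P12 n k. npairs \<pi> = r} = card S" ..
 also have "card S = (\<Sum>A | A \<subseteq> {1..n} \<and> card A = r. \<Prod>i = 0..<r. k - i)"
 proof -
  have fin: "finite A" if "A \<subseteq> {1..n}" for A using finite_subset[OF that] by simp
  have "finite {A. A \<subseteq> {1..n} \<and> card A = r}" by (rule finite_subset[of _ "Pow {1..n}"]) auto
  moreover have "finite {f \<in> A \<rightarrow>\<^sub>E {n + 1..n + k}. inj_on f A}" if "A \<subseteq> {1..n}" for A
   by (rule finite_subset[OF _ finite_PiE[of A "\<lambda>_. {n + 1..n + k}"]]) (use fin that in auto)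
  ultimately have "card S = (\<Sum>A | A \<subseteq> {1..n} \<and> card A = r. card {f \<in> A \<rightarrow>\<^sub>E {n + 1..n + k}. inj_on f A})"
   unfolding S_def by (intro card_SigmaI) auto
  also have "\<dots> = (\<Sum>A | A \<subseteq> {1..n} \<and> card A = r. \<Prod>i = 0..<r. k - i)"
  proof (rule sum.cong[OF refl])
   fix A assume "A \<in> {A. A \<subseteq> {1..n} \<and> card A = r}"
   then show "card {f \<in> A \<rightarrow>\<^sub>E {n + 1..n + k}. inj_on f A} = (\<Prod>i = 0..<r. k - i)"
    using card_inj_on_subset_funcset[OF fin, of A "{n + 1..n + k}" A] by simp
  qed
  finally show ?thesis .
 qed
 also have "\<dots> = (n choose r) * (\<Prod>i = 0..<r. k - i)" by (simp add: n_subsets)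
 finally have c: "card {\<pi> \<in> P12 n k. npairs \<pi> = r} = (n choose r) * (\<Prod>i = 0..<r. k - i)" .
 have "(\<Prod>i = 0..<r. k - i) * fact (k - r) = (fact k :: nat)"
  using r(2)
 proof (induction r)
  case (Suc r)
  have "fact (k - r) = (k - r) * (fact (k - Suc r) :: nat)"
   using Suc.prems by (metis Suc_diff_Suc Suc_le_lessD fact_Suc of_nat_id)
  then show ?case using Suc by (simp add: mult_ac)
 qed simp
 then show ?thesis using binomial_fact_lemma[OF r(1)] unfolding c
  by (metis (no_types, opaque_lifting) ab_semigroup_mult_class.mult_ac(1) mult.commute)
qed

lemma sum_P12:
 fixes h :: "nat \<Rightarrow> complex"
 shows "(\<Sum>\<pi>\<in>P12 n k. h (npairs \<pi>)) =
  (\<Sum>r | r \<le> n \<and> r \<le> k. fact n * fact k / (fact r * fact (n - r) * fact (k - r)) * h r)"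
proof -
 have fin: "finite (P12 n k)"
  by (rule finite_subset[OF _ finite_permutations[of "{1..n + k}"]]) (auto simp: P12_def)
 have le: "npairs \<pi> \<le> n \<and> npairs \<pi> \<le> k" if "\<pi> \<in> P12 n k" for \<pi>
 proof -
  interpret pair_partition \<pi> n k by unfold_locales (rule that)
  show ?thesis using r_le by simp
 qed
 have "(\<Sum>\<pi>\<in>P12 n k. h (npairs \<pi>)) = (\<Sum>r | r \<le> n \<and> r \<le> k. \<Sum>\<pi> | \<pi> \<in> P12 n k \<and> npairs \<pi> = r. h (npairs \<pi>))"
  by (rule sum.group[OF fin, symmetric]) (use le in auto)
 also have "\<dots> = (\<Sum>r | r \<le> n \<and> r \<le> k. fact n * fact k / (fact r * fact (n - r) * fact (k - r)) * h r)"
 proof (rule sum.cong[OF refl])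
  fix r assume "r \<in> {r. r \<le> n \<and> r \<le> k}"
  then have "complex_of_nat (card {\<pi> \<in> P12 n k. npairs \<pi> = r} * (fact r * fact (n - r) * fact (k - r))) = of_nat (fact n * fact k)"
   by (simp only: card_P12 mem_Collect_eq)
  then have "of_nat (card {\<pi> \<in> P12 n k. npairs \<pi> = r}) * (fact r * fact (n - r) * fact (k - r)) = (fact n * fact k :: complex)"
   by (simp only: of_nat_mult of_nat_fact)
  then have "of_nat (card {\<pi> \<in> P12 n k. npairs \<pi> = r}) = (fact n * fact k / (fact r * fact (n - r) * fact (k - r)) :: complex)"
   by (subst nonzero_eq_divide_eq) simp_all
  moreover have "(\<Sum>\<pi> | \<pi> \<in> P12 n k \<and> npairs \<pi> = r. h (npairs \<pi>)) = (\<Sum>\<pi> | \<pi> \<in> P12 n k \<and> npairs \<pi> = r. h r)"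
   by (rule sum.cong) auto
  ultimately show "(\<Sum>\<pi> | \<pi> \<in> P12 n k \<and> npairs \<pi> = r. h (npairs \<pi>)) =
   fact n * fact k / (fact r * fact (n - r) * fact (k - r)) * h r" by simp
 qed
 finally show ?thesis .
qed

context letters
begin

text \<open>The defining recursion of \<open>wick\<close> hands each letter to one of the two factors.\<close>

lemma wick_subsets:
 assumes "distinct ks"
 shows "wick (map W ks) f g = (\<Sum>A\<in>Pow (set ks).
  pairing (\<lambda>u. f (map W (filter (\<lambda>i. i \<in> A) ks) @ u)) (\<lambda>u. g (map W (filter (\<lambda>i. i \<notin> A) ks) @ u)))"
 using assms
proof (induction ks arbitrary: f g)
 case Nil
 show ?case by simp
next
 case (Cons x ks)
 let ?h = "\<lambda>A. pairing (\<lambda>u. f (map W (filter (\<lambda>i. i \<in> A) (x # ks)) @ u)) (\<lambda>u. g (map W (filter (\<lambda>i. i \<notin> A) (x # ks)) @ u))"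
 have x: "x \<notin> set ks" using Cons.prems by simp
 have inj: "inj_on (insert x) (Pow (set ks))" using x by (intro inj_onI) (metis PowD insert_ident subsetD)
 have disj: "Pow (set ks) \<inter> insert x ` Pow (set ks) = {}" using x by blast
 have "(\<Sum>A\<in>Pow (set (x # ks)). ?h A) = (\<Sum>A\<in>Pow (set ks). ?h A) + (\<Sum>A\<in>Pow (set ks). ?h (insert x A))"
  unfolding list.set Pow_insert by (subst sum.union_disjoint) (simp_all add: disj sum.reindex[OF inj])
 also have "(\<Sum>A\<in>Pow (set ks). ?h A) = wick (map W ks) f (\<lambda>u. g (W x # u))"
  unfolding Cons.IH[OF distinct.simps(2)[THEN iffD1, THEN conjunct2, OF Cons.prems]]
  by (rule sum.cong[OF refl]) (use x in auto)
 also have "(\<Sum>A\<in>Pow (set ks). ?h (insert x A)) = wick (map W ks) (\<lambda>u. f (W x # u)) g"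
  unfolding Cons.IH[OF distinct.simps(2)[THEN iffD1, THEN conjunct2, OF Cons.prems]]
 proof (rule sum.cong[OF refl])
  fix A
  have "filter (\<lambda>i. i \<in> insert x A) ks = filter (\<lambda>i. i \<in> A) ks" "filter (\<lambda>i. i \<notin> insert x A) ks = filter (\<lambda>i. i \<notin> A) ks"
   using x by (auto intro!: filter_cong)
  then show "?h (insert x A) = pairing (\<lambda>u. f (W x # map W (filter (\<lambda>i. i \<in> A) ks) @ u)) (\<lambda>u. g (map W (filter (\<lambda>i. i \<notin> A) ks) @ u))"
   by simp
 qed
 finally show ?case by (simp add: add.commute)
qed

lemma pairing_by_length:
 assumes R: "finite R" and z: "\<And>c. c \<in> words \<Longrightarrow> length c \<notin> R \<Longrightarrow> f c * g (map bar c) = 0"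
  and s: "(\<lambda>c. f c * g (map bar c) / fact (length c)) summable_on words"
 shows "pairing f g = (\<Sum>r\<in>R. (\<Sum>\<^sub>\<infinity>c\<in>{c \<in> words. length c = r}. f c * g (map bar c)) / fact r)"
  and "\<And>r. (\<lambda>c. f c * g (map bar c)) summable_on {c \<in> words. length c = r}"
proof -
 show sr: "(\<lambda>c. f c * g (map bar c)) summable_on {c \<in> words. length c = r}" for r
 proof -
  have "(\<lambda>c. fact r * (f c * g (map bar c) / fact (length c))) summable_on {c \<in> words. length c = r}"
   by (rule summable_on_cmult_right[OF summable_on_subset_banach[OF s]]) auto
  then show ?thesis by (rule summable_on_cong[THEN iffD1, rotated]) auto
 qed
 have "((\<lambda>c. f c * g (map bar c) / fact (length c)) has_sum
   (\<Sum>\<^sub>\<infinity>c\<in>{c \<in> words. length c = r}. f c * g (map bar c)) / fact r) {c \<in> words. length c = r}" for r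
 proof -
  have "((\<lambda>c. f c * g (map bar c) / fact r) has_sum
   (\<Sum>\<^sub>\<infinity>c\<in>{c \<in> words. length c = r}. f c * g (map bar c)) / fact r) {c \<in> words. length c = r}"
   using has_sum_cmult_left[OF has_sum_infsum[OF sr], of "1 / fact r" r] by simp
  then show ?thesis by (rule has_sum_cong[THEN iffD1, rotated]) auto
 qed
 then have "((\<lambda>c. f c * g (map bar c) / fact (length c)) has_sum
   (\<Sum>r\<in>R. (\<Sum>\<^sub>\<infinity>c\<in>{c \<in> words. length c = r}. f c * g (map bar c)) / fact r)) (\<Union>r\<in>R. {c \<in> words. length c = r})"
  by (intro sum_has_sum[OF R]) auto
 also have "?this \<longleftrightarrow> ((\<lambda>c. f c * g (map bar c) / fact (length c)) has_sum
   (\<Sum>r\<in>R. (\<Sum>\<^sub>\<infinity>c\<in>{c \<in> words. length c = r}. f c * g (map bar c)) / fact r)) words"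
  by (rule has_sum_cong_neutral) (use z in auto)
 finally show "pairing f g = (\<Sum>r\<in>R. (\<Sum>\<^sub>\<infinity>c\<in>{c \<in> words. length c = r}. f c * g (map bar c)) / fact r)"
  unfolding pairing_def by (rule infsumI)
qed

end

section \<open>The product in the matrix model\<close>

context model_pairing
begin

lemma mset_map_sets:
 assumes "distinct xs" "distinct ys" "set xs = set ys"
 shows "mset (map f xs) = mset (map f ys)"
 using assms set_eq_iff_mset_eq_distinct by (metis mset_map)

lemma word_left:
 assumes "c \<in> lefts \<rightarrow>\<^sub>E L"
 shows "mset (map w [1..<Suc (n - r)] @ map c (sorted_list_of_set lefts)) = mset (map (joinw w c) [1..<Suc n])"
proof -
 let ?ls = "sorted_list_of_set lefts"
 have 1: "map w [1..<Suc (n - r)] = map (joinw w c) (map u [1..<Suc (n - r)])" by (simp add: joinw_u del: upt_Suc)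
 have 2: "map c ?ls = map (joinw w c) ?ls" using joinw_left by (simp add: fin_lefts)
 have "set (map u [1..<Suc (n - r)] @ ?ls) = {1..n}"
  using u_image1 lefts_sub by (auto simp: fin_lefts atLeastLessThanSuc_atLeastAtMost simp del: upt_Suc)
 moreover have "distinct (map u [1..<Suc (n - r)] @ ?ls)"
  using u_image1 inj_on_subset[OF u_inj subset_UNIV, of "{1..n - r}"]
  by (auto simp: fin_lefts distinct_map atLeastLessThanSuc_atLeastAtMost simp del: upt_Suc)
 ultimately show ?thesis unfolding 1 2 map_append[symmetric]
  by (intro mset_map_sets) (auto simp del: upt_Suc)
qed

lemma word_right:
 assumes "c \<in> lefts \<rightarrow>\<^sub>E L"
 shows "mset (map w [Suc (n - r)..<Suc m] @ map bar (map c (sorted_list_of_set lefts))) =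
  mset (map (\<lambda>i. joinw w c (n + i)) [1..<Suc k])"
proof -
 let ?rs = "map \<pi> (sorted_list_of_set lefts)"
 let ?us = "map u [Suc (n - r)..<Suc m]"
 have 1: "map w [Suc (n - r)..<Suc m] = map (joinw w c) ?us" by (simp add: joinw_u del: upt_Suc)
 have 2: "map bar (map c (sorted_list_of_set lefts)) = map (joinw w c) ?rs"
  using joinw_right[OF pi_rights] by (simp add: fin_lefts)
 have 3: "map (\<lambda>i. joinw w c (n + i)) [1..<Suc k] = map (joinw w c) (map ((+) n) [1..<Suc k])" by (simp del: upt_Suc)
 have rs: "set ?rs = rights" by (simp add: fin_lefts) (simp add: rights_def lefts_def)
 have us: "set ?us = {n + 1..n + k} - rights"
  using u_image2 by (simp add: atLeastLessThanSuc_atLeastAtMost del: upt_Suc)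
 have "set (map ((+) n) [1..<Suc k]) = {n + 1..n + k}"
  by (simp add: atLeastLessThanSuc_atLeastAtMost del: upt_Suc)
 then have "set (?us @ ?rs) = set (map ((+) n) [1..<Suc k])" unfolding set_append rs us using rights_sub by auto
 moreover have "distinct (?us @ ?rs)"
 proof -
  have "distinct ?us" using inj_on_subset[OF u_inj subset_UNIV] by (simp add: distinct_map del: upt_Suc)
  moreover have "distinct ?rs" using permutes_inj_on[OF perm] by (simp add: distinct_map)
  ultimately show ?thesis unfolding distinct_append rs us by blast
 qed
 moreover have "distinct (map ((+) n) [1..<Suc k])" by (simp add: distinct_map del: upt_Suc)
 ultimately show ?thesis unfolding 1 2 3 map_append[symmetric] by (intro mset_map_sets)
qed

text \<open>By symmetry the letters may be listed with the surviving ones first, which turns the sum over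
 assignments of contracted letters into a sum over words.\<close>

lemma contraction_Phi:
 assumes \<xi>: "\<xi> \<in> U.families" and \<eta>: "\<eta> \<in> U.families" and ab: "a < N" "b < N"
  and w: "\<And>j. j \<in> {1..m} \<Longrightarrow> w j \<in> L"
 shows "(\<Sum>\<alpha>\<in>S0 n. \<Sum>\<beta>\<in>S0 k. of_real (contract_coeff q (n + k) \<pi> (perm_cup n \<alpha> \<beta>)) *
   entry m (contract_perm \<pi> (perm_cup n \<alpha> \<beta>)) (contract_tensor \<pi> (tensor_prod n (\<xi> n \<alpha>) (\<eta> k \<beta>))) a b w) *
   (of_nat N ^ r * scale n * scale k) =
  (\<Sum>\<^sub>\<infinity>z\<in>{z \<in> words. length z = r}. \<Sum>d<N. Phi \<xi> a d (map w [1..<Suc (n - r)] @ z) *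
   Phi \<eta> d b (map w [Suc (n - r)..<Suc m] @ map bar z))"
  (is "?S * _ = (\<Sum>\<^sub>\<infinity>z\<in>?Z. ?q z)")
proof -
 let ?ls = "sorted_list_of_set lefts"
 have "((\<lambda>c. \<Sum>\<alpha>\<in>S0 n. \<Sum>\<beta>\<in>S0 k. \<Sum>d<N. entry n \<alpha> (\<xi> n \<alpha>) a d (joinw w c) * entry k \<beta> (\<eta> k \<beta>) d b (\<lambda>i. joinw w c (n + i)))
  has_sum (\<Sum>\<alpha>\<in>S0 n. \<Sum>\<beta>\<in>S0 k. of_real (real N ^ r * contract_coeff q (n + k) \<pi> (perm_cup n \<alpha> \<beta>)) *
   entry m (contract_perm \<pi> (perm_cup n \<alpha> \<beta>)) (contract_tensor \<pi> (tensor_prod n (\<xi> n \<alpha>) (\<eta> k \<beta>))) a b w))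
  (lefts \<rightarrow>\<^sub>E L)"
  by (rule has_sum_finite_sum[OF finite_S0], rule has_sum_finite_sum[OF finite_S0],
    rule contraction_entry[OF _ _ U.familiesD(5)[OF \<xi>] U.familiesD(5)[OF \<eta>] ab(2) w])
 also have "(\<Sum>\<alpha>\<in>S0 n. \<Sum>\<beta>\<in>S0 k. of_real (real N ^ r * contract_coeff q (n + k) \<pi> (perm_cup n \<alpha> \<beta>)) *
   entry m (contract_perm \<pi> (perm_cup n \<alpha> \<beta>)) (contract_tensor \<pi> (tensor_prod n (\<xi> n \<alpha>) (\<eta> k \<beta>))) a b w) =
   of_nat N ^ r * ?S"
  by (simp only: sum_distrib_left of_real_mult of_real_power of_real_of_nat_eq mult.assoc)
 finally have "((\<lambda>c. scale n * scale k * (\<Sum>\<alpha>\<in>S0 n. \<Sum>\<beta>\<in>S0 k. \<Sum>d<N. entry n \<alpha> (\<xi> n \<alpha>) a d (joinw w c) *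
   entry k \<beta> (\<eta> k \<beta>) d b (\<lambda>i. joinw w c (n + i)))) has_sum scale n * scale k * (of_nat N ^ r * ?S)) (lefts \<rightarrow>\<^sub>E L)"
  by (rule has_sum_cmult_right)
 then have "((\<lambda>c. ?q (map c ?ls)) has_sum scale n * scale k * (of_nat N ^ r * ?S)) (lefts \<rightarrow>\<^sub>E L)"
 proof (rule has_sum_cong[THEN iffD1, rotated])
  fix c :: "nat \<Rightarrow> 'a letter" assume c: "c \<in> lefts \<rightarrow>\<^sub>E L"
  have jL: "joinw w c i \<in> L" if "i \<in> {1..n + k}" for i by (rule joinw_L[OF _ c that]) (rule w)
  have 1: "Phi \<xi> a d (map w [1..<Suc (n - r)] @ map c ?ls) = scale n * Psi \<xi> n a d (joinw w c)" if "d < N" for d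
   by (rule Phi_map[OF \<xi> ab(1) that _ word_left[OF c]]) (rule jL, simp)
  have 2: "Phi \<eta> d b (map w [Suc (n - r)..<Suc m] @ map bar (map c ?ls)) = scale k * Psi \<eta> k d b (\<lambda>i. joinw w c (n + i))" if "d < N" for d
   by (rule Phi_map[OF \<eta> that ab(2) _ word_right[OF c]]) (rule jL, simp)
  have "(\<Sum>\<alpha>\<in>S0 n. \<Sum>\<beta>\<in>S0 k. \<Sum>d<N. entry n \<alpha> (\<xi> n \<alpha>) a d (joinw w c) * entry k \<beta> (\<eta> k \<beta>) d b (\<lambda>i. joinw w c (n + i)))
   = (\<Sum>\<alpha>\<in>S0 n. \<Sum>d<N. \<Sum>\<beta>\<in>S0 k. entry n \<alpha> (\<xi> n \<alpha>) a d (joinw w c) * entry k \<beta> (\<eta> k \<beta>) d b (\<lambda>i. joinw w c (n + i)))"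
   by (rule sum.cong[OF refl], rule sum.swap)
  also have "\<dots> = (\<Sum>d<N. \<Sum>\<alpha>\<in>S0 n. \<Sum>\<beta>\<in>S0 k. entry n \<alpha> (\<xi> n \<alpha>) a d (joinw w c) * entry k \<beta> (\<eta> k \<beta>) d b (\<lambda>i. joinw w c (n + i)))"
   by (rule sum.swap)
  also have "\<dots> = (\<Sum>d<N. Psi \<xi> n a d (joinw w c) * Psi \<eta> k d b (\<lambda>i. joinw w c (n + i)))"
   by (simp only: Psi_def sum_product)
  finally have "scale n * scale k * (\<Sum>\<alpha>\<in>S0 n. \<Sum>\<beta>\<in>S0 k. \<Sum>d<N. entry n \<alpha> (\<xi> n \<alpha>) a d (joinw w c) * entry k \<beta> (\<eta> k \<beta>) d b (\<lambda>i. joinw w c (n + i)))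
   = (\<Sum>d<N. (scale n * Psi \<xi> n a d (joinw w c)) * (scale k * Psi \<eta> k d b (\<lambda>i. joinw w c (n + i))))"
   by (simp only: sum_distrib_left mult_ac)
  also have "\<dots> = ?q (map c ?ls)" by (rule sum.cong[OF refl]) (simp only: 1 2 lessThan_iff)
  finally show "scale n * scale k * (\<Sum>\<alpha>\<in>S0 n. \<Sum>\<beta>\<in>S0 k. \<Sum>d<N. entry n \<alpha> (\<xi> n \<alpha>) a d (joinw w c) *
   entry k \<beta> (\<eta> k \<beta>) d b (\<lambda>i. joinw w c (n + i))) = ?q (map c ?ls)" .
 qed
 moreover have "bij_betw (\<lambda>c. map c ?ls) (lefts \<rightarrow>\<^sub>E L) ?Z"
  using bij_list[of ?ls L] by (simp add: fin_lefts card_lefts)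
 ultimately have "(?q has_sum scale n * scale k * (of_nat N ^ r * ?S)) ?Z"
  using has_sum_reindex_bij_betw[of "\<lambda>c. map c ?ls" "lefts \<rightarrow>\<^sub>E L" ?Z ?q] by blast
 then show ?thesis by (simp add: infsumI mult_ac)
qed

end

context matrix_model
begin

lemma Phi_sum: "Phi (\<lambda>m \<gamma> x. \<Sum>i\<in>I. f i m \<gamma> x) a b w = (\<Sum>i\<in>I. Phi (f i) a b w)"
proof -
 have "entry n \<alpha> (\<lambda>x. \<Sum>i\<in>I. f i n \<alpha> x) a b W = (\<Sum>i\<in>I. entry n \<alpha> (f i n \<alpha>) a b W)" for n \<alpha> W
 proof (cases "\<forall>k\<in>{0..n}. colf a W k = rowf b W (\<alpha> k)")
  case True
  show ?thesis by (simp only: entry_def if_P[OF True] sum_distrib_left)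
 next
  case False
  show ?thesis by (simp only: entry_def if_not_P[OF False] sum.neutral_const)
 qed
 then have "Psi (\<lambda>m \<gamma> x. \<Sum>i\<in>I. f i m \<gamma> x) n a b W = (\<Sum>i\<in>I. Psi (f i) n a b W)" for n W
  unfolding Psi_def by (simp add: sum.swap[of _ I])
 note Psi = this
 show ?thesis
 proof (cases "a < N \<and> b < N \<and> w \<in> words")
  case True
  show ?thesis by (simp only: Phi_def if_P[OF True] Psi sum_distrib_left)
 next
  case False
  show ?thesis by (simp only: Phi_def if_not_P[OF False] sum.neutral_const)
 qed
qed

lemma Phi_cmult: "Phi (\<lambda>m \<gamma> x. c * f m \<gamma> x) a b w = c * Phi f a b w"
proof -
 have "entry n \<alpha> (\<lambda>x. c * f n \<alpha> x) a b W = c * entry n \<alpha> (f n \<alpha>) a b W" for n \<alpha> W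
  by (simp add: entry_def)
 then have "Psi (\<lambda>m \<gamma> x. c * f m \<gamma> x) n a b W = c * Psi f n a b W" for n W
  unfolding Psi_def by (simp add: sum_distrib_left)
 then show ?thesis by (simp add: Phi_def)
qed

lemma Phi_symt:
 assumes \<gamma>: "\<gamma> \<in> S0 m" and ab: "a < N" "b < N" and w: "w \<in> words"
 shows "Phi (symt m \<gamma> H) a b w = (if length w = m then
  of_real (sqrt (1 / real N) ^ m) * (\<Sum>\<sigma>\<in>Sn m. entry m \<gamma> H a b (\<lambda>k. w ! (\<sigma> k - 1))) else 0)"
proof (cases "length w = m")
 case True
 let ?W = "\<lambda>k. w ! (k - 1)"
 have e: "entry m \<delta> (symt m \<gamma> H m \<delta>) a b ?W =
   (\<Sum>\<sigma>\<in>Sn m. if \<delta> = conj_by \<sigma> \<gamma> then entry m \<delta> (\<lambda>x. H (x \<circ> \<sigma>)) a b ?W else 0) / fact m" for \<delta>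
 proof -
  have H: "symt m \<gamma> H m \<delta> = (\<lambda>x. (\<Sum>\<sigma>\<in>Sn m. if \<delta> = conj_by \<sigma> \<gamma> then H (x \<circ> \<sigma>) else 0) / fact m)"
   unfolding symt_def conj_by_def perm_op_def by simp
  show ?thesis
  proof (cases "\<forall>k\<in>{0..m}. colf a ?W k = rowf b ?W (\<delta> k)")
   case True
   show ?thesis unfolding H entry_def if_P[OF True]
    by (simp add: sum_distrib_left if_distrib[where f = "\<lambda>x. complex_of_real (sg \<delta>) * x"] cong: if_cong)
  next
   case False
   show ?thesis by (simp only: entry_def if_not_P[OF False] if_cancel sum.neutral_const div_0)
  qed
 qed
 have "Psi (symt m \<gamma> H) m a b ?W =
   (\<Sum>\<delta>\<in>S0 m. \<Sum>\<sigma>\<in>Sn m. if \<delta> = conj_by \<sigma> \<gamma> then entry m \<delta> (\<lambda>x. H (x \<circ> \<sigma>)) a b ?W else 0) / fact m"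
  unfolding Psi_def e by (rule sum_divide_distrib[symmetric])
 also have "\<dots> = (\<Sum>\<sigma>\<in>Sn m. \<Sum>\<delta>\<in>S0 m. if \<delta> = conj_by \<sigma> \<gamma> then entry m \<delta> (\<lambda>x. H (x \<circ> \<sigma>)) a b ?W else 0) / fact m"
  by (subst sum.swap) (rule refl)
 also have "\<dots> = (\<Sum>\<sigma>\<in>Sn m. entry m \<gamma> H a b (\<lambda>k. w ! (\<sigma> k - 1))) / fact m"
 proof (rule arg_cong[where f = "\<lambda>x. x / fact m"], rule sum.cong[OF refl])
  fix \<sigma> assume \<sigma>: "\<sigma> \<in> Sn m"
  have "(\<Sum>\<delta>\<in>S0 m. if \<delta> = conj_by \<sigma> \<gamma> then entry m \<delta> (\<lambda>x. H (x \<circ> \<sigma>)) a b ?W else 0) =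
    entry m (conj_by \<sigma> \<gamma>) (\<lambda>x. H (x \<circ> \<sigma>)) a b ?W"
   using conj_S0[OF \<sigma> \<gamma>] by (simp add: finite_S0)
  then show "(\<Sum>\<delta>\<in>S0 m. if \<delta> = conj_by \<sigma> \<gamma> then entry m \<delta> (\<lambda>x. H (x \<circ> \<sigma>)) a b ?W else 0) =
    entry m \<gamma> H a b (\<lambda>k. w ! (\<sigma> k - 1))"
   using entry_conj[OF \<sigma> \<gamma>, of H a b ?W] by (simp add: comp_def)
 qed
 finally show ?thesis using True ab w by (simp add: Phi_def scale_def)
next
 case False
 then have "entry (length w) \<delta> (symt m \<gamma> H (length w) \<delta>) a b W = 0" for \<delta> W
  by (simp add: entry_def symt_def)
 then show ?thesis using False by (simp add: Phi_def Psi_def)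
qed

end

context matrix_model
begin

text \<open>Both sides are sums over the ways to distribute the letters of \<open>w\<close> over the two factors and over the words
 of contracted letters.  There are \<open>n! k! / (r! (n - r)! (k - r)!)\<close> contractions with \<open>r\<close> pairs, and
 \<open>(n - r)! (k - r)!\<close> rearrangements of \<open>w\<close> with a given set of letters in front; together with the scales
 of the factors they leave \<open>1 / r!\<close>, the weight of a word of length \<open>r\<close> in the pairing.\<close>

lemma Phi_mult:
 assumes \<xi>: "\<xi> \<in> U.families" and \<eta>: "\<eta> \<in> U.families" and ab: "a < N" "b < N" and w: "w \<in> words"
 shows "Phi (tpmult q \<xi> \<eta>) a b w = (\<Sum>d<N. wick w (Phi \<xi> a d) (Phi \<eta> d b))"
proof -
 define M where "M = length w"
 define W where "W k = w ! (k - 1)" for k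
 define Q where "Q r us vs = (\<Sum>\<^sub>\<infinity>z\<in>{z \<in> words. length z = r}. \<Sum>d<N. Phi \<xi> a d (us @ z) * Phi \<eta> d b (vs @ map bar z))" for r us vs
 define ks where "ks = [1..<Suc M]"
 define G where "G r A = Q r (map W (filter (\<lambda>i. i \<in> A) ks)) (map W (filter (\<lambda>i. i \<notin> A) ks))" for r A
 define T where "T n k = {r. r \<le> n \<and> r \<le> k \<and> n + k - 2 * r = M}" for n k
 define S where "S n r = {A. A \<subseteq> {1..M} \<and> card A = n - r}" for n r :: nat
 have WL: "W j \<in> L" if "j \<in> {1..M}" for j using w that by (auto simp: W_def M_def in_lists_conv_set)
 have ks: "distinct ks" "set ks = {1..M}" by (auto simp: ks_def)
 have wW: "map W ks = w" unfolding W_def ks_def M_def by (rule word_map)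
 have Qcong: "Q r us vs = Q r us' vs'" if m: "mset us = mset us'" "mset vs = mset vs'" and us: "us \<in> words" and vs: "vs \<in> words" for r us us' vs vs'
  unfolding Q_def
 proof (rule infsum_cong, rule sum.cong[OF refl])
  fix z d assume z: "z \<in> {z \<in> words. length z = r}"
  then have "us @ z \<in> words" "vs @ map bar z \<in> words" using us vs map_bar_words by auto
  then have "Phi \<xi> a d (us @ z) = Phi \<xi> a d (us' @ z)" "Phi \<eta> d b (vs @ map bar z) = Phi \<eta> d b (vs' @ map bar z)"
   by (auto intro!: symmetricD[OF Phi_symmetric[OF \<xi>]] symmetricD[OF Phi_symmetric[OF \<eta>]] simp: m)
  then show "Phi \<xi> a d (us @ z) * Phi \<eta> d b (vs @ map bar z) = Phi \<xi> a d (us' @ z) * Phi \<eta> d b (vs' @ map bar z)" by simp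
 qed
 have step: "(\<Sum>\<alpha>\<in>S0 n. \<Sum>\<beta>\<in>S0 k. of_real (contract_coeff q (n + k) \<pi> (perm_cup n \<alpha> \<beta>)) *
   Phi (symt (n + k - 2 * npairs \<pi>) (contract_perm \<pi> (perm_cup n \<alpha> \<beta>))
    (contract_tensor \<pi> (tensor_prod n (\<xi> n \<alpha>) (\<eta> k \<beta>)))) a b w) =
   (if n + k - 2 * npairs \<pi> = M then fact (n - npairs \<pi>) * fact (k - npairs \<pi>) / (fact n * fact k) * (\<Sum>A\<in>S n (npairs \<pi>). G (npairs \<pi>) A) else 0)"
  if \<pi>: "\<pi> \<in> P12 n k" for n k \<pi>
 proof (cases "n + k - 2 * npairs \<pi> = M")
  case False
  have "Phi (symt (n + k - 2 * npairs \<pi>) \<gamma> H) a b w = 0" for \<gamma> H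
  proof -
   have "entry (length w) \<delta> (symt (n + k - 2 * npairs \<pi>) \<gamma> H (length w) \<delta>) a b W = 0" for \<delta> W
    using False by (simp add: entry_def symt_def M_def)
   then show ?thesis by (simp add: Phi_def Psi_def)
  qed
  then show ?thesis using False by simp
 next
  case True
  interpret model_pairing N neg q ty \<pi> n k by unfold_locales (rule \<pi>)
  have cpS: "contract_perm \<pi> (perm_cup n \<alpha> \<beta>) \<in> S0 M" if "\<alpha> \<in> S0 n" "\<beta> \<in> S0 k" for \<alpha> \<beta>
   using contract_perm_S0[OF S0_permutes[OF perm_cup_S0[OF that]]] by (simp add: True)
  let ?t = "complex_of_real (sqrt (1 / real N))"
  let ?c = "\<lambda>\<alpha> \<beta>. complex_of_real (contract_coeff q (n + k) \<pi> (perm_cup n \<alpha> \<beta>))"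
  let ?e = "\<lambda>\<alpha> \<beta> \<sigma>. entry M (contract_perm \<pi> (perm_cup n \<alpha> \<beta>)) (contract_tensor \<pi> (tensor_prod n (\<xi> n \<alpha>) (\<eta> k \<beta>))) a b (\<lambda>j. W (\<sigma> j))"
  let ?K = "of_nat N ^ r * scale n * scale k"
  have K0: "?K \<noteq> 0" using N scale_nz by simp
  have nr: "n - r \<le> M" "M - (n - r) = k - r" "r \<le> n" "r \<le> k" using r_le True by linarith+
  have Kt: "?t ^ M / ?K = 1 / (fact n * fact k)"
  proof -
   have "sqrt (1 / real N) ^ 2 * real N = 1" using N by simp
   then have "complex_of_real (sqrt (1 / real N) ^ 2 * real N) = 1" by (simp only: of_real_1)
   then have "?t ^ 2 * of_nat N = 1" by (simp only: of_real_mult of_real_power of_real_of_nat_eq)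
   then have t2: "(?t ^ 2 * of_nat N) ^ r = 1" by (simp only: power_one)
   have nk: "n + k = M + 2 * r" using True r_le by linarith
   have "?t ^ n * ?t ^ k = ?t ^ (n + k)" by (rule power_add[symmetric])
   also have "\<dots> = ?t ^ M * (?t ^ 2) ^ r" unfolding nk by (simp only: power_add power_mult)
   finally have tt: "?t ^ n * ?t ^ k = ?t ^ M * (?t ^ 2) ^ r" .
   have "?K = fact n * fact k * ((?t ^ n * ?t ^ k) * of_nat N ^ r)"
    by (simp only: scale_def of_real_power mult_ac)
   also have "\<dots> = fact n * fact k * (?t ^ M * (?t ^ 2 * of_nat N) ^ r)"
    unfolding tt by (simp only: power_mult_distrib mult.assoc)
   finally have "?K = fact n * fact k * ?t ^ M" by (simp only: t2 mult_1_right)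
   moreover have "?t ^ M \<noteq> 0" using N by simp
   ultimately show ?thesis by simp
  qed
  have ent: "(\<Sum>\<alpha>\<in>S0 n. \<Sum>\<beta>\<in>S0 k. ?c \<alpha> \<beta> * ?e \<alpha> \<beta> \<sigma>) * ?K = G r (\<sigma> ` {1..n - r})" if \<sigma>: "\<sigma> \<in> Sn M" for \<sigma>
  proof -
   have ps: "\<sigma> permutes {1..M}" by (rule Sn_permutes[OF \<sigma>])
   have inj: "inj_on \<sigma> X" for X by (rule permutes_inj_on[OF ps])
   have sL: "W (\<sigma> j) \<in> L" if "j \<in> {1..M}" for j using WL permutes_in_image[OF ps] that by blast
   have im: "\<sigma> ` {Suc (n - r)..M} = {1..M} - \<sigma> ` {1..n - r}"
   proof -
    have "{Suc (n - r)..M} = {1..M} - {1..n - r}" by auto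
    then show ?thesis using image_set_diff[OF permutes_inj[OF ps]] permutes_image[OF ps] by metis
   qed
   have sub: "\<sigma> ` {1..n - r} \<subseteq> {1..M}" using image_mono[of "{1..n - r}" "{1..M}" \<sigma>] permutes_image[OF ps] nr(1) by auto
   have m1: "mset (map (\<lambda>j. W (\<sigma> j)) [1..<Suc (n - r)]) = mset (map W (filter (\<lambda>i. i \<in> \<sigma> ` {1..n - r}) ks))"
   proof -
    have "mset (map W (map \<sigma> [1..<Suc (n - r)])) = mset (map W (filter (\<lambda>i. i \<in> \<sigma> ` {1..n - r}) ks))"
    proof (rule mset_map_sets)
     show "set (map \<sigma> [1..<Suc (n - r)]) = set (filter (\<lambda>i. i \<in> \<sigma> ` {1..n - r}) ks)"
      using sub by (auto simp: ks(2) atLeastLessThanSuc_atLeastAtMost simp del: upt_Suc)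
    qed (use ks(1) inj in \<open>simp_all add: distinct_map del: upt_Suc\<close>)
    then show ?thesis by (simp add: comp_def del: upt_Suc)
   qed
   have m2: "mset (map (\<lambda>j. W (\<sigma> j)) [Suc (n - r)..<Suc M]) = mset (map W (filter (\<lambda>i. i \<notin> \<sigma> ` {1..n - r}) ks))"
   proof -
    have "mset (map W (map \<sigma> [Suc (n - r)..<Suc M])) = mset (map W (filter (\<lambda>i. i \<notin> \<sigma> ` {1..n - r}) ks))"
    proof (rule mset_map_sets)
     have "set (map \<sigma> [Suc (n - r)..<Suc M]) = \<sigma> ` {Suc (n - r)..M}"
      by (simp only: set_map set_upt atLeastLessThanSuc_atLeastAtMost)
     also have "\<dots> = set (filter (\<lambda>i. i \<notin> \<sigma> ` {1..n - r}) ks)"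
      unfolding im set_filter ks(2) by blast
     finally show "set (map \<sigma> [Suc (n - r)..<Suc M]) = set (filter (\<lambda>i. i \<notin> \<sigma> ` {1..n - r}) ks)" .
    qed (use ks(1) inj in \<open>simp_all add: distinct_map del: upt_Suc\<close>)
    then show ?thesis by (simp add: comp_def del: upt_Suc)
   qed
   have "(\<Sum>\<alpha>\<in>S0 n. \<Sum>\<beta>\<in>S0 k. ?c \<alpha> \<beta> * ?e \<alpha> \<beta> \<sigma>) * ?K =
     Q r (map (\<lambda>j. W (\<sigma> j)) [1..<Suc (n - r)]) (map (\<lambda>j. W (\<sigma> j)) [Suc (n - r)..<Suc M])"
    using contraction_Phi[OF \<xi> \<eta> ab, of "\<lambda>j. W (\<sigma> j)"] sL unfolding True Q_def by simp
   also have "\<dots> = G r (\<sigma> ` {1..n - r})"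
    unfolding G_def
   proof (rule Qcong[OF m1 m2])
    show "map (\<lambda>j. W (\<sigma> j)) [1..<Suc (n - r)] \<in> words" "map (\<lambda>j. W (\<sigma> j)) [Suc (n - r)..<Suc M] \<in> words"
     using sL nr(1) by (auto simp del: upt_Suc)
   qed
   finally show ?thesis .
  qed
  have "(\<Sum>\<alpha>\<in>S0 n. \<Sum>\<beta>\<in>S0 k. ?c \<alpha> \<beta> * Phi (symt (n + k - 2 * r) (contract_perm \<pi> (perm_cup n \<alpha> \<beta>))
    (contract_tensor \<pi> (tensor_prod n (\<xi> n \<alpha>) (\<eta> k \<beta>)))) a b w) =
    (\<Sum>\<alpha>\<in>S0 n. \<Sum>\<beta>\<in>S0 k. \<Sum>\<sigma>\<in>Sn M. ?t ^ M * (?c \<alpha> \<beta> * ?e \<alpha> \<beta> \<sigma>))"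
  proof (rule sum.cong[OF refl], rule sum.cong[OF refl])
   fix \<alpha> \<beta> assume "\<alpha> \<in> S0 n" "\<beta> \<in> S0 k"
   from Phi_symt[OF cpS[OF this] ab w, of "contract_tensor \<pi> (tensor_prod n (\<xi> n \<alpha>) (\<eta> k \<beta>))"]
   show "?c \<alpha> \<beta> * Phi (symt (n + k - 2 * r) (contract_perm \<pi> (perm_cup n \<alpha> \<beta>))
    (contract_tensor \<pi> (tensor_prod n (\<xi> n \<alpha>) (\<eta> k \<beta>)))) a b w = (\<Sum>\<sigma>\<in>Sn M. ?t ^ M * (?c \<alpha> \<beta> * ?e \<alpha> \<beta> \<sigma>))"
    unfolding True by (simp add: M_def[symmetric] W_def sum_distrib_left mult_ac)
  qed
  also have "\<dots> = (\<Sum>\<alpha>\<in>S0 n. \<Sum>\<sigma>\<in>Sn M. \<Sum>\<beta>\<in>S0 k. ?t ^ M * (?c \<alpha> \<beta> * ?e \<alpha> \<beta> \<sigma>))"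
   by (rule sum.cong[OF refl], rule sum.swap)
  also have "\<dots> = (\<Sum>\<sigma>\<in>Sn M. \<Sum>\<alpha>\<in>S0 n. \<Sum>\<beta>\<in>S0 k. ?t ^ M * (?c \<alpha> \<beta> * ?e \<alpha> \<beta> \<sigma>))"
   by (rule sum.swap)
  also have "\<dots> = (\<Sum>\<sigma>\<in>Sn M. ?t ^ M / ?K * G r (\<sigma> ` {1..n - r}))"
  proof (rule sum.cong[OF refl])
   fix \<sigma> assume "\<sigma> \<in> Sn M"
   from ent[OF this] have "(\<Sum>\<alpha>\<in>S0 n. \<Sum>\<beta>\<in>S0 k. ?c \<alpha> \<beta> * ?e \<alpha> \<beta> \<sigma>) = G r (\<sigma> ` {1..n - r}) / ?K"
    unfolding nonzero_eq_divide_eq[OF K0] .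
   then show "(\<Sum>\<alpha>\<in>S0 n. \<Sum>\<beta>\<in>S0 k. ?t ^ M * (?c \<alpha> \<beta> * ?e \<alpha> \<beta> \<sigma>)) = ?t ^ M / ?K * G r (\<sigma> ` {1..n - r})"
    by (simp only: sum_distrib_left[symmetric]) (simp only: times_divide_eq_right times_divide_eq_left)
  qed
  also have "\<dots> = 1 / (fact n * fact k) * (\<Sum>\<sigma>\<in>Sn M. G r (\<sigma> ` {1..n - r}))"
   by (simp only: sum_distrib_left Kt)
  also have "\<dots> = fact (n - r) * fact (k - r) / (fact n * fact k) * (\<Sum>A\<in>S n r. G r A)"
   unfolding sum_permutations_image[OF nr(1)] nr(2) S_def by simp
  finally show ?thesis by (simp only: if_P[OF True])
 qed
 have "Phi (tpmult q \<xi> \<eta>) a b w = (\<Sum>n\<in>degs \<xi>. \<Sum>k\<in>degs \<eta>. \<Sum>\<pi>\<in>P12 n k. \<Sum>\<alpha>\<in>S0 n. \<Sum>\<beta>\<in>S0 k.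
   of_real (contract_coeff q (n + k) \<pi> (perm_cup n \<alpha> \<beta>)) *
   Phi (symt (n + k - 2 * npairs \<pi>) (contract_perm \<pi> (perm_cup n \<alpha> \<beta>))
    (contract_tensor \<pi> (tensor_prod n (\<xi> n \<alpha>) (\<eta> k \<beta>)))) a b w)" (is "_ = (\<Sum>n\<in>degs \<xi>. \<Sum>k\<in>degs \<eta>. \<Sum>\<pi>\<in>P12 n k. \<Sum>\<alpha>\<in>S0 n. \<Sum>\<beta>\<in>S0 k. ?z n k \<pi> \<alpha> \<beta>)")
 proof -
  have sw: "(\<Sum>\<alpha>\<in>S0 n. \<Sum>\<beta>\<in>S0 k. \<Sum>\<pi>\<in>P12 n k. ?z n k \<pi> \<alpha> \<beta>) = (\<Sum>\<pi>\<in>P12 n k. \<Sum>\<alpha>\<in>S0 n. \<Sum>\<beta>\<in>S0 k. ?z n k \<pi> \<alpha> \<beta>)" for n k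
  proof -
   have "(\<Sum>\<alpha>\<in>S0 n. \<Sum>\<beta>\<in>S0 k. \<Sum>\<pi>\<in>P12 n k. ?z n k \<pi> \<alpha> \<beta>) = (\<Sum>\<alpha>\<in>S0 n. \<Sum>\<pi>\<in>P12 n k. \<Sum>\<beta>\<in>S0 k. ?z n k \<pi> \<alpha> \<beta>)"
    by (rule sum.cong[OF refl], rule sum.swap)
   also have "\<dots> = (\<Sum>\<pi>\<in>P12 n k. \<Sum>\<alpha>\<in>S0 n. \<Sum>\<beta>\<in>S0 k. ?z n k \<pi> \<alpha> \<beta>)" by (rule sum.swap)
   finally show ?thesis .
  qed
  have "Phi (tpmult q \<xi> \<eta>) a b w = (\<Sum>n\<in>degs \<xi>. \<Sum>k\<in>degs \<eta>. \<Sum>\<alpha>\<in>S0 n. \<Sum>\<beta>\<in>S0 k. \<Sum>\<pi>\<in>P12 n k. ?z n k \<pi> \<alpha> \<beta>)"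
   unfolding tpmult_def by (simp only: Phi_sum Phi_cmult)
  then show ?thesis unfolding sw .
 qed
 also have "\<dots> = (\<Sum>n\<in>degs \<xi>. \<Sum>k\<in>degs \<eta>. \<Sum>r\<in>T n k. \<Sum>A\<in>S n r. G r A / fact r)"
 proof (rule sum.cong[OF refl], rule sum.cong[OF refl])
  fix n k
  have "(\<Sum>\<pi>\<in>P12 n k. \<Sum>\<alpha>\<in>S0 n. \<Sum>\<beta>\<in>S0 k. ?z n k \<pi> \<alpha> \<beta>) =
    (\<Sum>\<pi>\<in>P12 n k. (\<lambda>r. if n + k - 2 * r = M then fact (n - r) * fact (k - r) / (fact n * fact k) * (\<Sum>A\<in>S n r. G r A) else 0) (npairs \<pi>))"
   by (rule sum.cong[OF refl]) (simp only: step)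
  also have "\<dots> = (\<Sum>r | r \<le> n \<and> r \<le> k. if n + k - 2 * r = M then \<Sum>A\<in>S n r. G r A / fact r else 0)"
  proof -
   define h where "h r = (if n + k - 2 * r = M then fact (n - r) * fact (k - r) / (fact n * fact k) * (\<Sum>A\<in>S n r. G r A) else 0)" for r
   have "(\<Sum>\<pi>\<in>P12 n k. h (npairs \<pi>)) = (\<Sum>r | r \<le> n \<and> r \<le> k. fact n * fact k / (fact r * fact (n - r) * fact (k - r)) * h r)"
    by (rule sum_P12)
   also have "\<dots> = (\<Sum>r | r \<le> n \<and> r \<le> k. if n + k - 2 * r = M then \<Sum>A\<in>S n r. G r A / fact r else 0)"
    by (rule sum.cong[OF refl]) (simp add: h_def flip: sum_divide_distrib)
   finally show ?thesis unfolding h_def .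
  qed
  also have "\<dots> = (\<Sum>r\<in>T n k. \<Sum>A\<in>S n r. G r A / fact r)"
  proof -
   have "T n k = {r \<in> {r. r \<le> n \<and> r \<le> k}. n + k - 2 * r = M}" by (auto simp: T_def)
   then show ?thesis by (simp only: sum.inter_filter[OF finite_Collect_conjI[OF disjI1[OF finite_Collect_le_nat]]])
  qed
  finally show "(\<Sum>\<pi>\<in>P12 n k. \<Sum>\<alpha>\<in>S0 n. \<Sum>\<beta>\<in>S0 k. ?z n k \<pi> \<alpha> \<beta>) = (\<Sum>r\<in>T n k. \<Sum>A\<in>S n r. G r A / fact r)" .
 qed
 also have "\<dots> = (\<Sum>(n, k, r, A)\<in>Sigma (degs \<xi>) (\<lambda>n. Sigma (degs \<eta>) (\<lambda>k. Sigma (T n k) (S n))). G r A / fact r)"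
 proof -
  have f: "finite (degs \<xi>)" "finite (degs \<eta>)" "finite (T n k)" "finite (S n r)" for n k r
   using U.familiesD(1)[OF \<xi>] U.familiesD(1)[OF \<eta>]
   by (auto simp: T_def S_def intro: finite_subset[of _ "{..n}"] finite_subset[of _ "Pow {1..M}"])
  show ?thesis by (simp add: sum.Sigma f finite_SigmaI)
 qed
 also have "\<dots> = (\<Sum>(A, r)\<in>Sigma (Pow {1..M}) (\<lambda>A. {r. card A + r \<in> degs \<xi> \<and> M - card A + r \<in> degs \<eta>}). G r A / fact r)"
 proof (rule sum.reindex_bij_witness[where j = "\<lambda>(n, k, r, A). (A, r)" and i = "\<lambda>(A, r). (card A + r, M - card A + r, r, A)"])
  fix p assume "p \<in> Sigma (Pow {1..M}) (\<lambda>A. {r. card A + r \<in> degs \<xi> \<and> M - card A + r \<in> degs \<eta>})"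
  then obtain A r where p: "p = (A, r)" "A \<subseteq> {1..M}" "card A + r \<in> degs \<xi>" "M - card A + r \<in> degs \<eta>" by auto
  have "card A \<le> M" using card_mono[OF _ p(2)] by simp
  then have "card A + r + (M - card A + r) - 2 * r = M" by linarith
  then show "(case p of (A, r) \<Rightarrow> (card A + r, M - card A + r, r, A)) \<in> Sigma (degs \<xi>) (\<lambda>n. Sigma (degs \<eta>) (\<lambda>k. Sigma (T n k) (S n)))"
   using p by (simp add: T_def S_def)
 qed (auto simp: T_def S_def subset_iff)
 also have "\<dots> = (\<Sum>A\<in>Pow {1..M}. \<Sum>r | card A + r \<in> degs \<xi> \<and> M - card A + r \<in> degs \<eta>. G r A / fact r)"
 proof (rule sum.Sigma[symmetric])
  show "\<forall>A\<in>Pow {1..M}. finite {r. card A + r \<in> degs \<xi> \<and> M - card A + r \<in> degs \<eta>}"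
   using finite_vimageI[OF U.familiesD(1)[OF \<xi>], of "\<lambda>r. card A + r" for A]
   by (auto simp: vimage_def intro: finite_subset[rotated] inj_onI)
 qed simp
 also have "\<dots> = (\<Sum>A\<in>Pow {1..M}. \<Sum>d<N. pairing (\<lambda>u. Phi \<xi> a d (map W (filter (\<lambda>i. i \<in> A) ks) @ u)) (\<lambda>u. Phi \<eta> d b (map W (filter (\<lambda>i. i \<notin> A) ks) @ u)))"
 proof (rule sum.cong[OF refl])
  fix A assume A: "A \<in> Pow {1..M}"
  let ?us = "map W (filter (\<lambda>i. i \<in> A) ks)" and ?vs = "map W (filter (\<lambda>i. i \<notin> A) ks)"
  let ?R = "{r. card A + r \<in> degs \<xi> \<and> M - card A + r \<in> degs \<eta>}"
  have us: "?us \<in> words" and vs: "?vs \<in> words" using WL by (auto simp: ks(2))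
  have finA: "finite A" using A finite_subset by blast
  have "length ?us = card (set (filter (\<lambda>i. i \<in> A) ks))" "length ?vs = card (set (filter (\<lambda>i. i \<notin> A) ks))"
   by (simp_all only: length_map distinct_card[OF distinct_filter[OF ks(1)]])
  moreover have "set (filter (\<lambda>i. i \<in> A) ks) = A" "set (filter (\<lambda>i. i \<notin> A) ks) = {1..M} - A" using A by (auto simp: ks(2))
  ultimately have len: "length ?us = card A" "length ?vs = M - card A" using A finA by (simp_all add: card_Diff_subset)
  have finR: "finite ?R"
   by (rule finite_subset[OF _ finite_vimageI[OF U.familiesD(1)[OF \<xi>], of "\<lambda>r. card A + r"]]) (auto intro: inj_onI)
  have pb: "pairing (\<lambda>u. Phi \<xi> a d (?us @ u)) (\<lambda>u. Phi \<eta> d b (?vs @ u)) =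
    (\<Sum>r\<in>?R. (\<Sum>\<^sub>\<infinity>c\<in>{c \<in> words. length c = r}. Phi \<xi> a d (?us @ c) * Phi \<eta> d b (?vs @ map bar c)) / fact r) \<and>
    (\<forall>r. (\<lambda>c. Phi \<xi> a d (?us @ c) * Phi \<eta> d b (?vs @ map bar c)) summable_on {c \<in> words. length c = r})" for d
  proof -
   have "(\<lambda>c. Phi \<xi> a d (?us @ c) * Phi \<eta> d b (?vs @ map bar c) / fact (length c)) summable_on words"
    using pairable_tame[OF Phi_tame[OF \<xi>] Phi_tame[OF \<eta>]] us vs unfolding pairable_def by blast
   moreover have "Phi \<xi> a d (?us @ c) * Phi \<eta> d b (?vs @ map bar c) = 0" if "length c \<notin> ?R" for c
   proof -
    have "length (?us @ c) \<notin> degs \<xi> \<or> length (?vs @ map bar c) \<notin> degs \<eta>"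
     using that unfolding length_append length_map[of bar] len by blast
    then show ?thesis using Phi_len[OF \<xi>] Phi_len[OF \<eta>] by (metis mult_zero_left mult_zero_right)
   qed
   ultimately show ?thesis
    using pairing_by_length[OF finR, of "\<lambda>u. Phi \<xi> a d (?us @ u)" "\<lambda>u. Phi \<eta> d b (?vs @ u)"] by blast
  qed
  have "(\<Sum>r\<in>?R. G r A / fact r) = (\<Sum>r\<in>?R. \<Sum>d<N. (\<Sum>\<^sub>\<infinity>c\<in>{c \<in> words. length c = r}. Phi \<xi> a d (?us @ c) * Phi \<eta> d b (?vs @ map bar c)) / fact r)"
  proof (rule sum.cong[OF refl])
   fix r
   have "G r A = (\<Sum>d<N. \<Sum>\<^sub>\<infinity>c\<in>{c \<in> words. length c = r}. Phi \<xi> a d (?us @ c) * Phi \<eta> d b (?vs @ map bar c))"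
    unfolding G_def Q_def
    by (rule infsumI, rule has_sum_finite_sum[OF finite_lessThan], rule has_sum_infsum) (use pb in blast)
   then show "G r A / fact r = (\<Sum>d<N. (\<Sum>\<^sub>\<infinity>c\<in>{c \<in> words. length c = r}. Phi \<xi> a d (?us @ c) * Phi \<eta> d b (?vs @ map bar c)) / fact r)"
    by (simp only: sum_divide_distrib)
  qed
  also have "\<dots> = (\<Sum>d<N. \<Sum>r\<in>?R. (\<Sum>\<^sub>\<infinity>c\<in>{c \<in> words. length c = r}. Phi \<xi> a d (?us @ c) * Phi \<eta> d b (?vs @ map bar c)) / fact r)"
   by (rule sum.swap)
  also have "\<dots> = (\<Sum>d<N. pairing (\<lambda>u. Phi \<xi> a d (?us @ u)) (\<lambda>u. Phi \<eta> d b (?vs @ u)))"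
   by (rule sum.cong[OF refl]) (simp only: pb)
  finally show "(\<Sum>r\<in>?R. G r A / fact r) = (\<Sum>d<N. pairing (\<lambda>u. Phi \<xi> a d (?us @ u)) (\<lambda>u. Phi \<eta> d b (?vs @ u)))" .
 qed
 also have "\<dots> = (\<Sum>d<N. wick (map W ks) (Phi \<xi> a d) (Phi \<eta> d b))"
  unfolding wick_subsets[OF ks(1)] ks(2) by (rule sum.swap)
 finally show ?thesis unfolding wW .
qed

end

section \<open>The form in the matrix model\<close>

lemma inv_conj:
 assumes "\<sigma> \<in> Sn n" "\<alpha> \<in> S0 n"
 shows "inv (conj_by \<sigma> \<alpha>) = conj_by \<sigma> (inv \<alpha>)"
proof -
 have b: "bij \<sigma>" "bij \<alpha>" "bij (inv \<sigma>)"
  using permutes_bij[OF Sn_permutes] permutes_bij[OF S0_permutes] assms bij_imp_bij_inv by blast+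
 show ?thesis unfolding conj_by_def using b by (simp add: o_inv_distrib bij_comp inv_inv_eq comp_assoc)
qed

context real_projection
begin

lemma families_sum:
 assumes "finite I" "\<And>i. i \<in> I \<Longrightarrow> f i \<in> families"
 shows "(\<lambda>m \<gamma> x. \<Sum>i\<in>I. f i m \<gamma> x) \<in> families"
 using assms by (induction I) (simp_all add: families_zero families_add)

lemma tpmult_families:
 assumes \<xi>: "\<xi> \<in> families" and \<eta>: "\<eta> \<in> families"
 shows "tpmult q \<xi> \<eta> \<in> families"
proof -
 have fin: "finite (P12 n k)" for n k
  by (rule finite_subset[OF _ finite_permutations[of "{1..n + k}"]]) (auto simp: P12_def)
 show ?thesis unfolding tpmult_def
 proof (rule families_sum[OF familiesD(1)[OF \<xi>]], rule families_sum[OF familiesD(1)[OF \<eta>]],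
   rule families_sum[OF finite_S0], rule families_sum[OF finite_S0], rule families_sum[OF fin], rule families_cmult,
   rule symt_families)
  fix n k \<alpha> \<beta> \<pi> assume \<alpha>: "\<alpha> \<in> S0 n" and \<beta>: "\<beta> \<in> S0 k" and \<pi>: "\<pi> \<in> P12 n k"
  interpret pair_partition \<pi> n k by unfold_locales (rule \<pi>)
  show "contract_perm \<pi> (perm_cup n \<alpha> \<beta>) \<in> S0 (n + k - 2 * npairs \<pi>)"
   by (rule contract_perm_S0[OF S0_permutes[OF perm_cup_S0[OF \<alpha> \<beta>]]])
  show "contract_tensor \<pi> (tensor_prod n (\<xi> n \<alpha>) (\<eta> k \<beta>)) \<in> tensors (n + k - 2 * npairs \<pi>)"
   by (rule contract_tensors[OF \<pi> familiesD(3)[OF \<xi>] familiesD(3)[OF \<eta>]])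
 qed
qed

lemma tpstar_families:
 assumes \<xi>: "\<xi> \<in> families"
 shows "tpstar \<xi> \<in> families"
proof (rule familiesI[of "degs \<xi>"])
 show "tpstar \<xi> n (conj_by \<sigma> \<alpha>) x = tpstar \<xi> n \<alpha> (x \<circ> \<sigma>)" if \<sigma>: "\<sigma> \<in> Sn n" and \<alpha>: "\<alpha> \<in> S0 n" for n \<sigma> \<alpha> x
 proof -
  show ?thesis unfolding tpstar_def inv_conj[OF \<sigma> \<alpha>]
   using familiesD(4)[OF \<xi> \<sigma> S0_inv[OF \<alpha>]] conj_S0[OF \<sigma> \<alpha>] \<alpha> by simp
 qed
 show "tpstar \<xi> n \<alpha> \<in> tensors n" if "\<alpha> \<in> S0 n" for n \<alpha>
  using tensors_cnj[OF familiesD(3)[OF \<xi>]] that by (simp add: tpstar_def)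
qed (use familiesD(1)[OF \<xi>] in \<open>simp_all add: tpstar_def degs_zero\<close>)

definition unit_tp :: "'a tp" where
 "unit_tp = symt 0 id (\<lambda>_. 1)"

lemma id_S0: "id \<in> S0 n"
 by (simp add: S0_def permutes_id)

lemma unit_families: "unit_tp \<in> families"
proof -
 have "(\<lambda>_ :: nat \<Rightarrow> 'a. 1 :: complex) \<in> hilbert_schmidt 0"
  unfolding hilbert_schmidt_def by (auto intro!: exI[of _ 1])
 then have "(\<lambda>_. 1) \<in> tensors 0" by (simp add: tensors_def second_def)
 then show ?thesis unfolding unit_tp_def by (rule symt_families[OF id_S0])
qed

end

context matrix_model
begin

lemma Phi_outside: "\<not> (a < N \<and> b < N \<and> w \<in> words) \<Longrightarrow> Phi \<xi> a b w = 0"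
 by (auto simp: Phi_def)

lemma Phi_eqI:
 assumes "\<And>a b w. a < N \<Longrightarrow> b < N \<Longrightarrow> w \<in> words \<Longrightarrow> Phi \<xi> a b w = Phi \<eta> a b w"
 shows "Phi \<xi> = Phi \<eta>"
proof (intro ext)
 fix a b w show "Phi \<xi> a b w = Phi \<eta> a b w"
  using assms[of a b w] Phi_outside[of a b w] by (cases "a < N \<and> b < N \<and> w \<in> words") auto
qed

text \<open>Reversing \<open>\<alpha>\<close> exchanges the two sides of the colour equations.\<close>

lemma entry_star:
 assumes \<alpha>: "\<alpha> \<in> S0 n"
 shows "entry n (inv \<alpha>) (\<lambda>x. cnj (F x)) a b W = cnj (entry n \<alpha> F b a (\<lambda>k. bar (W k)))"
proof -
 have p: "\<alpha> permutes {0..n}" by (rule S0_permutes[OF \<alpha>])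
 have rc: "colf b (\<lambda>k. bar (W k)) k = rowf b W k" "rowf a (\<lambda>k. bar (W k)) k = colf a W k" for k
  by (simp_all add: colf_def rowf_def bar_def split: prod.split)
 have "(\<forall>k\<in>{0..n}. colf a W k = rowf b W (inv \<alpha> k)) \<longleftrightarrow> (\<forall>k\<in>\<alpha> ` {0..n}. colf a W k = rowf b W (inv \<alpha> k))"
  by (simp only: permutes_image[OF p])
 also have "\<dots> \<longleftrightarrow> (\<forall>k\<in>{0..n}. colf b (\<lambda>k. bar (W k)) k = rowf a (\<lambda>k. bar (W k)) (\<alpha> k))"
  unfolding ball_simps(9) rc permutes_inverses(2)[OF p] by (intro ball_cong refl eq_commute)
 finally have c: "(\<forall>k\<in>{0..n}. colf a W k = rowf b W (inv \<alpha> k)) \<longleftrightarrow> (\<forall>k\<in>{0..n}. colf b (\<lambda>k. bar (W k)) k = rowf a (\<lambda>k. bar (W k)) (\<alpha> k))" .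
 have f: "fst (bar x) = fst x" for x :: "'a letter" by (simp add: bar_def split: prod.split)
 show ?thesis unfolding entry_def c sg_inv[OF S0_permutation[OF \<alpha>]] f by simp
qed

lemma Phi_star:
 assumes \<xi>: "\<xi> \<in> U.families"
 shows "Phi (tpstar \<xi>) a b w = cnj (Phi \<xi> b a (map bar w))"
proof (cases "a < N \<and> b < N \<and> w \<in> words")
 case True
 let ?n = "length w"
 have mw: "map bar w \<in> words" using True map_bar_words by blast
 have "Psi (tpstar \<xi>) ?n a b (\<lambda>k. w ! (k - 1)) =
   (\<Sum>\<alpha>\<in>S0 ?n. entry ?n \<alpha> (\<lambda>x. cnj (\<xi> ?n (inv \<alpha>) x)) a b (\<lambda>k. w ! (k - 1)))"
  unfolding Psi_def by (rule sum.cong[OF refl]) (simp add: tpstar_def)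
 also have "\<dots> = (\<Sum>\<alpha>\<in>S0 ?n. entry ?n (inv \<alpha>) (\<lambda>x. cnj (\<xi> ?n \<alpha> x)) a b (\<lambda>k. w ! (k - 1)))"
  by (rule sum.reindex_bij_witness[where i = inv and j = inv])
   (auto simp: S0_inv inv_inv_eq permutes_bij[OF S0_permutes])
 also have "\<dots> = cnj (Psi \<xi> ?n b a (\<lambda>k. bar (w ! (k - 1))))"
  unfolding Psi_def cnj_sum by (rule sum.cong[OF refl]) (rule entry_star)
 also have "Psi \<xi> ?n b a (\<lambda>k. bar (w ! (k - 1))) = Psi \<xi> ?n b a (\<lambda>k. map bar w ! (k - 1))"
  by (rule Psi_cong[OF \<xi>]) auto
 finally show ?thesis using True mw by (simp add: Phi_def scale_def)
next
 case False
 have "w \<in> words" if "map bar w \<in> words"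
  using map_bar_words[OF that] by (simp add: comp_def bar_bar)
 then show ?thesis using False Phi_outside[of a b w] Phi_outside[of b a "map bar w"] by auto
qed

lemma S0_zero: "S0 0 = {id}" and Sn_zero: "Sn 0 = {id}"
 by (simp_all add: S0_def Sn_def permutes_empty permutes_sing)

lemma Phi_unit:
 assumes "a < N" "b < N" "w \<in> words"
 shows "Phi U.unit_tp a b w = (if w = [] then if a = b then 1 else 0 else 0)"
 using Phi_symt[OF U.id_S0 assms, of 0 "\<lambda>_. 1"]
 unfolding U.unit_tp_def Sn_zero by (simp add: entry_def colf_def rowf_def)

lemma Phi_Nil:
 assumes "\<xi> \<in> U.families" "a < N" "b < N"
 shows "Phi \<xi> a b [] = (if a = b then \<xi> 0 id undefined else 0)"
proof -
 have "multilin 0 (\<xi> 0 id)" using U.familiesD(5)[OF assms(1)] by (simp add: hilbert_schmidt_iff)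
 then have "\<xi> 0 id x = \<xi> 0 id undefined" for x by (rule multilin_cong) simp
 then show ?thesis
  using assms by (simp add: Phi_def Psi_def S0_zero entry_def colf_def rowf_def scale_def)
qed

text \<open>Two permutations impose the equations \<open>I \<circ> \<alpha> = J = I \<circ> \<beta>\<close> on the colours; they are solved by
 the functions constant on the cycles of \<open>\<alpha> \<beta>\<^sup>-\<^sup>1\<close>.\<close>

definition colours :: "nat \<Rightarrow> (nat \<Rightarrow> nat) \<Rightarrow> nat \<times> nat \<times> (nat \<Rightarrow> nat \<times> nat) \<Rightarrow> bool" where
 "colours n \<alpha> = (\<lambda>(a, b, c). \<forall>k\<in>{0..n}.
   (if k = 0 then a else snd (c k)) = (if \<alpha> k = 0 then b else fst (c (\<alpha> k))))"

lemma card_colours: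
 assumes \<alpha>: "\<alpha> \<in> S0 n" and \<beta>: "\<beta> \<in> S0 n"
 shows "card {p \<in> {..<N} \<times> {..<N} \<times> ({1..n} \<rightarrow>\<^sub>E {..<N} \<times> {..<N}). colours n \<alpha> p \<and> colours n \<beta> p} =
  N ^ Suc (cyc0 {0..n} (\<alpha> \<circ> inv \<beta>))"
proof -
 have p\<alpha>: "\<alpha> permutes {0..n}" and p\<beta>: "\<beta> permutes {0..n}" using S0_permutes \<alpha> \<beta> by blast+
 define \<rho> where "\<rho> = \<alpha> \<circ> inv \<beta>"
 have p: "\<rho> permutes {0..n}" unfolding \<rho>_def by (rule permutes_compose[OF permutes_inv[OF p\<beta>] p\<alpha>])
 have \<alpha>in: "\<alpha> k \<in> {0..n}" if "k \<in> {0..n}" for k using permutes_in_image[OF p\<alpha>] that by blast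
 let ?K = "{K \<in> {0..n} \<rightarrow>\<^sub>E {..<N}. \<forall>x\<in>{0..n}. K x = K (\<rho> x)}"
 have inv: "K (\<alpha> k) = K (\<beta> k)" if K: "K \<in> ?K" and k: "k \<in> {0..n}" for K k
 proof -
  have "\<beta> k \<in> {0..n}" using permutes_in_image[OF p\<beta>] k by blast
  then have "K (\<beta> k) = K (\<rho> (\<beta> k))" using K by blast
  then show ?thesis by (simp add: \<rho>_def permutes_inverses(2)[OF p\<beta>])
 qed
 let ?S = "{p \<in> {..<N} \<times> {..<N} \<times> ({1..n} \<rightarrow>\<^sub>E {..<N} \<times> {..<N}). colours n \<alpha> p \<and> colours n \<beta> p}"
 have "bij_betw (\<lambda>(a, b, c). \<lambda>k\<in>{0..n}. if k = 0 then b else fst (c k)) ?S ?K"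
 proof (rule bij_betw_byWitness[where f' = "\<lambda>K. (K (\<alpha> 0), K 0, \<lambda>k\<in>{1..n}. (K k, K (\<alpha> k)))"])
  show "\<forall>p\<in>?S. (\<lambda>K. (K (\<alpha> 0), K 0, \<lambda>k\<in>{1..n}. (K k, K (\<alpha> k))))
    ((\<lambda>(a, b, c). \<lambda>k\<in>{0..n}. if k = 0 then b else fst (c k)) p) = p"
  proof
   fix p assume pS: "p \<in> ?S"
   obtain a b c where abc: "p = (a, b, c)" by (cases p)
   let ?I = "\<lambda>k. if k = 0 then b else fst (c k)"
   have c: "c \<in> {1..n} \<rightarrow>\<^sub>E {..<N} \<times> {..<N}" and e: "\<And>k. k \<in> {0..n} \<Longrightarrow> (if k = 0 then a else snd (c k)) = ?I (\<alpha> k)"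
    using pS by (auto simp: abc colours_def)
   have r: "restrict ?I {0..n} k = ?I k" if "k \<in> {0..n}" for k using that by simp
   have "restrict ?I {0..n} (\<alpha> 0) = a" using e[of 0] r[OF \<alpha>in[of 0]] by simp
   moreover have "(\<lambda>k\<in>{1..n}. (restrict ?I {0..n} k, restrict ?I {0..n} (\<alpha> k))) = c"
   proof
    fix k show "(\<lambda>k\<in>{1..n}. (restrict ?I {0..n} k, restrict ?I {0..n} (\<alpha> k))) k = c k"
    proof (cases "k \<in> {1..n}")
     case True
     then have k: "k \<in> {0..n}" "k \<noteq> 0" by auto
     show ?thesis using e[OF k(1)] r[OF k(1)] r[OF \<alpha>in[OF k(1)]] k True by (simp add: prod_eq_iff)
    next
     case False
     then show ?thesis using PiE_arb[OF c False] by (simp only: restrict_apply if_False)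
    qed
   qed
   ultimately show "(\<lambda>K. (K (\<alpha> 0), K 0, \<lambda>k\<in>{1..n}. (K k, K (\<alpha> k))))
    ((\<lambda>(a, b, c). \<lambda>k\<in>{0..n}. if k = 0 then b else fst (c k)) p) = p"
    by (simp only: abc case_prod_conv) simp
  qed
  show "\<forall>K\<in>?K. (\<lambda>(a, b, c). \<lambda>k\<in>{0..n}. if k = 0 then b else fst (c k)) (K (\<alpha> 0), K 0, \<lambda>k\<in>{1..n}. (K k, K (\<alpha> k))) = K"
  proof
   fix K assume "K \<in> ?K"
   then have K: "K \<in> {0..n} \<rightarrow>\<^sub>E {..<N}" by blast
   show "(\<lambda>(a, b, c). \<lambda>k\<in>{0..n}. if k = 0 then b else fst (c k)) (K (\<alpha> 0), K 0, \<lambda>k\<in>{1..n}. (K k, K (\<alpha> k))) = K"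
   proof
    fix k show "(\<lambda>(a, b, c). \<lambda>k\<in>{0..n}. if k = 0 then b else fst (c k)) (K (\<alpha> 0), K 0, \<lambda>k\<in>{1..n}. (K k, K (\<alpha> k))) k = K k"
     using PiE_arb[OF K, of k] by (cases "k = 0"; cases "k \<le> n") auto
   qed
  qed
  show "(\<lambda>(a, b, c). \<lambda>k\<in>{0..n}. if k = 0 then b else fst (c k)) ` ?S \<subseteq> ?K"
  proof
   fix K assume "K \<in> (\<lambda>(a, b, c). \<lambda>k\<in>{0..n}. if k = 0 then b else fst (c k)) ` ?S"
   then obtain p where pS: "p \<in> ?S" and Kp: "K = (\<lambda>(a, b, c). \<lambda>k\<in>{0..n}. if k = 0 then b else fst (c k)) p" by blast
   obtain a b c where abc: "p = (a, b, c)" by (cases p)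
   have K: "K = (\<lambda>k\<in>{0..n}. if k = 0 then b else fst (c k))" by (simp only: Kp abc case_prod_conv)
   have b: "b < N" and c: "c \<in> {1..n} \<rightarrow>\<^sub>E {..<N} \<times> {..<N}" using pS by (auto simp: abc)
   have e: "(if k = 0 then a else snd (c k)) = (if \<alpha> k = 0 then b else fst (c (\<alpha> k)))"
     "(if k = 0 then a else snd (c k)) = (if \<beta> k = 0 then b else fst (c (\<beta> k)))" if "k \<in> {0..n}" for k
    using pS that unfolding abc colours_def mem_Collect_eq case_prod_conv by blast+
   have "K \<in> {0..n} \<rightarrow>\<^sub>E {..<N}"
   proof (rule PiE_I)
    fix k assume "k \<in> {0..n}"
    then show "K k \<in> {..<N}" using PiE_mem[OF c, of k] b by (auto simp: K)
   qed (simp add: K)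
   moreover have "K x = K (\<rho> x)" if x: "x \<in> {0..n}" for x
   proof -
    have y: "inv \<beta> x \<in> {0..n}" using permutes_in_image[OF permutes_inv[OF p\<beta>]] x by blast
    have "\<beta> (inv \<beta> x) = x" by (rule permutes_inverses(1)[OF p\<beta>])
    note bx = this
    have "K x = (if x = 0 then b else fst (c x))" using x by (simp add: K)
    moreover have "K (\<rho> x) = (if \<alpha> (inv \<beta> x) = 0 then b else fst (c (\<alpha> (inv \<beta> x))))"
     using \<alpha>in[OF y] by (simp add: K \<rho>_def)
    ultimately show ?thesis using trans[OF e(2)[OF y, symmetric] e(1)[OF y]] unfolding bx by (simp only:)
   qed
   ultimately show "K \<in> ?K" by blast
  qed
  show "(\<lambda>K. (K (\<alpha> 0), K 0, \<lambda>k\<in>{1..n}. (K k, K (\<alpha> k)))) ` ?K \<subseteq> ?S"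
  proof
   fix p assume "p \<in> (\<lambda>K. (K (\<alpha> 0), K 0, \<lambda>k\<in>{1..n}. (K k, K (\<alpha> k)))) ` ?K"
   then obtain K where K: "K \<in> ?K" and pK: "p = (K (\<alpha> 0), K 0, \<lambda>k\<in>{1..n}. (K k, K (\<alpha> k)))" by blast
   have KN: "K k < N" if "k \<in> {0..n}" for k using K that by (auto simp: PiE_iff)
   have c: "(if k = 0 then K 0 else fst ((\<lambda>k\<in>{1..n}. (K k, K (\<alpha> k))) k)) = K k" if "k \<in> {0..n}" for k
    using that by auto
   have d: "(if k = 0 then K (\<alpha> 0) else snd ((\<lambda>k\<in>{1..n}. (K k, K (\<alpha> k))) k)) = K (\<alpha> k)" if "k \<in> {0..n}" for k
    using that by auto
   have \<beta>in: "\<beta> k \<in> {0..n}" if "k \<in> {0..n}" for k using permutes_in_image[OF p\<beta>] that by blast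
   have "colours n \<alpha> p"
    unfolding pK colours_def case_prod_conv by (intro ballI) (simp only: d c[OF \<alpha>in])
   moreover have "colours n \<beta> p"
    unfolding pK colours_def case_prod_conv by (intro ballI) (simp only: d c[OF \<beta>in] inv[OF K])
   moreover have "p \<in> {..<N} \<times> {..<N} \<times> ({1..n} \<rightarrow>\<^sub>E {..<N} \<times> {..<N})"
   proof -
    have "K k < N" "K (\<alpha> k) < N" if "k \<le> n" for k using KN[of k] KN[OF \<alpha>in, of k] that by simp_all
    then show ?thesis unfolding pK by (auto simp: PiE_iff)
   qed
   ultimately show "p \<in> ?S" by blast
  qed
 qed
 then have "card ?S = card ?K" by (rule bij_betw_same_card)
 also have "\<dots> = N ^ card (orbits_on {0..n} \<rho>)" using card_invariant[OF p, of "{..<N}"] by simp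
 also have "card (orbits_on {0..n} \<rho>) = Suc (cyc0 {0..n} \<rho>)" using cyc0_orbits[OF p] by simp
 finally show ?thesis by (simp only: \<rho>_def)
qed

lemma chi_colours:
 assumes \<alpha>: "\<alpha> \<in> S0 n" and \<beta>: "\<beta> \<in> S0 n"
 shows "real N ^ Suc n * chi q n (\<alpha> \<circ> inv \<beta>) = sg \<alpha> * sg \<beta> * real N ^ Suc (cyc0 {0..n} (\<alpha> \<circ> inv \<beta>))"
proof -
 define \<rho> where "\<rho> = \<alpha> \<circ> inv \<beta>"
 let ?c = "cyc0 {0..n} \<rho>"
 have p: "\<rho> permutes {0..n}" unfolding \<rho>_def
  by (rule permutes_compose[OF permutes_inv[OF S0_permutes[OF \<beta>]] S0_permutes[OF \<alpha>]])
 have o: "Suc ?c = card (orbits_on {0..n} \<rho>)" using cyc0_orbits[OF p] by simp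
 have "card (orbits_on {0..n} \<rho>) \<le> card {0..n}" unfolding orbits_on_def by (rule card_image_le) simp
 then have le: "?c \<le> n" unfolding o[symmetric] by simp
 have "sign \<rho> = (-1) ^ (Suc n + Suc ?c)" unfolding o using sign_orbits[OF _ p] by simp
 also have "\<dots> = (-1) ^ (n - ?c)" using le by (simp add: minus_one_power_iff)
 finally have "(if neg then - 1 else 1 :: real) ^ (n - ?c) = sg \<rho>" by (simp add: sg_def)
 moreover have "sg \<rho> = sg \<alpha> * sg \<beta>"
  unfolding \<rho>_def using sg_comp[OF S0_permutation[OF \<alpha>] S0_permutation[OF S0_inv[OF \<beta>]]] sg_inv[OF S0_permutation[OF \<beta>]] by simp
 ultimately have s: "(if neg then - 1 else 1 :: real) ^ (n - ?c) = sg \<alpha> * sg \<beta>" by simp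
 have "chi q n \<rho> = (sg \<alpha> * sg \<beta>) / real N ^ (n - ?c)"
  unfolding chi_def q power_divide s by (rule refl)
 moreover have "real N ^ Suc n = real N ^ (n - ?c) * real N ^ Suc ?c" using le by (simp flip: power_add)
 ultimately show ?thesis using N unfolding \<rho>_def[symmetric] by simp
qed

end

lemma sum_swap_pairs:
 "(\<Sum>a\<in>A. \<Sum>b\<in>B. \<Sum>c\<in>C. \<Sum>d\<in>D. f a b c d) = (\<Sum>c\<in>C. \<Sum>d\<in>D. \<Sum>a\<in>A. \<Sum>b\<in>B. f a b c d)"
proof -
 have "(\<Sum>a\<in>A. \<Sum>b\<in>B. \<Sum>c\<in>C. \<Sum>d\<in>D. f a b c d) = (\<Sum>a\<in>A. \<Sum>c\<in>C. \<Sum>b\<in>B. \<Sum>d\<in>D. f a b c d)"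
  by (rule sum.cong[OF refl], rule sum.swap)
 also have "\<dots> = (\<Sum>c\<in>C. \<Sum>a\<in>A. \<Sum>b\<in>B. \<Sum>d\<in>D. f a b c d)" by (rule sum.swap)
 also have "\<dots> = (\<Sum>c\<in>C. \<Sum>a\<in>A. \<Sum>d\<in>D. \<Sum>b\<in>B. f a b c d)"
  by (rule sum.cong[OF refl], rule sum.cong[OF refl], rule sum.swap)
 also have "\<dots> = (\<Sum>c\<in>C. \<Sum>d\<in>D. \<Sum>a\<in>A. \<Sum>b\<in>B. f a b c d)"
  by (rule sum.cong[OF refl], rule sum.swap)
 finally show ?thesis .
qed

context matrix_model
begin

text \<open>For invariant families the sum over \<open>\<sigma>\<close> only reproduces the same sum \<open>n!\<close> times.\<close>

lemma form_families:
 assumes \<xi>: "\<xi> \<in> U.families" and \<eta>: "\<eta> \<in> U.families"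
 shows "form r \<xi> \<eta> = (\<Sum>n\<in>degs \<xi> \<inter> degs \<eta>. fact n * (\<Sum>\<alpha>\<in>S0 n. \<Sum>\<beta>\<in>S0 n.
  of_real (chi r n (\<alpha> \<circ> inv \<beta>)) * tinner n (\<xi> n \<alpha>) (\<eta> n \<beta>)))"
 unfolding form_def
proof (rule sum.cong[OF refl])
 fix n
 let ?f = "\<lambda>\<alpha> \<beta>. complex_of_real (chi r n (\<alpha> \<circ> inv \<beta>)) * tinner n (\<xi> n \<alpha>) (\<eta> n \<beta>)"
 have "(\<Sum>\<beta>\<in>S0 n. \<Sum>\<sigma>\<in>Sn n. of_real (chi r n (\<alpha> \<circ> \<sigma> \<circ> inv \<beta> \<circ> inv \<sigma>)) * tinner n (\<xi> n \<alpha>) (perm_op \<sigma> (\<eta> n \<beta>))) =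
   fact n * (\<Sum>\<beta>\<in>S0 n. ?f \<alpha> \<beta>)" for \<alpha>
 proof -
  have "(\<Sum>\<beta>\<in>S0 n. \<Sum>\<sigma>\<in>Sn n. of_real (chi r n (\<alpha> \<circ> \<sigma> \<circ> inv \<beta> \<circ> inv \<sigma>)) * tinner n (\<xi> n \<alpha>) (perm_op \<sigma> (\<eta> n \<beta>)))
    = (\<Sum>\<sigma>\<in>Sn n. \<Sum>\<beta>\<in>S0 n. of_real (chi r n (\<alpha> \<circ> \<sigma> \<circ> inv \<beta> \<circ> inv \<sigma>)) * tinner n (\<xi> n \<alpha>) (perm_op \<sigma> (\<eta> n \<beta>)))"
   by (rule sum.swap)
  also have "\<dots> = (\<Sum>\<sigma>\<in>Sn n. \<Sum>\<beta>\<in>S0 n. ?f \<alpha> \<beta>)"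
  proof (rule sum.cong[OF refl])
   fix \<sigma> assume \<sigma>: "\<sigma> \<in> Sn n"
   have "(\<Sum>\<beta>\<in>S0 n. of_real (chi r n (\<alpha> \<circ> \<sigma> \<circ> inv \<beta> \<circ> inv \<sigma>)) * tinner n (\<xi> n \<alpha>) (perm_op \<sigma> (\<eta> n \<beta>))) =
     (\<Sum>\<beta>\<in>S0 n. ?f \<alpha> (conj_by \<sigma> \<beta>))"
   proof (rule sum.cong[OF refl])
    fix \<beta> assume \<beta>: "\<beta> \<in> S0 n"
    have "\<alpha> \<circ> \<sigma> \<circ> inv \<beta> \<circ> inv \<sigma> = \<alpha> \<circ> inv (conj_by \<sigma> \<beta>)"
     unfolding inv_conj[OF \<sigma> \<beta>] by (simp add: conj_by_def comp_assoc)
    moreover have "perm_op \<sigma> (\<eta> n \<beta>) = \<eta> n (conj_by \<sigma> \<beta>)"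
     using U.familiesD(4)[OF \<eta> \<sigma> \<beta>] by (simp add: perm_op_def fun_eq_iff)
    ultimately show "of_real (chi r n (\<alpha> \<circ> \<sigma> \<circ> inv \<beta> \<circ> inv \<sigma>)) * tinner n (\<xi> n \<alpha>) (perm_op \<sigma> (\<eta> n \<beta>)) = ?f \<alpha> (conj_by \<sigma> \<beta>)"
     by (simp only:)
   qed
   also have "\<dots> = (\<Sum>\<beta>\<in>S0 n. ?f \<alpha> \<beta>)" by (rule sum.reindex_bij_betw[OF bij_conj[OF \<sigma>]])
   finally show "(\<Sum>\<beta>\<in>S0 n. of_real (chi r n (\<alpha> \<circ> \<sigma> \<circ> inv \<beta> \<circ> inv \<sigma>)) * tinner n (\<xi> n \<alpha>) (perm_op \<sigma> (\<eta> n \<beta>))) =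
     (\<Sum>\<beta>\<in>S0 n. ?f \<alpha> \<beta>)" .
  qed
  also have "\<dots> = fact n * (\<Sum>\<beta>\<in>S0 n. ?f \<alpha> \<beta>)" by (simp add: card_Sn)
  finally show ?thesis .
 qed
 then show "(\<Sum>\<alpha>\<in>S0 n. \<Sum>\<beta>\<in>S0 n. \<Sum>\<sigma>\<in>Sn n. of_real (chi r n (\<alpha> \<circ> \<sigma> \<circ> inv \<beta> \<circ> inv \<sigma>)) * tinner n (\<xi> n \<alpha>) (perm_op \<sigma> (\<eta> n \<beta>)))
  = fact n * (\<Sum>\<alpha>\<in>S0 n. \<Sum>\<beta>\<in>S0 n. ?f \<alpha> \<beta>)" by (simp only: sum_distrib_left)
qed

lemma entry_inner:
 assumes \<alpha>: "\<alpha> \<in> S0 n" and \<beta>: "\<beta> \<in> S0 n" and F: "F \<in> hilbert_schmidt n" and G: "G \<in> hilbert_schmidt n"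
 shows "((\<lambda>W. \<Sum>a<N. \<Sum>b<N. entry n \<alpha> F a b W * cnj (entry n \<beta> G a b W)) has_sum
  of_real (real N ^ Suc n * chi q n (\<alpha> \<circ> inv \<beta>)) * tinner n F G) ({1..n} \<rightarrow>\<^sub>E L)"
proof -
 let ?C = "{1..n} \<rightarrow>\<^sub>E {..<N} \<times> {..<N}"
 let ?s = "complex_of_real (sg \<alpha> * sg \<beta>)"
 define h where "h a b c = (if colours n \<alpha> (a, b, c) \<and> colours n \<beta> (a, b, c) then 1 else 0 :: complex)" for a b c
 have ent: "entry n \<gamma> H a b (\<lambda>i\<in>{1..n}. (e i, c i)) = (if colours n \<gamma> (a, b, c) then of_real (sg \<gamma>) * H e else 0)"
  if \<gamma>: "\<gamma> \<in> S0 n" and H: "H \<in> hilbert_schmidt n" for \<gamma> H a b c and e :: "nat \<Rightarrow> 'a"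
 proof -
  have Hm: "multilin n H" using H by (simp add: hilbert_schmidt_iff)
  have "H (\<lambda>k. fst ((\<lambda>i\<in>{1..n}. (e i, c i)) k)) = H e" by (rule multilin_cong[OF Hm]) simp
  moreover have "(\<forall>k\<in>{0..n}. colf a (\<lambda>i\<in>{1..n}. (e i, c i)) k = rowf b (\<lambda>i\<in>{1..n}. (e i, c i)) (\<gamma> k)) \<longleftrightarrow> colours n \<gamma> (a, b, c)"
   unfolding colours_def case_prod_conv
  proof (rule ball_cong[OF refl])
   fix k assume k: "k \<in> {0..n}"
   then have "\<gamma> k \<in> {0..n}" using permutes_in_image[OF S0_permutes[OF \<gamma>]] by blast
   then show "(colf a (\<lambda>i\<in>{1..n}. (e i, c i)) k = rowf b (\<lambda>i\<in>{1..n}. (e i, c i)) (\<gamma> k)) =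
     ((if k = 0 then a else snd (c k)) = (if \<gamma> k = 0 then b else fst (c (\<gamma> k))))"
    using k by (simp add: colf_def rowf_def)
  qed
  ultimately show ?thesis unfolding entry_def by simp
 qed
 have fs: "((\<lambda>e. F e * cnj (G e)) has_sum tinner n F G) ({1..n} \<rightarrow>\<^sub>E onb)"
 proof -
  have "ell2 F ({1..n} \<rightarrow>\<^sub>E onb)" "ell2 (\<lambda>e. cnj (G e)) ({1..n} \<rightarrow>\<^sub>E onb)"
   using F G by (simp_all add: hilbert_schmidt_iff ell2_def)
  from ell2_mult_summable[OF this] show ?thesis unfolding tinner_def by (rule has_sum_infsum)
 qed
 have finC: "finite ?C" by (rule finite_PiE) auto
 have count: "(\<Sum>c\<in>?C. \<Sum>a<N. \<Sum>b<N. h a b c) = of_nat (N ^ Suc (cyc0 {0..n} (\<alpha> \<circ> inv \<beta>)))"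
 proof -
  have "(\<Sum>c\<in>?C. \<Sum>a<N. \<Sum>b<N. h a b c) = (\<Sum>a<N. \<Sum>c\<in>?C. \<Sum>b<N. h a b c)" by (rule sum.swap)
  also have "\<dots> = (\<Sum>a<N. \<Sum>b<N. \<Sum>c\<in>?C. h a b c)" by (rule sum.cong[OF refl], rule sum.swap)
  also have "\<dots> = (\<Sum>p\<in>{..<N} \<times> {..<N} \<times> ?C. case p of (a, b, c) \<Rightarrow> h a b c)"
   by (simp only: sum.cartesian_product case_prod_unfold)
  also have "\<dots> = (\<Sum>p\<in>{..<N} \<times> {..<N} \<times> ?C. if colours n \<alpha> p \<and> colours n \<beta> p then 1 else 0)"
   by (rule sum.cong[OF refl]) (simp only: h_def case_prod_unfold prod.collapse)
  also have "\<dots> = of_nat (card {p \<in> {..<N} \<times> {..<N} \<times> ?C. colours n \<alpha> p \<and> colours n \<beta> p})"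
   using finC by (simp add: sum.inter_filter[symmetric])
  finally show ?thesis unfolding card_colours[OF \<alpha> \<beta>] .
 qed
 have "((\<lambda>(e, c). F e * cnj (G e) * (?s * (\<Sum>a<N. \<Sum>b<N. h a b c))) has_sum
   (tinner n F G * (\<Sum>c\<in>?C. ?s * (\<Sum>a<N. \<Sum>b<N. h a b c)))) (({1..n} \<rightarrow>\<^sub>E onb) \<times> ?C)"
  by (rule has_sum_times_finite[OF fs finC])
 then have "((\<lambda>p. (\<lambda>W. \<Sum>a<N. \<Sum>b<N. entry n \<alpha> F a b W * cnj (entry n \<beta> G a b W)) (case p of (e, c) \<Rightarrow> \<lambda>i\<in>{1..n}. (e i, c i)))
   has_sum (tinner n F G * (\<Sum>c\<in>?C. ?s * (\<Sum>a<N. \<Sum>b<N. h a b c)))) (({1..n} \<rightarrow>\<^sub>E onb) \<times> ?C)"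
 proof (rule has_sum_cong[THEN iffD1, rotated])
  fix p :: "(nat \<Rightarrow> 'a) \<times> (nat \<Rightarrow> nat \<times> nat)"
  obtain e c where p: "p = (e, c)" by (cases p)
  have "entry n \<alpha> F a b (\<lambda>i\<in>{1..n}. (e i, c i)) * cnj (entry n \<beta> G a b (\<lambda>i\<in>{1..n}. (e i, c i))) =
    F e * cnj (G e) * (?s * h a b c)" for a b
   unfolding ent[OF \<alpha> F] ent[OF \<beta> G] by (simp add: h_def)
  then show "(case p of (e, c) \<Rightarrow> F e * cnj (G e) * (?s * (\<Sum>a<N. \<Sum>b<N. h a b c))) =
    (\<lambda>W. \<Sum>a<N. \<Sum>b<N. entry n \<alpha> F a b W * cnj (entry n \<beta> G a b W)) (case p of (e, c) \<Rightarrow> \<lambda>i\<in>{1..n}. (e i, c i))"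
   by (simp only: p case_prod_conv sum_distrib_left)
 qed
 from has_sum_reindex_bij_betw[OF bij_PiE_pair[of "{1..n}" onb "{..<N} \<times> {..<N}"], THEN iffD1, OF this]
 have "((\<lambda>W. \<Sum>a<N. \<Sum>b<N. entry n \<alpha> F a b W * cnj (entry n \<beta> G a b W)) has_sum
   (tinner n F G * (\<Sum>c\<in>?C. ?s * (\<Sum>a<N. \<Sum>b<N. h a b c)))) ({1..n} \<rightarrow>\<^sub>E L)"
  unfolding L_def .
 moreover have "(\<Sum>c\<in>?C. ?s * (\<Sum>a<N. \<Sum>b<N. h a b c)) = of_real (real N ^ Suc n * chi q n (\<alpha> \<circ> inv \<beta>))"
  unfolding sum_distrib_left[symmetric] count chi_colours[OF \<alpha> \<beta>] by (simp only: of_real_mult of_real_power of_real_of_nat_eq of_nat_power)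
 ultimately show ?thesis by (simp only: mult.commute)
qed

text \<open>The weight \<open>n!\<close> of \<open>form_families\<close> and \<open>1 / N\<^sup>n\<close> come from the scale of \<open>Phi\<close>; counting colours
 supplies the values of \<open>\<chi>\<^sub>q\<close>.\<close>

theorem form_Phi:
 assumes \<xi>: "\<xi> \<in> U.families" and \<eta>: "\<eta> \<in> U.families"
 shows "((\<lambda>c. \<Sum>a<N. \<Sum>b<N. Phi \<xi> a b c * cnj (Phi \<eta> a b c) / fact (length c)) has_sum of_nat N * form q \<xi> \<eta>) words"
proof -
 let ?D = "degs \<xi> \<inter> degs \<eta>"
 let ?g = "\<lambda>n. fact n * (\<Sum>\<alpha>\<in>S0 n. \<Sum>\<beta>\<in>S0 n. complex_of_real (chi q n (\<alpha> \<circ> inv \<beta>)) * tinner n (\<xi> n \<alpha>) (\<eta> n \<beta>))"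
 let ?p = "\<lambda>c. \<Sum>a<N. \<Sum>b<N. Phi \<xi> a b c * cnj (Phi \<eta> a b c) / fact (length c)"
 have "(?p has_sum (\<Sum>n\<in>?D. of_nat N * ?g n)) words"
 proof (rule words_by_length)
  show "finite ?D" using U.familiesD(1)[OF \<xi>] by blast
  show "?p w = 0" if "length w \<notin> ?D" for w
  proof -
   from that have "length w \<notin> degs \<xi> \<or> length w \<notin> degs \<eta>" by blast
   then have "Phi \<xi> a b w * cnj (Phi \<eta> a b w) = 0" for a b using Phi_len[OF \<xi>] Phi_len[OF \<eta>] by auto
   then show ?thesis by (simp only: div_0 sum.neutral_const)
  qed
  fix n
  let ?k = "fact n * of_real ((1 / real N) ^ n) :: complex"
  have "((\<lambda>W. ?k * (\<Sum>\<alpha>\<in>S0 n. \<Sum>\<beta>\<in>S0 n. \<Sum>a<N. \<Sum>b<N. entry n \<alpha> (\<xi> n \<alpha>) a b W * cnj (entry n \<beta> (\<eta> n \<beta>) a b W))) has_sum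
    ?k * (\<Sum>\<alpha>\<in>S0 n. \<Sum>\<beta>\<in>S0 n. of_real (real N ^ Suc n * chi q n (\<alpha> \<circ> inv \<beta>)) * tinner n (\<xi> n \<alpha>) (\<eta> n \<beta>))) ({1..n} \<rightarrow>\<^sub>E L)"
   by (rule has_sum_cmult_right, rule has_sum_finite_sum[OF finite_S0], rule has_sum_finite_sum[OF finite_S0],
     rule entry_inner[OF _ _ U.familiesD(5)[OF \<xi>] U.familiesD(5)[OF \<eta>]])
  moreover have "?k * (\<Sum>\<alpha>\<in>S0 n. \<Sum>\<beta>\<in>S0 n. of_real (real N ^ Suc n * chi q n (\<alpha> \<circ> inv \<beta>)) * tinner n (\<xi> n \<alpha>) (\<eta> n \<beta>)) = of_nat N * ?g n"
  proof -
   have "complex_of_real ((1 / real N) ^ n) * of_real (real N ^ Suc n) = of_nat N"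
    using N by (simp add: power_divide)
   then have k: "?k * (of_real (real N ^ Suc n * x) * y) = of_nat N * (fact n * (of_real x * y))" for x y
    by (simp only: of_real_mult mult_ac)
   show ?thesis unfolding sum_distrib_left k by (rule refl)
  qed
  ultimately have "((\<lambda>W. ?k * (\<Sum>\<alpha>\<in>S0 n. \<Sum>\<beta>\<in>S0 n. \<Sum>a<N. \<Sum>b<N. entry n \<alpha> (\<xi> n \<alpha>) a b W * cnj (entry n \<beta> (\<eta> n \<beta>) a b W))) has_sum
    of_nat N * ?g n) ({1..n} \<rightarrow>\<^sub>E L)" by (simp only:)
  then show "((\<lambda>W. ?p (map W [1..<Suc n])) has_sum of_nat N * ?g n) ({1..n} \<rightarrow>\<^sub>E L)"
  proof (rule has_sum_cong[THEN iffD1, rotated])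
   fix W assume W: "W \<in> {1..n} \<rightarrow>\<^sub>E (L :: 'a letter set)"
   have sc: "scale n * cnj (scale n) / fact n = ?k"
   proof -
    have "sqrt (1 / real N) ^ n * sqrt (1 / real N) ^ n = (1 / real N) ^ n"
     by (simp flip: power_mult_distrib)
    then have "complex_of_real (sqrt (1 / real N) ^ n) * of_real (sqrt (1 / real N) ^ n) = of_real ((1 / real N) ^ n)"
     by (simp only: of_real_mult[symmetric])
    moreover have "scale n * cnj (scale n) / fact n = fact n * (complex_of_real (sqrt (1 / real N) ^ n) * of_real (sqrt (1 / real N) ^ n))"
     by (simp add: scale_def)
    ultimately show ?thesis by simp
   qed
   have t: "Phi \<xi> a b (map W [1..<Suc n]) * cnj (Phi \<eta> a b (map W [1..<Suc n])) / fact (length (map W [1..<Suc n])) =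
     (\<Sum>\<alpha>\<in>S0 n. \<Sum>\<beta>\<in>S0 n. ?k * (entry n \<alpha> (\<xi> n \<alpha>) a b W * cnj (entry n \<beta> (\<eta> n \<beta>) a b W)))"
    if ab: "a \<in> {..<N}" "b \<in> {..<N}" for a b
   proof -
    have "Phi \<xi> a b (map W [1..<Suc n]) * cnj (Phi \<eta> a b (map W [1..<Suc n])) / fact (length (map W [1..<Suc n])) =
      scale n * cnj (scale n) / fact n * (Psi \<xi> n a b W * cnj (Psi \<eta> n a b W))"
     using Phi_word[OF \<xi> _ _ W, of a b] Phi_word[OF \<eta> _ _ W, of a b] ab by (simp del: upt_Suc)
    then show ?thesis unfolding sc Psi_def cnj_sum sum_product by (simp only: sum_distrib_left)
   qed
   have "?p (map W [1..<Suc n]) = (\<Sum>a<N. \<Sum>b<N. \<Sum>\<alpha>\<in>S0 n. \<Sum>\<beta>\<in>S0 n. ?k * (entry n \<alpha> (\<xi> n \<alpha>) a b W * cnj (entry n \<beta> (\<eta> n \<beta>) a b W)))"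
    by (intro sum.cong refl t)
   also have "\<dots> = (\<Sum>\<alpha>\<in>S0 n. \<Sum>\<beta>\<in>S0 n. \<Sum>a<N. \<Sum>b<N. ?k * (entry n \<alpha> (\<xi> n \<alpha>) a b W * cnj (entry n \<beta> (\<eta> n \<beta>) a b W)))"
    by (rule sum_swap_pairs)
   finally show "?k * (\<Sum>\<alpha>\<in>S0 n. \<Sum>\<beta>\<in>S0 n. \<Sum>a<N. \<Sum>b<N. entry n \<alpha> (\<xi> n \<alpha>) a b W * cnj (entry n \<beta> (\<eta> n \<beta>) a b W)) = ?p (map W [1..<Suc n])"
    by (simp only: sum_distrib_left)
  qed
 qed
 then show ?thesis unfolding form_families[OF \<xi> \<eta>] by (simp only: sum_distrib_left)
qed

end

section \<open>The algebra of trace polynomials in the matrix model\<close>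

definition padd :: "'a tp \<Rightarrow> 'a tp \<Rightarrow> 'a tp" where
 "padd \<xi> \<eta> = (\<lambda>n \<alpha> x. \<xi> n \<alpha> x + \<eta> n \<alpha> x)"

definition pscl :: "complex \<Rightarrow> 'a tp \<Rightarrow> 'a tp" where
 "pscl c \<xi> = (\<lambda>n \<alpha> x. c * \<xi> n \<alpha> x)"

definition vac :: "'a tp \<Rightarrow> complex" where
 "vac \<xi> = \<xi> 0 id undefined"

context matrix_model
begin

abbreviation "fam \<equiv> U.families"

lemma padd_fam: "\<xi> \<in> fam \<Longrightarrow> \<eta> \<in> fam \<Longrightarrow> padd \<xi> \<eta> \<in> fam"
 unfolding padd_def by (rule U.families_add)

lemma pscl_fam: "\<xi> \<in> fam \<Longrightarrow> pscl c \<xi> \<in> fam"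
 unfolding pscl_def by (rule U.families_cmult)

lemma Phi_padd: "Phi (padd \<xi> \<eta>) a b w = Phi \<xi> a b w + Phi \<eta> a b w"
 using Phi_sum[of "\<lambda>i. if i then \<xi> else \<eta>" "UNIV :: bool set"] by (simp add: UNIV_bool padd_def add.commute)

lemma Phi_pscl: "Phi (pscl c \<xi>) a b w = c * Phi \<xi> a b w"
 unfolding pscl_def by (rule Phi_cmult)

lemma vac_Phi:
 assumes "\<xi> \<in> fam"
 shows "vac \<xi> = Phi \<xi> 0 0 []"
 using Phi_Nil[OF assms, of 0 0] N by (simp add: vac_def)

lemma vac_mult:
 assumes \<xi>: "\<xi> \<in> fam" and \<eta>: "\<eta> \<in> fam"
 shows "of_nat N * vac (tpmult q \<xi> \<eta>) = (\<Sum>a<N. \<Sum>d<N. pairing (Phi \<xi> a d) (Phi \<eta> d a))"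
proof -
 have "vac (tpmult q \<xi> \<eta>) = (\<Sum>d<N. pairing (Phi \<xi> a d) (Phi \<eta> d a))" if "a < N" for a
  using Phi_Nil[OF U.tpmult_families[OF \<xi> \<eta>] that that] Phi_mult[OF \<xi> \<eta> that that lists.Nil]
  by (simp add: vac_def)
 then have "(\<Sum>a<N. vac (tpmult q \<xi> \<eta>)) = (\<Sum>a<N. \<Sum>d<N. pairing (Phi \<xi> a d) (Phi \<eta> d a))" by simp
 then show ?thesis by simp
qed

lemma vac_commute:
 assumes \<xi>: "\<xi> \<in> fam" and \<eta>: "\<eta> \<in> fam"
 shows "vac (tpmult q \<xi> \<eta>) = vac (tpmult q \<eta> \<xi>)"
proof -
 have "of_nat N * vac (tpmult q \<xi> \<eta>) = of_nat N * vac (tpmult q \<eta> \<xi>)"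
  unfolding vac_mult[OF \<xi> \<eta>] vac_mult[OF \<eta> \<xi>]
  by (subst sum.swap) (simp only: pairing_commute[of "Phi \<xi> _ _"])
 then show ?thesis using N by simp
qed

text \<open>The left-hand side is an inner product of matrices of functions, and the adjoint of a trace polynomial is
 the conjugate transpose.\<close>

lemma form_vac:
 assumes \<xi>: "\<xi> \<in> fam" and \<eta>: "\<eta> \<in> fam"
 shows "form q \<xi> \<eta> = vac (tpmult q (tpstar \<eta>) \<xi>)"
proof -
 have s: "((\<lambda>c. Phi \<xi> a b c * cnj (Phi \<eta> a b c) / fact (length c)) has_sum pairing (Phi (tpstar \<eta>) b a) (Phi \<xi> a b)) words" for a b
 proof -
  have "ell2 (Phi (tpstar \<eta>) b a) words" "ell2 (Phi \<xi> a b) words"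
   using Phi_ell2[OF U.tpstar_families[OF \<eta>]] Phi_ell2[OF \<xi>] by blast+
  from abs_summable_summable[OF pairing_abs_summable[OF this]]
  have "((\<lambda>c. Phi (tpstar \<eta>) b a c * Phi \<xi> a b (map bar c) / fact (length c)) has_sum pairing (Phi (tpstar \<eta>) b a) (Phi \<xi> a b)) words"
   unfolding pairing_def by (rule has_sum_infsum)
  then have "((\<lambda>c. (\<lambda>c. Phi \<xi> a b c * cnj (Phi \<eta> a b c) / fact (length c)) (map bar c)) has_sum pairing (Phi (tpstar \<eta>) b a) (Phi \<xi> a b)) words"
   unfolding Phi_star[OF \<eta>] by (simp add: mult.commute)
  then show ?thesis by (rule has_sum_reindex_bij_betw[OF bij_map_bar, THEN iffD1])
 qed
 have "((\<lambda>c. \<Sum>a<N. \<Sum>b<N. Phi \<xi> a b c * cnj (Phi \<eta> a b c) / fact (length c)) has_sum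
   (\<Sum>a<N. \<Sum>b<N. pairing (Phi (tpstar \<eta>) b a) (Phi \<xi> a b))) words"
  by (rule has_sum_finite_sum[OF finite_lessThan], rule has_sum_finite_sum[OF finite_lessThan], rule s)
 from has_sum_unique[OF form_Phi[OF \<xi> \<eta>] this]
 have "of_nat N * form q \<xi> \<eta> = of_nat N * vac (tpmult q (tpstar \<eta>) \<xi>)"
  unfolding vac_mult[OF U.tpstar_families[OF \<eta>] \<xi>] by (subst (asm) sum.swap)
 then show ?thesis using N by simp
qed

lemma form_cong:
 assumes "\<xi> \<in> fam" "\<eta> \<in> fam" "\<xi>' \<in> fam" "\<eta>' \<in> fam" "Phi \<xi> = Phi \<xi>'" "Phi \<eta> = Phi \<eta>'"
 shows "form q \<xi> \<eta> = form q \<xi>' \<eta>'"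
 using has_sum_unique[OF form_Phi[OF assms(1,2), unfolded assms(5,6)] form_Phi[OF assms(3,4)]] N by simp

lemma form_add: "\<xi> \<in> fam \<Longrightarrow> \<eta> \<in> fam \<Longrightarrow> \<zeta> \<in> fam \<Longrightarrow> form q (padd \<xi> \<eta>) \<zeta> = form q \<xi> \<zeta> + form q \<eta> \<zeta>"
proof -
 assume \<xi>: "\<xi> \<in> fam" and \<eta>: "\<eta> \<in> fam" and \<zeta>: "\<zeta> \<in> fam"
 have "of_nat N * form q (padd \<xi> \<eta>) \<zeta> = of_nat N * form q \<xi> \<zeta> + of_nat N * form q \<eta> \<zeta>"
  by (rule has_sum_unique[OF form_Phi[OF padd_fam[OF \<xi> \<eta>] \<zeta>]])
   (use has_sum_add[OF form_Phi[OF \<xi> \<zeta>] form_Phi[OF \<eta> \<zeta>]] in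
    \<open>simp add: Phi_padd distrib_right add_divide_distrib sum.distrib\<close>)
 then have "of_nat N * form q (padd \<xi> \<eta>) \<zeta> = of_nat N * (form q \<xi> \<zeta> + form q \<eta> \<zeta>)" by (simp only: distrib_left)
 then show ?thesis using N by simp
qed

lemma form_scl: "\<xi> \<in> fam \<Longrightarrow> \<zeta> \<in> fam \<Longrightarrow> form q (pscl c \<xi>) \<zeta> = c * form q \<xi> \<zeta>"
proof -
 assume \<xi>: "\<xi> \<in> fam" and \<zeta>: "\<zeta> \<in> fam"
 have "of_nat N * form q (pscl c \<xi>) \<zeta> = c * (of_nat N * form q \<xi> \<zeta>)"
  by (rule has_sum_unique[OF form_Phi[OF pscl_fam[OF \<xi>] \<zeta>]])
   (use has_sum_cmult_right[OF form_Phi[OF \<xi> \<zeta>], of c] in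
    \<open>simp add: Phi_pscl sum_distrib_left mult.assoc\<close>)
 then have "of_nat N * form q (pscl c \<xi>) \<zeta> = of_nat N * (c * form q \<xi> \<zeta>)" by (simp only: mult.left_commute)
 then show ?thesis using N by simp
qed

lemma form_cnj: "\<xi> \<in> fam \<Longrightarrow> \<zeta> \<in> fam \<Longrightarrow> form q \<zeta> \<xi> = cnj (form q \<xi> \<zeta>)"
proof -
 assume \<xi>: "\<xi> \<in> fam" and \<zeta>: "\<zeta> \<in> fam"
 have "((\<lambda>c. cnj (\<Sum>a<N. \<Sum>b<N. Phi \<xi> a b c * cnj (Phi \<zeta> a b c) / fact (length c))) has_sum cnj (of_nat N * form q \<xi> \<zeta>)) words"
  using form_Phi[OF \<xi> \<zeta>] by (simp only: has_sum_cnj_iff)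
 then have "((\<lambda>c. \<Sum>a<N. \<Sum>b<N. Phi \<zeta> a b c * cnj (Phi \<xi> a b c) / fact (length c)) has_sum cnj (of_nat N * form q \<xi> \<zeta>)) words"
  by (simp add: mult.commute)
 from has_sum_unique[OF form_Phi[OF \<zeta> \<xi>] this] show ?thesis using N by simp
qed

lemma form_pos:
 assumes \<xi>: "\<xi> \<in> fam"
 shows "form q \<xi> \<xi> \<in> \<real>" and "0 \<le> Re (form q \<xi> \<xi>)" and "form q \<xi> \<xi> = 0 \<Longrightarrow> Phi \<xi> = (\<lambda>_ _ _. 0)"
proof -
 define h where "h c = (\<Sum>a<N. \<Sum>b<N. (cmod (Phi \<xi> a b c))\<^sup>2 / fact (length c))" for c
 have "(\<Sum>a<N. \<Sum>b<N. Phi \<xi> a b c * cnj (Phi \<xi> a b c) / fact (length c)) = of_real (h c)" for c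
  by (simp add: h_def complex_norm_square[symmetric])
 then have s: "((\<lambda>c. complex_of_real (h c)) has_sum of_nat N * form q \<xi> \<xi>) words"
  using form_Phi[OF \<xi> \<xi>] by simp
 have pos: "0 \<le> h c" for c unfolding h_def by (intro sum_nonneg) auto
 have re: "(h has_sum real N * Re (form q \<xi> \<xi>)) words" using has_sum_Re[OF s] by simp
 have "((\<lambda>c. Im (complex_of_real (h c))) has_sum Im (of_nat N * form q \<xi> \<xi>)) words" by (rule has_sum_Im[OF s])
 then have "((\<lambda>c. 0 :: real) has_sum real N * Im (form q \<xi> \<xi>)) words" by simp
 then have im: "Im (form q \<xi> \<xi>) = 0" using has_sum_unique[OF _ has_sum_0[of words "\<lambda>_. 0 :: real"]] N by fastforce
 then show "form q \<xi> \<xi> \<in> \<real>" by (simp add: complex_is_Real_iff)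
 have "0 \<le> real N * Re (form q \<xi> \<xi>)" by (rule has_sum_nonneg[OF re]) (rule pos)
 then show "0 \<le> Re (form q \<xi> \<xi>)" using N by (simp add: zero_le_mult_iff)
 assume z: "form q \<xi> \<xi> = 0"
 have "Phi \<xi> a b w = 0" for a b w
 proof (cases "a < N \<and> b < N \<and> w \<in> words")
  case True
  have "h w = 0" by (rule nonneg_has_sum_le_0D[OF re]) (use z pos True in auto)
  then have "\<forall>a\<in>{..<N}. (\<Sum>b<N. (cmod (Phi \<xi> a b w))\<^sup>2 / fact (length w)) = 0"
   unfolding h_def by (subst (asm) sum_nonneg_eq_0_iff) (auto intro!: sum_nonneg)
  then have "(\<Sum>b<N. (cmod (Phi \<xi> a b w))\<^sup>2 / fact (length w)) = 0" using True by blast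
  then have "\<forall>b\<in>{..<N}. (cmod (Phi \<xi> a b w))\<^sup>2 / fact (length w) = 0"
   by (subst (asm) sum_nonneg_eq_0_iff) auto
  then have "(cmod (Phi \<xi> a b w))\<^sup>2 / fact (length w) = 0" using True by blast
  then show ?thesis by simp
 qed (rule Phi_outside)
 then show "Phi \<xi> = (\<lambda>_ _ _. 0)" by (simp add: fun_eq_iff)
qed

lemma TP_UNIV: "TP (UNIV :: ('a \<times> 'a) set) = fam"
 using U.TP_eq by simp

lemma TP_real_UNIV: "TP_real (UNIV :: 'a set) = fam"
 by (rule U.TP_real_eq)

lemma ker_form_TP: "ker_form (TP_space q) = {\<xi> \<in> fam. Phi \<xi> = (\<lambda>_ _ _. 0)}"
proof -
 have "form q \<xi> \<eta> = 0" if \<xi>: "\<xi> \<in> fam" and z: "Phi \<xi> = (\<lambda>_ _ _. 0)" and \<eta>: "\<eta> \<in> fam" for \<xi> \<eta>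
 proof -
  have "((\<lambda>c. 0) has_sum of_nat N * form q \<xi> \<eta>) words" using form_Phi[OF \<xi> \<eta>] by (simp add: z)
  from has_sum_unique[OF this has_sum_0] show ?thesis using N by simp
 qed
 then show ?thesis using form_pos(3) by (auto simp: ker_form_def TP_space_def TP_UNIV)
qed

lemma Wcl_eq:
 assumes \<xi>: "\<xi> \<in> fam"
 shows "Wcl q \<xi> = {\<eta> \<in> fam. Phi \<eta> = Phi \<xi>}"
proof -
 have v: "vsub (TP_space q) \<eta> \<xi> = padd \<eta> (pscl (-1) \<xi>)" for \<eta> :: "'a tp"
  by (simp add: vsub_def TP_space_def padd_def pscl_def)
 have "Phi (padd \<eta> (pscl (-1) \<xi>)) = (\<lambda>_ _ _. 0) \<longleftrightarrow> Phi \<eta> = Phi \<xi>" for \<eta>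
  by (auto simp: fun_eq_iff Phi_padd Phi_pscl)
 moreover have "padd \<eta> (pscl (-1) \<xi>) \<in> fam" if "\<eta> \<in> fam" for \<eta> by (intro padd_fam pscl_fam that \<xi>)
 ultimately show ?thesis
  unfolding Wcl_def coset_def v ker_form_TP by (auto simp: TP_space_def TP_UNIV)
qed

lemma Wcl_iff: "\<xi> \<in> fam \<Longrightarrow> \<eta> \<in> fam \<Longrightarrow> Wcl q \<xi> = Wcl q \<eta> \<longleftrightarrow> Phi \<xi> = Phi \<eta>"
 by (auto simp: Wcl_eq)

lemma Wcl_cong: "\<xi> \<in> fam \<Longrightarrow> \<eta> \<in> fam \<Longrightarrow> Phi \<xi> = Phi \<eta> \<Longrightarrow> Wcl q \<xi> = Wcl q \<eta>"
 by (simp add: Wcl_iff)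

lemma rep_Wcl:
 assumes "\<xi> \<in> fam"
 shows "rep (Wcl q \<xi>) \<in> fam" "Phi (rep (Wcl q \<xi>)) = Phi \<xi>"
proof -
 have "rep (Wcl q \<xi>) \<in> Wcl q \<xi>" unfolding rep_def by (rule someI[of _ \<xi>]) (simp add: Wcl_eq assms)
 then show "rep (Wcl q \<xi>) \<in> fam" "Phi (rep (Wcl q \<xi>)) = Phi \<xi>" by (simp_all add: Wcl_eq assms)
qed

abbreviation "alg \<equiv> TPq_alg q :: 'a tp set staralg"

lemma carr_alg: "carr alg = Wcl q ` fam"
 by (simp add: TPq_alg_def TP_real_UNIV)

lemma carr_space: "carr (TPq_space q :: 'a tp set ipspace) = Wcl q ` fam"
 by (simp add: TPq_space_def quotient_space_def Wcl_def[abs_def] TP_space_def TP_UNIV)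

lemma Phi_mult_cong:
 assumes "\<xi> \<in> fam" "\<eta> \<in> fam" "\<xi>' \<in> fam" "\<eta>' \<in> fam" "Phi \<xi> = Phi \<xi>'" "Phi \<eta> = Phi \<eta>'"
 shows "Phi (tpmult q \<xi> \<eta>) = Phi (tpmult q \<xi>' \<eta>')"
 by (rule Phi_eqI) (simp only: Phi_mult assms)

lemma space_ops:
 fixes \<xi> \<eta> :: "'a tp"
 assumes \<xi>: "\<xi> \<in> fam" and \<eta>: "\<eta> \<in> fam"
 shows "vadd (TPq_space q) (Wcl q \<xi>) (Wcl q \<eta>) = Wcl q (padd \<xi> \<eta>)"
  and "vscl (TPq_space q) c (Wcl q \<xi>) = Wcl q (pscl c \<xi>)"
  and "ip (TPq_space q) (Wcl q \<xi>) (Wcl q \<eta>) = form q \<xi> \<eta>"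
proof -
 note r = rep_Wcl[OF \<xi>] rep_Wcl[OF \<eta>]
 have "vadd (TPq_space q) (Wcl q \<xi>) (Wcl q \<eta>) = Wcl q (padd (rep (Wcl q \<xi>)) (rep (Wcl q \<eta>)))"
  by (simp add: TPq_space_def quotient_space_def Wcl_def TP_space_def padd_def)
 also have "\<dots> = Wcl q (padd \<xi> \<eta>)"
  by (rule Wcl_cong) (use r \<xi> \<eta> in \<open>simp_all add: padd_fam fun_eq_iff Phi_padd\<close>)
 finally show "vadd (TPq_space q) (Wcl q \<xi>) (Wcl q \<eta>) = Wcl q (padd \<xi> \<eta>)" .
 have "vscl (TPq_space q) c (Wcl q \<xi>) = Wcl q (pscl c (rep (Wcl q \<xi>)))"
  by (simp add: TPq_space_def quotient_space_def Wcl_def TP_space_def pscl_def)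
 also have "\<dots> = Wcl q (pscl c \<xi>)"
  by (rule Wcl_cong) (use r \<xi> in \<open>simp_all add: pscl_fam fun_eq_iff Phi_pscl\<close>)
 finally show "vscl (TPq_space q) c (Wcl q \<xi>) = Wcl q (pscl c \<xi>)" .
 have "ip (TPq_space q) (Wcl q \<xi>) (Wcl q \<eta>) = form q (rep (Wcl q \<xi>)) (rep (Wcl q \<eta>))"
  by (simp add: TPq_space_def quotient_space_def Wcl_def TP_space_def)
 also have "\<dots> = form q \<xi> \<eta>" by (rule form_cong[OF r(1) r(3) \<xi> \<eta> r(2) r(4)])
 finally show "ip (TPq_space q) (Wcl q \<xi>) (Wcl q \<eta>) = form q \<xi> \<eta>" .
qed

lemma alg_ops:
 assumes \<xi>: "\<xi> \<in> fam" and \<eta>: "\<eta> \<in> fam"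
 shows "vadd alg (Wcl q \<xi>) (Wcl q \<eta>) = Wcl q (padd \<xi> \<eta>)"
  and "vscl alg c (Wcl q \<xi>) = Wcl q (pscl c \<xi>)"
  and "amult alg (Wcl q \<xi>) (Wcl q \<eta>) = Wcl q (tpmult q \<xi> \<eta>)"
  and "astar alg (Wcl q \<xi>) = Wcl q (tpstar \<xi>)"
  and "vacuum_state (Wcl q \<xi>) = vac \<xi>"
proof -
 note r = rep_Wcl[OF \<xi>] rep_Wcl[OF \<eta>]
 show "vadd alg (Wcl q \<xi>) (Wcl q \<eta>) = Wcl q (padd \<xi> \<eta>)" "vscl alg c (Wcl q \<xi>) = Wcl q (pscl c \<xi>)"
  using space_ops[OF \<xi> \<eta>] by (simp_all add: TPq_alg_def)
 have "amult alg (Wcl q \<xi>) (Wcl q \<eta>) = Wcl q (tpmult q (rep (Wcl q \<xi>)) (rep (Wcl q \<eta>)))"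
  by (simp add: TPq_alg_def)
 also have "\<dots> = Wcl q (tpmult q \<xi> \<eta>)"
  by (rule Wcl_cong[OF U.tpmult_families[OF r(1) r(3)] U.tpmult_families[OF \<xi> \<eta>] Phi_mult_cong[OF r(1) r(3) \<xi> \<eta> r(2) r(4)]])
 finally show "amult alg (Wcl q \<xi>) (Wcl q \<eta>) = Wcl q (tpmult q \<xi> \<eta>)" .
 have "astar alg (Wcl q \<xi>) = Wcl q (tpstar (rep (Wcl q \<xi>)))"
  by (simp add: TPq_alg_def)
 also have "\<dots> = Wcl q (tpstar \<xi>)"
  by (rule Wcl_cong[OF U.tpstar_families[OF r(1)] U.tpstar_families[OF \<xi>]], rule Phi_eqI)
   (simp only: Phi_star[OF r(1)] Phi_star[OF \<xi>] r(2))
 finally show "astar alg (Wcl q \<xi>) = Wcl q (tpstar \<xi>)" .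
 show "vacuum_state (Wcl q \<xi>) = vac \<xi>"
  using vac_Phi[OF r(1)] vac_Phi[OF \<xi>] r(2) by (simp add: vacuum_state_def vac_def)
qed

lemmas alg_simps = alg_ops(1,3) alg_ops(2,4,5)[OF _ U.unit_families]
lemmas space_simps = space_ops(1,3) space_ops(2)[OF _ U.unit_families]

lemma alg_one: "aone alg = Wcl q U.unit_tp"
 by (simp add: TPq_alg_def U.unit_tp_def)

lemma Phi_mult_assoc:
 assumes \<xi>: "\<xi> \<in> fam" and \<eta>: "\<eta> \<in> fam" and \<zeta>: "\<zeta> \<in> fam"
 shows "Phi (tpmult q (tpmult q \<xi> \<eta>) \<zeta>) = Phi (tpmult q \<xi> (tpmult q \<eta> \<zeta>))"
proof (rule Phi_eqI)
 fix a b w assume ab: "a < N" "b < N" and w: "w \<in> words"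
 note t = Phi_tame[OF \<xi>] Phi_tame[OF \<eta>] Phi_tame[OF \<zeta>]
 have l: "wick w (Phi (tpmult q \<xi> \<eta>) a d) (Phi \<zeta> d b) =
   (\<Sum>e<N. wick w (Phi \<xi> a e) (\<lambda>c. wick c (Phi \<eta> e d) (Phi \<zeta> d b)))" if d: "d < N" for d
 proof -
  have "wick w (Phi (tpmult q \<xi> \<eta>) a d) (Phi \<zeta> d b) =
    wick w (\<lambda>u. \<Sum>e<N. wick u (Phi \<xi> a e) (Phi \<eta> e d)) (Phi \<zeta> d b)"
   by (rule wick_cong[OF _ _ w]) (simp_all add: Phi_mult[OF \<xi> \<eta> ab(1) d])
  also have "\<dots> = (\<Sum>e<N. wick w (\<lambda>u. wick u (Phi \<xi> a e) (Phi \<eta> e d)) (Phi \<zeta> d b))"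
   by (rule wick_sum[OF _ _ w]) (simp_all add: pairable_wick t)
  finally show ?thesis by (simp only: wick_assoc[OF t w])
 qed
 have r: "wick w (Phi \<xi> a e) (Phi (tpmult q \<eta> \<zeta>) e b) =
   (\<Sum>d<N. wick w (Phi \<xi> a e) (\<lambda>c. wick c (Phi \<eta> e d) (Phi \<zeta> d b)))" if e: "e < N" for e
 proof -
  have "wick w (Phi \<xi> a e) (Phi (tpmult q \<eta> \<zeta>) e b) = wick w (Phi (tpmult q \<eta> \<zeta>) e b) (Phi \<xi> a e)"
   by (rule wick_commute)
  also have "\<dots> = wick w (\<lambda>u. \<Sum>d<N. wick u (Phi \<eta> e d) (Phi \<zeta> d b)) (Phi \<xi> a e)"
   by (rule wick_cong[OF _ _ w]) (simp_all add: Phi_mult[OF \<eta> \<zeta> e ab(2)])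
  also have "\<dots> = (\<Sum>d<N. wick w (\<lambda>u. wick u (Phi \<eta> e d) (Phi \<zeta> d b)) (Phi \<xi> a e))"
   by (rule wick_sum[OF _ _ w]) (simp_all add: pairable_wick t)
  finally show ?thesis by (simp only: wick_commute[of w _ "Phi \<xi> a e"])
 qed
 have "Phi (tpmult q (tpmult q \<xi> \<eta>) \<zeta>) a b w =
   (\<Sum>d<N. \<Sum>e<N. wick w (Phi \<xi> a e) (\<lambda>c. wick c (Phi \<eta> e d) (Phi \<zeta> d b)))"
  unfolding Phi_mult[OF U.tpmult_families[OF \<xi> \<eta>] \<zeta> ab w] by (rule sum.cong[OF refl]) (simp add: l)
 also have "\<dots> = (\<Sum>e<N. \<Sum>d<N. wick w (Phi \<xi> a e) (\<lambda>c. wick c (Phi \<eta> e d) (Phi \<zeta> d b)))" by (rule sum.swap)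
 also have "\<dots> = Phi (tpmult q \<xi> (tpmult q \<eta> \<zeta>)) a b w"
  unfolding Phi_mult[OF \<xi> U.tpmult_families[OF \<eta> \<zeta>] ab w] by (rule sum.cong[OF refl]) (simp add: r)
 finally show "Phi (tpmult q (tpmult q \<xi> \<eta>) \<zeta>) a b w = Phi (tpmult q \<xi> (tpmult q \<eta> \<zeta>)) a b w" .
qed

lemma Phi_mult_star:
 assumes \<xi>: "\<xi> \<in> fam" and \<eta>: "\<eta> \<in> fam"
 shows "Phi (tpstar (tpmult q \<xi> \<eta>)) = Phi (tpmult q (tpstar \<eta>) (tpstar \<xi>))"
proof (rule Phi_eqI)
 fix a b w assume ab: "a < N" "b < N" and w: "w \<in> words"
 have st: "Phi (tpstar \<xi>) a b = (\<lambda>c. cnj (Phi \<xi> b a (map bar c)))" if "\<xi> \<in> fam" for a b \<xi>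
  by (rule ext) (rule Phi_star[OF that])
 have "Phi (tpstar (tpmult q \<xi> \<eta>)) a b w = (\<Sum>d<N. cnj (wick (map bar w) (Phi \<xi> b d) (Phi \<eta> d a)))"
  unfolding Phi_star[OF U.tpmult_families[OF \<xi> \<eta>]] Phi_mult[OF \<xi> \<eta> ab(2,1) map_bar_words[OF w]] cnj_sum ..
 also have "\<dots> = (\<Sum>d<N. wick w (Phi (tpstar \<eta>) a d) (Phi (tpstar \<xi>) d b))"
  unfolding st[OF \<xi>] st[OF \<eta>] wick_star[symmetric] by (rule sum.cong[OF refl]) (rule wick_commute)
 also have "\<dots> = Phi (tpmult q (tpstar \<eta>) (tpstar \<xi>)) a b w"
  by (rule Phi_mult[OF U.tpstar_families[OF \<eta>] U.tpstar_families[OF \<xi>] ab w, symmetric])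
 finally show "Phi (tpstar (tpmult q \<xi> \<eta>)) a b w = Phi (tpmult q (tpstar \<eta>) (tpstar \<xi>)) a b w" .
qed

lemma Phi_mult_unit:
 assumes \<xi>: "\<xi> \<in> fam"
 shows "Phi (tpmult q U.unit_tp \<xi>) = Phi \<xi>" "Phi (tpmult q \<xi> U.unit_tp) = Phi \<xi>"
proof -
 have u: "wick w (Phi U.unit_tp a d) g = (if a = d then g w else 0)" if "a < N" "d < N" "w \<in> words" for a d w g
 proof -
  have "wick w (Phi U.unit_tp a d) g = wick w (\<lambda>u. if u = [] then if a = d then 1 else 0 else 0) g"
   by (rule wick_cong[OF _ _ that(3)]) (simp_all add: Phi_unit that)
  then show ?thesis by (simp add: wick_unit)
 qed
 show "Phi (tpmult q U.unit_tp \<xi>) = Phi \<xi>"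
  by (rule Phi_eqI) (simp add: Phi_mult[OF U.unit_families \<xi>] u)
 show "Phi (tpmult q \<xi> U.unit_tp) = Phi \<xi>"
  by (rule Phi_eqI) (simp add: Phi_mult[OF \<xi> U.unit_families] wick_commute[of _ "Phi \<xi> _ _"] u)
qed

lemma Phi_mult_linear:
 assumes \<xi>: "\<xi> \<in> fam" and \<eta>: "\<eta> \<in> fam" and \<zeta>: "\<zeta> \<in> fam"
 shows "Phi (tpmult q (padd \<xi> \<eta>) \<zeta>) = Phi (padd (tpmult q \<xi> \<zeta>) (tpmult q \<eta> \<zeta>))"
  and "Phi (tpmult q \<zeta> (padd \<xi> \<eta>)) = Phi (padd (tpmult q \<zeta> \<xi>) (tpmult q \<zeta> \<eta>))"
  and "Phi (tpmult q (pscl c \<xi>) \<zeta>) = Phi (pscl c (tpmult q \<xi> \<zeta>))"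
  and "Phi (tpmult q \<zeta> (pscl c \<xi>)) = Phi (pscl c (tpmult q \<zeta> \<xi>))"
proof -
 have a: "Phi (padd \<xi> \<eta>) i j = (\<lambda>u. Phi \<xi> i j u + Phi \<eta> i j u)" "Phi (pscl c \<xi>) i j = (\<lambda>u. c * Phi \<xi> i j u)" for i j
  by (simp_all add: fun_eq_iff Phi_padd Phi_pscl)
 have p: "pairable (Phi \<xi> i j) (Phi \<zeta> k l)" "pairable (Phi \<eta> i j) (Phi \<zeta> k l)" for i j k l
  by (intro pairable_tame Phi_tame \<xi> \<eta> \<zeta>)+
 have w: "wick w (Phi (padd \<xi> \<eta>) i j) (Phi \<zeta> k l) = wick w (Phi \<xi> i j) (Phi \<zeta> k l) + wick w (Phi \<eta> i j) (Phi \<zeta> k l)"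
  "wick w (Phi (pscl c \<xi>) i j) (Phi \<zeta> k l) = c * wick w (Phi \<xi> i j) (Phi \<zeta> k l)" if "w \<in> words" for i j k l w
  unfolding a by (rule wick_add[OF p that], rule wick_cmult)
 note mem = padd_fam[OF \<xi> \<eta>] pscl_fam[OF \<xi>, of c] \<xi> \<eta> \<zeta>
 show "Phi (tpmult q (padd \<xi> \<eta>) \<zeta>) = Phi (padd (tpmult q \<xi> \<zeta>) (tpmult q \<eta> \<zeta>))"
  by (rule Phi_eqI) (simp add: Phi_mult mem Phi_padd w sum.distrib)
 show "Phi (tpmult q \<zeta> (padd \<xi> \<eta>)) = Phi (padd (tpmult q \<zeta> \<xi>) (tpmult q \<zeta> \<eta>))"
  by (rule Phi_eqI) (simp add: Phi_mult mem Phi_padd wick_commute[of _ "Phi \<zeta> _ _"] w sum.distrib)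
 show "Phi (tpmult q (pscl c \<xi>) \<zeta>) = Phi (pscl c (tpmult q \<xi> \<zeta>))"
  by (rule Phi_eqI) (simp add: Phi_mult mem Phi_pscl w sum_distrib_left)
 show "Phi (tpmult q \<zeta> (pscl c \<xi>)) = Phi (pscl c (tpmult q \<zeta> \<xi>))"
  by (rule Phi_eqI) (simp add: Phi_mult mem Phi_pscl wick_commute[of _ "Phi \<zeta> _ _"] w sum_distrib_left)
qed

lemmas fam_closed = padd_fam pscl_fam U.tpmult_families U.tpstar_families U.unit_families

theorem star_algebra: "unital_star_algebra alg"
proof -
 note simps = alg_simps alg_one fam_closed
 note lin = fun_eq_iff Phi_padd Phi_pscl Phi_star algebra_simps
 show ?thesis
  apply (unfold_locales; unfold carr_alg; (elim imageE)?; (hypsubst)?)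
  apply (simp_all only: simps imageI)
  apply (rule Wcl_cong; (simp only: fam_closed Phi_mult_assoc Phi_mult_unit Phi_mult_linear Phi_mult_star)?; (auto simp: lin fam_closed bar_bar comp_def)?)+
  done
qed

theorem tracial_state: "faithful_tracial_state alg vacuum_state"
 unfolding faithful_tracial_state_def carr_alg
proof (intro conjI ballI allI impI; (elim imageE; hypsubst)?)
 fix \<xi> \<eta> c assume \<xi>: "\<xi> \<in> fam" and \<eta>: "\<eta> \<in> fam"
 show "vacuum_state (vadd alg (Wcl q \<xi>) (Wcl q \<eta>)) = vacuum_state (Wcl q \<xi>) + vacuum_state (Wcl q \<eta>)"
  using \<xi> \<eta> by (simp add: alg_simps fam_closed) (simp add: vac_def padd_def)
 show "vacuum_state (amult alg (Wcl q \<xi>) (Wcl q \<eta>)) = vacuum_state (amult alg (Wcl q \<eta>) (Wcl q \<xi>))"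
  using \<xi> \<eta> by (simp add: alg_simps fam_closed vac_commute)
next
 fix \<xi> c assume \<xi>: "\<xi> \<in> fam"
 show "vacuum_state (vscl alg c (Wcl q \<xi>)) = c * vacuum_state (Wcl q \<xi>)"
  using \<xi> by (simp add: alg_simps fam_closed) (simp add: vac_def pscl_def)
 have e: "vacuum_state (amult alg (astar alg (Wcl q \<xi>)) (Wcl q \<xi>)) = form q \<xi> \<xi>"
  using \<xi> by (simp add: alg_simps fam_closed form_vac)
 show "vacuum_state (amult alg (astar alg (Wcl q \<xi>)) (Wcl q \<xi>)) \<in> \<real>"
  "0 \<le> Re (vacuum_state (amult alg (astar alg (Wcl q \<xi>)) (Wcl q \<xi>)))"
  unfolding e by (rule form_pos[OF \<xi>])+
 show "Wcl q \<xi> = vscl alg 0 (Wcl q \<xi>)" if "vacuum_state (amult alg (astar alg (Wcl q \<xi>)) (Wcl q \<xi>)) = 0"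
  using form_pos(3)[OF \<xi>] that \<xi> unfolding e
  by (simp add: alg_simps fam_closed Wcl_iff) (simp add: fun_eq_iff Phi_pscl)
next
 show "vacuum_state (aone alg) = 1"
  using N by (simp add: alg_one alg_simps U.unit_families vac_Phi Phi_unit)
qed

end

section \<open>The conditional expectation\<close>

lemma real_projection_of_orthogonal:
 fixes P :: "'a::{real_inner, complete_space} \<times> 'a \<Rightarrow> 'a \<times> 'a"
 assumes M: "subspace M" and P: "orthogonal_projection complexification (M \<times> M) P"
 shows "real_projection (\<lambda>x. fst (P (x, 0))) M" and "P (x, 0) = (fst (P (x, 0)), 0)"
proof -
 define p where "p x = fst (P (x, 0))" for x
 have PM: "p x \<in> M" "snd (P (x, 0)) \<in> M" for x
 proof -
  have "P (x, 0) \<in> M \<times> M" using P by (simp add: orthogonal_projection_def complexification_def)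
  then show "p x \<in> M" "snd (P (x, 0)) \<in> M" by (auto simp: p_def)
 qed
 have o: "(x - p x) \<bullet> m = 0 \<and> snd (P (x, 0)) \<bullet> m = 0" if m: "m \<in> M" for x m
 proof -
  have "(m, 0) \<in> M \<times> M" using m subspace_0[OF M] by simp
  then have "cinner (vsub complexification (x, 0) (P (x, 0))) (m, 0) = 0"
   using P by (simp add: orthogonal_projection_def complexification_def)
  then show ?thesis
   by (cases "P (x, 0)") (simp add: vsub_def complexification_def cinner_def p_def complex_eq_iff)
 qed
 have "snd (P (x, 0)) \<bullet> snd (P (x, 0)) = 0" for x using o[OF PM(2)] by blast
 then have "snd (P (x, 0)) = 0" for x by simp
 then show "P (x, 0) = (fst (P (x, 0)), 0)" by (simp add: prod_eq_iff)
 have uniq: "p x = y" if "y \<in> M" "\<And>m. m \<in> M \<Longrightarrow> (x - y) \<bullet> m = 0" for x y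
 proof -
  have d: "p x - y \<in> M" by (rule subspace_diff[OF M PM(1) that(1)])
  have "(p x - y) \<bullet> (p x - y) = (x - y) \<bullet> (p x - y) - (x - p x) \<bullet> (p x - y)" by (simp add: inner_diff_left)
  then have "(p x - y) \<bullet> (p x - y) = 0" using that(2)[OF d] o[OF d, of x] by simp
  then show ?thesis by simp
 qed
 have "real_projection p M"
 proof (rule real_projection.intro)
  show "linear p"
  proof (rule linearI)
   show "p (x + y) = p x + p y" for x y
   proof (rule uniq)
    show "p x + p y \<in> M" by (rule subspace_add[OF M PM(1) PM(1)])
    show "(x + y - (p x + p y)) \<bullet> m = 0" if "m \<in> M" for m
     using o[OF that, of x] o[OF that, of y] by (simp add: inner_diff_left inner_add_left)
   qed
   show "p (c *\<^sub>R x) = c *\<^sub>R p x" for c x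
   proof (rule uniq)
    show "c *\<^sub>R p x \<in> M" by (rule subspace_scale[OF M PM(1)])
    show "(c *\<^sub>R x - c *\<^sub>R p x) \<bullet> m = 0" if "m \<in> M" for m
     using o[OF that, of x] by (simp add: inner_diff_left flip: scaleR_diff_right)
   qed
  qed
  show "p x = x" if "x \<in> M" for x using that by (intro uniq) auto
  show "p x \<in> M" for x by (rule PM)
  show "p x \<bullet> y = x \<bullet> p y" for x y
   using o[OF PM(1)[of y], of x] o[OF PM(1)[of x], of y] 
   by (simp add: inner_diff_left inner_commute[of "p y" "p x"] inner_commute[of y "p x"])
 qed
 then show "real_projection (\<lambda>x. fst (P (x, 0))) M" unfolding p_def[abs_def] .
qed

locale model_projection = matrix_model N neg q ty + R: real_projection p M
 for N neg q and ty :: "'a::{real_inner, complete_space} itself" and p :: "'a \<Rightarrow> 'a" and M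
begin

abbreviation "sub \<equiv> R.families"

text \<open>Second quantisation of the projection, on coefficient families.\<close>

definition hat :: "'a tp \<Rightarrow> 'a tp" where
 "hat \<xi> = (\<lambda>n \<alpha> x. \<xi> n \<alpha> (\<lambda>i. p (x i)))"

definition \<Gamma> :: "'a tp set \<Rightarrow> 'a tp set" where
 "\<Gamma> X = Wcl q (hat (rep X))"

lemma hat_second: "hat \<xi> n \<alpha> = R.second (\<xi> n \<alpha>)"
 by (simp add: hat_def R.second_def)

lemma sub_fam: "\<xi> \<in> sub \<Longrightarrow> \<xi> \<in> fam"
 by (rule U.familiesI[of "degs \<xi>"])
  (simp_all add: R.familiesD R.degs_zero U_tensors)

lemma hat_sub:
 assumes \<xi>: "\<xi> \<in> fam"
 shows "hat \<xi> \<in> sub"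
proof (rule R.familiesI[of "degs \<xi>"])
 show "hat \<xi> n \<alpha> \<in> R.tensors n" for n \<alpha>
  unfolding hat_second R.tensors_def by (simp add: R.second_hilbert_schmidt[OF U.familiesD(5)[OF \<xi>]])
 show "hat \<xi> n (conj_by \<sigma> \<alpha>) x = hat \<xi> n \<alpha> (x \<circ> \<sigma>)" if "\<sigma> \<in> Sn n" "\<alpha> \<in> S0 n" for n \<sigma> \<alpha> x
  unfolding hat_def U.familiesD(4)[OF \<xi> that] by (simp add: comp_def)
qed (use U.familiesD(1)[OF \<xi>] in \<open>simp_all add: hat_def U.degs_zero U.familiesD(2)[OF \<xi>]\<close>)

lemma hat_fam: "\<xi> \<in> fam \<Longrightarrow> hat \<xi> \<in> fam"
 by (rule sub_fam[OF hat_sub])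

lemma hat_fixed:
 assumes "\<xi> \<in> sub"
 shows "hat \<xi> = \<xi>"
proof (intro ext)
 fix n \<alpha> x
 have "R.second (\<xi> n \<alpha>) = \<xi> n \<alpha>" using R.familiesD(3)[OF assms] by (simp add: R.tensors_def)
 then show "hat \<xi> n \<alpha> x = \<xi> n \<alpha> x" by (simp add: hat_second)
qed

lemma hat_linear: "hat (padd \<xi> \<eta>) = padd (hat \<xi>) (hat \<eta>)" "hat (pscl c \<xi>) = pscl c (hat \<xi>)"
 by (simp_all add: hat_def padd_def pscl_def)

lemma hat_symt: "hat (symt n \<alpha> F) = symt n \<alpha> (R.second F)"
proof (intro ext)
 fix m \<beta> x
 have pe: "perm_op \<sigma> F (\<lambda>i. p (x i)) = perm_op \<sigma> (R.second F) x" for \<sigma>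
  by (simp add: perm_op_def R.second_def comp_def)
 show "hat (symt n \<alpha> F) m \<beta> x = symt n \<alpha> (R.second F) m \<beta> x"
  unfolding hat_def symt_def pe by (rule refl)
qed

lemma form_superset:
 assumes \<xi>: "\<xi> \<in> fam" and \<eta>: "\<eta> \<in> fam" and D: "finite D" "degs \<xi> \<inter> degs \<eta> \<subseteq> D"
 shows "form q \<xi> \<eta> = (\<Sum>n\<in>D. fact n * (\<Sum>\<alpha>\<in>S0 n. \<Sum>\<beta>\<in>S0 n.
  of_real (chi q n (\<alpha> \<circ> inv \<beta>)) * tinner n (\<xi> n \<alpha>) (\<eta> n \<beta>)))"
 unfolding form_families[OF \<xi> \<eta>]
proof (rule sum.mono_neutral_left[OF D], rule ballI)
 fix n assume "n \<in> D - degs \<xi> \<inter> degs \<eta>"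
 then have "tinner n (\<xi> n \<alpha>) (\<eta> n \<beta>) = 0" for \<alpha> \<beta>
  by (auto simp: tinner_def U.degs_zero)
 then show "fact n * (\<Sum>\<alpha>\<in>S0 n. \<Sum>\<beta>\<in>S0 n. of_real (chi q n (\<alpha> \<circ> inv \<beta>)) * tinner n (\<xi> n \<alpha>) (\<eta> n \<beta>)) = 0"
  by simp
qed

lemma form_hat:
 assumes \<xi>: "\<xi> \<in> fam" and \<eta>: "\<eta> \<in> fam"
 shows "form q (hat \<xi>) \<eta> = form q \<xi> (hat \<eta>)"
proof -
 have d: "degs (hat \<zeta>) \<subseteq> degs \<zeta>" for \<zeta> by (auto simp: degs_def hat_def)
 have fin: "finite (degs \<xi> \<inter> degs \<eta>)" using U.familiesD(1)[OF \<xi>] by blast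
 have "tinner n (hat \<xi> n \<alpha>) (\<eta> n \<beta>) = tinner n (\<xi> n \<alpha>) (hat \<eta> n \<beta>)" for n \<alpha> \<beta>
  unfolding hat_second by (rule R.second_adjoint[OF U.familiesD(5)[OF \<xi>] U.familiesD(5)[OF \<eta>]])
 moreover have "degs (hat \<xi>) \<inter> degs \<eta> \<subseteq> degs \<xi> \<inter> degs \<eta>" "degs \<xi> \<inter> degs (hat \<eta>) \<subseteq> degs \<xi> \<inter> degs \<eta>"
  using d by blast+
 ultimately show ?thesis
  using form_superset[OF hat_fam[OF \<xi>] \<eta> fin] form_superset[OF \<xi> hat_fam[OF \<eta>] fin] by simp
qed

text \<open>The form restricted to the subalgebra is still positive, so its elements can be tested against the subalgebra
 alone.\<close>

lemma form_separates:
 assumes \<xi>: "\<xi> \<in> sub" and \<eta>: "\<eta> \<in> sub" and z: "\<And>\<zeta>. \<zeta> \<in> sub \<Longrightarrow> form q \<xi> \<zeta> = form q \<eta> \<zeta>"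
 shows "Phi \<xi> = Phi \<eta>"
proof -
 let ?d = "padd \<xi> (pscl (-1) \<eta>)"
 have d: "?d \<in> sub" unfolding padd_def pscl_def by (intro R.families_add R.families_cmult \<xi> \<eta>)
 have "form q ?d ?d = form q \<xi> ?d + (-1) * form q \<eta> ?d"
  using form_add[OF sub_fam[OF \<xi>] pscl_fam[OF sub_fam[OF \<eta>]] sub_fam[OF d]]
   form_scl[OF sub_fam[OF \<eta>] sub_fam[OF d]] by simp
 then have "form q ?d ?d = 0" using z[OF d] by simp
 then have "Phi ?d = (\<lambda>_ _ _. 0)" by (rule form_pos(3)[OF sub_fam[OF d]])
 then show ?thesis by (simp add: fun_eq_iff Phi_padd Phi_pscl)
qed

lemma Phi_hat_cong:
 assumes "\<xi> \<in> fam" "\<eta> \<in> fam" "Phi \<xi> = Phi \<eta>"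
 shows "Phi (hat \<xi>) = Phi (hat \<eta>)"
proof (rule form_separates[OF hat_sub hat_sub])
 fix \<zeta> assume "\<zeta> \<in> sub"
 then have \<zeta>: "\<zeta> \<in> fam" by (rule sub_fam)
 show "form q (hat \<xi>) \<zeta> = form q (hat \<eta>) \<zeta>"
  unfolding form_hat[OF assms(1) \<zeta>] form_hat[OF assms(2) \<zeta>]
  by (rule form_cong[OF assms(1) hat_fam[OF \<zeta>] assms(2) hat_fam[OF \<zeta>] assms(3) refl])
qed (rule assms)+

lemma \<Gamma>_Wcl:
 assumes "\<xi> \<in> fam"
 shows "\<Gamma> (Wcl q \<xi>) = Wcl q (hat \<xi>)"
 unfolding \<Gamma>_def
 by (rule Wcl_cong[OF hat_fam[OF rep_Wcl(1)[OF assms]] hat_fam[OF assms] Phi_hat_cong[OF rep_Wcl(1)[OF assms] assms rep_Wcl(2)[OF assms]]])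

text \<open>Right multiplication by \<open>\<eta>\<close> has right multiplication by \<open>\<eta>\<^sup>*\<close> as adjoint; this is where the trace property
 enters.\<close>

lemma form_right_mult:
 assumes \<xi>: "\<xi> \<in> fam" and \<eta>: "\<eta> \<in> fam" and \<zeta>: "\<zeta> \<in> fam"
 shows "form q (tpmult q \<xi> \<eta>) \<zeta> = form q \<xi> (tpmult q \<zeta> (tpstar \<eta>))"
proof -
 note s = U.tpstar_families and m = U.tpmult_families
 note mem = \<xi> \<eta> \<zeta> s[OF \<eta>] s[OF \<zeta>] s[OF s[OF \<eta>]]
 have v: "vac \<xi>' = vac \<eta>'" if "\<xi>' \<in> fam" "\<eta>' \<in> fam" "Phi \<xi>' = Phi \<eta>'" for \<xi>' \<eta>'
  using vac_Phi that by simp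
 have ss: "Phi (tpstar (tpstar \<eta>)) = Phi \<eta>"
  by (simp add: fun_eq_iff Phi_star mem bar_bar comp_def)
 have "form q (tpmult q \<xi> \<eta>) \<zeta> = vac (tpmult q (tpstar \<zeta>) (tpmult q \<xi> \<eta>))"
  by (rule form_vac[OF m[OF \<xi> \<eta>] \<zeta>])
 also have "\<dots> = vac (tpmult q (tpmult q (tpstar \<zeta>) \<xi>) \<eta>)"
  by (rule v) (simp_all add: m mem Phi_mult_assoc)
 also have "\<dots> = vac (tpmult q \<eta> (tpmult q (tpstar \<zeta>) \<xi>))"
  by (rule vac_commute) (simp_all add: m mem)
 also have "\<dots> = vac (tpmult q (tpmult q \<eta> (tpstar \<zeta>)) \<xi>)"
  by (rule v) (simp_all add: m mem Phi_mult_assoc)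
 also have "\<dots> = vac (tpmult q (tpstar (tpmult q \<zeta> (tpstar \<eta>))) \<xi>)"
 proof (rule v)
  have "Phi (tpmult q \<eta> (tpstar \<zeta>)) = Phi (tpmult q (tpstar (tpstar \<eta>)) (tpstar \<zeta>))"
   by (rule Phi_mult_cong) (simp_all add: mem ss)
  then have "Phi (tpmult q \<eta> (tpstar \<zeta>)) = Phi (tpstar (tpmult q \<zeta> (tpstar \<eta>)))"
   by (simp add: Phi_mult_star mem)
  then show "Phi (tpmult q (tpmult q \<eta> (tpstar \<zeta>)) \<xi>) = Phi (tpmult q (tpstar (tpmult q \<zeta> (tpstar \<eta>))) \<xi>)"
   by (intro Phi_mult_cong) (simp_all add: m s mem)
 qed (simp_all add: m s mem)
 also have "\<dots> = form q \<xi> (tpmult q \<zeta> (tpstar \<eta>))"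
  by (rule form_vac[OF \<xi> m[OF \<zeta> s[OF \<eta>]], symmetric])
 finally show ?thesis .
qed

text \<open>Both sides lie in the subalgebra, and \<open>hat\<close> and right multiplication can be moved to the other side of the
 form, where \<open>\<zeta> \<eta>\<^sup>*\<close> stays in the subalgebra and is fixed by \<open>hat\<close>.\<close>

lemma Phi_hat_mult:
 assumes \<xi>: "\<xi> \<in> fam" and \<eta>: "\<eta> \<in> sub"
 shows "Phi (hat (tpmult q \<xi> \<eta>)) = Phi (tpmult q (hat \<xi>) \<eta>)"
proof (rule form_separates)
 note \<eta>' = sub_fam[OF \<eta>]
 note m = U.tpmult_families
 show "hat (tpmult q \<xi> \<eta>) \<in> sub" by (rule hat_sub[OF m[OF \<xi> \<eta>']])
 show "tpmult q (hat \<xi>) \<eta> \<in> sub" by (rule R.tpmult_families[OF hat_sub[OF \<xi>] \<eta>])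
 fix \<zeta> assume \<zeta>: "\<zeta> \<in> sub"
 note \<zeta>' = sub_fam[OF \<zeta>]
 have w: "tpmult q \<zeta> (tpstar \<eta>) \<in> sub" by (rule R.tpmult_families[OF \<zeta> R.tpstar_families[OF \<eta>]])
 have "form q (hat (tpmult q \<xi> \<eta>)) \<zeta> = form q \<xi> (tpmult q \<zeta> (tpstar \<eta>))"
  unfolding form_hat[OF m[OF \<xi> \<eta>'] \<zeta>'] hat_fixed[OF \<zeta>] by (rule form_right_mult[OF \<xi> \<eta>' \<zeta>'])
 also have "\<dots> = form q (tpmult q (hat \<xi>) \<eta>) \<zeta>"
  unfolding form_right_mult[OF hat_fam[OF \<xi>] \<eta>' \<zeta>'] form_hat[OF \<xi> sub_fam[OF w]] hat_fixed[OF w] ..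
 finally show "form q (hat (tpmult q \<xi> \<eta>)) \<zeta> = form q (tpmult q (hat \<xi>) \<eta>) \<zeta>" .
qed

context
 fixes V :: "'a tp set ipspace"
 assumes V: "carr V = Wcl q ` fam"
  "\<And>\<xi> \<eta>. \<xi> \<in> fam \<Longrightarrow> \<eta> \<in> fam \<Longrightarrow> vadd V (Wcl q \<xi>) (Wcl q \<eta>) = Wcl q (padd \<xi> \<eta>)"
  "\<And>\<xi> c. \<xi> \<in> fam \<Longrightarrow> vscl V c (Wcl q \<xi>) = Wcl q (pscl c \<xi>)"
  "\<And>\<xi> \<eta>. \<xi> \<in> fam \<Longrightarrow> \<eta> \<in> fam \<Longrightarrow> ip V (Wcl q \<xi>) (Wcl q \<eta>) = form q \<xi> \<eta>"
begin

lemma vsub_Wcl: "\<xi> \<in> fam \<Longrightarrow> \<eta> \<in> fam \<Longrightarrow> vsub V (Wcl q \<xi>) (Wcl q \<eta>) = Wcl q (padd \<xi> (pscl (-1) \<eta>))"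
 by (simp add: vsub_def V pscl_fam)

lemma hermitian: "hermitian_space V"
proof (unfold_locales; unfold V(1); (elim imageE; hypsubst)?)
 fix \<xi> \<eta> \<zeta> :: "'a tp" and c
 assume \<xi>: "\<xi> \<in> fam" and \<eta>: "\<eta> \<in> fam"
 show "vadd V (Wcl q \<xi>) (Wcl q \<eta>) \<in> Wcl q ` fam" using \<xi> \<eta> by (simp add: V padd_fam)
 show "ip V (vscl V c (Wcl q \<xi>)) (Wcl q \<eta>) = c * ip V (Wcl q \<xi>) (Wcl q \<eta>)"
  using \<xi> \<eta> by (simp add: V pscl_fam form_scl)
 show "ip V (Wcl q \<eta>) (Wcl q \<xi>) = cnj (ip V (Wcl q \<xi>) (Wcl q \<eta>))"
  unfolding V(4)[OF \<xi> \<eta>] V(4)[OF \<eta> \<xi>] by (rule form_cnj[OF \<xi> \<eta>])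
 assume \<zeta>: "\<zeta> \<in> fam"
 show "ip V (vadd V (Wcl q \<xi>) (Wcl q \<eta>)) (Wcl q \<zeta>) = ip V (Wcl q \<xi>) (Wcl q \<zeta>) + ip V (Wcl q \<eta>) (Wcl q \<zeta>)"
  using \<xi> \<eta> \<zeta> by (simp add: V padd_fam form_add)
next
 fix \<xi> :: "'a tp" and c
 assume \<xi>: "\<xi> \<in> fam"
 show "vscl V c (Wcl q \<xi>) \<in> Wcl q ` fam" using \<xi> by (simp add: V pscl_fam)
 show "0 \<le> Re (ip V (Wcl q \<xi>) (Wcl q \<xi>))" using \<xi> form_pos(2) by (simp add: V)
qed

lemma completed_projection:
 "orthogonal_projection (completion V) (completion_sub V (Wcl q ` sub)) (\<lambda>A. seq_class V (\<lambda>n. \<Gamma> (rep A n)))"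
 "\<xi> \<in> fam \<Longrightarrow> seq_class V (\<lambda>n. \<Gamma> (rep (embed V (Wcl q \<xi>)) n)) = embed V (Wcl q (hat \<xi>))"
proof -
 interpret hermitian_space V by (rule hermitian)
 have 1: "Wcl q ` sub \<subseteq> carr V" using sub_fam by (auto simp: V)
 have 2: "vsub V x y \<in> Wcl q ` sub" if x': "x \<in> Wcl q ` sub" and y': "y \<in> Wcl q ` sub" for x y
 proof -
  obtain \<xi> where x: "x = Wcl q \<xi>" "\<xi> \<in> sub" using x' by blast
  obtain \<eta> where y: "y = Wcl q \<eta>" "\<eta> \<in> sub" using y' by blast
  have "padd \<xi> (pscl (-1) \<eta>) \<in> sub" unfolding padd_def pscl_def by (intro R.families_add R.families_cmult x y)
  then show ?thesis unfolding x(1) y(1) vsub_Wcl[OF sub_fam[OF x(2)] sub_fam[OF y(2)]] by (rule imageI)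
 qed
 have 3: "\<Gamma> x \<in> Wcl q ` sub" if "x \<in> carr V" for x
  using that by (auto simp: V \<Gamma>_Wcl intro: hat_sub)
 have 4: "ip V (vsub V x (\<Gamma> x)) y = 0" if "x \<in> carr V" "y \<in> Wcl q ` sub" for x y
 proof -
  obtain \<xi> \<eta> where x: "x = Wcl q \<xi>" and \<xi>: "\<xi> \<in> fam" and y: "y = Wcl q \<eta>" and \<eta>: "\<eta> \<in> sub"
   using \<open>x \<in> carr V\<close> \<open>y \<in> Wcl q ` sub\<close> unfolding V by blast
  note m = \<xi> hat_fam[OF \<xi>] sub_fam[OF \<eta>]
  have "ip V (vsub V x (\<Gamma> x)) y = form q \<xi> \<eta> + (-1) * form q (hat \<xi>) \<eta>"
   unfolding x y \<Gamma>_Wcl[OF \<xi>] vsub_Wcl[OF m(1,2)] V(4)[OF padd_fam[OF m(1) pscl_fam[OF m(2)]] m(3)]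
    form_add[OF m(1) pscl_fam[OF m(2)] m(3)] form_scl[OF m(2,3)] ..
  then show ?thesis using form_hat[OF \<xi> m(3)] by (simp add: hat_fixed[OF \<eta>])
 qed
 show "orthogonal_projection (completion V) (completion_sub V (Wcl q ` sub)) (\<lambda>A. seq_class V (\<lambda>n. \<Gamma> (rep A n)))"
  by (rule projection_extends(1)[OF 1 2 3 4])
 show "seq_class V (\<lambda>n. \<Gamma> (rep (embed V (Wcl q \<xi>)) n)) = embed V (Wcl q (hat \<xi>))" if \<xi>: "\<xi> \<in> fam"
 proof -
  have "Wcl q \<xi> \<in> carr V" using \<xi> by (simp add: V)
  from projection_extends(2)[OF 1 2 3 4 this] show ?thesis by (simp add: \<Gamma>_Wcl \<xi>)
 qed
qed

text \<open>The quotient has no null vectors, so a vector of the dense domain comes from one algebra element only.\<close>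

lemma embed_inj:
 assumes \<xi>: "\<xi> \<in> fam" and \<eta>: "\<eta> \<in> fam" and e: "embed V (Wcl q \<xi>) = embed V (Wcl q \<eta>)"
 shows "Wcl q \<xi> = Wcl q \<eta>"
proof -
 interpret hermitian_space V by (rule hermitian)
 let ?d = "padd \<eta> (pscl (-1) \<xi>)"
 have d: "?d \<in> fam" by (intro padd_fam pscl_fam \<xi> \<eta>)
 have c: "(\<lambda>_. Wcl q \<xi>) \<in> cauchy_seqs V" by (rule cauchy_const) (simp add: V \<xi>)
 have "(\<lambda>_. Wcl q \<xi>) \<in> embed V (Wcl q \<xi>)"
  using c N_self[of "Wcl q \<xi>"] \<xi> by (simp add: embed_def seq_class_def V)
 then have "(\<lambda>_ :: nat. vnorm V (vsub V (Wcl q \<eta>) (Wcl q \<xi>))) \<longlonglongrightarrow> 0" unfolding e by (simp add: embed_def seq_class_def)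
 then have "vnorm V (vsub V (Wcl q \<eta>) (Wcl q \<xi>)) = 0" by (simp add: LIMSEQ_const_iff)
 then have "Re (form q ?d ?d) = 0" by (simp add: vnorm_def vsub_Wcl \<xi> \<eta> V d)
 then have "form q ?d ?d = 0" using form_pos(1)[OF d] by (simp add: complex_is_Real_iff complex_eq_iff)
 from form_pos(3)[OF d this] have "Phi \<xi> = Phi \<eta>" by (simp add: fun_eq_iff Phi_padd Phi_pscl)
 then show ?thesis by (rule Wcl_cong[OF \<xi> \<eta>])
qed

end

lemma Fock_space:
 "carr (TPq_space q :: 'a tp set ipspace) = Wcl q ` fam"
 "\<And>\<xi> \<eta>. \<xi> \<in> fam \<Longrightarrow> \<eta> \<in> fam \<Longrightarrow> vadd (TPq_space q) (Wcl q \<xi>) (Wcl q \<eta>) = Wcl q (padd \<xi> \<eta>)"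
 "\<And>\<xi> c. \<xi> \<in> fam \<Longrightarrow> vscl (TPq_space q) c (Wcl q \<xi>) = Wcl q (pscl c \<xi>)"
 "\<And>\<xi> \<eta>. \<xi> \<in> fam \<Longrightarrow> \<eta> \<in> fam \<Longrightarrow> ip (TPq_space q) (Wcl q \<xi>) (Wcl q \<eta>) = form q \<xi> \<eta>"
 by (simp_all add: carr_space space_simps)

lemma gns_space:
 "carr (gns_form alg vacuum_state) = Wcl q ` fam"
 "\<And>\<xi> \<eta>. \<xi> \<in> fam \<Longrightarrow> \<eta> \<in> fam \<Longrightarrow> vadd (gns_form alg vacuum_state) (Wcl q \<xi>) (Wcl q \<eta>) = Wcl q (padd \<xi> \<eta>)"
 "\<And>\<xi> c. \<xi> \<in> fam \<Longrightarrow> vscl (gns_form alg vacuum_state) c (Wcl q \<xi>) = Wcl q (pscl c \<xi>)"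
 "\<And>\<xi> \<eta>. \<xi> \<in> fam \<Longrightarrow> \<eta> \<in> fam \<Longrightarrow> ip (gns_form alg vacuum_state) (Wcl q \<xi>) (Wcl q \<eta>) = form q \<xi> \<eta>"
 by (simp_all add: gns_form_def carr_alg alg_simps fam_closed form_vac)

lemma TPq_sub_eq: "TPq_sub q M = Wcl q ` sub"
 by (simp add: TPq_sub_def R.TP_real_eq)

definition FP :: "(nat \<Rightarrow> 'a tp set) set \<Rightarrow> (nat \<Rightarrow> 'a tp set) set" where
 "FP = (\<lambda>A. seq_class (TPq_space q) (\<lambda>n. \<Gamma> (rep A n)))"

lemma FP_projection: "orthogonal_projection (Fock q) (Fock_sub q (M \<times> M)) FP"
 unfolding Fock_def Fock_sub_def R.TP_eq FP_def
 by (rule completed_projection(1)[OF Fock_space])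

lemma FP_vec: "\<xi> \<in> fam \<Longrightarrow> FP (Fock_vec q (Wcl q \<xi>)) = Fock_vec q (Wcl q (hat \<xi>))"
 unfolding Fock_vec_def FP_def by (rule completed_projection(2)[OF Fock_space])

lemma \<Gamma>_linear: "linear_map alg alg \<Gamma>"
 unfolding linear_map_def carr_alg
proof (intro conjI ballI allI; (elim imageE; hypsubst)?)
 show "\<Gamma> ` Wcl q ` fam \<subseteq> Wcl q ` fam" by (auto simp: \<Gamma>_Wcl intro: hat_fam)
qed (simp_all add: alg_simps \<Gamma>_Wcl fam_closed hat_fam hat_linear)

lemma conditional_expectation:
 "algebraic_conditional_expectation alg vacuum_state (TPq_sub q M) \<Gamma>"
 unfolding algebraic_conditional_expectation_def
proof (intro conjI star_algebra tracial_state ballI exI)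
 show "unital_star_subalgebra alg (TPq_sub q M)"
  unfolding unital_star_subalgebra_def TPq_sub_eq
 proof (intro conjI ballI allI; (elim imageE; hypsubst)?)
  show "Wcl q ` sub \<subseteq> carr alg" using sub_fam by (auto simp: carr_alg)
  show "aone alg \<in> Wcl q ` sub"
   using R.unit_families unfolding alg_one U.unit_tp_def R.unit_tp_def by (rule imageI)
 qed (simp_all add: alg_simps sub_fam R.tpmult_families R.tpstar_families
   R.families_add[folded padd_def] R.families_cmult[folded pscl_def])
 show "\<Gamma> a \<in> TPq_sub q M" if "a \<in> carr alg" for a
  using that by (auto simp: carr_alg TPq_sub_eq \<Gamma>_Wcl intro: hat_sub)
 let ?V = "gns_form alg vacuum_state"
 show "orthogonal_projection (completion ?V) (completion_sub ?V (TPq_sub q M)) (\<lambda>A. seq_class ?V (\<lambda>n. \<Gamma> (rep A n)))"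
  unfolding TPq_sub_eq by (rule completed_projection(1)[OF gns_space])
 show "seq_class ?V (\<lambda>n. \<Gamma> (rep (embed ?V a) n)) = embed ?V (\<Gamma> a)" if "a \<in> carr alg" for a
  using that completed_projection(2)[OF gns_space] by (auto simp: carr_alg \<Gamma>_Wcl)
qed

lemma gns_op_Wcl:
 assumes \<xi>: "\<xi> \<in> fam" and \<eta>: "\<eta> \<in> fam"
 shows "gns_op q (Wcl q \<xi>) (Fock_vec q (Wcl q \<eta>)) = Fock_vec q (Wcl q (tpmult q \<xi> \<eta>))"
proof -
 have "(THE b. b \<in> carr alg \<and> Fock_vec q b = Fock_vec q (Wcl q \<eta>)) = Wcl q \<eta>"
 proof (rule the_equality)
  show "Wcl q \<eta> \<in> carr alg \<and> Fock_vec q (Wcl q \<eta>) = Fock_vec q (Wcl q \<eta>)" using \<eta> by (simp add: carr_alg)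
  show "b = Wcl q \<eta>" if "b \<in> carr alg \<and> Fock_vec q b = Fock_vec q (Wcl q \<eta>)" for b
   using that embed_inj[OF Fock_space _ \<eta>] by (auto simp: carr_alg Fock_vec_def)
 qed
 then show ?thesis by (simp add: gns_op_def alg_simps \<xi> \<eta>)
qed

lemma implemented:
 assumes a: "a \<in> carr alg" and v: "v \<in> Fock_vec q ` TPq_sub q M"
 shows "gns_op q (\<Gamma> a) v = FP (gns_op q a (FP v))"
proof -
 obtain \<xi> where \<xi>: "a = Wcl q \<xi>" "\<xi> \<in> fam" using a by (auto simp: carr_alg)
 obtain \<eta> where \<eta>: "v = Fock_vec q (Wcl q \<eta>)" "\<eta> \<in> sub" using v by (auto simp: TPq_sub_eq)
 note m = sub_fam[OF \<eta>(2)] U.tpmult_families[OF \<xi>(2) sub_fam[OF \<eta>(2)]]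
 have "FP (gns_op q a (FP v)) = Fock_vec q (Wcl q (hat (tpmult q \<xi> \<eta>)))"
  unfolding \<xi>(1) \<eta>(1) FP_vec[OF m(1)] hat_fixed[OF \<eta>(2)] gns_op_Wcl[OF \<xi>(2) m(1)] by (rule FP_vec[OF m(2)])
 also have "Wcl q (hat (tpmult q \<xi> \<eta>)) = Wcl q (tpmult q (hat \<xi>) \<eta>)"
  by (rule Wcl_cong[OF hat_fam[OF m(2)] U.tpmult_families[OF hat_fam[OF \<xi>(2)] m(1)] Phi_hat_mult[OF \<xi>(2) \<eta>(2)]])
 also have "Fock_vec q \<dots> = gns_op q (\<Gamma> a) v"
  unfolding \<xi>(1) \<eta>(1) \<Gamma>_Wcl[OF \<xi>(2)] by (rule gns_op_Wcl[OF hat_fam[OF \<xi>(2)] m(1), symmetric])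
 finally show ?thesis ..
qed

end

theorem propositionV19:
 fixes q :: real
  and M :: "'a::{real_inner, complete_space} set"
  and P :: "'a \<times> 'a \<Rightarrow> 'a \<times> 'a"
 assumes q: "q \<in> Zset - {0}"
  and M: "subspace M" "closed M"
  and P: "orthogonal_projection complexification (M \<times> M) P"
 shows "\<exists>FP.
  (\<forall>n. \<forall>\<alpha>\<in>S0 n. \<forall>F\<in>tensor_power UNIV n.
    FP (Fock_vec q (Wcl q (symt n \<alpha> F))) = Fock_vec q (Wcl q (symt n \<alpha> (tensor_op P n F)))) \<and>
  orthogonal_projection (Fock q) (Fock_sub q (M \<times> M)) FP \<and>
  (\<exists>\<Gamma>. linear_map (TPq_alg q) (TPq_alg q) \<Gamma> \<and>
    (\<forall>a\<in>carr (TPq_alg q). \<Gamma> a \<in> TPq_sub q M) \<and>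
    (\<forall>n. \<forall>\<alpha>\<in>S0 n. \<forall>F\<in>real_tensor_power UNIV n.
     \<Gamma> (Wcl q (symt n \<alpha> F)) = Wcl q (symt n \<alpha> (tensor_op P n F))) \<and>
    algebraic_conditional_expectation (TPq_alg q) vacuum_state (TPq_sub q M) \<Gamma> \<and>
    (\<forall>a\<in>carr (TPq_alg q). \<forall>v\<in>Fock_vec q ` TPq_sub q M.
     gns_op q (\<Gamma> a) v = FP (gns_op q a (FP v))))"
proof -
 obtain N neg where N: "1 \<le> N" "q = (if neg then - 1 else 1) / real N"
 proof -
  from q consider N where "1 \<le> N" "q = 1 / real N" | N where "1 \<le> N" "q = - 1 / real N"
   by (auto simp: Zset_def)
  then show thesis
  proof cases
   case 1 then show thesis by (intro that[of _ False]) simp_all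
  next
   case 2 then show thesis by (intro that[of _ True]) simp_all
  qed
 qed
 note rp = real_projection_of_orthogonal[OF M(1) P]
 interpret model_projection N neg q "TYPE('a)" "\<lambda>x. fst (P (x, 0))" M
  by (rule model_projection.intro[OF matrix_model.intro[OF N] rp(1)])
 have op: "tensor_op P n F = R.second F" if "F \<in> U.tensors n" for n F
  by (rule R.tensor_op_second[OF P rp(2)]) (use that in \<open>simp add: U_tensors\<close>)
 have symt: "symt n \<alpha> F \<in> fam" "hat (symt n \<alpha> F) = symt n \<alpha> (tensor_op P n F)"
  if "\<alpha> \<in> S0 n" "F \<in> U.tensors n" for n \<alpha> F
  using U.symt_families[OF that] hat_symt op[OF that(2)] by simp_all
 have t: "tensor_power UNIV n = U.tensors n" for n using U.tensor_power_eq[of n] by simp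
 have r: "F \<in> U.tensors n" if "F \<in> real_tensor_power UNIV n" for n F
  using that U.real_tensor_power_eq[of n] by simp
 show ?thesis
 proof (intro exI[of _ FP] exI[of _ \<Gamma>] conjI allI ballI)
  fix n \<alpha> and F :: "'a tensor" assume "\<alpha> \<in> S0 n" "F \<in> tensor_power UNIV n"
  then show "FP (Fock_vec q (Wcl q (symt n \<alpha> F))) = Fock_vec q (Wcl q (symt n \<alpha> (tensor_op P n F)))"
   using FP_vec[OF symt(1)] symt(2) by (simp add: t)
 next
  fix n \<alpha> and F :: "'a tensor" assume "\<alpha> \<in> S0 n" "F \<in> real_tensor_power UNIV n"
  then show "\<Gamma> (Wcl q (symt n \<alpha> F)) = Wcl q (symt n \<alpha> (tensor_op P n F))"
   using \<Gamma>_Wcl[OF symt(1)] symt(2) r by simp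
 next
  show "\<Gamma> a \<in> TPq_sub q M" if "a \<in> carr (TPq_alg q)" for a
   using conditional_expectation that by (simp add: algebraic_conditional_expectation_def)
 qed (rule FP_projection \<Gamma>_linear conditional_expectation implemented; assumption)+
qed

end
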